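(* Consider the stochastic block model with $q\ge2$ communities, $n$ vertices and parameters $d>0$, $\lambda\in(0,1)$, $d=o(n)$: sample $\sigma_*\in[q]^n$ uniformly and, conditionally on $\sigma_*$, let $Y_{i,j}$ ($1\le i<j\le n$) be independent Bernoulli variables with $\mathbb P(Y_{i,j}=1\mid\sigma_* )=\frac{(1+(q-1)\lambda)d}{n}$ if $\sigma_*(i)=\sigma_*(j)$ and $\frac{(1-\lambda)d}{n}$ otherwise; $Y$ is observed. Suppose that $$2\le q=n^{\frac18-\Omega(1)}\qquad\text{and}\qquad d\lambda^2<1-\delta\ \text{ for some constant }\delta>0.$$ Assume that the low-degree heuristic holds for the hidden informative sample problems associated with this model (see context). Then any algorithm which, given $Y$, outputs an estimator $\mathcal X=\mathcal X(Y)$ achieving weak recovery of $\Theta=(\Theta_{i,j})$, $\Theta_{i,j}=\frac{(q\mathbf 1_{\sigma_*(i)=\sigma_*(j)}-1)\lambda d}{n}$, i.e. $\mathbb E\big[\langle\mathcal X,\Theta\rangle/(\|\mathcal X\|\,\|\Theta\|)\big]\ge c$ for some constant $c>0$, requires running time $\exp\big(nq^{-6}(\log n)^{-3}\big)$. In particular, when $q=n^{o(1)}$ and $d\lambda^2<1-\Omega(1)$, any algorithm achieving weak recovery in this sense requires running time $\exp(n^{1-o(1)})$.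
   Context: Asymptotic notation is with respect to $n\to\infty$; $x_n\ll y_n$ means $x_n/y_n\to0$. The parameters are known and may depend on $n$. $[q]=\{1,\dots,q\}$. Inner product and norm are Euclidean/Frobenius; the ratio in weak recovery is read as $0$ when its denominator vanishes. Low-degree heuristic. Let $P=P_n,Q=Q_n$ be probability measures on $\mathbb R^{N}$, $N=N_n$. For a degree $D=D_n$ put $\mathsf{Adv}_{\le D}(P;Q)=\sup_f \mathbb E_P[f]/\sqrt{\mathbb E_Q[f^2]}$, the supremum over real polynomials $f$ on $\mathbb R^N$ of degree at most $D$. A $\{0,1\}$-valued algorithm $\mathcal A$ achieves strong detection if $Q(\mathcal A=1)+P(\mathcal A=0)\to0$, and weak detection if this sum is at most $1-\epsilon$ for some fixed $\epsilon>0$. The low-degree heuristic holds for testing $P$ against $Q$ if: (1) whenever $\mathsf{Adv}_{\le D}(P;Q)=O(1)$ there is a constant $C$ such that no algorithm with running time $N^{D/(C\log N)}$ achieves strong detection; (2) whenever $\mathsf{Adv}_{\le D}(P;Q)=1+o(1)$ there is a constant $C$ such that no algorithm with running time $N^{D/(C\log N)}$ achieves weak detection. Hidden informative sample problem with base pair $(P,Q)$ and sample number $M=M_n$: test between $\overline Q$, the law of $(\mathsf Y_1,\dots,\mathsf Y_M)$ i.i.d. from $Q$, and $\overline P$, the law of $(\mathsf Y_1,\dots,\mathsf Y_M)$ where $\kappa$ is uniform on $\{1,\dots,M\}$ and, given $\kappa$, the $\mathsf Y_j$ are independent with $\mathsf Y_\kappa\sim P$ and $\mathsf Y_j\sim Q$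 for $j\ne\kappa$ (dimension $MN$). The associated problems: the base pair is ($P$ = law of the stochastic block model $Y$ with parameters $d,\lambda,q,n$; $Q$ = law of an Erdős–Rényi graph on $[n]$ with edge probability $d/n$), for any parameters satisfying the displayed assumptions (for some constant $\delta>0$); the sample number is any $M$ with $\Delta\ll M\le N\Delta$, where $\Delta>1$ is an upper bound for $\mathsf{Adv}_{\le D}(P;Q)^2$ and $N$ is the dimension of the base pair. The constant $C$ in the heuristic may be taken independent of the choice of $M$. *)

theory Defs
  imports "HOL-Probability.Probability" "HOL-Library.Landau_Symbols"
begin

section \<open>Algorithms and running time\<close>

text \<open>
  An algorithm is a sequence of randomised Boolean circuits over the NAND basis, one for each
  \<open>n\<close>. Non-uniformity in \<open>n\<close> expresses that the (real, \<open>n\<close>-dependent) model parameters are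
  known to the algorithm. The wires of a circuit are, in this order, the input bits, the
  \<open>coins\<close> (independent fair bits), and one wire per gate; the gate \<open>(i, j)\<close> computes the NAND of
  the wires \<open>i\<close> and \<open>j\<close>.
\<close>

datatype circuit =
  Circuit (coins: nat) (gates: "(nat \<times> nat) list") (outs: "nat list")

definition valid_circuit :: "nat \<Rightarrow> nat \<Rightarrow> circuit \<Rightarrow> bool" where
  "valid_circuit k m A \<longleftrightarrow>
     (\<forall>g<length (gates A). fst (gates A ! g) < k + coins A + g \<and> snd (gates A ! g) < k + coins A + g) \<and>
     (\<forall>i\<in>set (outs A). i < k + coins A + length (gates A)) \<and>
     length (outs A) = m"

fun eval_gates :: "bool list \<Rightarrow> (nat \<times> nat) list \<Rightarrow> bool list" where
  "eval_gates w [] = w"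
| "eval_gates w ((i, j) # gs) = eval_gates (w @ [\<not> (w ! i \<and> w ! j)]) gs"

definition run :: "circuit \<Rightarrow> bool list \<Rightarrow> bool list pmf" where
  "run A x = map_pmf (\<lambda>r. map ((!) (eval_gates (x @ r) (gates A))) (outs A))
     (pmf_of_set {r. length r = coins A})"

text \<open>Writing one output bit costs one step, just like evaluating one gate.\<close>

definition runtime :: "circuit \<Rightarrow> nat" where
  "runtime A = length (gates A) + length (outs A)"

definition runs_within :: "(nat \<Rightarrow> circuit) \<Rightarrow> (nat \<Rightarrow> real) \<Rightarrow> bool" where
  "runs_within A T \<longleftrightarrow> (\<forall>\<^sub>F n in sequentially. real (runtime (A n)) \<le> T n)"

section \<open>Low-degree advantage and detection\<close>

text \<open>
  All laws considered here live on \<open>{0,1}\<^sup>N\<close>, regarded as a subset of \<open>N\<close>-dimensional real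
  space; a sample is a \<open>bool list\<close> of length \<open>N\<close>. A polynomial in \<open>N\<close> real variables is given by
  its coefficients on the (finitely many) exponent vectors of total degree at most \<open>D\<close>.
\<close>

definition exponents :: "nat \<Rightarrow> nat \<Rightarrow> (nat \<Rightarrow> nat) set" where
  "exponents N D = {\<alpha>. (\<forall>i\<ge>N. \<alpha> i = 0) \<and> (\<Sum>i<N. \<alpha> i) \<le> D}"

lemma finite_exponents: "finite (exponents N D)"
proof (rule finite_subset)
  show "exponents N D \<subseteq> {\<alpha>. \<forall>i. (i \<in> {..<N} \<longrightarrow> \<alpha> i \<in> {..D}) \<and> (i \<notin> {..<N} \<longrightarrow> \<alpha> i = 0)}"
  proof
    fix \<alpha> assume \<alpha>: "\<alpha> \<in> exponents N D"
    have "\<alpha> i \<le> D" if "i < N" for i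
    proof -
      have "\<alpha> i \<le> (\<Sum>i<N. \<alpha> i)"
        using that by (intro member_le_sum) auto
      then show ?thesis using \<alpha> by (simp add: exponents_def)
    qed
    then show "\<alpha> \<in> {\<alpha>. \<forall>i. (i \<in> {..<N} \<longrightarrow> \<alpha> i \<in> {..D}) \<and> (i \<notin> {..<N} \<longrightarrow> \<alpha> i = 0)}"
      using \<alpha> by (simp add: exponents_def)
  qed
  show "finite {\<alpha>. \<forall>i. (i \<in> {..<N} \<longrightarrow> \<alpha> i \<in> {..D}) \<and> (i \<notin> {..<N} \<longrightarrow> \<alpha> i = (0::nat))}"
    by (rule finite_set_of_finite_funs) auto
qed

definition polynomials :: "nat \<Rightarrow> nat \<Rightarrow> ((nat \<Rightarrow> real) \<Rightarrow> real) set" where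
  "polynomials N D =
     {f. \<exists>c :: (nat \<Rightarrow> nat) \<Rightarrow> real. f = (\<lambda>x. \<Sum>\<alpha>\<in>exponents N D. c \<alpha> * (\<Prod>i<N. x i ^ \<alpha> i))}"

definition point :: "bool list \<Rightarrow> nat \<Rightarrow> real" where
  "point y i = of_bool (y ! i)"

text \<open>
  The quotient is taken in the extended reals, so a polynomial vanishing \<open>Q\<close>-almost surely
  contributes \<open>\<infinity>\<close> if its \<open>P\<close>-mean is positive and \<open>0\<close> if its \<open>P\<close>-mean is zero.
\<close>

definition adv :: "nat \<Rightarrow> nat \<Rightarrow> bool list pmf \<Rightarrow> bool list pmf \<Rightarrow> ereal" where
  "adv N D P Q = (SUP f\<in>polynomials N D.
     ereal (measure_pmf.expectation P (\<lambda>y. f (point y))) /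
     ereal (sqrt (measure_pmf.expectation Q (\<lambda>y. (f (point y))\<^sup>2))))"

definition detection_error :: "bool list pmf \<Rightarrow> bool list pmf \<Rightarrow> circuit \<Rightarrow> real" where
  "detection_error P Q A = pmf (bind_pmf Q (run A)) [True] + pmf (bind_pmf P (run A)) [False]"

definition strong_detection ::
  "(nat \<Rightarrow> bool list pmf) \<Rightarrow> (nat \<Rightarrow> bool list pmf) \<Rightarrow> (nat \<Rightarrow> circuit) \<Rightarrow> bool" where
  "strong_detection P Q A \<longleftrightarrow> (\<lambda>n. detection_error (P n) (Q n) (A n)) \<longlonglongrightarrow> 0"

definition weak_detection ::
  "(nat \<Rightarrow> bool list pmf) \<Rightarrow> (nat \<Rightarrow> bool list pmf) \<Rightarrow> (nat \<Rightarrow> circuit) \<Rightarrow> bool" where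
  "weak_detection P Q A \<longleftrightarrow>
     (\<exists>\<epsilon>>0. \<forall>\<^sub>F n in sequentially. detection_error (P n) (Q n) (A n) \<le> 1 - \<epsilon>)"

section \<open>The low-degree heuristic\<close>

text \<open>A testing problem consists of the dimensions, the planted laws and the null laws.\<close>

type_synonym testing_problem =
  "(nat \<Rightarrow> nat) \<times> (nat \<Rightarrow> bool list pmf) \<times> (nat \<Rightarrow> bool list pmf)"

definition heuristic_time :: "(nat \<Rightarrow> nat) \<Rightarrow> (nat \<Rightarrow> nat) \<Rightarrow> real \<Rightarrow> nat \<Rightarrow> real" where
  "heuristic_time N D C n = real (N n) powr (real (D n) / (C * ln (real (N n))))"

definition strong_clause :: "(nat \<Rightarrow> nat) \<Rightarrow> real \<Rightarrow> testing_problem \<Rightarrow> bool" where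
  "strong_clause D C = (\<lambda>(N, P, Q).
     (\<exists>B::real. \<forall>\<^sub>F n in sequentially. adv (N n) (D n) (P n) (Q n) \<le> ereal B) \<longrightarrow>
     \<not> (\<exists>A. (\<forall>n. valid_circuit (N n) 1 (A n)) \<and> runs_within A (heuristic_time N D C) \<and>
            strong_detection P Q A))"

definition weak_clause :: "(nat \<Rightarrow> nat) \<Rightarrow> real \<Rightarrow> testing_problem \<Rightarrow> bool" where
  "weak_clause D C = (\<lambda>(N, P, Q).
     (\<lambda>n. adv (N n) (D n) (P n) (Q n)) \<longlonglongrightarrow> 1 \<longrightarrow>
     \<not> (\<exists>A. (\<forall>n. valid_circuit (N n) 1 (A n)) \<and> runs_within A (heuristic_time N D C) \<and>
            weak_detection P Q A))"

text \<open>
  The heuristic at degree \<open>D\<close> for a family of problems, with constants \<open>C\<close> that serve the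
  whole family; the heuristic for a single problem is the case of a one-element family.
\<close>

definition low_degree_heuristic :: "(nat \<Rightarrow> nat) \<Rightarrow> testing_problem set \<Rightarrow> bool" where
  "low_degree_heuristic D \<P> \<longleftrightarrow>
     (\<exists>C>0. \<forall>p\<in>\<P>. strong_clause D C p) \<and> (\<exists>C>0. \<forall>p\<in>\<P>. weak_clause D C p)"

section \<open>Hidden informative sample problems\<close>

definition product_law :: "nat \<Rightarrow> (nat \<Rightarrow> bool list pmf) \<Rightarrow> bool list pmf" where
  "product_law M R = map_pmf (\<lambda>Y. concat (map Y [0..<M])) (Pi_pmf {..<M} [] R)"

definition hidden_null :: "nat \<Rightarrow> bool list pmf \<Rightarrow> bool list pmf" where
  "hidden_null M Q = product_law M (\<lambda>_. Q)"

definition hidden_planted :: "nat \<Rightarrow> bool list pmf \<Rightarrow> bool list pmf \<Rightarrow> bool list pmf" where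
  "hidden_planted M P Q =
     bind_pmf (pmf_of_set {..<M}) (\<lambda>\<kappa>. product_law M (\<lambda>j. if j = \<kappa> then P else Q))"

definition hidden_problem :: "(nat \<Rightarrow> nat) \<Rightarrow> testing_problem \<Rightarrow> testing_problem" where
  "hidden_problem M = (\<lambda>(N, P, Q).
     (\<lambda>n. M n * N n, \<lambda>n. hidden_planted (M n) (P n) (Q n), \<lambda>n. hidden_null (M n) (Q n)))"

section \<open>The stochastic block model\<close>

text \<open>
  Vertices are \<open>0, \<dots>, n - 1\<close> and communities are \<open>0, \<dots>, q - 1\<close>. A graph is the list of its edge
  indicators, ordered as in \<open>edge_slots n\<close>. The function \<open>bernoulli_pmf\<close> clamps its parameter
  to the unit interval; in the regime below this can matter for finitely many \<open>n\<close> only.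
\<close>

definition edge_slots :: "nat \<Rightarrow> (nat \<times> nat) list" where
  "edge_slots n = concat (map (\<lambda>i. map (\<lambda>j. (i, j)) [Suc i..<n]) [0..<n])"

definition sbm_dim :: "nat \<Rightarrow> nat" where
  "sbm_dim n = length (edge_slots n)"

definition random_graph :: "nat \<Rightarrow> (nat \<times> nat \<Rightarrow> real) \<Rightarrow> bool list pmf" where
  "random_graph n p =
     map_pmf (\<lambda>Y. map Y (edge_slots n)) (Pi_pmf (set (edge_slots n)) False (\<lambda>e. bernoulli_pmf (p e)))"

definition erdos_renyi :: "nat \<Rightarrow> real \<Rightarrow> bool list pmf" where
  "erdos_renyi n d = random_graph n (\<lambda>_. d / real n)"

definition labelings :: "nat \<Rightarrow> nat \<Rightarrow> nat list set" where
  "labelings n q = {\<sigma>. length \<sigma> = n \<and> set \<sigma> \<subseteq> {..<q}}"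

definition sbm_given :: "nat \<Rightarrow> real \<Rightarrow> real \<Rightarrow> nat \<Rightarrow> nat list \<Rightarrow> bool list pmf" where
  "sbm_given n d lam q \<sigma> = random_graph n (\<lambda>(i, j).
     if \<sigma> ! i = \<sigma> ! j then (1 + (real q - 1) * lam) * d / real n else (1 - lam) * d / real n)"

definition sbm :: "nat \<Rightarrow> real \<Rightarrow> real \<Rightarrow> nat \<Rightarrow> bool list pmf" where
  "sbm n d lam q = bind_pmf (pmf_of_set (labelings n q)) (sbm_given n d lam q)"

definition sbm_regime :: "(nat \<Rightarrow> real) \<Rightarrow> (nat \<Rightarrow> real) \<Rightarrow> (nat \<Rightarrow> nat) \<Rightarrow> bool" where
  "sbm_regime d lam q \<longleftrightarrow>
     (\<forall>\<^sub>F n in sequentially. d n > 0 \<and> 0 < lam n \<and> lam n < 1) \<and>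
     d \<in> o(\<lambda>n. real n) \<and>
     (\<forall>\<^sub>F n in sequentially. 2 \<le> q n) \<and>
     (\<exists>\<epsilon>>0. \<forall>\<^sub>F n in sequentially. real (q n) \<le> real n powr (1 / 8 - \<epsilon>)) \<and>
     (\<exists>\<delta>>0. \<forall>\<^sub>F n in sequentially. d n * (lam n)\<^sup>2 < 1 - \<delta>)"

definition sbm_problem :: "(nat \<Rightarrow> real) \<Rightarrow> (nat \<Rightarrow> real) \<Rightarrow> (nat \<Rightarrow> nat) \<Rightarrow> testing_problem" where
  "sbm_problem d lam q =
     (sbm_dim, \<lambda>n. sbm n (d n) (lam n) (q n), \<lambda>n. erdos_renyi n (d n))"

definition sbm_hidden_problems ::
  "(nat \<Rightarrow> real) \<Rightarrow> (nat \<Rightarrow> real) \<Rightarrow> (nat \<Rightarrow> nat) \<Rightarrow> (nat \<Rightarrow> real) \<Rightarrow> testing_problem set" where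
  "sbm_hidden_problems d lam q \<Delta> =
     {hidden_problem M (sbm_problem d lam q) | M.
        \<Delta> \<in> o(\<lambda>n. real (M n)) \<and>
        (\<forall>\<^sub>F n in sequentially. real (M n) \<le> real (sbm_dim n) * \<Delta> n)}"

definition sbm_low_degree_heuristic :: bool where
  "sbm_low_degree_heuristic \<longleftrightarrow>
     (\<forall>d lam q D \<Delta>. sbm_regime d lam q \<longrightarrow>
        (\<forall>\<^sub>F n in sequentially. \<Delta> n > 1 \<and>
           (adv (sbm_dim n) (D n) (sbm n (d n) (lam n) (q n)) (erdos_renyi n (d n)))\<^sup>2
             \<le> ereal (\<Delta> n)) \<longrightarrow>
        low_degree_heuristic D (sbm_hidden_problems d lam q \<Delta>))"

section \<open>Weak recovery\<close>

definition Theta :: "nat \<Rightarrow> real \<Rightarrow> real \<Rightarrow> nat \<Rightarrow> nat list \<Rightarrow> nat \<Rightarrow> real" where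
  "Theta n d lam q \<sigma> k =
     (case edge_slots n ! k of (i, j) \<Rightarrow>
        (real q * of_bool (\<sigma> ! i = \<sigma> ! j) - 1) * lam * d / real n)"

text \<open>
  An estimator outputs one \<open>w\<close>-bit number per edge slot: a sign bit followed by the magnitude,
  least significant bit first. Since weak recovery is invariant under rescaling the estimator,
  fixed-point numbers may be read as integers.
\<close>

fun decode_number :: "bool list \<Rightarrow> real" where
  "decode_number [] = 0"
| "decode_number (s # bs) = (if s then - 1 else 1) * horner_sum of_bool 2 bs"

definition decode_estimate :: "nat \<Rightarrow> bool list \<Rightarrow> nat \<Rightarrow> real" where
  "decode_estimate w z k = decode_number (take w (drop (k * w) z))"

text \<open>Division by zero yields zero, as required when the estimate vanishes.\<close>

definition overlap :: "nat \<Rightarrow> (nat \<Rightarrow> real) \<Rightarrow> (nat \<Rightarrow> real) \<Rightarrow> real" where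
  "overlap N X \<Theta> = (\<Sum>k<N. X k * \<Theta> k) / (L2_set X {..<N} * L2_set \<Theta> {..<N})"

definition expected_overlap ::
  "nat \<Rightarrow> real \<Rightarrow> real \<Rightarrow> nat \<Rightarrow> nat \<Rightarrow> circuit \<Rightarrow> real" where
  "expected_overlap n d lam q w A =
     measure_pmf.expectation
       (bind_pmf (pmf_of_set (labelings n q)) (\<lambda>\<sigma>.
        bind_pmf (sbm_given n d lam q \<sigma>) (\<lambda>Y.
        map_pmf (\<lambda>z. (\<sigma>, z)) (run A Y))))
       (\<lambda>(\<sigma>, z). overlap (sbm_dim n) (decode_estimate w z) (Theta n d lam q \<sigma>))"

definition weak_recovery ::
  "(nat \<Rightarrow> real) \<Rightarrow> (nat \<Rightarrow> real) \<Rightarrow> (nat \<Rightarrow> nat) \<Rightarrow> (nat \<Rightarrow> circuit) \<Rightarrow> bool" where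
  "weak_recovery d lam q A \<longleftrightarrow>
     (\<exists>w. (\<forall>n. valid_circuit (sbm_dim n) (sbm_dim n * w n) (A n)) \<and>
        (\<exists>c>0. \<forall>\<^sub>F n in sequentially. expected_overlap n (d n) (lam n) (q n) (w n) (A n) \<ge> c))"

end

theory Submission
  imports Defs "HOL-Real_Asymp.Real_Asymp"
begin

text \<open>
  A fast weak recovery algorithm is turned into a fast test that the heuristic forbids. For the
  latter, the second moment of the low-degree likelihood ratio is at most the mean of a truncated
  exponential of \<open>\<langle>\<Theta>, \<Theta>'\<rangle>\<close> for two independent labelings; by the method of types, with a relative
  entropy bound for the joint community counts, it is at most \<open>\<Delta> = exp (O (q\<^sup>2 ln n))\<close> at degree
  \<open>D = n / (q\<^sup>4 (ln n)\<^sup>2)\<close> below the threshold \<open>d \<lambda>\<^sup>2 < 1\<close>. Hiding the sample among \<open>M = \<Delta> ln n\<close> null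
  samples reduces the advantage to \<open>1 + \<surd>(\<Delta> / M) = 1 + o(1)\<close>.

  For the former, observe each sample at a larger average degree \<open>d' = d / (1 - \<beta>)\<close> and hide
  each edge slot independently with probability \<open>\<beta>\<close>. What remains visible is a sample at degree \<open>d\<close>,
  from which the algorithm estimates \<open>\<Theta>\<close>; the hidden slots are fresh data to be correlated with the
  estimate. Under the null model the correlation has exponential tails, so a union bound over \<open>M\<close>
  samples is affordable, whereas in the informative sample it is large with constant probability.
  Mask and coins can be fixed to their best values. The resulting test takes time
  \<open>M n\<^bsup>O(1)\<^esup> exp (2 n / (q\<^sup>6 (ln n)\<^sup>3)) = exp (o(D))\<close>.
\<close>

section \<open>Expectations of finitely supported laws\<close>

text \<open>Below the threshold the base advantage is only bounded by a quantity that may be a power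
  of n of order q^2, so hiding is what makes the heuristic applicable. Its price is that the test
  may err under the null with probability at most a small constant over M. This shapes the
  estimates. With s = d \<lambda>^2, the exponent 2 s q^2 ln (n + 1) of \<Delta> must keep its
  factor s, because the Chernoff exponent of the test is a multiple of min (n d \<lambda>) (n q s).
  Both entries are at least n s, so q^2 ln n = o(n) suffices, however small s is. The remaining
  factor ln n of M requires n q s of order ln n. This is implied by recovery: for smaller n q s no
  estimator, fast or slow, has an overlap bounded away from 0. The degree is chosen such that D ln n
  = o(n / q^2), the exponent at which atypical pairs of labelings are rare. The time granted by the
  heuristic is exp (D / C), and the square of exp (n / (q^6 (ln n)^3)) fits below it.\<close>

abbreviation mean :: "'a pmf \<Rightarrow> ('a \<Rightarrow> real) \<Rightarrow> real" where
  "mean P f \<equiv> measure_pmf.expectation P f"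

lemma mean_eq_sum:
  assumes "finite (set_pmf P)"
  shows "mean P f = (\<Sum>x\<in>set_pmf P. pmf P x * f x)"
  using assms by (subst integral_measure_pmf_real[where A = "set_pmf P"]) (auto simp: mult.commute)

lemma mean_add:
  assumes "finite (set_pmf P)"
  shows "mean P (\<lambda>x. f x + g x) = mean P f + mean P g"
  using assms by (simp add: mean_eq_sum sum.distrib algebra_simps)

lemma mean_diff:
  assumes "finite (set_pmf P)"
  shows "mean P (\<lambda>x. f x - g x) = mean P f - mean P g"
  using assms by (simp add: mean_eq_sum sum_subtractf algebra_simps)

lemma mean_sum:
  assumes "finite (set_pmf P)"
  shows "mean P (\<lambda>x. \<Sum>i\<in>I. f i x) = (\<Sum>i\<in>I. mean P (f i))"
  using assms by (simp add: mean_eq_sum sum_distrib_left) (rule sum.swap)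

lemma mean_mono:
  assumes "finite (set_pmf P)" "\<And>x. x \<in> set_pmf P \<Longrightarrow> f x \<le> g x"
  shows "mean P f \<le> mean P g"
  using assms by (simp add: mean_eq_sum sum_mono mult_left_mono)

lemma mean_cong:
  assumes "\<And>x. x \<in> set_pmf P \<Longrightarrow> f x = g x"
  shows "mean P f = mean P g"
  using assms by (intro integral_cong_AE) (auto simp: AE_measure_pmf_iff)

lemma mean_nonneg:
  assumes "\<And>x. x \<in> set_pmf P \<Longrightarrow> f x \<ge> 0"
  shows "mean P f \<ge> 0"
  using assms by (intro integral_nonneg_AE) (auto simp: AE_measure_pmf_iff)

lemma mean_le_const:
  assumes "finite (set_pmf P)" "\<And>x. x \<in> set_pmf P \<Longrightarrow> f x \<le> c"
  shows "mean P f \<le> c"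
  using mean_mono[of P f "\<lambda>_. c"] assms by simp

text \<open>The first moment method. It serves to fix the coins of the algorithm and the mask at
  values at least as good as the average, which leaves a deterministic test.\<close>

lemma mean_attained:
  assumes "finite (set_pmf P)" "c \<le> mean P f"
  shows "\<exists>x\<in>set_pmf P. c \<le> f x"
proof (rule ccontr)
  assume "\<not> (\<exists>x\<in>set_pmf P. c \<le> f x)"
  then have *: "f x < c" if "x \<in> set_pmf P" for x using that by force
    have "mean P f < (\<Sum>x\<in>set_pmf P. pmf P x * c)"
    unfolding mean_eq_sum[OF assms(1)]
    using * assms(1) by (intro sum_strict_mono) (auto simp: set_pmf_not_empty pmf_positive)
  also have "\<dots> = c" by (simp flip: sum_distrib_right add: sum_pmf_eq_1 assms(1))
  finally show False using assms(2) by simp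
qed

lemma mean_bind:
  assumes "finite (set_pmf P)" "\<And>x. x \<in> set_pmf P \<Longrightarrow> finite (set_pmf (f x))"
  shows "mean (bind_pmf P f) g = mean P (\<lambda>x. mean (f x) g)"
  using assms by (subst pmf_expectation_bind[where A = "set_pmf P"]) (auto simp: mean_eq_sum)

lemma mean_swap:
  assumes "finite (set_pmf P)" "finite (set_pmf Q)"
  shows "mean P (\<lambda>x. mean Q (\<lambda>y. f x y)) = mean Q (\<lambda>y. mean P (\<lambda>x. f x y))"
proof -
  have "mean P (\<lambda>x. mean Q (\<lambda>y. f x y)) = (\<Sum>x\<in>set_pmf P. \<Sum>y\<in>set_pmf Q. pmf P x * (pmf Q y * f x y))"
    using assms by (simp add: mean_eq_sum sum_distrib_left)
  also have "\<dots> = (\<Sum>y\<in>set_pmf Q. \<Sum>x\<in>set_pmf P. pmf P x * (pmf Q y * f x y))" by (rule sum.swap)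
  also have "\<dots> = mean Q (\<lambda>y. mean P (\<lambda>x. f x y))"
    using assms by (simp add: mean_eq_sum sum_distrib_left algebra_simps)
  finally show ?thesis .
qed

lemma mean_Cauchy_Schwarz:
  assumes "finite (set_pmf P)"
  shows "(mean P (\<lambda>x. f x * g x))\<^sup>2 \<le> mean P (\<lambda>x. (f x)\<^sup>2) * mean P (\<lambda>x. (g x)\<^sup>2)"
proof -
  have "(mean P (\<lambda>x. f x * g x))\<^sup>2
      = (\<Sum>x\<in>set_pmf P. (sqrt (pmf P x) * f x) * (sqrt (pmf P x) * g x))\<^sup>2"
    using assms by (simp add: mean_eq_sum algebra_simps)
  also have "\<dots> \<le> (\<Sum>x\<in>set_pmf P. (sqrt (pmf P x) * f x)\<^sup>2) * (\<Sum>x\<in>set_pmf P. (sqrt (pmf P x) * g x)\<^sup>2)"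
    by (rule Cauchy_Schwarz_ineq_sum)
  also have "\<dots> = mean P (\<lambda>x. (f x)\<^sup>2) * mean P (\<lambda>x. (g x)\<^sup>2)"
    using assms by (simp add: mean_eq_sum power_mult_distrib)
  finally show ?thesis .
qed

lemma mean_bernoulli:
  assumes "0 \<le> p" "p \<le> 1"
  shows "mean (bernoulli_pmf p) f = p * f True + (1 - p) * f False"
  using assms by (simp add: integral_bernoulli_pmf)


section \<open>Product laws and resampling of one coordinate\<close>

lemma finite_set_Pi_pmf [simp]:
  assumes "finite A" "\<And>x. x \<in> A \<Longrightarrow> finite (set_pmf (p x))"
  shows "finite (set_pmf (Pi_pmf A d p))"
  using assms by (simp add: set_Pi_pmf finite_PiE_dflt)

text \<open>The other coordinates are independent of coordinate \<open>x\<close>, so its old value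
  may be drawn first and then overwritten.\<close>

lemma Pi_pmf_fun_upd:
  assumes "finite A" "x \<in> A"
  shows "Pi_pmf A d (p(x := q)) = bind_pmf (Pi_pmf A d p) (\<lambda>Y. map_pmf (\<lambda>v. Y(x := v)) q)"
proof -
  define B where "B = A - {x}"
  have A: "A = insert x B" "x \<notin> B" "finite B"
    using assms by (auto simp: B_def)
  have B: "Pi_pmf B d (p(x := q)) = Pi_pmf B d p"
    using A by (intro Pi_pmf_cong) auto
  have "bind_pmf (Pi_pmf A d p) (\<lambda>Y. map_pmf (\<lambda>v. Y(x := v)) q)
      = do {y \<leftarrow> p x; f \<leftarrow> Pi_pmf B d p; v \<leftarrow> q; return_pmf (f(x := v))}"
    unfolding A(1) by (subst Pi_pmf_insert'[OF A(3,2)]) (simp add: bind_assoc_pmf bind_return_pmf map_pmf_def)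
  also have "\<dots> = do {f \<leftarrow> Pi_pmf B d p; v \<leftarrow> q; return_pmf (f(x := v))}"
    by simp
  also have "\<dots> = do {v \<leftarrow> q; f \<leftarrow> Pi_pmf B d p; return_pmf (f(x := v))}"
    by (rule bind_commute_pmf)
  also have "\<dots> = Pi_pmf A d (p(x := q))"
    unfolding A(1) by (subst Pi_pmf_insert'[OF A(3,2)]) (simp add: B)
  finally show ?thesis ..
qed

lemma mean_Pi_fun_upd:
  assumes "finite A" "x \<in> A" "\<And>x. x \<in> A \<Longrightarrow> finite (set_pmf (p x))" "finite (set_pmf q)"
  shows "mean (Pi_pmf A d (p(x := q))) F = mean (Pi_pmf A d p) (\<lambda>Y. mean q (\<lambda>v. F (Y(x := v))))"
  using assms by (simp add: Pi_pmf_fun_upd mean_bind)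

text \<open>Independence enters most later arguments in this form: one coordinate is redrawn while
  the others are kept, which takes the place of a conditional expectation.\<close>

lemma mean_resample:
  assumes "finite A" "x \<in> A" "\<And>x. x \<in> A \<Longrightarrow> finite (set_pmf (p x))"
  shows "mean (Pi_pmf A d p) F = mean (Pi_pmf A d p) (\<lambda>Y. mean (p x) (\<lambda>v. F (Y(x := v))))"
  using mean_Pi_fun_upd[of A x p "p x"] assms by simp

lemma mean_prod:
  fixes g :: "'a \<Rightarrow> 'b \<Rightarrow> real"
  assumes "finite A" "\<And>x. x \<in> A \<Longrightarrow> finite (set_pmf (p x))"
  shows "mean (Pi_pmf A d p) (\<lambda>Y. \<Prod>x\<in>A. g x (Y x)) = (\<Prod>x\<in>A. mean (p x) (g x))"
  using assms
proof (induction A rule: finite_induct)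
  case (insert x A)
  have *: "(\<Prod>z\<in>A. g z ((f(x := y)) z)) = (\<Prod>z\<in>A. g z (f z))" for f y
    using insert.hyps by (intro prod.cong) auto
  have "mean (Pi_pmf (insert x A) d p) (\<lambda>Y. \<Prod>z\<in>insert x A. g z (Y z))
      = mean (p x) (\<lambda>y. mean (Pi_pmf A d p) (\<lambda>f. g x y * (\<Prod>z\<in>A. g z (f z))))"
    using insert by (simp add: Pi_pmf_insert' mean_bind * del: fun_upd_apply) (simp add: *)
  then show ?case
    using insert by simp
qed simp

lemma mean_Pi_component:
  assumes "finite A" "x \<in> A"
  shows "mean (Pi_pmf A d p) (\<lambda>Y. g (Y x)) = mean (p x) g"
proof -
  have "mean (p x) g = mean (map_pmf (\<lambda>f. f x) (Pi_pmf A d p)) g"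
    using assms by (simp add: Pi_pmf_component)
  then show ?thesis by simp
qed

section \<open>Samples as lists of independent entries\<close>

fun list_law :: "'a pmf list \<Rightarrow> 'a list pmf" where
  "list_law [] = return_pmf []"
| "list_law (p # ps) = bind_pmf p (\<lambda>y. map_pmf ((#) y) (list_law ps))"

text \<open>The law of a list of independent entries depends on the list of entry laws and not on
  the index set. \<open>list_law\<close> is the canonical form through which products over edges and
  products over positions are identified.\<close>

lemma list_law_Pi_pmf:
  assumes "distinct xs"
  shows "map_pmf (\<lambda>Y. map Y xs) (Pi_pmf (set xs) d p) = list_law (map p xs)"
  using assms
proof (induction xs)
  case (Cons x xs)
  then have *: "map (f(x := y)) xs = map f xs" for f :: "'a \<Rightarrow> 'b" and y
    by (intro map_cong) auto
  from Cons show ?case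
    by (simp add: Pi_pmf_insert' map_bind_pmf map_pmf_comp * bind_return_pmf flip: map_pmf_def)
       (simp add: map_pmf_def bind_assoc_pmf bind_return_pmf flip: Cons.IH)
qed simp

lemma list_law_upt: "list_law (map p [0..<n]) = map_pmf (\<lambda>Y. map Y [0..<n]) (Pi_pmf {..<n} d p)"
  using list_law_Pi_pmf[of "[0..<n]" d p] by (simp add: atLeast0LessThan)

lemma map_Pi_pmf_nth:
  assumes "distinct xs"
  shows "map_pmf (\<lambda>Y. map Y xs) (Pi_pmf (set xs) d p)
       = map_pmf (\<lambda>Y. map Y [0..<length xs]) (Pi_pmf {..<length xs} d (\<lambda>k. p (xs ! k)))"
proof -
  have "map p xs = map (\<lambda>k. p (xs ! k)) [0..<length xs]"
    by (rule nth_equalityI) auto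
  then show ?thesis
    by (simp only: list_law_Pi_pmf[OF assms] flip: list_law_upt[where d = d])
qed

lemma distinct_edge_slots: "distinct (edge_slots n)"
proof -
  have "distinct (concat (map (\<lambda>i. map (\<lambda>j. (i, j)) [Suc i..<n]) is))" if "distinct is" for "is"
    using that by (induction "is") (auto simp: distinct_map inj_on_def)
  then show ?thesis by (simp add: edge_slots_def)
qed

lemma set_edge_slots: "set (edge_slots n) = {(i, j). i < j \<and> j < n}"
proof -
  have "(i, j) \<in> set (edge_slots n) \<longleftrightarrow> i < j \<and> j < n" for i j
    by (simp add: edge_slots_def image_iff) arith
  then show ?thesis by auto
qed

abbreviation bits :: "nat \<Rightarrow> (nat \<Rightarrow> real) \<Rightarrow> (nat \<Rightarrow> bool) pmf" where
  "bits N p \<equiv> Pi_pmf {..<N} False (\<lambda>k. bernoulli_pmf (p k))"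

lemma random_graph_bits:
  "random_graph n p = map_pmf (\<lambda>Y. map Y [0..<sbm_dim n]) (bits (sbm_dim n) (\<lambda>k. p (edge_slots n ! k)))"
  unfolding random_graph_def sbm_dim_def by (rule map_Pi_pmf_nth[OF distinct_edge_slots])

abbreviation labels :: "nat \<Rightarrow> nat \<Rightarrow> (nat \<Rightarrow> nat) pmf" where
  "labels n q \<equiv> Pi_pmf {..<n} 0 (\<lambda>_. pmf_of_set {..<q})"

text \<open>A uniform labeling has independent uniform labels. As a function it allows a single
  label to be redrawn; the default 0 beyond \<open>n\<close> makes the correspondence with lists
  injective.\<close>

lemma labelings_labels:
  assumes "q > 0"
  shows "pmf_of_set (labelings n q) = map_pmf (\<lambda>s. map s [0..<n]) (labels n q)"
proof -
  have inj: "inj_on (\<lambda>s. map s [0..<n]) (PiE_dflt {..<n} 0 (\<lambda>_. {..<q}))"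
  proof (rule inj_onI)
    fix s t :: "nat \<Rightarrow> nat"
    assume *: "s \<in> PiE_dflt {..<n} 0 (\<lambda>_. {..<q})" "t \<in> PiE_dflt {..<n} 0 (\<lambda>_. {..<q})"
      "map s [0..<n] = map t [0..<n]"
    show "s = t"
    proof
      fix i
      have "s i = t i" if "i < n"
        using arg_cong[OF *(3), of "\<lambda>l. l ! i"] that by simp
      moreover have "s i = t i" if "\<not> i < n"
      proof -
        have "s i = 0" "t i = 0" using *(1,2) that by (simp_all add: PiE_dflt_def)
        then show ?thesis by simp
      qed
      ultimately show "s i = t i" by blast
    qed
  qed
  have im: "(\<lambda>s. map s [0..<n]) ` PiE_dflt {..<n} 0 (\<lambda>_. {..<q}) = labelings n q"
  proof (intro equalityI subsetI)
    fix l assume l: "l \<in> labelings n q"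
    then have "l = map (\<lambda>i. if i < n then l ! i else 0) [0..<n]"
      by (auto simp: labelings_def intro!: nth_equalityI)
    moreover have "(\<lambda>i. if i < n then l ! i else 0) \<in> PiE_dflt {..<n} 0 (\<lambda>_. {..<q})"
      using l nth_mem[of _ l] by (auto simp: labelings_def PiE_dflt_def subset_iff)
    ultimately show "l \<in> (\<lambda>s. map s [0..<n]) ` PiE_dflt {..<n} 0 (\<lambda>_. {..<q})" by blast
  qed (auto simp: labelings_def PiE_dflt_def)
  have ne: "{..<q} \<noteq> {}" using assms by auto
  have "labels n q = pmf_of_set (PiE_dflt {..<n} 0 (\<lambda>_. {..<q}))"
    using ne by (subst Pi_pmf_of_set) auto
  moreover have "map_pmf (\<lambda>s. map s [0..<n]) (pmf_of_set (PiE_dflt {..<n} 0 (\<lambda>_. {..<q})))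
      = pmf_of_set (labelings n q)"
    using ne by (subst map_pmf_of_set_inj[OF inj]) (auto simp: im finite_PiE_dflt)
  ultimately show ?thesis by (simp only:)
qed

lemma mean_pmf_of_set_lessThan:
  assumes "q > 0"
  shows "mean (pmf_of_set {..<q}) f = (\<Sum>a<q. f a) / real q"
  using assms by (subst integral_pmf_of_set) (auto simp: lessThan_empty_iff)

section \<open>Circuit complexity\<close>

lemma length_eval_gates [simp]: "length (eval_gates w gs) = length w + length gs"
  by (induction w gs rule: eval_gates.induct) auto

lemma eval_gates_append: "eval_gates w (gs @ hs) = eval_gates (eval_gates w gs) hs"
  by (induction w gs rule: eval_gates.induct) auto

definition wires_ok :: "nat \<Rightarrow> (nat \<times> nat) list \<Rightarrow> bool" where
  "wires_ok k gs \<longleftrightarrow> (\<forall>i<length gs. fst (gs ! i) < k + i \<and> snd (gs ! i) < k + i)"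

lemma wires_ok_Nil [simp]: "wires_ok k []"
  by (simp add: wires_ok_def)

lemma wires_ok_Cons: "wires_ok k (g # gs) \<longleftrightarrow> fst g < k \<and> snd g < k \<and> wires_ok (Suc k) gs"
  by (auto simp: wires_ok_def nth_Cons less_Suc_eq_0_disj split: nat.splits)

lemma wires_ok_snoc: "wires_ok k (gs @ [g]) \<longleftrightarrow> wires_ok k gs \<and> fst g < k + length gs \<and> snd g < k + length gs"
  by (auto simp: wires_ok_def nth_append less_Suc_eq)

text \<open>All functions of \<open>F\<close> are wires of one and the same circuit, so that they
  can be shared by later gates.\<close>

definition computable :: "nat \<Rightarrow> (bool list \<Rightarrow> bool) set \<Rightarrow> nat \<Rightarrow> bool" where
  "computable k F c \<longleftrightarrow> (\<exists>gs. length gs \<le> c \<and> wires_ok k gs \<and>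
     (\<forall>f\<in>F. \<exists>i<k + length gs. \<forall>x. length x = k \<longrightarrow> eval_gates x gs ! i = f x))"

text \<open>Quantifying over all \<open>G \<supseteq> F\<close> makes costs additive: wires computed so far stay available.\<close>

definition adds :: "nat \<Rightarrow> (bool list \<Rightarrow> bool) set \<Rightarrow> (bool list \<Rightarrow> bool) set \<Rightarrow> nat \<Rightarrow> bool" where
  "adds k F H c \<longleftrightarrow> (\<forall>G b. F \<subseteq> G \<longrightarrow> computable k G b \<longrightarrow> computable k (G \<union> H) (b + c))"

definition inputs :: "nat \<Rightarrow> (bool list \<Rightarrow> bool) set" where
  "inputs k = (\<lambda>i x. x ! i) ` {..<k}"

lemma computable_inputs: "computable k (inputs k) 0"
  unfolding computable_def inputs_def by (intro exI[of _ "[]"]) auto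

lemma computable_mono: "computable k F c \<Longrightarrow> F' \<subseteq> F \<Longrightarrow> c \<le> c' \<Longrightarrow> computable k F' c'"
  unfolding computable_def by (meson order.trans subsetD)

lemma addsD: "adds k F H c \<Longrightarrow> computable k F b \<Longrightarrow> computable k (F \<union> H) (b + c)"
  by (simp add: adds_def)

lemma adds_mono: "adds k F H c \<Longrightarrow> F \<subseteq> F' \<Longrightarrow> H' \<subseteq> H \<Longrightarrow> c \<le> c' \<Longrightarrow> adds k F' H' c'"
  unfolding adds_def
  by (meson Un_mono add_left_mono computable_mono order.trans order_refl)

lemma adds_subset: "H \<subseteq> F \<Longrightarrow> adds k F H c"
  unfolding adds_def by (metis computable_mono le_add1 order_refl sup.absorb1 sup.mono order.trans)

lemma adds_trans:
  assumes "adds k F H c" "adds k (F \<union> H) H' c'"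
  shows "adds k F (H \<union> H') (c + c')"
  unfolding adds_def
proof (intro allI impI)
  fix G b assume G: "F \<subseteq> G" "computable k G b"
  then have "computable k (G \<union> H) (b + c)" using assms(1) by (simp add: adds_def)
  moreover have "F \<union> H \<subseteq> G \<union> H" using G by auto
  ultimately have "computable k (G \<union> H \<union> H') (b + c + c')" using assms(2) by (simp add: adds_def)
  then show "computable k (G \<union> (H \<union> H')) (b + (c + c'))" by (simp add: Un_assoc add.assoc)
qed

lemma adds_UN:
  assumes "finite I" "\<And>i. i \<in> I \<Longrightarrow> adds k F (H i) c"
  shows "adds k F (\<Union>i\<in>I. H i) (card I * c)"
  using assms
proof (induction I rule: finite_induct)
  case empty
  then show ?case by (simp add: adds_subset)
next
  case (insert i I)
  have "adds k F (H i \<union> (\<Union>i\<in>I. H i)) (c + card I * c)"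
    by (rule adds_trans) (use insert in \<open>auto intro: adds_mono\<close>)
  then show ?case using insert by simp
qed

lemma adds_image:
  assumes "finite I" "\<And>i. i \<in> I \<Longrightarrow> adds k F {h i} c"
  shows "adds k F (h ` I) (card I * c)"
  using adds_UN[of I k F "\<lambda>i. {h i}" c] assms by (simp add: UNION_singleton_eq_range)

lemma adds_nand:
  assumes "f \<in> F" "g \<in> F"
  shows "adds k F {\<lambda>x. \<not> (f x \<and> g x)} 1"
  unfolding adds_def
proof (intro allI impI)
  fix G b assume G: "F \<subseteq> G" "computable k G b"
  from G(2) obtain gs where gs: "length gs \<le> b" "wires_ok k gs"
    "\<And>f. f \<in> G \<Longrightarrow> \<exists>i<k + length gs. \<forall>x. length x = k \<longrightarrow> eval_gates x gs ! i = f x"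
    unfolding computable_def by blast
  have "f \<in> G" "g \<in> G" using assms G(1) by auto
  from gs(3)[OF this(1)] gs(3)[OF this(2)]
  obtain i j where ij: "i < k + length gs" "\<And>x. length x = k \<Longrightarrow> eval_gates x gs ! i = f x"
    "j < k + length gs" "\<And>x. length x = k \<Longrightarrow> eval_gates x gs ! j = g x"
    by blast
  let ?gs = "gs @ [(i, j)]"
  have old: "\<exists>i<k + length ?gs. \<forall>x. length x = k \<longrightarrow> eval_gates x ?gs ! i = f x" if f: "f \<in> G" for f
  proof -
    obtain l where l: "l < k + length gs" "\<And>x. length x = k \<Longrightarrow> eval_gates x gs ! l = f x"
      using gs(3)[OF f] by blast
    then show ?thesis
      by (intro exI[of _ l]) (auto simp: eval_gates_append nth_append)
  qed
  have new: "\<exists>l<k + length ?gs. \<forall>x. length x = k \<longrightarrow> eval_gates x ?gs ! l = (\<not> (f x \<and> g x))"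
    using ij by (intro exI[of _ "k + length gs"]) (auto simp: eval_gates_append nth_append)
  show "computable k (G \<union> {\<lambda>x. \<not> (f x \<and> g x)}) (b + 1)"
    unfolding computable_def
  proof (intro exI[of _ ?gs] conjI ballI)
    show "length ?gs \<le> b + 1" "wires_ok k ?gs"
      using gs(1,2) ij(1,3) by (simp_all add: wires_ok_snoc)
    fix h assume "h \<in> G \<union> {\<lambda>x. \<not> (f x \<and> g x)}"
    then show "\<exists>i<k + length ?gs. \<forall>x. length x = k \<longrightarrow> eval_gates x ?gs ! i = h x"
      using old new by blast
  qed
qed

section \<open>Constants, multiplexers, decision trees and branching programs\<close>

lemma adds_nand_insert:
  assumes "adds k F H c" "f \<in> F \<union> H" "g \<in> F \<union> H"
  shows "adds k F (insert (\<lambda>x. \<not> (f x \<and> g x)) H) (c + 1)"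
  using adds_trans[OF assms(1) adds_nand[OF assms(2,3)]] by simp

text \<open>The NAND basis has no constants: True is the NAND of a wire and its negation, so some
  wire \<open>f\<close> is required.\<close>

lemma adds_consts:
  assumes "f \<in> F"
  shows "adds k F {\<lambda>_. True, \<lambda>_. False} 3"
proof -
  have 0: "adds k F {} 0" by (simp add: adds_subset)
  have 1: "adds k F {\<lambda>x. \<not> f x} 1" using adds_nand_insert[OF 0, of f f] assms by simp
  have 2: "adds k F {\<lambda>x. True, \<lambda>x. \<not> f x} 2"
    using adds_nand_insert[OF 1, of f "\<lambda>x. \<not> f x"] assms by (simp add: numeral_2_eq_2)
  have 3: "adds k F {\<lambda>x. False, \<lambda>x. True, \<lambda>x. \<not> f x} 3"
    using adds_nand_insert[OF 2, of "\<lambda>x. True" "\<lambda>x. True"] assms by (simp add: numeral_3_eq_3 numeral_2_eq_2)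
  show ?thesis by (rule adds_mono[OF 3]) auto
qed

lemma adds_mux:
  assumes "f \<in> F" "g \<in> F" "h \<in> F"
  shows "adds k F {\<lambda>x. if f x then g x else h x} 4"
proof -
  have 0: "adds k F {} 0" by (simp add: adds_subset)
  have 1: "adds k F {\<lambda>x. \<not> f x} 1" using adds_nand_insert[OF 0, of f f] assms by simp
  have 2: "adds k F {\<lambda>x. \<not> (f x \<and> g x), \<lambda>x. \<not> f x} 2"
    using adds_nand_insert[OF 1, of f g] assms by (simp add: numeral_2_eq_2)
  have 3: "adds k F {\<lambda>x. \<not> (\<not> f x \<and> h x), \<lambda>x. \<not> (f x \<and> g x), \<lambda>x. \<not> f x} 3"
    using adds_nand_insert[OF 2, of "\<lambda>x. \<not> f x" h] assms by (simp add: numeral_3_eq_3 numeral_2_eq_2)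
  have 4: "adds k F {\<lambda>x. \<not> (\<not> (f x \<and> g x) \<and> \<not> (\<not> f x \<and> h x)), \<lambda>x. \<not> (\<not> f x \<and> h x), \<lambda>x. \<not> (f x \<and> g x), \<lambda>x. \<not> f x} 4"
    using adds_nand_insert[OF 3, of "\<lambda>x. \<not> (f x \<and> g x)" "\<lambda>x. \<not> (\<not> f x \<and> h x)"] by simp
  have "(\<lambda>x. \<not> (\<not> (f x \<and> g x) \<and> \<not> (\<not> f x \<and> h x))) = (\<lambda>x. if f x then g x else h x)"
    by auto
  from 4[unfolded this] show ?thesis by (rule adds_mono) simp_all
qed

text \<open>A complete binary tree of multiplexers that query the wires \<open>fs\<close> in turn:
  2^r - 1 inner nodes for r = \<open>length fs\<close>, with four gates each. The leaves
  \<open>G bs\<close> may be arbitrary available functions, which allows trees to be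
  stacked.\<close>

lemma adds_decision_tree:
  assumes "set fs \<subseteq> F" "\<And>bs. length bs = length fs \<Longrightarrow> G bs \<in> F"
  shows "adds k F {\<lambda>x. G (map (\<lambda>f. f x) fs) x} (4 * (2 ^ length fs - 1))"
  using assms
proof (induction fs arbitrary: G)
  case Nil
  have "(\<lambda>x. G [] x) \<in> F" using Nil(2)[of "[]"] by simp
  then show ?case by (intro adds_subset) auto
next
  case (Cons f fs)
  define g where "g b = (\<lambda>x. G (b # map (\<lambda>f. f x) fs) x)" for b
  have g: "adds k F {g b} (4 * (2 ^ length fs - 1))" for b
    unfolding g_def using Cons.prems by (intro Cons.IH) auto
  have "adds k F ({g True} \<union> {g False}) (4 * (2 ^ length fs - 1) + 4 * (2 ^ length fs - 1))"
    by (rule adds_trans[OF g adds_mono[OF g]]) auto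
  then have "adds k F (({g True} \<union> {g False}) \<union> {\<lambda>x. if f x then g True x else g False x})
     (4 * (2 ^ length fs - 1) + 4 * (2 ^ length fs - 1) + 4)"
    by (rule adds_trans[OF _ adds_mux]) (use Cons.prems in auto)
  moreover have "(\<lambda>x. if f x then g True x else g False x) = (\<lambda>x. G (map (\<lambda>f. f x) (f # fs)) x)"
    by (auto simp: g_def fun_eq_iff)
  moreover have "4 * (2 ^ length fs - 1) + 4 * (2 ^ length fs - 1) + 4 = 4 * (2 ^ length (f # fs) - (1::nat))"
  proof -
    have "(1::nat) \<le> 2 ^ length fs" by simp
    then show ?thesis unfolding length_Cons power_Suc by linarith
  qed
  ultimately have "adds k F (({g True} \<union> {g False}) \<union> {\<lambda>x. G (map (\<lambda>f. f x) (f # fs)) x})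
     (4 * (2 ^ length (f # fs) - 1))"
    by (simp only:)
  then show ?case by (rule adds_mono) simp_all
qed

text \<open>A branching program: the state after the remaining steps is computed backwards, one
  function per state, which needs no injectivity of the transitions.\<close>

lemma adds_branching_program:
  fixes V :: "nat \<Rightarrow> 's::comm_monoid_add set" and g :: "nat \<Rightarrow> bool list \<Rightarrow> 's"
  assumes fs: "\<And>i. i < m \<Longrightarrow> set (fs i) \<subseteq> F" "\<And>i. i < m \<Longrightarrow> length (fs i) \<le> r"
    and const: "(\<lambda>_. True) \<in> F" "(\<lambda>_. False) \<in> F"
    and V: "\<And>i. i < m \<Longrightarrow> finite (V i)" "\<And>i. i < m \<Longrightarrow> card (V i) \<le> K"
    and step: "\<And>i v bs. i < m \<Longrightarrow> v \<in> V i \<Longrightarrow> length bs = length (fs i) \<Longrightarrow> v + g i bs \<in> V (Suc i)"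
    and "0 \<in> V 0"
  shows "adds k F {\<lambda>x. acc (\<Sum>i<m. g i (map (\<lambda>f. f x) (fs i)))} (4 * 2 ^ r * K * m)"
proof -
  let ?t = "\<lambda>i x. g i (map (\<lambda>f. f x) (fs i))"
  have const': "(\<lambda>_. b) \<in> F" for b using const by (cases b) auto
  have "adds k F ((\<lambda>v x. acc (v + (\<Sum>i = i..<m. ?t i x))) ` V i) (4 * 2 ^ r * K * l)"
    if "i + l = m" for i l
    using that
  proof (induction l arbitrary: i)
    case 0
    then show ?case using const' by (intro adds_subset) auto
  next
    case (Suc l)
    then have im: "i < m" "Suc i + l = m" by auto
    let ?H = "(\<lambda>v x. acc (v + (\<Sum>i = Suc i..<m. ?t i x))) ` V (Suc i)"
    have "adds k (F \<union> ?H) ((\<lambda>v x. acc (v + (\<Sum>i = i..<m. ?t i x))) ` V i) (card (V i) * (4 * 2 ^ r))"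
    proof (rule adds_image[OF V(1)[OF im(1)]])
      fix v assume v: "v \<in> V i"
      have "adds k (F \<union> ?H) {\<lambda>x. (\<lambda>bs x. acc ((v + g i bs) + (\<Sum>i = Suc i..<m. ?t i x))) (map (\<lambda>f. f x) (fs i)) x}
          (4 * (2 ^ length (fs i) - 1))"
        using fs(1)[OF im(1)] step[OF im(1) v] by (intro adds_decision_tree) auto
      moreover have "(\<lambda>x. (\<lambda>bs x. acc ((v + g i bs) + (\<Sum>i = Suc i..<m. ?t i x))) (map (\<lambda>f. f x) (fs i)) x)
         = (\<lambda>x. acc (v + (\<Sum>i = i..<m. ?t i x)))"
        using im by (auto simp: sum.atLeast_Suc_lessThan add.assoc)
      moreover have "4 * (2 ^ length (fs i) - 1) \<le> 4 * (2::nat) ^ r"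
        using power_increasing[OF fs(2)[OF im(1)], of "2::nat"] by linarith
      ultimately show "adds k (F \<union> ?H) {\<lambda>x. acc (v + (\<Sum>i = i..<m. ?t i x))} (4 * 2 ^ r)"
        by (simp only:) (erule adds_mono; simp)
    qed
    then have "adds k F (?H \<union> (\<lambda>v x. acc (v + (\<Sum>i = i..<m. ?t i x))) ` V i) (4 * 2 ^ r * K * l + card (V i) * (4 * 2 ^ r))"
      by (rule adds_trans[OF Suc.IH[OF im(2)]])
    moreover have "4 * 2 ^ r * K * l + card (V i) * (4 * 2 ^ r) \<le> 4 * 2 ^ r * K * Suc l"
      using V(2)[OF im(1)] by simp
    ultimately show ?case by (rule adds_mono[OF _ order_refl Un_upper2])
  qed
  from this[of 0 m] show ?thesis
    using \<open>0 \<in> V 0\<close>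
    by (rule_tac adds_mono[where F = F and F' = F and c = "4 * 2 ^ r * K * m"])
       (auto simp: atLeast0LessThan image_iff intro!: bexI[of _ 0])
qed

text \<open>Composition of circuits: the simulated circuit reads arbitrary available functions
  \<open>us\<close>. The induction moves the output of the first gate into \<open>us\<close>, so
  \<open>us\<close> and \<open>F\<close> have to vary.\<close>

lemma adds_eval_gates:
  assumes "set us \<subseteq> F" "wires_ok (length us) gs"
  shows "adds k F ((\<lambda>i x. eval_gates (map (\<lambda>u. u x) us) gs ! i) ` {..<length us + length gs}) (length gs)"
  using assms
proof (induction gs arbitrary: us F)
  case Nil
  have "(\<lambda>x. map (\<lambda>u. u x) us ! i) = us ! i" if "i < length us" for i
    using that by (auto simp: fun_eq_iff)
  then have "(\<lambda>i x. eval_gates (map (\<lambda>u. u x) us) [] ! i) ` {..<length us + length []} \<subseteq> F"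
    using Nil by (auto simp: subset_iff)
  then show ?case by (rule adds_subset)
next
  case (Cons g gs)
  obtain i j where g: "g = (i, j)" by force
  let ?h = "\<lambda>x. \<not> ((us ! i) x \<and> (us ! j) x)"
  have ij: "i < length us" "j < length us" and ok: "wires_ok (Suc (length us)) gs"
    using Cons.prems g by (auto simp: wires_ok_Cons)
  have 1: "adds k F {?h} 1"
    using ij Cons.prems by (intro adds_nand) (auto simp: subset_iff)
  have 2: "adds k (F \<union> {?h})
      ((\<lambda>i x. eval_gates (map (\<lambda>u. u x) (us @ [?h])) gs ! i) ` {..<length (us @ [?h]) + length gs}) (length gs)"
    using Cons.prems ok by (intro Cons.IH) auto
  have eq: "eval_gates (map (\<lambda>u. u x) (us @ [?h])) gs = eval_gates (map (\<lambda>u. u x) us) (g # gs)" for x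
    using ij by (simp add: g)
  show ?case
    using adds_trans[OF 1 2] unfolding eq by (rule adds_mono) auto
qed

lemma adds_exists:
  assumes "finite I" "\<And>i. i \<in> I \<Longrightarrow> h i \<in> F" "(\<lambda>_. True) \<in> F" "(\<lambda>_. False) \<in> F"
  shows "adds k F {\<lambda>x. \<exists>i\<in>I. h i x} (4 * card I)"
  using assms
proof (induction I rule: finite_induct)
  case empty
  then show ?case by (intro adds_subset) simp
next
  case (insert i I)
  have "adds k F ({\<lambda>x. \<exists>i\<in>I. h i x} \<union> {\<lambda>x. if h i x then True else (\<exists>i\<in>I. h i x)}) (4 * card I + 4)"
    by (rule adds_trans[OF _ adds_mux]) (use insert in auto)
  moreover have "(\<lambda>x. if h i x then True else (\<exists>i\<in>I. h i x)) = (\<lambda>x. \<exists>i\<in>insert i I. h i x)"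
    by auto
  ultimately have "adds k F ({\<lambda>x. \<exists>i\<in>I. h i x} \<union> {\<lambda>x. \<exists>i\<in>insert i I. h i x}) (4 * card I + 4)"
    by (simp only:)
  then show ?case by (rule adds_mono) (use insert in simp_all)
qed

lemma computable_circuit:
  assumes "computable k F c" "f \<in> F"
  obtains A where "valid_circuit k 1 A" "runtime A \<le> c + 1" "\<And>x. length x = k \<Longrightarrow> run A x = return_pmf [f x]"
proof -
  obtain gs i where gs: "length gs \<le> c" "wires_ok k gs" "i < k + length gs"
    "\<And>x. length x = k \<Longrightarrow> eval_gates x gs ! i = f x"
    using assms unfolding computable_def by blast
  show ?thesis
  proof (rule that)
    show "valid_circuit k 1 (Circuit 0 gs [i])"
      using gs by (auto simp: valid_circuit_def wires_ok_def)
    show "runtime (Circuit 0 gs [i]) \<le> c + 1"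
      using gs by (simp add: runtime_def)
    show "run (Circuit 0 gs [i]) x = return_pmf [f x]" if "length x = k" for x
      using gs(4)[OF that] by (simp add: run_def pmf_of_set_singleton)
  qed
qed

section \<open>Low-degree advantage of biased bits\<close>

lemma polynomials_monomial:
  assumes "\<alpha> \<in> exponents N D"
  shows "(\<lambda>x. \<Prod>i<N. x i ^ \<alpha> i) \<in> polynomials N D"
proof -
  have "(\<Prod>i<N. x i ^ \<alpha> i) = (\<Sum>\<beta>\<in>exponents N D. (if \<beta> = \<alpha> then 1 else 0) * (\<Prod>i<N. x i ^ \<beta> i))"
    for x :: "nat \<Rightarrow> real"
  proof -
    have "(\<Sum>\<beta>\<in>exponents N D. (if \<beta> = \<alpha> then 1 else 0) * (\<Prod>i<N. x i ^ \<beta> i))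
      = (\<Sum>\<beta>\<in>exponents N D. if \<beta> = \<alpha> then (\<Prod>i<N. x i ^ \<beta> i) else 0)"
      by (rule sum.cong) auto
    then show ?thesis using assms by (simp add: sum.delta[OF finite_exponents])
  qed
  then show ?thesis
    unfolding polynomials_def by (intro CollectI exI[of _ "\<lambda>\<beta>. if \<beta> = \<alpha> then 1 else 0"] ext)
qed

lemma polynomials_add:
  assumes "f \<in> polynomials N D" "g \<in> polynomials N D"
  shows "(\<lambda>x. f x + g x) \<in> polynomials N D"
proof -
  obtain a b where "f = (\<lambda>x. \<Sum>\<alpha>\<in>exponents N D. a \<alpha> * (\<Prod>i<N. x i ^ \<alpha> i))"
    "g = (\<lambda>x. \<Sum>\<alpha>\<in>exponents N D. b \<alpha> * (\<Prod>i<N. x i ^ \<alpha> i))"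
    using assms unfolding polynomials_def by blast
  then show ?thesis
    unfolding polynomials_def
    by (auto intro!: exI[of _ "\<lambda>\<alpha>. a \<alpha> + b \<alpha>"] simp: algebra_simps sum.distrib)
qed

lemma polynomials_cmult:
  assumes "f \<in> polynomials N D"
  shows "(\<lambda>x. c * f x) \<in> polynomials N D"
proof -
  obtain a where "f = (\<lambda>x. \<Sum>\<alpha>\<in>exponents N D. a \<alpha> * (\<Prod>i<N. x i ^ \<alpha> i))"
    using assms unfolding polynomials_def by blast
  then show ?thesis
    unfolding polynomials_def
    by (auto intro!: exI[of _ "\<lambda>\<alpha>. c * a \<alpha>"] simp: mult.assoc sum_distrib_left)
qed

lemma polynomials_const: "(\<lambda>_. c) \<in> polynomials N D"
  using polynomials_cmult[OF polynomials_monomial[of "\<lambda>_. 0" N D], of c] by (simp add: exponents_def)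

lemma polynomials_sum:
  assumes "\<And>i. i \<in> I \<Longrightarrow> f i \<in> polynomials N D"
  shows "(\<lambda>x. \<Sum>i\<in>I. f i x) \<in> polynomials N D"
  using assms
  by (induction I rule: infinite_finite_induct) (auto intro: polynomials_const polynomials_add)

text \<open>Monomials in centred bits. They form an orthogonal system under independent Bernoulli
  bits of parameter \<open>p\<close>.\<close>

abbreviation chi :: "real \<Rightarrow> nat set \<Rightarrow> (nat \<Rightarrow> bool) \<Rightarrow> real" where
  "chi p S Y \<equiv> \<Prod>i\<in>S. (of_bool (Y i) - p)"

lemma monomial_chi:
  assumes "finite A"
  shows "(\<Prod>i\<in>A. of_bool (Y i) :: real) = (\<Sum>S\<in>Pow A. p ^ card (A - S) * chi p S Y)"
  using prod_add[OF assms, of "\<lambda>i. of_bool (Y i) - p" "\<lambda>_. p"] by (simp add: mult.commute)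

text \<open>On bits, every positive power of a variable is the variable itself, so a monomial
  depends only on its support, whose size is at most the degree. Writing each bit as its centred
  version plus \<open>p\<close> expands it into \<open>chi p S\<close> over subsets of the
  support.\<close>

lemma polynomials_chi:
  assumes "f \<in> polynomials N D"
  shows "\<exists>a. \<forall>Y. f (point (map Y [0..<N])) = (\<Sum>S | S \<subseteq> {..<N} \<and> card S \<le> D. a S * chi p S Y)"
proof -
  let ?SS = "{S. S \<subseteq> {..<N} \<and> card S \<le> D}"
  obtain c where c: "f = (\<lambda>x. \<Sum>\<alpha>\<in>exponents N D. c \<alpha> * (\<Prod>i<N. x i ^ \<alpha> i))"
    using assms unfolding polynomials_def by blast
  define s where "s \<alpha> = {i. i < N \<and> \<alpha> i \<noteq> 0}" for \<alpha> :: "nat \<Rightarrow> nat"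
  have fin: "finite ?SS" by (rule finite_subset[of _ "Pow {..<N}"]) auto
  have mono: "(\<Prod>i<N. point (map Y [0..<N]) i ^ \<alpha> i)
      = (\<Sum>S\<in>?SS. (if S \<subseteq> s \<alpha> then p ^ card (s \<alpha> - S) else 0) * chi p S Y)"
    if "\<alpha> \<in> exponents N D" for \<alpha> Y
  proof -
    have "card (s \<alpha>) = (\<Sum>i\<in>s \<alpha>. 1)" by simp
    also have "\<dots> \<le> (\<Sum>i\<in>s \<alpha>. \<alpha> i)" by (rule sum_mono) (auto simp: s_def)
    also have "\<dots> \<le> (\<Sum>i<N. \<alpha> i)" by (rule sum_mono2) (auto simp: s_def)
    also have "\<dots> \<le> D" using that by (simp add: exponents_def)
    finally have card: "card (s \<alpha>) \<le> D" .
    have fs: "finite (s \<alpha>)" by (simp add: s_def)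
    have "(\<Prod>i<N. point (map Y [0..<N]) i ^ \<alpha> i) = (\<Prod>i<N. if i \<in> s \<alpha> then of_bool (Y i) else 1)"
      by (rule prod.cong) (auto simp: point_def s_def)
    also have "\<dots> = (\<Prod>i\<in>s \<alpha>. of_bool (Y i))"
      by (subst prod.inter_restrict[symmetric]) (auto simp: s_def intro!: prod.cong)
    also have "\<dots> = (\<Sum>S\<in>Pow (s \<alpha>). p ^ card (s \<alpha> - S) * chi p S Y)"
      by (rule monomial_chi[OF fs])
    also have "\<dots> = (\<Sum>S\<in>?SS. if S \<in> Pow (s \<alpha>) then p ^ card (s \<alpha> - S) * chi p S Y else 0)"
    proof (subst sum.inter_restrict[OF fin, symmetric], rule sum.cong)
      have "card S \<le> D" if "S \<subseteq> s \<alpha>" for S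
        using card_mono[OF fs that] card by simp
      moreover have "s \<alpha> \<subseteq> {..<N}" by (auto simp: s_def)
      ultimately show "Pow (s \<alpha>) = ?SS \<inter> Pow (s \<alpha>)" by auto
    qed simp
    also have "\<dots> = (\<Sum>S\<in>?SS. (if S \<subseteq> s \<alpha> then p ^ card (s \<alpha> - S) else 0) * chi p S Y)"
      by (rule sum.cong) auto
    finally show ?thesis .
  qed
  have "f (point (map Y [0..<N])) =
     (\<Sum>S\<in>?SS. (\<Sum>\<alpha>\<in>exponents N D. c \<alpha> * (if S \<subseteq> s \<alpha> then p ^ card (s \<alpha> - S) else 0)) * chi p S Y)" for Y
    unfolding c sum_distrib_right
    by (subst sum.swap) (simp add: mono sum_distrib_left mult.assoc)
  then show ?thesis
    by (intro exI[of _ "\<lambda>S. \<Sum>\<alpha>\<in>exponents N D. c \<alpha> * (if S \<subseteq> s \<alpha> then p ^ card (s \<alpha> - S) else 0)"] allI)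
qed

lemma mean_chi:
  assumes "S \<subseteq> {..<N}" "\<And>k. k < N \<Longrightarrow> 0 \<le> r k \<and> r k \<le> 1"
  shows "mean (bits N r) (chi p S) = (\<Prod>k\<in>S. (r k - p))"
proof -
  have "mean (bits N r) (chi p S)
      = mean (bits N r) (\<lambda>Y. \<Prod>k<N. if k \<in> S then of_bool (Y k) - p else 1)"
    using assms by (subst prod.inter_restrict[symmetric]) (auto simp: Int_absorb1)
  also have "\<dots> = (\<Prod>k<N. mean (bernoulli_pmf (r k)) (\<lambda>y. if k \<in> S then of_bool y - p else 1))"
    by (rule mean_prod) auto
  also have "\<dots> = (\<Prod>k<N. if k \<in> S then r k - p else 1)"
    using assms by (intro prod.cong) (auto simp: mean_bernoulli algebra_simps)
  also have "\<dots> = (\<Prod>k\<in>S. (r k - p))"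
    using assms by (subst prod.inter_restrict[symmetric]) (auto simp: Int_absorb1)
  finally show ?thesis .
qed

lemma mean_chi_chi:
  assumes "S \<subseteq> {..<N}" "T \<subseteq> {..<N}" "0 \<le> p" "p \<le> 1"
  shows "mean (bits N (\<lambda>_. p)) (\<lambda>Y. chi p S Y * chi p T Y) = (if S = T then (p * (1 - p)) ^ card S else 0)"
proof -
  let ?h = "\<lambda>k y. (if k \<in> S then of_bool y - p else 1) * (if k \<in> T then of_bool y - p else 1)"
  have "mean (bits N (\<lambda>_. p)) (\<lambda>Y. chi p S Y * chi p T Y)
      = mean (bits N (\<lambda>_. p)) (\<lambda>Y. \<Prod>k<N. ?h k (Y k))"
    using assms unfolding prod.distrib
    by (subst (1 2) prod.inter_restrict[symmetric]) (auto simp: Int_absorb1)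
  also have "\<dots> = (\<Prod>k<N. mean (bernoulli_pmf p) (?h k))"
    by (rule mean_prod) auto
  also have "\<dots> = (\<Prod>k<N. if k \<in> S \<longleftrightarrow> k \<in> T then (if k \<in> S then p * (1 - p) else 1) else 0)"
    using assms by (intro prod.cong) (auto simp: mean_bernoulli algebra_simps)
  also have "\<dots> = (if S = T then (p * (1 - p)) ^ card S else 0)"
  proof (cases "S = T")
    case True
    have "(\<Prod>k<N. if k \<in> S then p * (1 - p) else 1) = (p * (1 - p)) ^ card S"
      using assms by (subst prod.inter_restrict[symmetric]) (auto simp: Int_absorb1)
    then show ?thesis using True by simp
  next
    case False
    then obtain k where "k < N" "(k \<in> S) \<noteq> (k \<in> T)" using assms by blast
    then have "(\<Prod>k<N. if k \<in> S \<longleftrightarrow> k \<in> T then (if k \<in> S then p * (1 - p) else 1) else 0) = 0"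
      by (intro prod_zero) auto
    then show ?thesis using False by simp
  qed
  finally show ?thesis .
qed

text \<open>For b = 0 the assumption gives a \<le> 0, and the extended quotient is then 0 or minus
  infinity.\<close>

lemma ereal_div_sqrt_le:
  fixes a b c :: real
  assumes "a \<le> c * sqrt b" "0 \<le> b" "0 \<le> c"
  shows "ereal a / ereal (sqrt b) \<le> ereal c"
proof (cases "b = 0")
  case True
  then show ?thesis using assms by (cases "a = 0") auto
next
  case False
  then show ?thesis using assms by (simp add: divide_le_eq)
qed

section \<open>The advantage and second moments\<close>

lemma adv_le:
  assumes "0 \<le> c" "\<And>f. f \<in> polynomials N D \<Longrightarrow>
     mean P (\<lambda>y. f (point y)) \<le> c * sqrt (mean Q (\<lambda>y. (f (point y))\<^sup>2))"
  shows "adv N D P Q \<le> ereal c"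
  unfolding adv_def using assms by (intro SUP_least ereal_div_sqrt_le mean_nonneg) auto

lemma adv_ge_1: "adv N D P Q \<ge> 1"
proof -
  have "ereal (mean P (\<lambda>y. (\<lambda>_. 1) (point y))) / ereal (sqrt (mean Q (\<lambda>y. ((\<lambda>_. 1) (point y))\<^sup>2))) \<le> adv N D P Q"
    unfolding adv_def by (rule SUP_upper[OF polynomials_const])
  then show ?thesis by (simp add: one_ereal_def)
qed

text \<open>A polynomial with vanishing null second moment and positive planted mean would make the
  advantage infinite, so the inequality covers the degenerate case too.\<close>

lemma adv_bound:
  assumes "f \<in> polynomials N D" "adv N D P Q \<le> ereal c"
  shows "mean P (\<lambda>y. f (point y)) \<le> c * sqrt (mean Q (\<lambda>y. (f (point y))\<^sup>2))"
proof -
  let ?a = "mean P (\<lambda>y. f (point y))" and ?b = "mean Q (\<lambda>y. (f (point y))\<^sup>2)"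
  have le: "ereal ?a / ereal (sqrt ?b) \<le> ereal c"
    using assms(2) unfolding adv_def by (rule order_trans[OF SUP_upper[OF assms(1)]])
  have b: "0 \<le> ?b" by (intro mean_nonneg) auto
  show ?thesis
  proof (cases "?b = 0")
    case True
    then show ?thesis using le by (cases "?a > 0") auto
  next
    case False
    then show ?thesis using le b by (simp add: divide_le_eq)
  qed
qed

text \<open>\<open>U\<close> is the law of the latent labeling, given which the planted bits are
  independent. In the orthogonal basis of the \<open>chi p S\<close>, Cauchy-Schwarz bounds the
  planted mean by the null norm of f times the norm of the projection of the likelihood ratio to
  degree \<open>D\<close>; the sum bounded by \<open>B\<close> is the square of the latter.\<close>

lemma low_degree_second_moment:
  fixes U :: "'s pmf"
  assumes U: "finite (set_pmf U)" and p: "0 < p" "p < 1"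
    and r: "\<And>s k. s \<in> set_pmf U \<Longrightarrow> k < N \<Longrightarrow> 0 \<le> r s k \<and> r s k \<le> 1"
    and P: "P = bind_pmf U (\<lambda>s. map_pmf (\<lambda>Y. map Y [0..<N]) (bits N (r s)))"
    and Q: "Q = map_pmf (\<lambda>Y. map Y [0..<N]) (bits N (\<lambda>_. p))"
    and B: "(\<Sum>S | S \<subseteq> {..<N} \<and> card S \<le> D. (mean U (\<lambda>s. \<Prod>k\<in>S. (r s k - p)))\<^sup>2 / (p * (1 - p)) ^ card S) \<le> B"
  shows "adv N D P Q \<le> ereal (sqrt B)"
proof (rule adv_le)
  let ?SS = "{S. S \<subseteq> {..<N} \<and> card S \<le> D}"
  let ?v = "\<lambda>S. (p * (1 - p)) ^ card S" and ?m = "\<lambda>S. mean U (\<lambda>s. \<Prod>k\<in>S. (r s k - p))"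
  have v: "?v S > 0" for S using p by simp
  have fin: "finite ?SS" by (rule finite_subset[of _ "Pow {..<N}"]) auto
  have "0 \<le> (\<Sum>S\<in>?SS. (?m S)\<^sup>2 / ?v S)" by (intro sum_nonneg divide_nonneg_pos v) auto
  then have "0 \<le> B" using B by simp
  then show "0 \<le> sqrt B" by simp
  fix f assume "f \<in> polynomials N D"
  from polynomials_chi[OF this, of p]
  obtain a where a: "\<And>Y. f (point (map Y [0..<N])) = (\<Sum>S\<in>?SS. a S * chi p S Y)" by blast
  have bits: "finite (set_pmf (bits N r))" for r by simp
  have mP: "mean P (\<lambda>y. f (point y)) = (\<Sum>S\<in>?SS. a S * ?m S)"
  proof -
    have "mean P (\<lambda>y. f (point y)) = mean U (\<lambda>s. mean (bits N (r s)) (\<lambda>Y. \<Sum>S\<in>?SS. a S * chi p S Y))"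
      using U by (simp add: P mean_bind a)
    also have "\<dots> = mean U (\<lambda>s. \<Sum>S\<in>?SS. a S * (\<Prod>k\<in>S. (r s k - p)))"
    proof (rule mean_cong)
      fix s assume s: "s \<in> set_pmf U"
      show "mean (bits N (r s)) (\<lambda>Y. \<Sum>S\<in>?SS. a S * chi p S Y) = (\<Sum>S\<in>?SS. a S * (\<Prod>k\<in>S. (r s k - p)))"
        unfolding mean_sum[OF bits] using mean_chi r[OF s] by (intro sum.cong) auto
    qed
    also have "\<dots> = (\<Sum>S\<in>?SS. a S * ?m S)"
      by (simp add: mean_sum[OF U])
    finally show ?thesis .
  qed
  have mQ: "mean Q (\<lambda>y. (f (point y))\<^sup>2) = (\<Sum>S\<in>?SS. (a S)\<^sup>2 * ?v S)"
  proof -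
    have "mean Q (\<lambda>y. (f (point y))\<^sup>2)
       = mean (bits N (\<lambda>_. p)) (\<lambda>Y. \<Sum>S\<in>?SS. \<Sum>T\<in>?SS. a S * a T * (chi p S Y * chi p T Y))"
      by (simp add: Q a power2_eq_square sum_product algebra_simps)
    also have "\<dots> = (\<Sum>S\<in>?SS. \<Sum>T\<in>?SS. a S * a T * (if S = T then ?v S else 0))"
      unfolding mean_sum[OF bits] using p by (intro sum.cong refl) (simp add: mean_chi_chi)
    also have "\<dots> = (\<Sum>S\<in>?SS. (a S)\<^sup>2 * ?v S)"
      using fin by (intro sum.cong) (auto simp: power2_eq_square if_distrib sum.delta cong: if_cong)
    finally show ?thesis .
  qed
  have "(\<Sum>S\<in>?SS. a S * ?m S)\<^sup>2 = (\<Sum>S\<in>?SS. (a S * sqrt (?v S)) * (?m S / sqrt (?v S)))\<^sup>2"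
    using p by simp
  also have "\<dots> \<le> (\<Sum>S\<in>?SS. (a S * sqrt (?v S))\<^sup>2) * (\<Sum>S\<in>?SS. (?m S / sqrt (?v S))\<^sup>2)"
    by (rule Cauchy_Schwarz_ineq_sum)
  also have "\<dots> = (\<Sum>S\<in>?SS. (a S)\<^sup>2 * ?v S) * (\<Sum>S\<in>?SS. (?m S)\<^sup>2 / ?v S)"
    using p by (simp add: power_mult_distrib power_divide)
  also have "\<dots> \<le> (\<Sum>S\<in>?SS. (a S)\<^sup>2 * ?v S) * B"
    using v by (intro mult_left_mono B sum_nonneg mult_nonneg_nonneg) (auto intro: less_imp_le)
  finally have "(mean P (\<lambda>y. f (point y)))\<^sup>2 \<le> mean Q (\<lambda>y. (f (point y))\<^sup>2) * B"
    unfolding mP mQ .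
  then have "mean P (\<lambda>y. f (point y)) \<le> sqrt (mean Q (\<lambda>y. (f (point y))\<^sup>2) * B)"
    by (rule real_le_rsqrt)
  then show "mean P (\<lambda>y. f (point y)) \<le> sqrt B * sqrt (mean Q (\<lambda>y. (f (point y))\<^sup>2))"
    by (simp add: real_sqrt_mult mult.commute)
qed

section \<open>Positive kernels and truncated exponentials\<close>

text \<open>Finite sums of rank-one kernels. Closure under products is the Schur product theorem,
  and the mean over two independent arguments is a sum of squared means.\<close>

inductive pos_kernel :: "('s \<Rightarrow> 's \<Rightarrow> real) \<Rightarrow> bool" where
  square: "pos_kernel (\<lambda>s t. h s * h t)"
| add: "pos_kernel f \<Longrightarrow> pos_kernel g \<Longrightarrow> pos_kernel (\<lambda>s t. f s t + g s t)"

lemma pos_kernel_mult: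
  assumes "pos_kernel f" "pos_kernel g"
  shows "pos_kernel (\<lambda>s t. f s t * g s t)"
  using assms(1)
proof induction
  case (square h)
  from assms(2) show ?case
  proof induction
    case (square h')
    have "(\<lambda>s t. h s * h t * (h' s * h' t)) = (\<lambda>s t. (h s * h' s) * (h t * h' t))"
      by (auto simp: algebra_simps)
    then show ?case using pos_kernel.square[of "\<lambda>s. h s * h' s"] by simp
  next
    case (add f' g')
    then show ?case using pos_kernel.add[OF add.IH] by (simp add: distrib_left)
  qed
next
  case (add f' g')
  then show ?case using pos_kernel.add[OF add.IH] by (simp add: distrib_right)
qed

lemma pos_kernel_const: "c \<ge> 0 \<Longrightarrow> pos_kernel (\<lambda>_ _. c)"
  using pos_kernel.square[of "\<lambda>_. sqrt c"] by simp

lemma pos_kernel_cmult: "c \<ge> 0 \<Longrightarrow> pos_kernel f \<Longrightarrow> pos_kernel (\<lambda>s t. c * f s t)"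
  by (rule pos_kernel_mult[OF pos_kernel_const])

lemma pos_kernel_sum:
  "(\<And>i. i \<in> I \<Longrightarrow> pos_kernel (f i)) \<Longrightarrow> pos_kernel (\<lambda>s t. \<Sum>i\<in>I. f i s t)"
  by (induction I rule: infinite_finite_induct) (auto intro: pos_kernel_const pos_kernel.add)

lemma pos_kernel_power: "pos_kernel f \<Longrightarrow> pos_kernel (\<lambda>s t. f s t ^ k)"
  by (induction k) (auto intro: pos_kernel_const pos_kernel_mult)

lemma mean_pos_kernel:
  assumes "finite (set_pmf U)" "pos_kernel f"
  shows "0 \<le> mean U (\<lambda>s. mean U (\<lambda>t. f s t))"
  using assms(2)
proof induction
  case (square h)
  then show ?case by (simp flip: power2_eq_square)
qed (simp add: mean_add[OF assms(1)])

text \<open>The elementary symmetric polynomial of degree k in the variables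
  \<open>x e\<close>.\<close>

definition esym :: "('e \<Rightarrow> real) \<Rightarrow> 'e set \<Rightarrow> nat \<Rightarrow> real" where
  "esym x E k = (\<Sum>S | S \<subseteq> E \<and> card S = k. \<Prod>e\<in>S. x e)"

lemma esym_0: "finite E \<Longrightarrow> esym x E 0 = 1"
proof -
  assume "finite E"
  then have "{S. S \<subseteq> E \<and> card S = 0} = {{}}" by (auto dest: finite_subset)
  then show ?thesis by (simp add: esym_def)
qed

lemma esym_insert:
  assumes "finite E" "e \<notin> E"
  shows "esym x (insert e E) (Suc k) = esym x E (Suc k) + x e * esym x E k"
proof -
  have sub: "finite S" "e \<notin> S" if "S \<subseteq> E" for S
    using that assms by (auto dest: finite_subset)
  have eq: "{S. S \<subseteq> insert e E \<and> card S = Suc k} = {S. S \<subseteq> E \<and> card S = Suc k} \<union> insert e ` {S. S \<subseteq> E \<and> card S = k}"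
  proof (intro equalityI subsetI)
    fix S assume S: "S \<in> {S. S \<subseteq> insert e E \<and> card S = Suc k}"
    show "S \<in> {S. S \<subseteq> E \<and> card S = Suc k} \<union> insert e ` {S. S \<subseteq> E \<and> card S = k}"
    proof (cases "e \<in> S")
      case True
      then have "S = insert e (S - {e})" "S - {e} \<subseteq> E" "card (S - {e}) = k"
        using S by auto
      then show ?thesis by blast
    qed (use S in auto)
  qed (auto simp: sub)
  have inj: "inj_on (insert e) {S. S \<subseteq> E \<and> card S = k}"
    using assms by (auto simp: inj_on_def)
  have fin: "finite {S. S \<subseteq> E \<and> P S}" for P
    by (rule finite_subset[of _ "Pow E"]) (use assms in auto)
  have "esym x (insert e E) (Suc k) = esym x E (Suc k) + (\<Sum>S\<in>insert e ` {S. S \<subseteq> E \<and> card S = k}. \<Prod>e\<in>S. x e)"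
    unfolding esym_def eq by (rule sum.union_disjoint) (use fin assms in auto)
  also have "(\<Sum>S\<in>insert e ` {S. S \<subseteq> E \<and> card S = k}. \<Prod>e\<in>S. x e) = (\<Sum>S | S \<subseteq> E \<and> card S = k. x e * (\<Prod>e\<in>S. x e))"
    by (subst sum.reindex[OF inj]) (auto intro!: sum.cong simp: sub)
  finally show ?thesis by (simp add: esym_def sum_distrib_left)
qed

text \<open>The product rule for exponential series: dividing powers by factorials absorbs the
  binomial coefficients.\<close>

lemma power_add_div_fact:
  fixes x y :: real
  shows "(x + y) ^ k / fact k = (\<Sum>i\<le>k. (x ^ i / fact i) * (y ^ (k - i) / fact (k - i)))"
  using exp_series_add_commuting[of x y k] by (simp add: divide_inverse mult.commute)

lemma power_add_div_fact_Suc: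
  fixes x y :: real
  shows "(x + y) ^ Suc l / fact (Suc l) = y ^ Suc l / fact (Suc l) + x * (y ^ l / fact l)
      + (\<Sum>i\<in>{2..Suc l}. (1 / fact i) * x ^ i * ((1 / fact (Suc l - i)) * y ^ (Suc l - i)))"
proof -
  have "{..Suc l} = insert 0 (insert 1 {2..Suc l})" by auto
  then have "(x + y) ^ Suc l / fact (Suc l)
    = (\<Sum>i\<in>insert 0 (insert 1 {2..Suc l}). (x ^ i / fact i) * (y ^ (Suc l - i) / fact (Suc l - i)))"
    by (simp only: power_add_div_fact)
  then show ?thesis by (simp del: power_Suc fact_Suc)
qed

text \<open>Expanding the power, the terms with repeated factors have nonnegative mean because each is a
  positive kernel.\<close>

lemma pos_kernel_power_esym:
  fixes x :: "'e \<Rightarrow> 's \<Rightarrow> 's \<Rightarrow> real"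
  assumes "finite E" "\<And>e. e \<in> E \<Longrightarrow> pos_kernel (x e)" "c \<ge> 0"
  shows "pos_kernel (\<lambda>s t. (c + (\<Sum>e\<in>E. x e s t)) ^ k / fact k - esym (\<lambda>e. x e s t) E k)"
  using assms(1,2)
proof (induction E arbitrary: k rule: finite_induct)
  case empty
  show ?case
  proof (cases k)
    case 0
    then show ?thesis using pos_kernel_const[of 0] by (simp add: esym_0)
  next
    case (Suc l)
    then have "esym (\<lambda>e. x e s t) {} k = 0" for s t
      by (auto simp: esym_def intro!: sum.neutral)
    then show ?thesis using assms(3) by (simp add: pos_kernel_const)
  qed
next
  case (insert e E)
  define X where "X = (\<lambda>s t. c + (\<Sum>e\<in>E. x e s t))"
  have IH: "pos_kernel (\<lambda>s t. X s t ^ m / fact m - esym (\<lambda>e. x e s t) E m)" for m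
    unfolding X_def using insert by simp
  show ?case
  proof (cases k)
    case 0
    then show ?thesis using insert pos_kernel_const[of 0] by (simp add: esym_0)
  next
    case (Suc l)
    have X: "pos_kernel X"
      unfolding X_def using insert assms(3) by (intro pos_kernel.add pos_kernel_const pos_kernel_sum) auto
    have e: "pos_kernel (x e)" using insert by simp
    \<comment> \<open>The terms with exponent 0 and 1 in the new variable reproduce the recursion of
      \<open>esym\<close>. Those with exponent at least 2 contain the repeated factors and are
      positive kernels by themselves.\<close>
    have split: "(x e s t + X s t) ^ k / fact k = X s t ^ Suc l / fact (Suc l) + x e s t * (X s t ^ l / fact l)
        + (\<Sum>i\<in>{2..k}. (1 / fact i) * x e s t ^ i * ((1 / fact (k - i)) * X s t ^ (k - i)))" for s t
      using power_add_div_fact_Suc[of "x e s t" "X s t" l] by (simp only: Suc)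
    have "pos_kernel (\<lambda>s t. (X s t ^ Suc l / fact (Suc l) - esym (\<lambda>e. x e s t) E (Suc l))
        + x e s t * (X s t ^ l / fact l - esym (\<lambda>e. x e s t) E l)
        + (\<Sum>i\<in>{2..k}. (1 / fact i) * x e s t ^ i * ((1 / fact (k - i)) * X s t ^ (k - i))))"
      by (intro pos_kernel.add IH pos_kernel_mult[OF e IH] pos_kernel_sum
          pos_kernel_mult[OF pos_kernel_cmult pos_kernel_cmult] pos_kernel_power X e) auto
    moreover have "(c + (\<Sum>e'\<in>insert e E. x e' s t)) ^ k / fact k - esym (\<lambda>e. x e s t) (insert e E) k
      = (X s t ^ Suc l / fact (Suc l) - esym (\<lambda>e. x e s t) E (Suc l))
        + x e s t * (X s t ^ l / fact l - esym (\<lambda>e. x e s t) E l)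
        + (\<Sum>i\<in>{2..k}. (1 / fact i) * x e s t ^ i * ((1 / fact (k - i)) * X s t ^ (k - i)))" for s t
    proof -
      have "c + (\<Sum>e'\<in>insert e E. x e' s t) = x e s t + X s t" using insert by (simp add: X_def)
      then show ?thesis
        by (simp only: split) (simp only: Suc esym_insert[OF insert.hyps] algebra_simps)
    qed
    ultimately show ?thesis by simp
  qed
qed

text \<open>Squaring a mean over labelings introduces an independent copy t, so each summand is the
  mean of the product of r * w s e * w t e over \<open>S\<close>. Sets of size k add up to an
  elementary symmetric polynomial, which is dominated in mean by the k-th power divided by k!. The
  constant \<open>c\<close> leaves room for diagonal terms.\<close>

lemma mean_truncated_exp_ge:
  fixes w :: "'s \<Rightarrow> 'e \<Rightarrow> real"
  assumes U: "finite (set_pmf U)" and E: "finite E" and "c \<ge> 0" "r \<ge> 0"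
  shows "(\<Sum>S | S \<subseteq> E \<and> card S \<le> D. r ^ card S * (mean U (\<lambda>s. \<Prod>e\<in>S. w s e))\<^sup>2)
    \<le> mean U (\<lambda>s. mean U (\<lambda>t. \<Sum>k\<le>D. (c + (\<Sum>e\<in>E. r * w s e * w t e)) ^ k / fact k))"
proof -
  let ?x = "\<lambda>e s t. r * w s e * w t e"
  let ?MM = "\<lambda>f. mean U (\<lambda>s. mean U (\<lambda>t. f s t))"
  have ker: "pos_kernel (?x e)" for e
    using pos_kernel_cmult[OF \<open>r \<ge> 0\<close> pos_kernel.square[of "\<lambda>s. w s e"]] by (simp add: mult.assoc)
  have fin: "finite {S. S \<subseteq> E \<and> P S}" for P
    by (rule finite_subset[of _ "Pow E"]) (use E in auto)
  have MM: "?MM (\<lambda>s t. \<Prod>e\<in>S. ?x e s t) = r ^ card S * (mean U (\<lambda>s. \<Prod>e\<in>S. w s e))\<^sup>2" for S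
    by (simp add: prod.distrib power2_eq_square mult.assoc)
  have "(\<Sum>S | S \<subseteq> E \<and> card S \<le> D. r ^ card S * (mean U (\<lambda>s. \<Prod>e\<in>S. w s e))\<^sup>2)
     = (\<Sum>S | S \<subseteq> E \<and> card S \<le> D. ?MM (\<lambda>s t. \<Prod>e\<in>S. ?x e s t))"
    by (simp only: MM)
  also have "\<dots> = (\<Sum>S\<in>(\<Union>k\<le>D. {S. S \<subseteq> E \<and> card S = k}). ?MM (\<lambda>s t. \<Prod>e\<in>S. ?x e s t))"
    by (rule sum.cong) auto
  also have "\<dots> = (\<Sum>k\<le>D. \<Sum>S | S \<subseteq> E \<and> card S = k. ?MM (\<lambda>s t. \<Prod>e\<in>S. ?x e s t))"
    by (rule sum.UNION_disjoint) (use fin in auto)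
  also have "\<dots> = (\<Sum>k\<le>D. ?MM (\<lambda>s t. esym (\<lambda>e. ?x e s t) E k))"
    by (simp only: esym_def mean_sum[OF U])
  also have "\<dots> \<le> (\<Sum>k\<le>D. ?MM (\<lambda>s t. (c + (\<Sum>e\<in>E. ?x e s t)) ^ k / fact k))"
  proof (rule sum_mono)
    fix k
    have "0 \<le> ?MM (\<lambda>s t. (c + (\<Sum>e\<in>E. ?x e s t)) ^ k / fact k - esym (\<lambda>e. ?x e s t) E k)"
      using E ker \<open>c \<ge> 0\<close> by (intro mean_pos_kernel[OF U] pos_kernel_power_esym) auto
    then show "?MM (\<lambda>s t. esym (\<lambda>e. ?x e s t) E k) \<le> ?MM (\<lambda>s t. (c + (\<Sum>e\<in>E. ?x e s t)) ^ k / fact k)"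
      by (simp add: mean_diff[OF U])
  qed
  also have "\<dots> = ?MM (\<lambda>s t. \<Sum>k\<le>D. (c + (\<Sum>e\<in>E. ?x e s t)) ^ k / fact k)"
    by (simp only: mean_sum[OF U])
  finally show ?thesis .
qed

section \<open>Joint community counts of two labelings\<close>

lemma sum_edge_slots:
  "(\<Sum>k<sbm_dim n. f (edge_slots n ! k)) = (\<Sum>e\<in>set (edge_slots n). f e)"
  using sum.reindex_bij_betw[OF bij_betw_nth[OF distinct_edge_slots refl refl], of f n]
  by (simp add: sbm_dim_def lessThan_atLeast0)

lemma sum_edge_slots_pairs:
  fixes g :: "nat \<Rightarrow> nat \<Rightarrow> real"
  assumes "\<And>i j. g i j = g j i"
  shows "(\<Sum>i<n. \<Sum>j<n. g i j) = (\<Sum>i<n. g i i) + 2 * (\<Sum>k<sbm_dim n. case edge_slots n ! k of (i, j) \<Rightarrow> g i j)"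
proof -
  have "(\<Sum>i<n. \<Sum>j<n. g i j) = (\<Sum>i<n. g i i) + 2 * (\<Sum>(i, j)\<in>{(i, j). i < j \<and> j < n}. g i j)"
  proof (induction n)
    case (Suc n)
    have eq: "{(i, j). i < j \<and> j < Suc n} = {(i, j). i < j \<and> j < n} \<union> (\<lambda>i. (i, n)) ` {..<n}"
      by auto
    have fin: "finite {(i, j). i < j \<and> j < n}"
      by (rule finite_subset[of _ "{..<n} \<times> {..<n}"]) auto
    have "(\<Sum>(i, j)\<in>{(i, j). i < j \<and> j < Suc n}. g i j) = (\<Sum>(i, j)\<in>{(i, j). i < j \<and> j < n}. g i j) + (\<Sum>i<n. g i n)"
      unfolding eq by (subst sum.union_disjoint) (auto simp: fin sum.reindex inj_on_def)
    moreover have "(\<Sum>i<n. g n i) = (\<Sum>i<n. g i n)" by (intro sum.cong refl assms)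
    ultimately show ?case
      using Suc by (simp add: sum.distrib)
  qed simp
  then show ?thesis
    using sum_edge_slots[of "\<lambda>(i, j). g i j" n] by (simp add: set_edge_slots)
qed

lemma sbm_dim_eq: "2 * real (sbm_dim n) = real n * (real n - 1)"
  using sum_edge_slots_pairs[of "\<lambda>_ _. 1" n] by (simp add: algebra_simps)

text \<open>An entry of \<Theta> without the factor \<lambda> d / n. For i \<noteq> j it has mean 0
  when one of the two labels is redrawn uniformly.\<close>

definition omega :: "nat \<Rightarrow> (nat \<Rightarrow> nat) \<Rightarrow> nat \<Rightarrow> nat \<Rightarrow> real" where
  "omega q s i j = real q * of_bool (s i = s j) - 1"

lemma omega_sym: "omega q s i j = omega q s j i"
  by (simp add: omega_def eq_commute)

lemma sum_swap3: "(\<Sum>i\<in>A. \<Sum>j\<in>B. \<Sum>c\<in>C. F i j c) = (\<Sum>c\<in>C. \<Sum>i\<in>A. \<Sum>j\<in>B. F i j c)"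
proof -
  have "(\<Sum>i\<in>A. \<Sum>j\<in>B. \<Sum>c\<in>C. F i j c) = (\<Sum>i\<in>A. \<Sum>c\<in>C. \<Sum>j\<in>B. F i j c)"
    by (rule sum.cong[OF refl], rule sum.swap)
  also have "\<dots> = (\<Sum>c\<in>C. \<Sum>i\<in>A. \<Sum>j\<in>B. F i j c)" by (rule sum.swap)
  finally show ?thesis .
qed

lemma sum_swap4:
  "(\<Sum>i\<in>A. \<Sum>j\<in>B. \<Sum>a\<in>C. \<Sum>b\<in>D. F i j a b) = (\<Sum>a\<in>C. \<Sum>b\<in>D. \<Sum>i\<in>A. \<Sum>j\<in>B. F i j a b)"
proof -
  have "(\<Sum>i\<in>A. \<Sum>j\<in>B. \<Sum>a\<in>C. \<Sum>b\<in>D. F i j a b) = (\<Sum>a\<in>C. \<Sum>i\<in>A. \<Sum>j\<in>B. \<Sum>b\<in>D. F i j a b)"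
    by (rule sum_swap3)
  also have "\<dots> = (\<Sum>a\<in>C. \<Sum>b\<in>D. \<Sum>i\<in>A. \<Sum>j\<in>B. F i j a b)"
    by (rule sum.cong[OF refl], rule sum_swap3)
  finally show ?thesis .
qed

text \<open>\<open>omega\<close> is q times the Gram matrix of the centred indicator vectors
  \<open>u s i\<close>. The entrywise product of two Gram matrices is the Gram matrix of the tensor
  products, and the sum of all its entries is a sum of squares.\<close>

lemma sum_omega_omega_nonneg:
  assumes "q > 0" "\<And>i. i < n \<Longrightarrow> s i < q" "\<And>i. i < n \<Longrightarrow> t i < q"
  shows "0 \<le> (\<Sum>i<n. \<Sum>j<n. omega q s i j * omega q t i j)"
proof -
  define u where "u s i a = of_bool (s i = a) - 1 / real q" for s :: "nat \<Rightarrow> nat" and i a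
  have om: "omega q s i j = real q * (\<Sum>a<q. u s i a * u s j a)" if "s i < q" "s j < q" for s i j
  proof -
    have "(\<Sum>a<q. u s i a * u s j a) = (\<Sum>a<q. (if a = s i then of_bool (s j = a) else 0)
        - (if a = s i then 1 / q else 0) - (if a = s j then 1 / q else 0) + 1 / (real q)\<^sup>2)"
      by (rule sum.cong) (auto simp: u_def algebra_simps power2_eq_square)
    also have "\<dots> = of_bool (s i = s j) - 1 / q"
      using that assms(1) by (simp add: sum.distrib sum_subtractf power2_eq_square eq_commute[of "s j"])
    finally show ?thesis using assms(1) by (simp add: omega_def right_diff_distrib)
  qed
  have "omega q s i j * omega q t i j = (real q)\<^sup>2 * (\<Sum>a<q. \<Sum>b<q. (u s i a * u t i b) * (u s j a * u t j b))"
    if "i < n" "j < n" for i j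
  proof -
    have "omega q s i j * omega q t i j = (real q)\<^sup>2 * ((\<Sum>a<q. u s i a * u s j a) * (\<Sum>b<q. u t i b * u t j b))"
      using that assms by (simp add: om power2_eq_square)
    also have "\<dots> = (real q)\<^sup>2 * (\<Sum>a<q. \<Sum>b<q. (u s i a * u s j a) * (u t i b * u t j b))"
      by (simp only: sum_product)
    finally show ?thesis by (simp only: mult_ac)
  qed
  then have "(\<Sum>i<n. \<Sum>j<n. omega q s i j * omega q t i j)
      = (real q)\<^sup>2 * (\<Sum>i<n. \<Sum>j<n. \<Sum>a<q. \<Sum>b<q. (u s i a * u t i b) * (u s j a * u t j b))"
    by (simp add: sum_distrib_left)
  also have "\<dots> = (real q)\<^sup>2 * (\<Sum>a<q. \<Sum>b<q. \<Sum>i<n. \<Sum>j<n. (u s i a * u t i b) * (u s j a * u t j b))"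
    by (rule arg_cong[OF sum_swap4])
  also have "\<dots> = (real q)\<^sup>2 * (\<Sum>a<q. \<Sum>b<q. (\<Sum>i<n. u s i a * u t i b)\<^sup>2)"
    by (simp add: power2_eq_square sum_product)
  also have "\<dots> \<ge> 0" by (intro mult_nonneg_nonneg sum_nonneg) auto
  finally show ?thesis .
qed

lemma sum_of_bool_eq_squares:
  assumes "finite I" "finite C" "f ` I \<subseteq> C"
  shows "(\<Sum>i\<in>I. \<Sum>j\<in>I. of_bool (f i = f j) :: real) = (\<Sum>c\<in>C. (real (card {i\<in>I. f i = c}))\<^sup>2)"
proof -
  have card: "real (card {i\<in>I. f i = c}) = (\<Sum>i\<in>I. of_bool (f i = c))" for c
    using assms(1) by (simp add: of_bool_def sum.If_cases Int_def)
  have "(\<Sum>i\<in>I. \<Sum>j\<in>I. of_bool (f i = f j) :: real) = (\<Sum>i\<in>I. \<Sum>j\<in>I. \<Sum>c\<in>C. of_bool (f i = c) * of_bool (f j = c))"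
  proof (intro sum.cong refl)
    fix i j assume "i \<in> I" "j \<in> I"
    have "(\<Sum>c\<in>C. of_bool (f i = c) * of_bool (f j = c)) = (\<Sum>c\<in>C. if c = f i then of_bool (f j = f i) else (0::real))"
      by (rule sum.cong) auto
    then show "(of_bool (f i = f j) :: real) = (\<Sum>c\<in>C. of_bool (f i = c) * of_bool (f j = c))"
      using \<open>i \<in> I\<close> assms by (auto simp: sum.delta)
  qed
  also have "\<dots> = (\<Sum>c\<in>C. \<Sum>i\<in>I. \<Sum>j\<in>I. of_bool (f i = c) * of_bool (f j = c))"
    by (rule sum_swap3)
  also have "\<dots> = (\<Sum>c\<in>C. (real (card {i\<in>I. f i = c}))\<^sup>2)"
    by (simp add: card power2_eq_square sum_product)
  finally show ?thesis .
qed

lemma sum_of_bool_eq_ge: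
  assumes "q > 0" "\<And>i. i < n \<Longrightarrow> s i < q"
  shows "(real n)\<^sup>2 \<le> real q * (\<Sum>i<n. \<Sum>j<n. of_bool (s i = s j))"
proof -
  have "(\<Sum>a<q. real (card {i\<in>{..<n}. s i = a})) = (\<Sum>a<q. \<Sum>i<n. of_bool (s i = a))"
    by (simp add: of_bool_def sum.If_cases Int_def)
  also have "\<dots> = (\<Sum>i<n. \<Sum>a<q. of_bool (s i = a))" by (rule sum.swap)
  also have "\<dots> = (\<Sum>i<n. 1)"
    using assms by (intro sum.cong) (auto simp: of_bool_def sum.If_cases Int_def Collect_conv_if)
  finally have "(real n)\<^sup>2 = (\<Sum>a<q. 1 * real (card {i\<in>{..<n}. s i = a}))\<^sup>2" by simp
  also have "\<dots> \<le> (\<Sum>a<q. 1\<^sup>2) * (\<Sum>a<q. (real (card {i\<in>{..<n}. s i = a}))\<^sup>2)"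
    by (rule Cauchy_Schwarz_ineq_sum)
  also have "\<dots> = real q * (\<Sum>i<n. \<Sum>j<n. of_bool (s i = s j))"
    using assms by (subst sum_of_bool_eq_squares[of _ "{..<q}"]) auto
  finally show ?thesis .
qed

text \<open>The value 0 outside the grid of community pairs makes the joint counts members of a
  finite function space, over which they can be summed.\<close>

definition counts :: "nat \<Rightarrow> nat \<Rightarrow> (nat \<Rightarrow> nat) \<Rightarrow> (nat \<Rightarrow> nat) \<Rightarrow> nat \<times> nat \<Rightarrow> nat" where
  "counts n q s t c = (if c \<in> {..<q} \<times> {..<q} then card {i. i < n \<and> (s i, t i) = c} else 0)"

text \<open>The relative deviation of a joint count from its mean n / q^2.\<close>

definition excess :: "nat \<Rightarrow> nat \<Rightarrow> (nat \<times> nat \<Rightarrow> nat) \<Rightarrow> nat \<times> nat \<Rightarrow> real" where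
  "excess n q m c = (real q)\<^sup>2 * real (m c) / real n - 1"

lemma sum_counts:
  assumes "\<And>i. i < n \<Longrightarrow> s i < q" "\<And>i. i < n \<Longrightarrow> t i < q"
  shows "(\<Sum>c\<in>{..<q} \<times> {..<q}. counts n q s t c) = n"
proof -
  have "(\<Sum>c\<in>{..<q} \<times> {..<q}. counts n q s t c) = (\<Sum>c\<in>{..<q} \<times> {..<q}. \<Sum>i\<in>{i \<in> {..<n}. (s i, t i) = c}. 1)"
    by (intro sum.cong) (auto simp: counts_def)
  also have "\<dots> = (\<Sum>i<n. 1)"
    using assms by (intro sum.group) auto
  finally show ?thesis by simp
qed

lemma sum_excess:
  assumes "n > 0" "q > 0" "(\<Sum>c\<in>{..<q} \<times> {..<q}. m c) = n"
  shows "(\<Sum>c\<in>{..<q} \<times> {..<q}. excess n q m c) = 0"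
proof -
  have "(\<Sum>c\<in>{..<q} \<times> {..<q}. excess n q m c) = (real q)\<^sup>2 / n * real (\<Sum>c\<in>{..<q} \<times> {..<q}. m c) - (real q)\<^sup>2"
    by (simp add: excess_def sum_subtractf sum_distrib_left power2_eq_square)
  then show ?thesis using assms by simp
qed

text \<open>Since the excesses x sum to 0, q^2 times the sum of squared joint counts is n^2 plus n^2
  / q^2 times the sum of x^2. The two marginal terms carry a minus sign and are at least n^2 each by
  Cauchy-Schwarz, so the copies of n^2 cancel: n^2 - n^2 - n^2 + n^2.\<close>

lemma sum_omega_omega_le:
  assumes "q > 0" "n > 0" "\<And>i. i < n \<Longrightarrow> s i < q" "\<And>i. i < n \<Longrightarrow> t i < q"
  shows "(\<Sum>i<n. \<Sum>j<n. omega q s i j * omega q t i j)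
    \<le> (real n)\<^sup>2 / (real q)\<^sup>2 * (\<Sum>c\<in>{..<q} \<times> {..<q}. (excess n q (counts n q s t) c)\<^sup>2)"
proof -
  let ?C = "{..<q} \<times> {..<q}" and ?x = "excess n q (counts n q s t)"
  have AB: "(\<Sum>i<n. \<Sum>j<n. of_bool (s i = s j) * of_bool (t i = t j)) = (\<Sum>c\<in>?C. (real (counts n q s t c))\<^sup>2)"
  proof -
    have "(\<Sum>i<n. \<Sum>j<n. of_bool ((s i, t i) = (s j, t j)) :: real) = (\<Sum>c\<in>?C. (real (card {i\<in>{..<n}. (s i, t i) = c}))\<^sup>2)"
      using assms by (intro sum_of_bool_eq_squares) auto
    also have "\<dots> = (\<Sum>c\<in>?C. (real (counts n q s t c))\<^sup>2)"
      by (intro sum.cong) (auto simp: counts_def)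
    finally show ?thesis by (simp add: of_bool_conj)
  qed
  have cnt: "real (counts n q s t c) = real n / (real q)\<^sup>2 * (1 + ?x c)" for c
    using assms by (simp add: excess_def)
  have "(\<Sum>c\<in>?C. (real (counts n q s t c))\<^sup>2)
     = (real n / (real q)\<^sup>2)\<^sup>2 * (\<Sum>c\<in>?C. 1 + 2 * ?x c + (?x c)\<^sup>2)"
    unfolding sum_distrib_left cnt by (intro sum.cong refl) (simp only: power_mult_distrib, simp add: power2_sum)
  also have "(\<Sum>c\<in>?C. 1 + 2 * ?x c + (?x c)\<^sup>2) = (real q)\<^sup>2 + (\<Sum>c\<in>?C. (?x c)\<^sup>2)"
    using sum_excess[OF assms(2,1) sum_counts[of n s q t]] assms(3,4)
    by (simp add: sum.distrib power2_eq_square flip: sum_distrib_left)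
  finally have sq: "(real q)\<^sup>2 * (\<Sum>c\<in>?C. (real (counts n q s t c))\<^sup>2) = (real n)\<^sup>2 + (real n)\<^sup>2 / (real q)\<^sup>2 * (\<Sum>c\<in>?C. (?x c)\<^sup>2)"
    using assms by (simp add: power2_eq_square field_simps)
  have one: "(\<Sum>i<n. \<Sum>j<n. 1 :: real) = (real n)\<^sup>2"
    by (simp add: power2_eq_square)
  have "(\<Sum>i<n. \<Sum>j<n. omega q s i j * omega q t i j) = (\<Sum>i<n. \<Sum>j<n. (real q)\<^sup>2 * (of_bool (s i = s j) * of_bool (t i = t j))
      - real q * of_bool (s i = s j) - real q * of_bool (t i = t j) + 1)"
    by (intro sum.cong refl) (simp add: omega_def algebra_simps power2_eq_square)
  also have "\<dots> = (real q)\<^sup>2 * (\<Sum>i<n. \<Sum>j<n. of_bool (s i = s j) * of_bool (t i = t j))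
      - real q * (\<Sum>i<n. \<Sum>j<n. of_bool (s i = s j)) - real q * (\<Sum>i<n. \<Sum>j<n. of_bool (t i = t j)) + (real n)\<^sup>2"
    by (simp only: sum.distrib sum_subtractf sum_distrib_left one)
  also have "\<dots> \<le> (real n)\<^sup>2 / (real q)\<^sup>2 * (\<Sum>c\<in>?C. (?x c)\<^sup>2)"
    using sum_of_bool_eq_ge[of q n s] sum_of_bool_eq_ge[of q n t] assms unfolding AB sq by simp
  finally show ?thesis .
qed

text \<open>The function of Bennett's inequality. Its sum over the excesses of all cells is q^2
  times the relative entropy of the joint type to the uniform law, because the linear terms
  cancel.\<close>

definition entropy_fun :: "real \<Rightarrow> real" where
  "entropy_fun x = (1 + x) * ln (1 + x) - x"

text \<open>The difference of the two sides vanishes at 1 and has derivative (y - 1)^2 / (y (y +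
  1)^2).\<close>

lemma ln_ge_frac:
  assumes "y \<ge> (1::real)"
  shows "ln y \<ge> 2 * (y - 1) / (y + 1)"
proof -
  let ?f = "\<lambda>y. ln y - 2 * (y - 1) / (y + 1)"
  have "?f 1 \<le> ?f y"
  proof (rule DERIV_nonneg_imp_nondecreasing[OF assms])
    fix x :: real assume "1 \<le> x" "x \<le> y"
    have "(?f has_real_derivative (1 / x - (2 * (x + 1) - 2 * (x - 1)) / (x + 1)\<^sup>2)) (at x)"
      using \<open>1 \<le> x\<close> by (auto intro!: derivative_eq_intros simp: power2_eq_square)
    moreover have "1 / x - (2 * (x + 1) - 2 * (x - 1)) / (x + 1)\<^sup>2 = (x - 1)\<^sup>2 / (x * (x + 1)\<^sup>2)"
    proof -
      have "x \<noteq> 0" "(x + 1)\<^sup>2 \<noteq> 0" using \<open>1 \<le> x\<close> by auto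
      then have "1 / x - (2 * (x + 1) - 2 * (x - 1)) / (x + 1)\<^sup>2 = ((x + 1)\<^sup>2 - 4 * x) / (x * (x + 1)\<^sup>2)"
        by (subst diff_frac_eq) (auto simp: algebra_simps)
      also have "(x + 1)\<^sup>2 - 4 * x = (x - 1)\<^sup>2" by (simp add: power2_eq_square algebra_simps)
      finally show ?thesis .
    qed
    ultimately show "\<exists>z. (?f has_real_derivative z) (at x) \<and> 0 \<le> z"
      using \<open>1 \<le> x\<close> by (intro exI[of _ "(x - 1)\<^sup>2 / (x * (x + 1)\<^sup>2)"]) auto
  qed
  then show ?thesis by simp
qed

text \<open>The difference vanishes at 1 and has derivative - (y - 1)^2 / (2 y^2), so it decreases
  towards 1.\<close>

lemma ln_ge_half_diff_inverse:
  assumes "0 < y" "y \<le> (1::real)"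
  shows "ln y \<ge> (y - 1 / y) / 2"
proof -
  let ?f = "\<lambda>y. ln y - (y - 1 / y) / 2"
  have "?f 1 \<le> ?f y"
  proof (rule DERIV_nonpos_imp_nonincreasing[OF assms(2)])
    fix x :: real assume "y \<le> x" "x \<le> 1"
    have "x > 0" using \<open>y \<le> x\<close> assms by simp
    have "(?f has_real_derivative (1 / x - (1 + 1 / x\<^sup>2) / 2)) (at x)"
      using \<open>x > 0\<close> by (auto intro!: derivative_eq_intros simp: power2_eq_square)
    moreover have "1 / x - (1 + 1 / x\<^sup>2) / 2 = - ((x - 1)\<^sup>2 / (2 * x\<^sup>2))"
      using \<open>x > 0\<close> by (simp add: field_simps power2_eq_square)
    ultimately show "\<exists>z. (?f has_real_derivative z) (at x) \<and> z \<le> 0"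
      by (intro exI[of _ "- ((x - 1)\<^sup>2 / (2 * x\<^sup>2))"]) auto
  qed
  then show ?thesis by simp
qed

lemma entropy_fun_ge_pos:
  assumes "x \<ge> 0"
  shows "entropy_fun x \<ge> x\<^sup>2 / (2 + x)"
proof -
  have "(1 + x) * (2 * (1 + x - 1) / (1 + x + 1)) \<le> (1 + x) * ln (1 + x)"
    using assms by (intro mult_left_mono ln_ge_frac) auto
  then show ?thesis
    using assms by (simp add: entropy_fun_def field_simps power2_eq_square)
qed

text \<open>The constant 1 / (2 (1 + a)) approaches the Taylor coefficient 1 / 2 as a tends to 0. A
  worse constant would lose the sharp threshold d \<lambda>^2 < 1.\<close>

lemma entropy_fun_ge:
  assumes "-1 \<le> x" "x \<le> a" "a > 0"
  shows "entropy_fun x \<ge> x\<^sup>2 / (2 * (1 + a))"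
proof -
  consider "x = -1" | "-1 < x" "x \<le> 0" | "x \<ge> 0" using assms by linarith
  then show ?thesis
  proof cases
    case 1
    then show ?thesis using assms by (simp add: entropy_fun_def divide_le_eq)
  next
    case 2
    have "(1 + x) * ((1 + x - 1 / (1 + x)) / 2) \<le> (1 + x) * ln (1 + x)"
      using 2 by (intro mult_left_mono ln_ge_half_diff_inverse) auto
    also have "(1 + x) * ((1 + x - 1 / (1 + x)) / 2) = ((1 + x)\<^sup>2 - 1) / 2"
      using 2 by (simp add: right_diff_distrib power2_eq_square)
    finally have "x\<^sup>2 / 2 \<le> entropy_fun x"
      by (simp add: entropy_fun_def power2_eq_square algebra_simps)
    moreover have "x\<^sup>2 / (2 * (1 + a)) \<le> x\<^sup>2 / 2"
      using assms by (intro divide_left_mono) auto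
    ultimately show ?thesis by linarith
  next
    case 3
    have "x\<^sup>2 / (2 * (1 + a)) \<le> x\<^sup>2 / (2 + x)"
      using assms 3 by (intro divide_left_mono) auto
    then show ?thesis using entropy_fun_ge_pos[OF 3] by linarith
  qed
qed

lemma entropy_fun_ge_tail:
  assumes "x \<ge> a" "a > 0"
  shows "entropy_fun x \<ge> a\<^sup>2 / (2 + a)"
proof -
  \<comment> \<open>The product equals x^2 (2 + a) - a^2 (2 + x), so this is the monotonicity of x^2
    / (2 + x).\<close>
  have "0 \<le> (x - a) * (2 * x + 2 * a + a * x)" using assms by simp
  then have "a\<^sup>2 / (2 + a) \<le> x\<^sup>2 / (2 + x)"
    using assms by (simp add: divide_simps power2_eq_square algebra_simps)
  then show ?thesis using entropy_fun_ge_pos[of x] assms by linarith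
qed

lemma entropy_fun_nonneg: "-1 \<le> x \<Longrightarrow> entropy_fun x \<ge> 0"
  using entropy_fun_ge[of x "max x 1"] by (smt (verit) divide_nonneg_nonneg zero_le_power2 max.cobounded1 max.cobounded2)

section \<open>The probability of a joint type\<close>

lemma mean_labels_prod:
  assumes "q > 0"
  shows "mean (labels n q) (\<lambda>s. mean (labels n q) (\<lambda>t. \<Prod>i<n. f (s i) (t i)))
    = ((\<Sum>a<q. \<Sum>b<q. f a b) / (real q)\<^sup>2) ^ n"
proof -
  have fin: "finite (set_pmf (pmf_of_set {..<q}))" using assms by (auto simp: lessThan_empty_iff)
  have "mean (labels n q) (\<lambda>s. mean (labels n q) (\<lambda>t. \<Prod>i<n. f (s i) (t i)))
     = mean (labels n q) (\<lambda>s. \<Prod>i<n. (\<Sum>b<q. f (s i) b) / q)"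
    using fin assms by (intro mean_cong, subst mean_prod) (auto simp: mean_pmf_of_set_lessThan)
  also have "\<dots> = (\<Prod>i<n. ((\<Sum>a<q. (\<Sum>b<q. f a b) / q) / q))"
    by (subst mean_prod) (use fin in \<open>simp_all only: mean_pmf_of_set_lessThan[OF assms] finite_lessThan\<close>)
  also have "\<dots> = ((\<Sum>a<q. \<Sum>b<q. f a b) / (real q)\<^sup>2) ^ n"
  proof -
    have "(\<Sum>a<q. (\<Sum>b<q. f a b) / q) / q = (\<Sum>a<q. \<Sum>b<q. f a b) / (real q)\<^sup>2"
      by (simp only: sum_divide_distrib[symmetric] power2_eq_square divide_divide_eq_left)
    then show ?thesis by simp
  qed
  finally show ?thesis .
qed

lemma finite_set_labels: "q > 0 \<Longrightarrow> finite (set_pmf (labels n q))"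
  by (intro finite_set_Pi_pmf) (auto simp: lessThan_empty_iff)

lemma labels_less: "q > 0 \<Longrightarrow> s \<in> set_pmf (labels n q) \<Longrightarrow> i < n \<Longrightarrow> s i < q"
  by (subst (asm) set_Pi_pmf) (auto simp: PiE_dflt_def lessThan_empty_iff)

text \<open>Exponential tilting: \<open>w\<close> is q^2 times the frequencies prescribed by
  \<open>m\<close>, so it has mean 1 over a uniform pair of labels, and its product over the
  vertices has mean 1. On the event that the counts are \<open>m\<close> this product is the
  constant \<open>W\<close>, the exponential of n times the relative entropy, and Markov's
  inequality applies.\<close>

lemma prob_counts_le:
  assumes "q > 0" "n > 0" "(\<Sum>c\<in>{..<q} \<times> {..<q}. m c) = n"
  shows "mean (labels n q) (\<lambda>s. mean (labels n q) (\<lambda>t. of_bool (counts n q s t = m)))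
    \<le> exp (- (real n / (real q)\<^sup>2) * (\<Sum>c\<in>{..<q} \<times> {..<q}. entropy_fun (excess n q m c)))"
proof -
  let ?C = "{..<q} \<times> {..<q}" and ?U = "labels n q"
  define w where "w c = 1 + excess n q m c" for c
  define W where "W = (\<Prod>c\<in>?C. w c ^ m c)"
  have w: "w c = (real q)\<^sup>2 * real (m c) / real n" for c by (simp add: w_def excess_def)
  have wpos: "w c > 0" if "m c > 0" for c using that assms by (simp add: w)
  \<comment> \<open>For an empty cell both sides are 1, because 1 + \<open>excess\<close> vanishes
    in front of the logarithm.\<close>
  have fac: "w c ^ m c = exp (real n / (real q)\<^sup>2 * ((1 + excess n q m c) * ln (1 + excess n q m c)))" for c
  proof (cases "m c = 0")
    case True
    then show ?thesis by (simp add: excess_def)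
  next
    case False
    then have "w c ^ m c = exp (real (m c) * ln (w c))"
      using wpos[of c] by (simp add: exp_of_nat_mult)
    also have "real (m c) = real n / (real q)\<^sup>2 * w c" using assms by (simp add: w)
    finally show ?thesis by (simp add: w_def mult.assoc)
  qed
  have W: "W = exp (real n / (real q)\<^sup>2 * (\<Sum>c\<in>?C. entropy_fun (excess n q m c)))"
    using sum_excess[OF assms(2,1,3)]
    by (simp only: W_def fac exp_sum[symmetric, OF finite_cartesian_product[OF finite_lessThan finite_lessThan]]
        sum_distrib_left[symmetric] entropy_fun_def sum_subtractf diff_zero)
  have pt: "of_bool (counts n q s t = m) * W \<le> (\<Prod>i<n. w (s i, t i))"
    if s: "s \<in> set_pmf ?U" and t: "t \<in> set_pmf ?U" for s t
  proof (cases "counts n q s t = m")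
    case True
    have "(\<Prod>i<n. w (s i, t i)) = (\<Prod>c\<in>?C. \<Prod>i\<in>{i\<in>{..<n}. (s i, t i) = c}. w (s i, t i))"
      using labels_less[OF assms(1) s] labels_less[OF assms(1) t]
      by (intro prod.group[symmetric]) auto
    also have "\<dots> = (\<Prod>c\<in>?C. \<Prod>i\<in>{i\<in>{..<n}. (s i, t i) = c}. w c)"
      by (intro prod.cong) auto
    also have "\<dots> = W"
      unfolding W_def True[symmetric] by (intro prod.cong refl) (auto simp: counts_def)
    finally show ?thesis using True by simp
  next
    case False
    have "0 \<le> w c" for c by (simp add: w)
    then show ?thesis using False by (simp add: prod_nonneg)
  qed
  have fin: "finite (set_pmf ?U)" by (rule finite_set_labels[OF assms(1)])
  have "mean ?U (\<lambda>s. mean ?U (\<lambda>t. of_bool (counts n q s t = m))) * W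
      = mean ?U (\<lambda>s. mean ?U (\<lambda>t. of_bool (counts n q s t = m) * W))" by simp
  also have "\<dots> \<le> mean ?U (\<lambda>s. mean ?U (\<lambda>t. \<Prod>i<n. w (s i, t i)))"
    by (intro mean_mono fin pt)
  also have "\<dots> = ((\<Sum>a<q. \<Sum>b<q. w (a, b)) / (real q)\<^sup>2) ^ n"
    using assms(1) mean_labels_prod[of q n "\<lambda>a b. w (a, b)"] by simp
  also have "(\<Sum>a<q. \<Sum>b<q. w (a, b)) = (\<Sum>c\<in>?C. 1 + excess n q m c)"
    by (simp add: sum.cartesian_product w_def)
  also have "\<dots> = (real q)\<^sup>2"
    using sum_excess[OF assms(2,1,3)] by (simp add: sum.distrib power2_eq_square)
  finally have "mean ?U (\<lambda>s. mean ?U (\<lambda>t. of_bool (counts n q s t = m))) * W \<le> 1"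
    using assms by simp
  then have "mean ?U (\<lambda>s. mean ?U (\<lambda>t. of_bool (counts n q s t = m))) \<le> 1 / W"
    by (simp add: W field_simps)
  then show ?thesis by (simp add: W exp_minus divide_inverse)
qed

section \<open>Low-degree advantage of the stochastic block model\<close>

definition edge_prob :: "nat \<Rightarrow> real \<Rightarrow> real \<Rightarrow> nat \<Rightarrow> (nat \<Rightarrow> nat) \<Rightarrow> nat \<Rightarrow> real" where
  "edge_prob n d lam q s k = (case edge_slots n ! k of (i, j) \<Rightarrow> d / real n * (1 + lam * omega q s i j))"

definition omega_slot :: "nat \<Rightarrow> nat \<Rightarrow> (nat \<Rightarrow> nat) \<Rightarrow> nat \<Rightarrow> real" where
  "omega_slot n q s k = (case edge_slots n ! k of (i, j) \<Rightarrow> omega q s i j)"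

lemma edge_prob_omega: "edge_prob n d lam q s k = d / real n * (1 + lam * omega_slot n q s k)"
  by (simp add: edge_prob_def omega_slot_def split: prod.splits)

lemma edge_slots_nth:
  assumes "k < sbm_dim n" "edge_slots n ! k = (i, j)"
  shows "i < j" "j < n" "i < n"
proof -
  have "(i, j) \<in> set (edge_slots n)" using assms by (metis nth_mem sbm_dim_def)
  then show "i < j" "j < n" "i < n" by (auto simp: set_edge_slots)
qed

abbreviation sample :: "nat \<Rightarrow> (nat \<Rightarrow> real) \<Rightarrow> bool list pmf" where
  "sample N p \<equiv> map_pmf (\<lambda>Y. map Y [0..<N]) (bits N p)"

lemma sbm_given_sample:
  "sbm_given n d lam q (map s [0..<n]) = sample (sbm_dim n) (edge_prob n d lam q s)"
proof -
  have "bits (sbm_dim n) (\<lambda>k. (\<lambda>(i, j). if map s [0..<n] ! i = map s [0..<n] ! j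
        then (1 + (real q - 1) * lam) * d / real n else (1 - lam) * d / real n) (edge_slots n ! k))
      = bits (sbm_dim n) (edge_prob n d lam q s)"
  proof (rule Pi_pmf_cong[OF refl refl])
    fix k assume "k \<in> {..<sbm_dim n}"
    then obtain i j where e: "edge_slots n ! k = (i, j)" "i < n" "j < n"
      using edge_slots_nth[of k n] by (cases "edge_slots n ! k") auto
    then show "bernoulli_pmf ((\<lambda>(i, j). if map s [0..<n] ! i = map s [0..<n] ! j
        then (1 + (real q - 1) * lam) * d / real n else (1 - lam) * d / real n) (edge_slots n ! k))
       = bernoulli_pmf (edge_prob n d lam q s k)"
      by (simp add: edge_prob_def omega_def algebra_simps add_divide_distrib diff_divide_distrib)
  qed
  then show ?thesis unfolding sbm_given_def random_graph_bits by simp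
qed

lemma sbm_sample:
  assumes "q > 0"
  shows "sbm n d lam q = bind_pmf (labels n q) (\<lambda>s. sample (sbm_dim n) (edge_prob n d lam q s))"
  unfolding sbm_def labelings_labels[OF assms] bind_map_pmf by (simp add: sbm_given_sample)

lemma erdos_renyi_sample: "erdos_renyi n d = sample (sbm_dim n) (\<lambda>_. d / real n)"
  by (simp add: erdos_renyi_def random_graph_bits)

lemma edge_prob_range:
  assumes "n > 0" "d \<ge> 0" "0 \<le> lam" "lam \<le> 1" "(1 + real q * lam) * (d / real n) \<le> 1"
  shows "0 \<le> edge_prob n d lam q s k" "edge_prob n d lam q s k \<le> (1 + real q * lam) * (d / real n)"
        "edge_prob n d lam q s k \<le> 1"
proof -
  obtain i j where e: "edge_slots n ! k = (i, j)" by force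
  have p: "0 \<le> d / real n" using assms by simp
  have lo: "-1 \<le> lam * omega q s i j"
    using assms by (auto simp: omega_def of_bool_def algebra_simps) 
      (metis add.commute add_increasing mult_nonneg_nonneg of_nat_0_le_iff)
  have hi: "lam * omega q s i j \<le> real q * lam"
    using assms by (auto simp: omega_def of_bool_def algebra_simps intro: order_trans[of _ 0])
  show "0 \<le> edge_prob n d lam q s k"
    unfolding edge_prob_def e prod.case using p lo by (intro mult_nonneg_nonneg) auto
  show *: "edge_prob n d lam q s k \<le> (1 + real q * lam) * (d / real n)"
    using mult_left_mono[OF hi p] by (simp add: edge_prob_def e algebra_simps)
  show "edge_prob n d lam q s k \<le> 1" using * assms by linarith
qed

section \<open>From joint types to the truncated exponential\<close>

abbreviation trunc_exp :: "nat \<Rightarrow> real \<Rightarrow> real" where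
  "trunc_exp D g \<equiv> \<Sum>k\<le>D. g ^ k / fact k"

lemma trunc_exp_le_exp:
  assumes "g \<ge> 0"
  shows "trunc_exp D g \<le> exp g"
proof -
  have "(\<Sum>k\<le>D. g ^ k /\<^sub>R fact k) \<le> (\<Sum>k. g ^ k /\<^sub>R fact k)"
    using assms by (intro sum_le_suminf summable_exp_generic) auto
  then show ?thesis by (simp add: exp_def divide_inverse mult.commute)
qed

text \<open>Bounding 1 / k! by a binomial coefficient is wasteful but keeps polynomial growth of
  degree \<open>D\<close> in g, which is what the truncation has to provide for atypical
  pairs.\<close>

lemma trunc_exp_le_power:
  assumes "g \<ge> 0"
  shows "trunc_exp D g \<le> (1 + g) ^ D"
proof -
  have "trunc_exp D g \<le> (\<Sum>k\<le>D. real (D choose k) * g ^ k)"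
  proof (rule sum_mono)
    fix k assume "k \<in> {..D}"
    then have "1 \<le> D choose k" by (simp add: Suc_leI)
    then have "g ^ k / fact k \<le> g ^ k" "g ^ k \<le> real (D choose k) * g ^ k"
      using assms by (auto simp: divide_le_eq mult_le_cancel_left1 mult_le_cancel_right1 zero_less_mult_iff)
    then show "g ^ k / fact k \<le> real (D choose k) * g ^ k" by linarith
  qed
  also have "\<dots> = (g + 1) ^ D" by (simp add: binomial_ring)
  finally show ?thesis by (simp add: add.commute)
qed

lemma trunc_exp_mono:
  assumes "0 \<le> g" "g \<le> h"
  shows "trunc_exp D g \<le> trunc_exp D h"
  using assms by (intro sum_mono divide_right_mono power_mono) auto

text \<open>Up to L the factor exp (\<theta> L) suffices, and beyond L the slope is at most 1. For
  types of probability at most exp (- H), of which there are at most exp L, it yields the total 2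
  exp (\<theta> L): the factor \<theta>, of the size of d \<lambda>^2, survives the sum over types,
  where a plain union bound would cost exp L.\<close>

lemma exp_interpolate:
  assumes "0 \<le> \<theta>" "\<theta> \<le> (1::real)"
  shows "exp (\<theta> * H) \<le> exp (\<theta> * L) * (1 + exp (H - L))"
proof (cases "H \<le> L")
  case True
  then have "exp (\<theta> * H) \<le> exp (\<theta> * L) * 1" using assms by (simp add: mult_left_mono)
  also have "\<dots> \<le> exp (\<theta> * L) * (1 + exp (H - L))" by (intro mult_left_mono) auto
  finally show ?thesis .
next
  case False
  then have "\<theta> * (H - L) \<le> 1 * (H - L)" using assms by (intro mult_right_mono) auto
  then have "exp (\<theta> * H) \<le> exp (\<theta> * L + (H - L))" by (simp add: algebra_simps)
  also have "\<dots> = exp (\<theta> * L) * exp (H - L)" by (rule exp_add)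
  also have "\<dots> \<le> exp (\<theta> * L) * (1 + exp (H - L))" by (intro mult_left_mono) auto
  finally show ?thesis .
qed

text \<open>The first term stems from pairs of labelings whose joint counts exceed their means by a factor
  at most \<open>1 + a\<close>. The remaining pairs are exponentially rare, and on them the truncation at degree
  \<open>D\<close> limits the exponential.\<close>

lemma mean_trunc_exp_le:
  fixes n q D :: nat and a r :: real
  defines "C \<equiv> {..<q} \<times> {..<q}"
  assumes nq: "n > 0" "q > 0" and a: "a > 0" and r: "0 \<le> r" "r * n * (1 + a) \<le> 1"
  shows "mean (labels n q) (\<lambda>s. mean (labels n q) (\<lambda>t.
      trunc_exp D (r / 2 * (\<Sum>i<n. \<Sum>j<n. omega q s i j * omega q t i j))))
    \<le> 2 * exp (r * n * (1 + a) * (real q)\<^sup>2 * ln (real n + 1))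
      + (real n + 1) ^ (q\<^sup>2) * (1 + real n * real q ^ 4) ^ D * exp (- real n / (real q)\<^sup>2 * (a\<^sup>2 / (2 + a)))"
proof -
  let ?U = "labels n q"
  define \<T> where "\<T> = {m \<in> PiE_dflt C 0 (\<lambda>_. {..n}). sum m C = n}"
  define G where "G m = r * (real n)\<^sup>2 / (2 * (real q)\<^sup>2) * (\<Sum>c\<in>C. (excess n q m c)\<^sup>2)" for m
  define Pm where "Pm m = mean ?U (\<lambda>s. mean ?U (\<lambda>t. of_bool (counts n q s t = m)))" for m
  define \<theta> where "\<theta> = r * n * (1 + a)"
  define L where "L = (real q)\<^sup>2 * ln (real n + 1)"
  define good where "good m \<longleftrightarrow> (\<forall>c\<in>C. excess n q m c \<le> a)" for m
  have \<theta>: "0 \<le> \<theta>" "\<theta> \<le> 1" using r a by (auto simp: \<theta>_def)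
  have finC: "finite C" "card C = q\<^sup>2" by (auto simp: C_def power2_eq_square)
  have finT: "finite \<T>" unfolding \<T>_def using finC by (intro finite_subset[OF _ finite_PiE_dflt[of C "\<lambda>_. {..n}" 0]]) auto
  have cardT: "real (card \<T>) \<le> exp L"
  proof -
    have "card \<T> \<le> card (PiE_dflt C 0 (\<lambda>_. {..n}))"
      unfolding \<T>_def using finC by (intro card_mono finite_PiE_dflt) auto
    also have "\<dots> = (n + 1) ^ q\<^sup>2" using finC by (subst card_PiE_dflt) auto
    finally have "real (card \<T>) \<le> (real n + 1) ^ q\<^sup>2"
      by (metis of_nat_1 of_nat_add of_nat_le_iff of_nat_power)
    also have "\<dots> = exp L" by (simp add: L_def exp_of_nat_mult flip: of_nat_power)
    finally show ?thesis .
  qed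
  have expL: "exp L = (real n + 1) ^ q\<^sup>2" by (simp add: L_def exp_of_nat_mult flip: of_nat_power)
  have finU: "finite (set_pmf ?U)" by (rule finite_set_labels[OF nq(2)])
  have G0: "G m \<ge> 0" for m using r by (simp add: G_def sum_nonneg)
  have countsT: "counts n q s t \<in> \<T>" if "s \<in> set_pmf ?U" "t \<in> set_pmf ?U" for s t
  proof -
    have "counts n q s t c \<le> n" for c
      using card_mono[of "{..<n}" "{i. i < n \<and> (s i, t i) = c}"] by (auto simp: counts_def)
    moreover have "counts n q s t c = 0" if "c \<notin> C" for c using that by (auto simp: counts_def C_def)
    moreover have "sum (counts n q s t) C = n"
      unfolding C_def using labels_less[OF nq(2) that(1)] labels_less[OF nq(2) that(2)]
      by (intro sum_counts) auto
    ultimately show ?thesis by (auto simp: \<T>_def PiE_dflt_def)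
  qed
  have Pm0: "Pm m \<ge> 0" for m by (auto simp: Pm_def intro!: mean_nonneg)
  have Pm1: "(\<Sum>m\<in>\<T>. Pm m) = 1"
  proof -
    have "(\<Sum>m\<in>\<T>. Pm m) = mean ?U (\<lambda>s. mean ?U (\<lambda>t. \<Sum>m\<in>\<T>. of_bool (counts n q s t = m)))"
      by (simp only: Pm_def mean_sum[OF finU])
    also have "\<dots> = mean ?U (\<lambda>s. mean ?U (\<lambda>t. 1))"
      by (intro mean_cong) (simp add: of_bool_def countsT finT)
    finally show ?thesis by simp
  qed
  have "mean ?U (\<lambda>s. mean ?U (\<lambda>t. trunc_exp D (r / 2 * (\<Sum>i<n. \<Sum>j<n. omega q s i j * omega q t i j))))
     \<le> mean ?U (\<lambda>s. mean ?U (\<lambda>t. trunc_exp D (G (counts n q s t))))"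
  proof (intro mean_mono finU trunc_exp_mono)
    fix s t assume st: "s \<in> set_pmf ?U" "t \<in> set_pmf ?U"
    note lt = labels_less[OF nq(2) st(1)] labels_less[OF nq(2) st(2)]
    show "0 \<le> r / 2 * (\<Sum>i<n. \<Sum>j<n. omega q s i j * omega q t i j)"
      using r lt nq by (intro mult_nonneg_nonneg sum_omega_omega_nonneg) auto
    show "r / 2 * (\<Sum>i<n. \<Sum>j<n. omega q s i j * omega q t i j) \<le> G (counts n q s t)"
      using mult_left_mono[OF sum_omega_omega_le[of q n s t], of "r / 2"] lt nq r
      by (simp add: G_def C_def)
  qed
  also have "\<dots> = mean ?U (\<lambda>s. mean ?U (\<lambda>t. \<Sum>m\<in>\<T>. trunc_exp D (G m) * of_bool (counts n q s t = m)))"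
    by (intro mean_cong) (simp add: of_bool_def countsT finT if_distrib cong: if_cong)
  also have "\<dots> = (\<Sum>m\<in>\<T>. trunc_exp D (G m) * Pm m)"
    by (simp add: Pm_def mean_sum[OF finU])
  also have "\<dots> \<le> (\<Sum>m\<in>\<T>. exp (\<theta> * L) * (Pm m + exp (- L))
      + (1 + real n * real q ^ 4) ^ D * exp (- real n / (real q)\<^sup>2 * (a\<^sup>2 / (2 + a))))"
  proof (rule sum_mono)
    fix m assume m: "m \<in> \<T>"
    have x: "-1 \<le> excess n q m c" for c by (simp add: excess_def)
    have Pm_le: "Pm m \<le> exp (- (real n / (real q)\<^sup>2) * (\<Sum>c\<in>C. entropy_fun (excess n q m c)))"
      unfolding Pm_def C_def using m nq by (intro prob_counts_le) (auto simp: \<T>_def C_def)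
    show "trunc_exp D (G m) * Pm m \<le> exp (\<theta> * L) * (Pm m + exp (- L))
      + (1 + real n * real q ^ 4) ^ D * exp (- real n / (real q)\<^sup>2 * (a\<^sup>2 / (2 + a)))"
    proof (cases "good m")
      case True
      \<comment> \<open>H is the quadratic lower bound for n times the relative entropy of a good
        type. The exponent G is the same quadratic form multiplied by \<theta> \<le> 1.\<close>
      define H where "H = real n / (real q)\<^sup>2 * (\<Sum>c\<in>C. (excess n q m c)\<^sup>2 / (2 * (1 + a)))"
      have GH: "G m = \<theta> * H"
        unfolding G_def H_def \<theta>_def sum_divide_distrib[symmetric]
        using a nq by (simp add: divide_simps power2_eq_square)
      have "H \<le> real n / (real q)\<^sup>2 * (\<Sum>c\<in>C. entropy_fun (excess n q m c))"
        unfolding H_def using True x a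
        by (intro mult_left_mono sum_mono entropy_fun_ge) (auto simp: good_def)
      then have "exp H * Pm m \<le> exp H * exp (- H)"
        by (intro mult_left_mono order_trans[OF Pm_le]) auto
      then have HP: "exp H * Pm m \<le> 1" by (simp add: exp_minus)
      have "trunc_exp D (G m) * Pm m \<le> exp (\<theta> * H) * Pm m"
        unfolding GH[symmetric] by (intro mult_right_mono trunc_exp_le_exp G0 Pm0)
      also have "\<dots> \<le> exp (\<theta> * L) * (1 + exp (H - L)) * Pm m"
        by (intro mult_right_mono exp_interpolate \<theta> Pm0)
      also have "\<dots> = exp (\<theta> * L) * (Pm m + exp (- L) * (exp H * Pm m))"
        by (simp add: exp_diff exp_minus divide_inverse algebra_simps)
      also have "\<dots> \<le> exp (\<theta> * L) * (Pm m + exp (- L) * 1)"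
        using HP by (intro mult_left_mono add_left_mono) auto
      also have "\<dots> \<le> exp (\<theta> * L) * (Pm m + exp (- L))
        + (1 + real n * real q ^ 4) ^ D * exp (- real n / (real q)\<^sup>2 * (a\<^sup>2 / (2 + a)))" by simp
      finally show ?thesis .
    next
      case False
      then obtain c0 where c0: "c0 \<in> C" "a \<le> excess n q m c0" by (auto simp: good_def)
      have "a\<^sup>2 / (2 + a) \<le> entropy_fun (excess n q m c0)" by (rule entropy_fun_ge_tail[OF c0(2) a])
      also have "\<dots> \<le> (\<Sum>c\<in>C. entropy_fun (excess n q m c))"
        by (intro member_le_sum c0 finC entropy_fun_nonneg x)
      finally have "real n / (real q)\<^sup>2 * (a\<^sup>2 / (2 + a))
          \<le> real n / (real q)\<^sup>2 * (\<Sum>c\<in>C. entropy_fun (excess n q m c))"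
        by (rule mult_left_mono) simp
      then have P: "Pm m \<le> exp (- real n / (real q)\<^sup>2 * (a\<^sup>2 / (2 + a)))"
        by (intro order_trans[OF Pm_le]) simp
      \<comment> \<open>No cell holds more than n vertices, so an excess is at most q^2 in absolute
        value. With r n \<le> 1 this gives G \<le> n q^4.\<close>
      have "(excess n q m c)\<^sup>2 \<le> real q ^ 4" if "c \<in> C" for c
      proof -
        have "real (m c) \<le> real n" using m that by (cases c) (auto simp: \<T>_def PiE_dflt_def)
        then have "(real q)\<^sup>2 * real (m c) / real n \<le> (real q)\<^sup>2"
          using nq by (simp add: divide_le_eq mult_left_mono)
        moreover have "1 \<le> (real q)\<^sup>2" using nq by simp
        ultimately have "\<bar>excess n q m c\<bar> \<le> (real q)\<^sup>2"
          using x[of c] unfolding abs_le_iff excess_def by linarith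
        then have "(excess n q m c)\<^sup>2 \<le> ((real q)\<^sup>2)\<^sup>2" by (metis abs_le_square_iff abs_of_nonneg zero_le_power2)
        then show ?thesis by simp
      qed
      then have "(\<Sum>c\<in>C. (excess n q m c)\<^sup>2) \<le> (\<Sum>c\<in>C. real q ^ 4)" by (rule sum_mono)
      also have "\<dots> = (real q)\<^sup>2 * real q ^ 4" by (simp add: finC)
      finally have "G m \<le> r * (real n)\<^sup>2 / (2 * (real q)\<^sup>2) * ((real q)\<^sup>2 * real q ^ 4)"
        unfolding G_def using r by (intro mult_left_mono) auto
      also have "\<dots> = (r * real n) * (real n * real q ^ 4) / 2"
        using nq by (simp add: power2_eq_square)
      also have "\<dots> \<le> 1 * (real n * real q ^ 4)"
      proof -
        have "0 \<le> r * real n * a" using r a by simp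
        then have "r * real n \<le> 1" "0 \<le> r * real n" using r by (simp_all add: distrib_left)
        moreover have "0 \<le> real n * real q ^ 4" by simp
        ultimately show ?thesis using mult_right_mono[of "r * real n" 1 "real n * real q ^ 4"] 
          by (smt (verit) field_sum_of_halves)
      qed
      finally have Gle: "G m \<le> real n * real q ^ 4" by simp
      have "trunc_exp D (G m) \<le> (1 + G m) ^ D" by (rule trunc_exp_le_power[OF G0])
      also have "\<dots> \<le> (1 + real n * real q ^ 4) ^ D" using Gle G0[of m] by (intro power_mono) auto
      finally have "trunc_exp D (G m) * Pm m \<le> (1 + real n * real q ^ 4) ^ D * exp (- real n / (real q)\<^sup>2 * (a\<^sup>2 / (2 + a)))"
        using P Pm0 by (intro mult_mono) auto
      moreover have "0 \<le> exp (\<theta> * L) * (Pm m + exp (- L))" using Pm0[of m] by simp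
      ultimately show ?thesis by linarith
    qed
  qed
  also have "\<dots> = exp (\<theta> * L) * (1 + card \<T> * exp (- L))
      + card \<T> * ((1 + real n * real q ^ 4) ^ D * exp (- real n / (real q)\<^sup>2 * (a\<^sup>2 / (2 + a))))"
    by (simp add: sum.distrib Pm1 flip: sum_distrib_left)
  also have "\<dots> \<le> exp (\<theta> * L) * (1 + exp L * exp (- L))
      + exp L * ((1 + real n * real q ^ 4) ^ D * exp (- real n / (real q)\<^sup>2 * (a\<^sup>2 / (2 + a))))"
    using cardT by (intro add_mono mult_left_mono mult_right_mono) auto
  also have "\<dots> = 2 * exp (\<theta> * L) + (real n + 1) ^ (q\<^sup>2) * (1 + real n * real q ^ 4) ^ D * exp (- real n / (real q)\<^sup>2 * (a\<^sup>2 / (2 + a)))"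
    by (simp add: exp_minus expL)
  finally show ?thesis by (simp add: \<theta>_def L_def mult.assoc)
qed

text \<open>The coefficient \<open>r\<close> is the squared deviation of an edge probability from d
  / n in units of the null variance, per unit of \<open>omega\<close>^2. As r n is close to d
  \<lambda>^2, the condition on r n (1 + a) is the threshold.\<close>

lemma sbm_adv_le:
  fixes n q D :: nat and a d lam :: real
  defines "r \<equiv> lam\<^sup>2 * (d / n) / (1 - d / n)"
  assumes nq: "n > 0" "q > 0" and a: "a > 0" and d: "0 < d" "d < n" and lam: "0 \<le> lam" "lam \<le> 1"
    and range: "(1 + real q * lam) * (d / real n) \<le> 1" and r: "r * n * (1 + a) \<le> 1"
  shows "adv (sbm_dim n) D (sbm n d lam q) (erdos_renyi n d) \<le> ereal (sqrt (
      2 * exp (r * n * (1 + a) * (real q)\<^sup>2 * ln (real n + 1))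
      + (real n + 1) ^ (q\<^sup>2) * (1 + real n * real q ^ 4) ^ D * exp (- real n / (real q)\<^sup>2 * (a\<^sup>2 / (2 + a)))))"
proof (rule low_degree_second_moment)
  let ?N = "sbm_dim n" and ?U = "labels n q" and ?p = "d / real n"
  have finU: "finite (set_pmf ?U)" by (rule finite_set_labels[OF nq(2)])
  show "finite (set_pmf ?U)" by (rule finU)
  have p: "0 < ?p" "?p < 1" using d nq by auto
  then show "0 < ?p" "?p < 1" by auto
  have r0: "r \<ge> 0" unfolding r_def using p d by (intro divide_nonneg_nonneg mult_nonneg_nonneg) auto
  show "0 \<le> edge_prob n d lam q s k \<and> edge_prob n d lam q s k \<le> 1" for s k
    using edge_prob_range[of n d lam q s k] nq d lam range by simp
  show "sbm n d lam q = bind_pmf ?U (\<lambda>s. sample ?N (edge_prob n d lam q s))"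
    by (rule sbm_sample[OF nq(2)])
  show "erdos_renyi n d = sample ?N (\<lambda>_. ?p)" by (rule erdos_renyi_sample)
  \<comment> \<open>On the diagonal \<open>omega\<close> is q - 1 for every labeling. Adding it as a
    constant completes the sum over edge slots to half the sum over all ordered pairs of
    vertices.\<close>
  let ?c = "r / 2 * (\<Sum>i<n. omega q (\<lambda>_. 0) i i * omega q (\<lambda>_. 0) i i)"
  have coeff: "(mean ?U (\<lambda>s. \<Prod>k\<in>S. (edge_prob n d lam q s k - ?p)))\<^sup>2 / (?p * (1 - ?p)) ^ card S
    = r ^ card S * (mean ?U (\<lambda>s. \<Prod>k\<in>S. omega_slot n q s k))\<^sup>2" for S
  proof -
    have "(\<Prod>k\<in>S. (edge_prob n d lam q s k - ?p)) = (?p * lam) ^ card S * (\<Prod>k\<in>S. omega_slot n q s k)" for s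
    proof -
      have "edge_prob n d lam q s k - ?p = (?p * lam) * omega_slot n q s k" for k
        by (simp add: edge_prob_omega distrib_left)
      then show ?thesis by (simp only: prod.distrib) (simp add: power_mult_distrib power_divide)
    qed
    moreover have "((?p * lam) ^ card S)\<^sup>2 / (?p * (1 - ?p)) ^ card S = r ^ card S"
    proof -
      have "(?p * lam)\<^sup>2 / (?p * (1 - ?p)) = r"
        unfolding r_def using p by (simp only: power_mult_distrib) (simp add: power2_eq_square)
      moreover have "((?p * lam) ^ card S)\<^sup>2 = ((?p * lam)\<^sup>2) ^ card S"
        by (simp only: power_mult[symmetric] mult.commute)
      ultimately show ?thesis by (simp only: power_divide[symmetric])
    qed
    ultimately show ?thesis
      by (simp only: integral_mult_right_zero power_mult_distrib times_divide_eq_left[symmetric])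
  qed
  have "(\<Sum>S | S \<subseteq> {..<?N} \<and> card S \<le> D. (mean ?U (\<lambda>s. \<Prod>k\<in>S. (edge_prob n d lam q s k - ?p)))\<^sup>2 / (?p * (1 - ?p)) ^ card S)
     = (\<Sum>S | S \<subseteq> {..<?N} \<and> card S \<le> D. r ^ card S * (mean ?U (\<lambda>s. \<Prod>k\<in>S. omega_slot n q s k))\<^sup>2)"
    by (simp only: coeff)
  also have "\<dots> \<le> mean ?U (\<lambda>s. mean ?U (\<lambda>t. trunc_exp D (?c + (\<Sum>k<?N. r * omega_slot n q s k * omega_slot n q t k))))"
    using r0 nq by (intro mean_truncated_exp_ge finU mult_nonneg_nonneg sum_nonneg) (auto simp: omega_def)
  also have "(\<lambda>s. mean ?U (\<lambda>t. trunc_exp D (?c + (\<Sum>k<?N. r * omega_slot n q s k * omega_slot n q t k))))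
     = (\<lambda>s. mean ?U (\<lambda>t. trunc_exp D (r / 2 * (\<Sum>i<n. \<Sum>j<n. omega q s i j * omega q t i j))))"
  proof -
    have "?c + (\<Sum>k<?N. r * omega_slot n q s k * omega_slot n q t k)
       = r / 2 * (\<Sum>i<n. \<Sum>j<n. omega q s i j * omega q t i j)" for s t
    proof -
      have "(\<Sum>i<n. \<Sum>j<n. omega q s i j * omega q t i j) = (\<Sum>i<n. omega q s i i * omega q t i i)
          + 2 * (\<Sum>k<?N. case edge_slots n ! k of (i, j) \<Rightarrow> omega q s i j * omega q t i j)"
        by (rule sum_edge_slots_pairs) (simp add: omega_sym[of q _ i j for i j])
      also have "(\<Sum>k<?N. case edge_slots n ! k of (i, j) \<Rightarrow> omega q s i j * omega q t i j)
          = (\<Sum>k<?N. omega_slot n q s k * omega_slot n q t k)"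
        by (intro sum.cong refl) (simp add: omega_slot_def split: prod.splits)
      finally show ?thesis by (simp add: omega_def distrib_left sum_distrib_left mult.assoc)
    qed
    then show ?thesis by (simp only:)
  qed
  also have "mean ?U \<dots> \<le> 2 * exp (r * n * (1 + a) * (real q)\<^sup>2 * ln (real n + 1))
      + (real n + 1) ^ (q\<^sup>2) * (1 + real n * real q ^ 4) ^ D * exp (- real n / (real q)\<^sup>2 * (a\<^sup>2 / (2 + a)))"
    by (rule mean_trunc_exp_le[OF nq a r0 r])
  finally show "(\<Sum>S | S \<subseteq> {..<?N} \<and> card S \<le> D. (mean ?U (\<lambda>s. \<Prod>k\<in>S. (edge_prob n d lam q s k - ?p)))\<^sup>2 / (?p * (1 - ?p)) ^ card S)
     \<le> 2 * exp (r * n * (1 + a) * (real q)\<^sup>2 * ln (real n + 1))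
      + (real n + 1) ^ (q\<^sup>2) * (1 + real n * real q ^ 4) ^ D * exp (- real n / (real q)\<^sup>2 * (a\<^sup>2 / (2 + a)))" .
qed

section \<open>Advantage of hidden informative samples\<close>

lemma hidden_planted_eq:
  assumes "M > 0"
  shows "hidden_planted M P Q = bind_pmf (pmf_of_set {..<M}) (\<lambda>\<kappa>. bind_pmf (Pi_pmf {..<M} [] (\<lambda>_. Q))
     (\<lambda>Y. map_pmf (\<lambda>y. concat (map (Y(\<kappa> := y)) [0..<M])) P))"
  unfolding hidden_planted_def
proof (rule bind_pmf_cong[OF refl])
  fix \<kappa> assume "\<kappa> \<in> set_pmf (pmf_of_set {..<M})"
  then have k: "\<kappa> \<in> {..<M}" using assms by (subst (asm) set_pmf_of_set) auto
  have "(\<lambda>j. if j = \<kappa> then P else Q) = (\<lambda>_. Q)(\<kappa> := P)" by auto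
  then show "product_law M (\<lambda>j. if j = \<kappa> then P else Q) = bind_pmf (Pi_pmf {..<M} [] (\<lambda>_. Q))
     (\<lambda>Y. map_pmf (\<lambda>y. concat (map (Y(\<kappa> := y)) [0..<M])) P)"
    using Pi_pmf_fun_upd[OF _ k, of "[]" "\<lambda>_. Q" P]
    by (simp add: product_law_def map_bind_pmf map_pmf_comp)
qed

lemma concat_nth:
  assumes "\<And>j. j < M \<Longrightarrow> length (Y j) = N" "j < M" "i < N"
  shows "concat (map Y [0..<M]) ! (j * N + i) = Y j ! i"
  using assms
proof (induction M)
  case (Suc M)
  have len: "length (concat (map Y [0..<M])) = M * N"
    using Suc.prems(1) by (induction M) auto
  show ?case
  proof (cases "j = M")
    case False
    then have j: "j < M" using Suc by simp
    then have "j * N + i < M * N"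
      using Suc.prems(3) by (metis add_less_cancel_left less_le_trans mult_Suc mult_le_mono1 add.commute Suc_leI)
    then show ?thesis using Suc j by (simp add: nth_append len)
  qed (use Suc in \<open>simp add: nth_append len\<close>)
qed simp

lemma length_concat_blocks:
  assumes "\<And>j. j < M \<Longrightarrow> length (Y j) = N"
  shows "length (concat (map Y [0..<M])) = M * N"
  using assms by (induction M) auto

lemma sum_blocks:
  fixes f :: "nat \<Rightarrow> 'a::comm_monoid_add"
  shows "(\<Sum>i<M * N. f i) = (\<Sum>j<M. \<Sum>i<N. f (j * N + i))"
proof -
  have "sum f {j * N..<j * N + N} = (\<Sum>i<N. f (j * N + i))" for j
    using sum.shift_bounds_nat_ivl[of f 0 "j * N" N] by (simp add: lessThan_atLeast0 add.commute)
  then show ?thesis by (simp flip: sum.nat_group)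
qed

lemma prod_blocks:
  fixes f :: "nat \<Rightarrow> 'a::comm_monoid_mult"
  shows "(\<Prod>i<M * N. f i) = (\<Prod>j<M. \<Prod>i<N. f (j * N + i))"
proof -
  have "prod f {j * N..<j * N + N} = (\<Prod>i<N. f (j * N + i))" for j
    using prod.shift_bounds_nat_ivl[of f 0 "j * N" N] by (simp add: lessThan_atLeast0 add.commute)
  then show ?thesis by (simp flip: prod.nat_group)
qed

text \<open>Averaging over the other blocks turns a monomial into a constant times its part in block
  \<kappa>, whose degree is not larger.\<close>

lemma block_polynomial:
  assumes f: "f \<in> polynomials (M * N) D" and R: "finite (set_pmf R)"
    and len: "\<And>Y j. Y \<in> set_pmf R \<Longrightarrow> j < M \<Longrightarrow> length (Y j) = N" and k: "\<kappa> < M"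
  shows "\<exists>g\<in>polynomials N D. \<forall>y. length y = N \<longrightarrow>
     g (point y) = mean R (\<lambda>Y. f (point (concat (map (Y(\<kappa> := y)) [0..<M]))))"
proof -
  obtain c where c: "f = (\<lambda>x. \<Sum>\<alpha>\<in>exponents (M * N) D. c \<alpha> * (\<Prod>i<M * N. x i ^ \<alpha> i))"
    using f unfolding polynomials_def by blast
  define \<beta> where "\<beta> \<alpha> i = (if i < N then \<alpha> (\<kappa> * N + i) else 0)" for \<alpha> :: "nat \<Rightarrow> nat" and i
  define w where "w \<alpha> Y = (\<Prod>j\<in>{..<M} - {\<kappa>}. \<Prod>i<N. point (Y j) i ^ \<alpha> (j * N + i))" for \<alpha> :: "nat \<Rightarrow> nat" and Y
  have \<beta>: "\<beta> \<alpha> \<in> exponents N D" if "\<alpha> \<in> exponents (M * N) D" for \<alpha>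
  proof -
    have "(\<Sum>i<N. \<beta> \<alpha> i) = (\<Sum>i<N. \<alpha> (\<kappa> * N + i))" by (simp add: \<beta>_def)
    also have "\<dots> \<le> (\<Sum>j<M. \<Sum>i<N. \<alpha> (j * N + i))"
      using k by (intro member_le_sum[where f = "\<lambda>j. \<Sum>i<N. \<alpha> (j * N + i)"]) auto
    also have "\<dots> \<le> D" using that by (simp add: exponents_def flip: sum_blocks)
    finally show ?thesis by (simp add: exponents_def \<beta>_def)
  qed
  have eq: "(\<Prod>i<M * N. point (concat (map (Y(\<kappa> := y)) [0..<M])) i ^ \<alpha> i) = (\<Prod>i<N. point y i ^ \<beta> \<alpha> i) * w \<alpha> Y"
    if Y: "Y \<in> set_pmf R" and y: "length y = N" for Y y \<alpha>
  proof -
    have "(\<Prod>i<M * N. point (concat (map (Y(\<kappa> := y)) [0..<M])) i ^ \<alpha> i)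
       = (\<Prod>j<M. \<Prod>i<N. point ((Y(\<kappa> := y)) j) i ^ \<alpha> (j * N + i))"
      unfolding prod_blocks using len[OF Y] y
      by (intro prod.cong refl) (simp add: point_def concat_nth[of M "Y(\<kappa> := y)" N])
    also have "\<dots> = (\<Prod>i<N. point y i ^ \<alpha> (\<kappa> * N + i)) * (\<Prod>j\<in>{..<M} - {\<kappa>}. \<Prod>i<N. point ((Y(\<kappa> := y)) j) i ^ \<alpha> (j * N + i))"
      using k by (subst prod.remove[of _ \<kappa>]) auto
    also have "(\<Prod>j\<in>{..<M} - {\<kappa>}. \<Prod>i<N. point ((Y(\<kappa> := y)) j) i ^ \<alpha> (j * N + i)) = w \<alpha> Y"
      unfolding w_def by (intro prod.cong refl) auto
    also have "(\<Prod>i<N. point y i ^ \<alpha> (\<kappa> * N + i)) = (\<Prod>i<N. point y i ^ \<beta> \<alpha> i)"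
      by (intro prod.cong refl) (simp add: \<beta>_def)
    finally show ?thesis .
  qed
  let ?g = "\<lambda>x. \<Sum>\<alpha>\<in>exponents (M * N) D. (c \<alpha> * mean R (w \<alpha>)) * (\<Prod>i<N. x i ^ \<beta> \<alpha> i)"
  have "?g \<in> polynomials N D"
    by (intro polynomials_sum polynomials_cmult polynomials_monomial \<beta>)
  moreover have "?g (point y) = mean R (\<lambda>Y. f (point (concat (map (Y(\<kappa> := y)) [0..<M]))))" if "length y = N" for y
  proof -
    have "mean R (\<lambda>Y. f (point (concat (map (Y(\<kappa> := y)) [0..<M]))))
       = mean R (\<lambda>Y. \<Sum>\<alpha>\<in>exponents (M * N) D. c \<alpha> * ((\<Prod>i<N. point y i ^ \<beta> \<alpha> i) * w \<alpha> Y))"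
      unfolding c by (intro mean_cong sum.cong refl) (simp only: eq[OF _ that])
    also have "\<dots> = ?g (point y)"
      by (simp only: mean_sum[OF R] integral_mult_right_zero) (simp only: mult_ac)
    finally show ?thesis by (rule sym)
  qed
  ultimately show ?thesis by (intro bexI[of _ ?g] allI impI)
qed

text \<open>\<open>G \<kappa>\<close> is the conditional mean of F given block \<kappa>, and
  \<open>g \<kappa>\<close> is its centred version. The latter are orthogonal under the null law, so
  their squared norms add up to at most that of F. Since the planted law changes a single block, it
  sees only the mean \<open>m\<close> and the average over \<kappa> of the planted means of
  \<open>g \<kappa>\<close>, each at most B times the norm of \<open>g \<kappa>\<close>.
  Cauchy-Schwarz over the M blocks gives the factor B / sqrt M.\<close>

lemma hidden_adv_le:
  assumes P: "finite (set_pmf P)" "\<And>y. y \<in> set_pmf P \<Longrightarrow> length y = N"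
    and Q: "finite (set_pmf Q)" "\<And>y. y \<in> set_pmf Q \<Longrightarrow> length y = N"
    and M: "M > 0" and adv: "adv N D P Q \<le> ereal B" and B: "B \<ge> 0"
  shows "adv (M * N) D (hidden_planted M P Q) (hidden_null M Q) \<le> ereal (1 + B / sqrt M)"
proof (rule adv_le)
  show "0 \<le> 1 + B / sqrt M" using B by simp
  fix f assume f: "f \<in> polynomials (M * N) D"
  let ?R = "Pi_pmf {..<M} [] (\<lambda>_. Q)"
  define F where "F Y = f (point (concat (map Y [0..<M])))" for Y
  define m where "m = mean ?R F"
  define G where "G = (\<lambda>\<kappa> y. mean ?R (\<lambda>Y. F (Y(\<kappa> := y))))"
  define g where "g = (\<lambda>\<kappa> y. G \<kappa> y - m)"
  have R: "finite (set_pmf ?R)" using Q by simp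
  have len: "length (Y j) = N" if "Y \<in> set_pmf ?R" "j < M" for Y j
    using that Q(2) by (subst (asm) set_Pi_pmf) (auto simp: PiE_dflt_def)
  have res: "mean ?R H = mean ?R (\<lambda>Y. mean Q (\<lambda>y. H (Y(\<kappa> := y))))" if "\<kappa> < M" for \<kappa> H
    using that Q by (intro mean_resample) auto
  have G_mean: "mean Q (G \<kappa>) = m" if "\<kappa> < M" for \<kappa>
    unfolding G_def m_def using res[OF that, of F] mean_swap[OF Q(1) R] by simp
  have g0: "mean Q (g \<kappa>) = 0" if "\<kappa> < M" for \<kappa>
    using G_mean[OF that] by (simp add: g_def mean_diff[OF Q(1)])
  have g_bound: "mean P (g \<kappa>) \<le> B * sqrt (mean Q (\<lambda>y. (g \<kappa> y)\<^sup>2))" if k: "\<kappa> < M" for \<kappa>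
  proof -
    have "\<exists>h\<in>polynomials N D. \<forall>y. length y = N \<longrightarrow> h (point y) = G \<kappa> y"
      unfolding G_def F_def using f R len k by (intro block_polynomial)
    then obtain h where h: "h \<in> polynomials N D" "\<And>y. length y = N \<Longrightarrow> h (point y) = G \<kappa> y"
      by auto
    have "(\<lambda>x. h x + - m) \<in> polynomials N D"
      by (intro polynomials_add polynomials_const h(1))
    from adv_bound[OF this adv]
    have "mean P (\<lambda>y. h (point y) + - m) \<le> B * sqrt (mean Q (\<lambda>y. (h (point y) + - m)\<^sup>2))" .
    moreover have "mean P (\<lambda>y. h (point y) + - m) = mean P (g \<kappa>)"
      by (intro mean_cong) (simp add: h(2) P(2) g_def)
    moreover have "mean Q (\<lambda>y. (h (point y) + - m)\<^sup>2) = mean Q (\<lambda>y. (g \<kappa> y)\<^sup>2)"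
      by (intro mean_cong) (simp add: h(2) Q(2) g_def)
    ultimately show ?thesis by simp
  qed
  have Fg: "mean ?R (\<lambda>Y. F Y * g \<kappa> (Y \<kappa>)) = mean Q (\<lambda>y. (g \<kappa> y)\<^sup>2)" if k: "\<kappa> < M" for \<kappa>
  proof -
    have "mean ?R (\<lambda>Y. F Y * g \<kappa> (Y \<kappa>)) = mean ?R (\<lambda>Y. mean Q (\<lambda>y. F (Y(\<kappa> := y)) * g \<kappa> y))"
      by (subst res[OF k]) simp
    also have "\<dots> = mean Q (\<lambda>y. G \<kappa> y * g \<kappa> y)"
      by (subst mean_swap[OF R Q(1)]) (simp add: G_def)
    also have "\<dots> = mean Q (\<lambda>y. (g \<kappa> y)\<^sup>2 + m * g \<kappa> y)"
      by (intro mean_cong) (simp add: g_def power2_eq_square algebra_simps)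
    also have "\<dots> = mean Q (\<lambda>y. (g \<kappa> y)\<^sup>2)"
      by (simp add: mean_add[OF Q(1)] g0[OF k])
    finally show ?thesis .
  qed
  have gg: "mean ?R (\<lambda>Y. g \<kappa> (Y \<kappa>) * g \<iota> (Y \<iota>)) = (if \<kappa> = \<iota> then mean Q (\<lambda>y. (g \<kappa> y)\<^sup>2) else 0)"
    if k: "\<kappa> < M" "\<iota> < M" for \<kappa> \<iota>
  proof (cases "\<kappa> = \<iota>")
    case True
    then show ?thesis using k by (simp add: mean_Pi_component[where g = "\<lambda>y. g \<iota> y * g \<iota> y"] power2_eq_square)
  next
    case False
    then have "mean ?R (\<lambda>Y. g \<kappa> (Y \<kappa>) * g \<iota> (Y \<iota>)) = mean ?R (\<lambda>Y. mean Q (g \<kappa>) * g \<iota> (Y \<iota>))"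
      by (subst res[OF k(1)]) simp
    then show ?thesis using False k by (simp add: g0)
  qed
  let ?v = "\<lambda>\<kappa>. mean Q (\<lambda>y. (g \<kappa> y)\<^sup>2)"
  have v0: "?v \<kappa> \<ge> 0" for \<kappa> by (intro mean_nonneg) auto
  \<comment> \<open>Bessel's inequality, from the squared distance between F and the sum of its
    one-block parts.\<close>
  have "0 \<le> mean ?R (\<lambda>Y. (F Y - (\<Sum>\<kappa><M. g \<kappa> (Y \<kappa>)))\<^sup>2)" by (intro mean_nonneg) auto
  also have "\<dots> = mean ?R (\<lambda>Y. (F Y)\<^sup>2 - 2 * (\<Sum>\<kappa><M. F Y * g \<kappa> (Y \<kappa>)) + (\<Sum>\<kappa><M. \<Sum>\<iota><M. g \<kappa> (Y \<kappa>) * g \<iota> (Y \<iota>)))"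
    by (intro mean_cong) (simp add: power2_diff power2_eq_square[of "sum _ _"] sum_product sum_distrib_left algebra_simps)
  also have "\<dots> = mean ?R (\<lambda>Y. (F Y)\<^sup>2) - 2 * (\<Sum>\<kappa><M. ?v \<kappa>) + (\<Sum>\<kappa><M. \<Sum>\<iota><M. if \<kappa> = \<iota> then ?v \<kappa> else 0)"
    by (simp add: mean_add[OF R] mean_diff[OF R] mean_sum[OF R] Fg gg)
  also have "\<dots> = mean ?R (\<lambda>Y. (F Y)\<^sup>2) - (\<Sum>\<kappa><M. ?v \<kappa>)"
    by simp
  finally have bessel: "(\<Sum>\<kappa><M. ?v \<kappa>) \<le> mean ?R (\<lambda>Y. (F Y)\<^sup>2)" by simp
  let ?S = "sqrt (mean ?R (\<lambda>Y. (F Y)\<^sup>2))"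
  have m_le: "m \<le> ?S"
    using mean_Cauchy_Schwarz[OF R, of F "\<lambda>_. 1"] by (intro real_le_rsqrt) (simp add: m_def)
  have "(\<Sum>\<kappa><M. sqrt (?v \<kappa>)) \<le> sqrt M * ?S"
  proof -
    have "(\<Sum>\<kappa><M. 1 * sqrt (?v \<kappa>))\<^sup>2 \<le> (\<Sum>\<kappa><M. 1\<^sup>2) * (\<Sum>\<kappa><M. (sqrt (?v \<kappa>))\<^sup>2)"
      by (rule Cauchy_Schwarz_ineq_sum)
    also have "\<dots> \<le> M * mean ?R (\<lambda>Y. (F Y)\<^sup>2)"
      using bessel v0 by (simp add: mult_left_mono)
    finally show ?thesis
      unfolding real_sqrt_mult[symmetric] by (intro real_le_rsqrt) simp
  qed
  then have sum_le: "B / M * (\<Sum>\<kappa><M. sqrt (?v \<kappa>)) \<le> B / M * (sqrt M * ?S)"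
    using B by (intro mult_left_mono) auto
  have Mne: "{..<M} \<noteq> {}" using M by auto
  have "mean (hidden_planted M P Q) (\<lambda>y. f (point y))
      = mean (pmf_of_set {..<M}) (\<lambda>\<kappa>. mean ?R (\<lambda>Y. mean P (\<lambda>y. F (Y(\<kappa> := y)))))"
    unfolding hidden_planted_eq[OF M] F_def using P R Mne by (simp add: mean_bind)
  also have "\<dots> = (\<Sum>\<kappa><M. mean P (G \<kappa>)) / M"
    using M by (simp add: mean_pmf_of_set_lessThan mean_swap[OF R P(1)] G_def)
  also have "\<dots> = (\<Sum>\<kappa><M. m + mean P (g \<kappa>)) / M"
    by (simp add: g_def mean_diff[OF P(1)])
  also have "\<dots> \<le> (\<Sum>\<kappa><M. m + B * sqrt (?v \<kappa>)) / M"
    using g_bound by (intro divide_right_mono sum_mono add_left_mono) auto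
  also have "\<dots> = m + B / M * (\<Sum>\<kappa><M. sqrt (?v \<kappa>))"
    using M by (simp add: sum.distrib add_divide_distrib sum_distrib_left[symmetric])
  also have "\<dots> \<le> ?S + B / M * (sqrt M * ?S)"
    using m_le sum_le by (rule add_mono)
  also have "\<dots> = (1 + B / sqrt M) * ?S"
    using M by (simp add: field_simps)
  also have "?S = sqrt (mean (hidden_null M Q) (\<lambda>y. (f (point y))\<^sup>2))"
    by (simp add: hidden_null_def product_law_def F_def)
  finally show "mean (hidden_planted M P Q) (\<lambda>y. f (point y))
     \<le> (1 + B / sqrt M) * sqrt (mean (hidden_null M Q) (\<lambda>y. (f (point y))\<^sup>2))" .
qed

section \<open>Weak recovery requires a signal\<close>

text \<open>Given the label of u, redrawing the label of v makes \<open>omega\<close> centred, and F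
  does not notice the change.\<close>

lemma mean_omega_zero:
  assumes "q > 0" "v < n" "u < n" "v \<noteq> u" and F: "\<And>s a. F (s(v := a)) = F s"
  shows "mean (labels n q) (\<lambda>s. omega q s v u * F s) = 0"
proof -
  have ne: "finite (set_pmf (pmf_of_set {..<q}))" using assms by (auto simp: lessThan_empty_iff)
  have "mean (labels n q) (\<lambda>s. omega q s v u * F s)
     = mean (labels n q) (\<lambda>s. mean (pmf_of_set {..<q}) (\<lambda>a. omega q (s(v := a)) v u * F (s(v := a))))"
    using assms ne by (intro mean_resample) auto
  also have "\<dots> = mean (labels n q) (\<lambda>s. 0)"
  proof (rule mean_cong)
    fix s assume s: "s \<in> set_pmf (labels n q)"
    have "s u < q" by (rule labels_less[OF assms(1) s assms(3)])
    then have "(\<Sum>a<q. real q * of_bool (a = s u) - 1) = 0"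
      by (simp add: sum_subtractf of_bool_def flip: sum_distrib_left)
    moreover have "(\<Sum>a<q. omega q (s(v := a)) v u * F (s(v := a))) = (\<Sum>a<q. real q * of_bool (a = s u) - 1) * F s"
      using assms(4) by (simp add: omega_def F sum_distrib_right)
    ultimately show "mean (pmf_of_set {..<q}) (\<lambda>a. omega q (s(v := a)) v u * F (s(v := a))) = 0"
      by (simp add: mean_pmf_of_set_lessThan[OF assms(1)])
  qed
  finally show ?thesis by simp
qed

text \<open>The two values q - 1 and -1 are the roots of z^2 - (q - 2) z - (q - 1).\<close>

lemma omega_slot_sq: "(omega_slot n q s k)\<^sup>2 = (real q - 2) * omega_slot n q s k + (real q - 1)"
  by (simp add: omega_slot_def omega_def of_bool_def power2_eq_square algebra_simps split: prod.splits)

lemma mean_omega_slot: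
  assumes "q > 0" "k < sbm_dim n"
  shows "mean (labels n q) (\<lambda>s. omega_slot n q s k) = 0"
proof -
  obtain i j where e: "edge_slots n ! k = (i, j)" by force
  show ?thesis
    using mean_omega_zero[of q i n j "\<lambda>_. 1"] assms edge_slots_nth[OF assms(2) e]
    by (simp add: omega_slot_def e)
qed

text \<open>Of two different edges, the first has an endpoint outside the second; redrawing its
  label centres the product.\<close>

lemma mean_omega_slot_mult:
  assumes "q > 0" "k < sbm_dim n" "l < sbm_dim n"
  shows "mean (labels n q) (\<lambda>s. omega_slot n q s k * omega_slot n q s l) = (if k = l then real q - 1 else 0)"
proof (cases "k = l")
  case True
  then have "mean (labels n q) (\<lambda>s. omega_slot n q s k * omega_slot n q s l)
     = mean (labels n q) (\<lambda>s. (real q - 2) * omega_slot n q s k + (real q - 1))"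
    by (simp add: omega_slot_sq flip: power2_eq_square)
  then show ?thesis
    using True mean_omega_slot[OF assms(1,2)] by (simp add: mean_add[OF finite_set_labels[OF assms(1)]])
next
  case False
  obtain i j where e: "edge_slots n ! k = (i, j)" by force
  obtain i' j' where e': "edge_slots n ! l = (i', j')" by force
  note b = edge_slots_nth[OF assms(2) e] and b' = edge_slots_nth[OF assms(3) e']
  have "edge_slots n ! k \<noteq> edge_slots n ! l"
    using False assms distinct_edge_slots[of n] by (simp add: nth_eq_iff_index_eq sbm_dim_def)
  then have "(i, j) \<noteq> (i', j')" using e e' by simp
  then consider "i \<notin> {i', j'}" | "j \<notin> {i', j'}" using b b' by force
  then have "mean (labels n q) (\<lambda>s. omega q s i j * omega q s i' j') = 0"
  proof cases
    case 1
    then show ?thesis using b b' assms by (intro mean_omega_zero) (auto simp: omega_def)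
  next
    case 2
    then have "mean (labels n q) (\<lambda>s. omega q s j i * omega q s i' j') = 0"
      using b b' assms by (intro mean_omega_zero) (auto simp: omega_def)
    then show ?thesis by (simp add: omega_sym[of q _ j i])
  qed
  then show ?thesis using False by (simp add: omega_slot_def e e')
qed

lemma mean_linear_omega_sq:
  assumes "q > 0"
  shows "mean (labels n q) (\<lambda>s. (\<Sum>k<sbm_dim n. x k * omega_slot n q s k)\<^sup>2) = (real q - 1) * (\<Sum>k<sbm_dim n. (x k)\<^sup>2)"
proof -
  note fin = finite_set_labels[OF assms]
  have "mean (labels n q) (\<lambda>s. (\<Sum>k<sbm_dim n. x k * omega_slot n q s k)\<^sup>2)
    = mean (labels n q) (\<lambda>s. \<Sum>k<sbm_dim n. \<Sum>l<sbm_dim n. x k * x l * (omega_slot n q s k * omega_slot n q s l))"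
    by (simp add: power2_eq_square sum_product mult_ac)
  also have "\<dots> = (\<Sum>k<sbm_dim n. \<Sum>l<sbm_dim n. x k * x l * (if k = l then real q - 1 else 0))"
    by (simp add: mean_sum[OF fin] mean_omega_slot_mult[OF assms])
  also have "\<dots> = (\<Sum>k<sbm_dim n. x k * x k * (real q - 1))"
    by (intro sum.cong) (auto simp: if_distrib sum.delta cong: if_cong)
  finally show ?thesis by (simp add: power2_eq_square sum_distrib_left mult.commute)
qed

text \<open>By \<open>omega_slot_sq\<close> the squared norm of the target is an affine function of
  this sum, so typicality fixes the norm up to a constant factor.\<close>

definition typical :: "nat \<Rightarrow> nat \<Rightarrow> (nat \<Rightarrow> nat) \<Rightarrow> bool" where
  "typical n q s \<longleftrightarrow> \<bar>\<Sum>k<sbm_dim n. omega_slot n q s k\<bar> \<le> real (sbm_dim n) / 2"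

text \<open>Chebyshev's inequality, with the variance from the orthogonality of the slots.\<close>

lemma mean_not_typical:
  assumes "q > 0" "sbm_dim n > 0"
  shows "mean (labels n q) (\<lambda>s. of_bool (\<not> typical n q s)) \<le> 4 * real q / real (sbm_dim n)"
proof -
  note fin = finite_set_labels[OF assms(1)]
  let ?N = "real (sbm_dim n)"
  have "mean (labels n q) (\<lambda>s. of_bool (\<not> typical n q s))
     \<le> mean (labels n q) (\<lambda>s. 4 / ?N\<^sup>2 * (\<Sum>k<sbm_dim n. 1 * omega_slot n q s k)\<^sup>2)"
  proof (intro mean_mono fin)
    fix s
    show "of_bool (\<not> typical n q s) \<le> 4 / ?N\<^sup>2 * (\<Sum>k<sbm_dim n. 1 * omega_slot n q s k)\<^sup>2"
    proof (cases "typical n q s")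
      case False
      then have "(?N / 2)\<^sup>2 \<le> \<bar>\<Sum>k<sbm_dim n. omega_slot n q s k\<bar>\<^sup>2"
        by (intro power_mono) (auto simp: typical_def)
      then show ?thesis using False assms by (simp add: power_divide field_simps)
    qed simp
  qed
  also have "\<dots> = 4 / ?N\<^sup>2 * ((real q - 1) * ?N)"
    using mean_linear_omega_sq[OF assms(1), of n "\<lambda>_. 1"] by simp
  also have "\<dots> = 4 * (real q - 1) / ?N" using assms by (simp add: power2_eq_square)
  also have "\<dots> \<le> 4 * real q / ?N" by (intro divide_right_mono) auto
  finally show ?thesis .
qed

lemma typical_bounds:
  assumes "q \<ge> 2" "typical n q s"
  shows "real (sbm_dim n) * real q / 2 \<le> (\<Sum>k<sbm_dim n. (omega_slot n q s k)\<^sup>2)"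
    and "(\<Sum>k<sbm_dim n. (omega_slot n q s k)\<^sup>2) \<le> 3 / 2 * real (sbm_dim n) * real q"
proof -
  let ?N = "real (sbm_dim n)" and ?S = "\<Sum>k<sbm_dim n. omega_slot n q s k"
  have eq: "(\<Sum>k<sbm_dim n. (omega_slot n q s k)\<^sup>2) = (real q - 2) * ?S + ?N * (real q - 1)"
    by (simp add: omega_slot_sq sum.distrib sum_distrib_left)
  have S: "- (?N / 2) \<le> ?S" "?S \<le> ?N / 2" using assms(2) by (auto simp: typical_def abs_le_iff)
  define A where "A = (real q - 2) * ?S"
  have q2: "0 \<le> real q - 2" using assms(1) by simp
  have "- A \<le> (real q - 2) * (?N / 2)" "A \<le> (real q - 2) * (?N / 2)"
    using mult_left_mono[OF S(1) q2] mult_left_mono[OF S(2) q2] by (simp_all add: A_def)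
  moreover have "(real q - 2) * (?N / 2) = ?N * real q / 2 - ?N"
    by (simp add: field_simps)
  moreover have "?N * (real q - 1) = ?N * real q - ?N"
    by (simp add: right_diff_distrib)
  moreover have "0 \<le> ?N" by simp
  ultimately have "?N * real q / 2 \<le> A + ?N * (real q - 1)" "A + ?N * (real q - 1) \<le> 3 / 2 * (?N * real q)"
    by linarith+
  then show "?N * real q / 2 \<le> (\<Sum>k<sbm_dim n. (omega_slot n q s k)\<^sup>2)"
    "(\<Sum>k<sbm_dim n. (omega_slot n q s k)\<^sup>2) \<le> 3 / 2 * ?N * real q"
    unfolding eq A_def by simp_all
qed

text \<open>The product is the likelihood ratio of the two product laws.\<close>

lemma mean_change_measure:
  assumes "0 < p" "p < 1" "\<And>k. k < N \<Longrightarrow> 0 \<le> r k \<and> r k \<le> 1"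
  shows "mean (bits N r) f
    = mean (bits N (\<lambda>_. p)) (\<lambda>Y. (\<Prod>k<N. if Y k then r k / p else (1 - r k) / (1 - p)) * f Y)"
proof -
  let ?S = "PiE_dflt {..<N} False (\<lambda>_. UNIV :: bool set)"
  have fin: "finite ?S" by (intro finite_PiE_dflt) auto
  have sub: "Y \<in> ?S" if "Y \<in> set_pmf (bits N r')" for Y r'
    using set_Pi_pmf_subset'[of "{..<N}" False "\<lambda>k. bernoulli_pmf (r' k)"] that by (auto simp: PiE_dflt_def)
  have "mean (bits N r) f = (\<Sum>Y\<in>?S. f Y * pmf (bits N r) Y)"
    by (rule integral_measure_pmf_real[OF fin]) (use sub in auto)
  also have "\<dots> = (\<Sum>Y\<in>?S. ((\<Prod>k<N. if Y k then r k / p else (1 - r k) / (1 - p)) * f Y) * pmf (bits N (\<lambda>_. p)) Y)"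
  proof (rule sum.cong[OF refl])
    fix Y assume Y: "Y \<in> ?S"
    have "pmf (bits N r) Y = (\<Prod>k<N. pmf (bernoulli_pmf (r k)) (Y k))"
      using Y by (intro pmf_Pi') (auto simp: PiE_dflt_def)
    also have "\<dots> = (\<Prod>k<N. (if Y k then r k / p else (1 - r k) / (1 - p)) * pmf (bernoulli_pmf p) (Y k))"
      using assms by (intro prod.cong refl) (auto simp: less_imp_le)
    also have "\<dots> = (\<Prod>k<N. if Y k then r k / p else (1 - r k) / (1 - p)) * pmf (bits N (\<lambda>_. p)) Y"
      using Y by (subst pmf_Pi') (auto simp: PiE_dflt_def prod.distrib)
    finally show "f Y * pmf (bits N r) Y
       = ((\<Prod>k<N. if Y k then r k / p else (1 - r k) / (1 - p)) * f Y) * pmf (bits N (\<lambda>_. p)) Y"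
      by simp
  qed
  also have "\<dots> = mean (bits N (\<lambda>_. p)) (\<lambda>Y. (\<Prod>k<N. if Y k then r k / p else (1 - r k) / (1 - p)) * f Y)"
    by (rule integral_measure_pmf_real[OF fin, symmetric]) (use sub in auto)
  finally show ?thesis .
qed

text \<open>In each slot the second moment is 1 plus the chi-square divergence z, and 1 + z \<le>
  exp z.\<close>

lemma mean_likelihood_sq:
  assumes "0 < p" "p < 1"
  shows "mean (bits N (\<lambda>_. p)) (\<lambda>Y. (\<Prod>k<N. if Y k then r k / p else (1 - r k) / (1 - p))\<^sup>2)
    \<le> exp (\<Sum>k<N. (r k - p)\<^sup>2 / (p * (1 - p)))"
proof -
  have "mean (bits N (\<lambda>_. p)) (\<lambda>Y. (\<Prod>k<N. if Y k then r k / p else (1 - r k) / (1 - p))\<^sup>2)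
     = mean (bits N (\<lambda>_. p)) (\<lambda>Y. \<Prod>k<N. (if Y k then r k / p else (1 - r k) / (1 - p))\<^sup>2)"
    by (simp add: prod_power_distrib)
  also have "\<dots> = (\<Prod>k<N. mean (bernoulli_pmf p) (\<lambda>b. (if b then r k / p else (1 - r k) / (1 - p))\<^sup>2))"
    by (rule mean_prod) auto
  also have "\<dots> = (\<Prod>k<N. 1 + (r k - p)\<^sup>2 / (p * (1 - p)))"
  proof (intro prod.cong refl)
    fix k
    have "p * (r k / p)\<^sup>2 + (1 - p) * ((1 - r k) / (1 - p))\<^sup>2 = (r k)\<^sup>2 / p + (1 - r k)\<^sup>2 / (1 - p)"
      using assms by (simp add: power2_eq_square)
    also have "\<dots> = ((r k)\<^sup>2 * (1 - p) + (1 - r k)\<^sup>2 * p) / (p * (1 - p))"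
      using assms by (simp add: add_frac_eq)
    also have "(r k)\<^sup>2 * (1 - p) + (1 - r k)\<^sup>2 * p = p * (1 - p) + (r k - p)\<^sup>2"
      by (simp add: power2_eq_square algebra_simps)
    also have "\<dots> / (p * (1 - p)) = 1 + (r k - p)\<^sup>2 / (p * (1 - p))"
      using assms by (simp add: add_divide_distrib)
    finally show "mean (bernoulli_pmf p) (\<lambda>b. (if b then r k / p else (1 - r k) / (1 - p))\<^sup>2) = 1 + (r k - p)\<^sup>2 / (p * (1 - p))"
      using assms by (simp add: mean_bernoulli mult.commute)
  qed
  also have "\<dots> \<le> (\<Prod>k<N. exp ((r k - p)\<^sup>2 / (p * (1 - p))))"
    using assms by (intro prod_mono) (auto intro!: add_nonneg_nonneg)
  also have "\<dots> = exp (\<Sum>k<N. (r k - p)\<^sup>2 / (p * (1 - p)))" by (simp add: exp_sum)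
  finally show ?thesis .
qed

text \<open>Only the direction of the target matters, so \<Theta> can be replaced by
  \<open>omega_slot\<close>.\<close>

lemma overlap_cmult: "c > 0 \<Longrightarrow> overlap N X (\<lambda>k. c * T k) = overlap N X T"
proof -
  assume c: "c > 0"
  have "(\<Sum>k<N. X k * (c * T k)) = c * (\<Sum>k<N. X k * T k)"
    by (simp add: sum_distrib_left algebra_simps)
  moreover have "L2_set (\<lambda>k. c * T k) {..<N} = c * L2_set T {..<N}"
    using c by (simp add: L2_set_def power_mult_distrib real_sqrt_mult flip: sum_distrib_left)
  ultimately show ?thesis using c by (simp add: overlap_def)
qed

lemma abs_overlap_le_1: "\<bar>overlap N X T\<bar> \<le> 1"
proof -
  have "\<bar>\<Sum>k<N. X k * T k\<bar> \<le> (\<Sum>k<N. \<bar>X k\<bar> * \<bar>T k\<bar>)"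
    by (metis (no_types, lifting) abs_mult sum.cong sum_abs)
  also have "\<dots> \<le> L2_set X {..<N} * L2_set T {..<N}" by (rule L2_set_mult_ineq)
  finally show ?thesis by (auto simp: overlap_def abs_mult divide_le_eq)
qed

text \<open>Change of measure to the null model, under which the estimate is independent of the labeling, and
  AM-GM with weight \<open>\<eta>\<close> between the squares of likelihood ratio and overlap.\<close>

lemma mean_overlap_le:
  fixes X :: "(nat \<Rightarrow> bool) \<Rightarrow> nat \<Rightarrow> real"
  defines "N \<equiv> real \<circ> sbm_dim"
  assumes n: "n > 0" "sbm_dim n > 0" and q: "q \<ge> 2" and d: "0 < d" "d < n" and lam: "0 \<le> lam" "lam \<le> 1"
    and range: "(1 + real q * lam) * (d / real n) \<le> 1" and eta: "\<eta> > 0"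
  shows "mean (labels n q) (\<lambda>s. mean (bits (sbm_dim n) (edge_prob n d lam q s)) (\<lambda>Y. overlap (sbm_dim n) (X Y) (omega_slot n q s)))
    \<le> 4 * real q / N n + (\<eta> * exp (3 / 2 * (lam\<^sup>2 * (d / n) / (1 - d / n)) * N n * real q) + 2 / (N n * \<eta>)) / 2"
proof -
  let ?N = "sbm_dim n" and ?U = "labels n q" and ?p = "d / real n"
  let ?Q = "bits ?N (\<lambda>_. ?p)"
  let ?E = "exp (3 / 2 * (lam\<^sup>2 * ?p / (1 - ?p)) * N n * real q)"
  have q0: "q > 0" using q by simp
  note fin = finite_set_labels[OF q0, of n]
  have p: "0 < ?p" "?p < 1" using d n by auto
  have finQ: "finite (set_pmf (bits ?N r))" for r by simp
  have ep: "0 \<le> edge_prob n d lam q s k \<and> edge_prob n d lam q s k \<le> 1" for s k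
    using edge_prob_range[of n d lam q s k] n d lam range by simp
  define L where "L s Y = (\<Prod>k<?N. if Y k then edge_prob n d lam q s k / ?p else (1 - edge_prob n d lam q s k) / (1 - ?p))" for s Y
  define o' where "o' s Y = overlap ?N (X Y) (omega_slot n q s)" for s Y
  have o1: "\<bar>o' s Y\<bar> \<le> 1" for s Y by (simp add: o'_def abs_overlap_le_1)
  have L2: "mean ?Q (\<lambda>Y. (L s Y)\<^sup>2) \<le> ?E" if "typical n q s" for s
  proof -
    have "mean ?Q (\<lambda>Y. (L s Y)\<^sup>2) \<le> exp (\<Sum>k<?N. (edge_prob n d lam q s k - ?p)\<^sup>2 / (?p * (1 - ?p)))"
      unfolding L_def by (rule mean_likelihood_sq[OF p])
    also have "(\<Sum>k<?N. (edge_prob n d lam q s k - ?p)\<^sup>2 / (?p * (1 - ?p))) = (lam\<^sup>2 * ?p / (1 - ?p)) * (\<Sum>k<?N. (omega_slot n q s k)\<^sup>2)"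
    proof -
      have "(edge_prob n d lam q s k - ?p)\<^sup>2 / (?p * (1 - ?p)) = (lam\<^sup>2 * ?p / (1 - ?p)) * (omega_slot n q s k)\<^sup>2" for k
      proof -
        have "edge_prob n d lam q s k - ?p = ?p * (lam * omega_slot n q s k)"
          by (simp add: edge_prob_omega distrib_left)
        then show ?thesis using p by (simp only: power_mult_distrib) (simp add: power2_eq_square)
      qed
      then show ?thesis by (simp only: sum_distrib_left)
    qed
    also have "\<dots> \<le> (lam\<^sup>2 * ?p / (1 - ?p)) * (3 / 2 * real ?N * real q)"
      using p d by (intro mult_left_mono typical_bounds q that divide_nonneg_nonneg mult_nonneg_nonneg) auto
    finally show ?thesis by (simp add: N_def mult_ac)
  qed
  have "mean ?U (\<lambda>s. mean (bits ?N (edge_prob n d lam q s)) (\<lambda>Y. o' s Y))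
    \<le> mean ?U (\<lambda>s. of_bool (\<not> typical n q s) + (\<eta> * ?E + mean ?Q (\<lambda>Y. of_bool (typical n q s) * (o' s Y)\<^sup>2) / \<eta>) / 2)"
  proof (intro mean_mono fin)
    fix s
    show "mean (bits ?N (edge_prob n d lam q s)) (\<lambda>Y. o' s Y)
      \<le> of_bool (\<not> typical n q s) + (\<eta> * ?E + mean ?Q (\<lambda>Y. of_bool (typical n q s) * (o' s Y)\<^sup>2) / \<eta>) / 2"
    proof (cases "typical n q s")
      case False
      have "mean (bits ?N (edge_prob n d lam q s)) (\<lambda>Y. o' s Y) \<le> 1"
        using o1 by (intro mean_le_const finQ) (simp add: abs_le_iff)
      moreover have "0 \<le> \<eta> * ?E" using eta by simp
      ultimately show ?thesis using False by simp
    next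
      case True
      have "mean (bits ?N (edge_prob n d lam q s)) (\<lambda>Y. o' s Y) = mean ?Q (\<lambda>Y. L s Y * o' s Y)"
        unfolding L_def by (rule mean_change_measure[OF p ep])
      also have "\<dots> \<le> mean ?Q (\<lambda>Y. \<eta> / 2 * (L s Y)\<^sup>2 + 1 / (2 * \<eta>) * (o' s Y)\<^sup>2)"
      proof (intro mean_mono finQ)
        fix Y
        have "0 \<le> (\<eta> * L s Y - o' s Y)\<^sup>2 / (2 * \<eta>)" using eta by simp
        then show "L s Y * o' s Y \<le> \<eta> / 2 * (L s Y)\<^sup>2 + 1 / (2 * \<eta>) * (o' s Y)\<^sup>2"
          using eta by (simp add: power2_eq_square field_simps)
      qed
      also have "\<dots> = \<eta> / 2 * mean ?Q (\<lambda>Y. (L s Y)\<^sup>2) + 1 / (2 * \<eta>) * mean ?Q (\<lambda>Y. (o' s Y)\<^sup>2)"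
        by (simp only: mean_add[OF finQ] integral_mult_right_zero)
      also have "\<dots> \<le> \<eta> / 2 * ?E + 1 / (2 * \<eta>) * mean ?Q (\<lambda>Y. (o' s Y)\<^sup>2)"
        using eta L2[OF True] by (intro add_right_mono mult_left_mono) auto
      finally show ?thesis using True by (simp add: add_divide_distrib mult.commute)
    qed
  qed
  also have "\<dots> = mean ?U (\<lambda>s. of_bool (\<not> typical n q s)) + (\<eta> * ?E + mean ?U (\<lambda>s. mean ?Q (\<lambda>Y. of_bool (typical n q s) * (o' s Y)\<^sup>2)) / \<eta>) / 2"
    by (simp add: mean_add[OF fin])
  finally have total: "mean ?U (\<lambda>s. mean (bits ?N (edge_prob n d lam q s)) (\<lambda>Y. o' s Y))
    \<le> mean ?U (\<lambda>s. of_bool (\<not> typical n q s)) + (\<eta> * ?E + mean ?U (\<lambda>s. mean ?Q (\<lambda>Y. of_bool (typical n q s) * (o' s Y)\<^sup>2)) / \<eta>) / 2" .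
  \<comment> \<open>After exchanging the means the estimate is a fixed vector X. Its linear form in
    \<open>omega_slot\<close> has second moment q - 1 times the squared norm of X, while a typical
    target has squared norm at least N q / 2.\<close>
  have "mean ?U (\<lambda>s. mean ?Q (\<lambda>Y. of_bool (typical n q s) * (o' s Y)\<^sup>2)) \<le> 2 / N n"
  proof -
    have "mean ?U (\<lambda>s. mean ?Q (\<lambda>Y. of_bool (typical n q s) * (o' s Y)\<^sup>2))
       = mean ?Q (\<lambda>Y. mean ?U (\<lambda>s. of_bool (typical n q s) * (o' s Y)\<^sup>2))"
      by (rule mean_swap[OF fin finQ])
    also have "\<dots> \<le> 2 / N n"
    proof (rule mean_le_const[OF finQ])
      fix Y
      let ?x = "\<Sum>k<?N. (X Y k)\<^sup>2"
      have x0: "?x \<ge> 0" by (intro sum_nonneg) auto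
      have "mean ?U (\<lambda>s. of_bool (typical n q s) * (o' s Y)\<^sup>2)
         \<le> mean ?U (\<lambda>s. 2 / (N n * real q * ?x) * (\<Sum>k<?N. X Y k * omega_slot n q s k)\<^sup>2)"
      proof (intro mean_mono fin)
        fix s
        show "of_bool (typical n q s) * (o' s Y)\<^sup>2 \<le> 2 / (N n * real q * ?x) * (\<Sum>k<?N. X Y k * omega_slot n q s k)\<^sup>2"
        proof (cases "typical n q s")
          case True
          have w: "N n * real q / 2 \<le> (\<Sum>k<?N. (omega_slot n q s k)\<^sup>2)"
            using typical_bounds(1)[OF q True] by (simp add: N_def)
          have "(o' s Y)\<^sup>2 = (\<Sum>k<?N. X Y k * omega_slot n q s k)\<^sup>2 / (?x * (\<Sum>k<?N. (omega_slot n q s k)\<^sup>2))"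
            by (simp add: o'_def overlap_def L2_set_def power_divide power_mult_distrib sum_nonneg)
          also have "\<dots> \<le> (\<Sum>k<?N. X Y k * omega_slot n q s k)\<^sup>2 / (?x * (N n * real q / 2))"
          proof (cases "?x = 0")
            case False
            then show ?thesis using x0 w n q
              by (intro divide_left_mono mult_left_mono mult_pos_pos) (auto simp: N_def intro: less_le_trans[OF _ w])
          qed simp
          finally show ?thesis using True by (simp add: mult_ac)
        next
          case False
          then show ?thesis using x0 by (simp add: N_def)
        qed
      qed
      also have "\<dots> = 2 / (N n * real q * ?x) * ((real q - 1) * ?x)"
        by (simp only: integral_mult_right_zero mean_linear_omega_sq[OF q0])
      also have "\<dots> \<le> 2 / N n"
      proof (cases "?x = 0")
        case False
        then show ?thesis using n q by (simp add: N_def divide_simps)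
      qed (simp add: N_def)
      finally show "mean ?U (\<lambda>s. of_bool (typical n q s) * (o' s Y)\<^sup>2) \<le> 2 / N n" .
    qed
    finally show ?thesis .
  qed
  then have bad: "mean ?U (\<lambda>s. mean ?Q (\<lambda>Y. of_bool (typical n q s) * (o' s Y)\<^sup>2)) / \<eta> \<le> 2 / (N n * \<eta>)"
    using eta divide_right_mono[of _ "2 / N n" \<eta>] by fastforce
  have atyp: "mean ?U (\<lambda>s. of_bool (\<not> typical n q s)) \<le> 4 * real q / N n"
    using mean_not_typical[OF q0 n(2)] by (simp add: N_def)
  have "mean ?U (\<lambda>s. mean (bits ?N (edge_prob n d lam q s)) (\<lambda>Y. o' s Y))
      \<le> 4 * real q / N n + (\<eta> * ?E + 2 / (N n * \<eta>)) / 2"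
    by (rule order_trans[OF total], intro add_mono divide_right_mono add_left_mono bad atyp) simp
  then show ?thesis by (simp only: o'_def)
qed

section \<open>Concentration and thinning\<close>

lemma mean_const: "mean P (\<lambda>_. c) = c"
  by simp

text \<open>For x = - y with y \<ge> 0 the claim is 1 \<le> (1 - y + y^2) exp y, and the Taylor
  polynomial 1 + y + y^2 / 2 in place of exp y already makes the product at least 1.\<close>

lemma exp_le_quadratic:
  assumes "\<bar>x\<bar> \<le> (1::real)"
  shows "exp x \<le> 1 + x + x\<^sup>2"
proof (cases "x \<ge> 0")
  case True
  then show ?thesis using assms by (intro exp_bound) auto
next
  case False
  define y where "y = - x"
  have y: "0 \<le> y" using False by (simp add: y_def)
  have "1 + y + y\<^sup>2 / 2 \<le> exp y" by (rule exp_lower_Taylor_quadratic[OF y])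
  moreover have "1 \<le> (1 - y + y\<^sup>2) * (1 + y + y\<^sup>2 / 2)"
  proof -
    have "(1 - y + y\<^sup>2) * (1 + y + y\<^sup>2 / 2) = 1 + y\<^sup>2 / 2 + y ^ 3 / 2 + y ^ 4 / 2"
      by (simp add: field_simps power2_eq_square power3_eq_cube power4_eq_xxxx)
    then show ?thesis using y by simp
  qed
  moreover have "0 \<le> 1 - y + y\<^sup>2"
  proof -
    have "1 - y + y\<^sup>2 = (y - 1 / 2)\<^sup>2 + 3 / 4" by (simp add: power2_eq_square algebra_simps)
    then show ?thesis by simp
  qed
  ultimately have "1 \<le> (1 - y + y\<^sup>2) * exp y"
    by (meson mult_left_mono order_trans)
  then have "exp (- y) \<le> 1 - y + y\<^sup>2" by (simp add: exp_minus divide_inverse[symmetric] pos_divide_le_eq inverse_eq_divide)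
  then show ?thesis by (simp add: y_def)
qed

lemma bernoulli_mgf_le:
  assumes "0 \<le> p" "p \<le> 1" "\<bar>v\<bar> \<le> 1"
  shows "mean (bernoulli_pmf p) (\<lambda>y. exp (v * (of_bool y - p) - v\<^sup>2 * p)) \<le> 1"
proof -
  have "mean (bernoulli_pmf p) (\<lambda>y. exp (v * (of_bool y - p) - v\<^sup>2 * p)) = exp (- (v * p) - v\<^sup>2 * p) * (1 + p * (exp v - 1))"
    using assms by (simp add: mean_bernoulli algebra_simps exp_diff exp_add exp_minus divide_inverse)
  also have "\<dots> \<le> exp (- (v * p) - v\<^sup>2 * p) * exp (p * (exp v - 1))"
    by (intro mult_left_mono exp_ge_add_one_self) auto
  also have "\<dots> \<le> exp (- (v * p) - v\<^sup>2 * p) * exp (p * (v + v\<^sup>2))"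
    using exp_le_quadratic[OF assms(3)] assms by (intro mult_left_mono iffD2[OF exp_le_cancel_iff]) auto
  also have "\<dots> = 1" by (simp add: algebra_simps flip: exp_add)
  finally show ?thesis .
qed

text \<open>The coefficients v may depend on the slots outside B only, so given those the sum
  consists of independent terms. Slots of B are peeled off one at a time, each factor having
  conditional mean at most 1.\<close>

lemma mean_exp_martingale_le:
  assumes p: "\<And>k. k < N \<Longrightarrow> 0 \<le> p k \<and> p k \<le> 1" and B: "B \<subseteq> {..<N}"
    and inv: "\<And>b Y x. b \<in> B \<Longrightarrow> v (Y(b := x)) = v Y" and v: "\<And>Y k. \<bar>v Y k\<bar> \<le> 1"
  shows "mean (bits N p) (\<lambda>Y. exp (\<Sum>k\<in>B. v Y k * (of_bool (Y k) - p k) - (v Y k)\<^sup>2 * p k)) \<le> 1"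
proof -
  have fin: "finite (set_pmf (bits N p))" by simp
  let ?t = "\<lambda>Y k. v Y k * (of_bool (Y k) - p k) - (v Y k)\<^sup>2 * p k"
  have "finite B" using B finite_subset by blast
  have "C \<subseteq> B \<Longrightarrow> mean (bits N p) (\<lambda>Y. exp (\<Sum>k\<in>C. ?t Y k)) \<le> 1" if "finite C" for C
    using that
  proof (induction C rule: finite_induct)
    case (insert b C)
    then have b: "b < N" "b \<in> B" using B by auto
    have eq: "exp (\<Sum>k\<in>insert b C. ?t (Y(b := x)) k)
        = exp (\<Sum>k\<in>C. ?t Y k) * exp (v Y b * (of_bool x - p b) - (v Y b)\<^sup>2 * p b)" for Y x
    proof -
      have "(\<Sum>k\<in>C. ?t (Y(b := x)) k) = (\<Sum>k\<in>C. ?t Y k)"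
        using insert by (intro sum.cong refl) (auto simp: inv[OF b(2)])
      then show ?thesis
        using insert by (simp add: inv[OF b(2)] exp_add[symmetric] add.commute)
    qed
    have "mean (bits N p) (\<lambda>Y. exp (\<Sum>k\<in>insert b C. ?t Y k))
       = mean (bits N p) (\<lambda>Y. mean (bernoulli_pmf (p b)) (\<lambda>x. exp (\<Sum>k\<in>insert b C. ?t (Y(b := x)) k)))"
      using b by (intro mean_resample) auto
    also have "\<dots> = mean (bits N p) (\<lambda>Y. exp (\<Sum>k\<in>C. ?t Y k)
        * mean (bernoulli_pmf (p b)) (\<lambda>x. exp (v Y b * (of_bool x - p b) - (v Y b)\<^sup>2 * p b)))"
      by (simp only: eq integral_mult_right_zero)
    also have "\<dots> \<le> mean (bits N p) (\<lambda>Y. exp (\<Sum>k\<in>C. ?t Y k) * 1)"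
      using p b v by (intro mean_mono[OF fin] mult_left_mono bernoulli_mgf_le) auto
    also have "\<dots> \<le> 1" using insert by simp
    finally show ?case .
  qed simp
  then show ?thesis using \<open>finite B\<close> by blast
qed

text \<open>As v does not depend on the slots in B, the terms are centred and uncorrelated, and the
  conditional variance of a term is at most c times its squared coefficient.\<close>

lemma mean_sq_martingale_le:
  assumes p: "\<And>k. k < N \<Longrightarrow> 0 \<le> p k \<and> p k \<le> c" "c \<le> 1" and B: "B \<subseteq> {..<N}"
    and inv: "\<And>b Y x. b \<in> B \<Longrightarrow> v (Y(b := x)) = v Y" and v: "\<And>Y. (\<Sum>k\<in>B. (v Y k)\<^sup>2) \<le> 1"
    and c: "c \<ge> 0"
  shows "mean (bits N p) (\<lambda>Y. (\<Sum>k\<in>B. v Y k * (of_bool (Y k) - p k))\<^sup>2) \<le> c"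
proof -
  have fin: "finite (set_pmf (bits N p))" by simp
  let ?t = "\<lambda>Y k. v Y k * (of_bool (Y k) - p k)"
  have "finite B" using B finite_subset by blast
  have "C \<subseteq> B \<Longrightarrow> mean (bits N p) (\<lambda>Y. (\<Sum>k\<in>C. ?t Y k)\<^sup>2) \<le> mean (bits N p) (\<lambda>Y. \<Sum>k\<in>C. (v Y k)\<^sup>2 * c)"
    if "finite C" for C
    using that
  proof (induction C rule: finite_induct)
    case (insert b C)
    then have b: "b < N" "b \<in> B" using B by auto
    have eq: "(\<Sum>k\<in>insert b C. ?t (Y(b := x)) k) = (\<Sum>k\<in>C. ?t Y k) + v Y b * (of_bool x - p b)" for Y x
    proof -
      have "(\<Sum>k\<in>C. ?t (Y(b := x)) k) = (\<Sum>k\<in>C. ?t Y k)"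
        using insert by (intro sum.cong refl) (auto simp: inv[OF b(2)])
      then show ?thesis using insert by (simp add: inv[OF b(2)])
    qed
    have "mean (bits N p) (\<lambda>Y. (\<Sum>k\<in>insert b C. ?t Y k)\<^sup>2)
       = mean (bits N p) (\<lambda>Y. mean (bernoulli_pmf (p b)) (\<lambda>x. (\<Sum>k\<in>insert b C. ?t (Y(b := x)) k)\<^sup>2))"
      using b by (intro mean_resample) auto
    also have "\<dots> = mean (bits N p) (\<lambda>Y. (\<Sum>k\<in>C. ?t Y k)\<^sup>2 + (v Y b)\<^sup>2 * (p b * (1 - p b)))"
    proof (rule mean_cong)
      fix Y
      have pb: "0 \<le> p b" "p b \<le> 1" using p(1)[OF b(1)] p(2) by auto
      show "mean (bernoulli_pmf (p b)) (\<lambda>x. (\<Sum>k\<in>insert b C. ?t (Y(b := x)) k)\<^sup>2)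
         = (\<Sum>k\<in>C. ?t Y k)\<^sup>2 + (v Y b)\<^sup>2 * (p b * (1 - p b))"
        unfolding eq mean_bernoulli[OF pb] by (simp add: power2_eq_square algebra_simps)
    qed
    also have "\<dots> = mean (bits N p) (\<lambda>Y. (\<Sum>k\<in>C. ?t Y k)\<^sup>2) + mean (bits N p) (\<lambda>Y. (v Y b)\<^sup>2 * (p b * (1 - p b)))"
      by (rule mean_add[OF fin])
    also have "\<dots> \<le> mean (bits N p) (\<lambda>Y. \<Sum>k\<in>C. (v Y k)\<^sup>2 * c) + mean (bits N p) (\<lambda>Y. (v Y b)\<^sup>2 * c)"
    proof (rule add_mono)
      show "mean (bits N p) (\<lambda>Y. (\<Sum>k\<in>C. ?t Y k)\<^sup>2) \<le> mean (bits N p) (\<lambda>Y. \<Sum>k\<in>C. (v Y k)\<^sup>2 * c)"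
        using insert by simp
      have "p b * (1 - p b) \<le> c" using p(1)[OF b(1)] p(2) mult_left_mono[of "1 - p b" 1 "p b"] by auto
      then show "mean (bits N p) (\<lambda>Y. (v Y b)\<^sup>2 * (p b * (1 - p b))) \<le> mean (bits N p) (\<lambda>Y. (v Y b)\<^sup>2 * c)"
        by (intro mean_mono[OF fin] mult_left_mono) auto
    qed
    also have "\<dots> = mean (bits N p) (\<lambda>Y. \<Sum>k\<in>insert b C. (v Y k)\<^sup>2 * c)"
      using insert by (simp add: mean_add[OF fin] add.commute)
    finally show ?case .
  qed simp
  then have "mean (bits N p) (\<lambda>Y. (\<Sum>k\<in>B. ?t Y k)\<^sup>2) \<le> mean (bits N p) (\<lambda>Y. \<Sum>k\<in>B. (v Y k)\<^sup>2 * c)"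
    using \<open>finite B\<close> by blast
  also have "\<dots> \<le> c"
    using v c by (intro mean_le_const[OF fin]) (simp add: mult_left_le_one_le sum_nonneg flip: sum_distrib_right)
  finally show ?thesis .
qed

text \<open>A slot is occupied and visible with probability (1 - \<beta>) p', independently over the
  slots. Averaged over the mask, the visible part therefore has the law of the sparser
  model.\<close>

lemma mean_thinning:
  assumes "0 \<le> \<beta>" "\<beta> \<le> 1" "\<And>k. k < N \<Longrightarrow> 0 \<le> p' k \<and> p' k \<le> 1" "\<And>k. k < N \<Longrightarrow> p k = (1 - \<beta>) * p' k"
  shows "mean (bits N (\<lambda>_. \<beta>)) (\<lambda>B. mean (bits N p') (\<lambda>Y. G (\<lambda>k. Y k \<and> \<not> B k))) = mean (bits N p) G"
proof -
  have inner: "Pi_pmf {..<N} False (\<lambda>k. map_pmf (\<lambda>y. y \<and> \<not> B k) (bernoulli_pmf (p' k)))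
      = map_pmf (\<lambda>Y k. Y k \<and> \<not> B k) (bits N p')" for B :: "nat \<Rightarrow> bool"
  proof -
    have "Pi_pmf {..<N} False (\<lambda>k. map_pmf (\<lambda>y. y \<and> \<not> B k) (bernoulli_pmf (p' k)))
       = bind_pmf (bits N p') (\<lambda>Y. return_pmf (\<lambda>k. if k \<in> {..<N} then Y k \<and> \<not> B k else False))"
      unfolding map_pmf_def by (subst Pi_pmf_bind[where d' = False]) auto
    also have "\<dots> = bind_pmf (bits N p') (\<lambda>Y. return_pmf (\<lambda>k. Y k \<and> \<not> B k))"
    proof (rule bind_pmf_cong[OF refl], rule arg_cong[where f = return_pmf], rule ext)
      fix Y k assume "Y \<in> set_pmf (bits N p')"
      then have "Y k = False" if "k \<notin> {..<N}"
        using that set_Pi_pmf_subset[of "{..<N}" False "\<lambda>k. bernoulli_pmf (p' k)"] by auto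
      then show "(if k \<in> {..<N} then Y k \<and> \<not> B k else False) = (Y k \<and> \<not> B k)" by auto
    qed
    finally show ?thesis by (simp add: map_pmf_def)
  qed
  have one: "bind_pmf (bernoulli_pmf \<beta>) (\<lambda>b. map_pmf (\<lambda>y. y \<and> \<not> b) (bernoulli_pmf (p' k))) = bernoulli_pmf (p k)"
    if k: "k < N" for k
  proof (rule pmf_eqI)
    fix y
    have pk: "0 \<le> p k" "p k \<le> 1"
      using assms k mult_le_one[of "1 - \<beta>" "p' k"] by auto
    have m: "map_pmf (\<lambda>y. y \<and> \<not> b) (bernoulli_pmf (p' k)) = (if b then return_pmf False else bernoulli_pmf (p' k))" for b
      by (cases b) (simp_all add: map_pmf_const)
    have "pmf (bind_pmf (bernoulli_pmf \<beta>) (\<lambda>b. map_pmf (\<lambda>y. y \<and> \<not> b) (bernoulli_pmf (p' k)))) y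
      = \<beta> * pmf (return_pmf False) y + (1 - \<beta>) * pmf (bernoulli_pmf (p' k)) y"
      using assms by (simp add: m pmf_bind)
    also have "\<dots> = pmf (bernoulli_pmf (p k)) y"
      using pk assms(3)[OF k] assms(4)[OF k] by (cases y) (auto simp: algebra_simps)
    finally show "pmf (bind_pmf (bernoulli_pmf \<beta>) (\<lambda>b. map_pmf (\<lambda>y. y \<and> \<not> b) (bernoulli_pmf (p' k)))) y = pmf (bernoulli_pmf (p k)) y" .
  qed
  have "bits N p = Pi_pmf {..<N} False (\<lambda>k. bind_pmf (bernoulli_pmf \<beta>) (\<lambda>b. map_pmf (\<lambda>y. y \<and> \<not> b) (bernoulli_pmf (p' k))))"
    by (intro Pi_pmf_cong) (auto simp: one)
  also have "\<dots> = bind_pmf (bits N (\<lambda>_. \<beta>)) (\<lambda>B. map_pmf (\<lambda>Y k. Y k \<and> \<not> B k) (bits N p'))"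
    by (subst Pi_pmf_bind[where d' = False]) (simp_all add: inner)
  finally show ?thesis by (simp add: mean_bind)
qed

text \<open>A hidden slot always looks empty. Restricting to masks that hide e thus amounts to
  forcing T e = False in the sparser model; the density (1 - T e) / (1 - p e) expresses this while
  leaving the argument of G unchanged.\<close>

lemma mean_thinning_hidden:
  assumes "0 \<le> \<beta>" "\<beta> \<le> 1" "\<And>k. k < N \<Longrightarrow> 0 \<le> p' k \<and> p' k \<le> 1" "\<And>k. k < N \<Longrightarrow> p k = (1 - \<beta>) * p' k"
    and e: "e < N" "p e < 1"
  shows "mean (bits N (\<lambda>_. \<beta>)) (\<lambda>B. mean (bits N p') (\<lambda>Y. G (\<lambda>k. Y k \<and> \<not> B k) * of_bool (B e)))
    = \<beta> * mean (bits N p) (\<lambda>T. G T * ((1 - of_bool (T e)) / (1 - p e)))"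
proof -
  have pe: "0 \<le> p e" using assms e by simp
  have "mean (bits N (\<lambda>_. \<beta>)) (\<lambda>B. mean (bits N p') (\<lambda>Y. G (\<lambda>k. Y k \<and> \<not> B k) * of_bool (B e)))
     = mean (bits N (\<lambda>_. \<beta>)) (\<lambda>B. mean (bernoulli_pmf \<beta>) (\<lambda>x. mean (bits N p') (\<lambda>Y. G (\<lambda>k. Y k \<and> \<not> (B(e := x)) k) * of_bool ((B(e := x)) e))))"
    using e by (intro mean_resample) auto
  also have "\<dots> = mean (bits N (\<lambda>_. \<beta>)) (\<lambda>B. \<beta> * mean (bits N p') (\<lambda>Y. G ((\<lambda>k. Y k \<and> \<not> B k)(e := False))))"
  proof (rule mean_cong)
    fix B :: "nat \<Rightarrow> bool"
    have "(\<lambda>k. Y k \<and> \<not> (B(e := True)) k) = (\<lambda>k. Y k \<and> \<not> B k)(e := False)" for Y :: "nat \<Rightarrow> bool"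
      by auto
    then show "mean (bernoulli_pmf \<beta>) (\<lambda>x. mean (bits N p') (\<lambda>Y. G (\<lambda>k. Y k \<and> \<not> (B(e := x)) k) * of_bool ((B(e := x)) e)))
       = \<beta> * mean (bits N p') (\<lambda>Y. G ((\<lambda>k. Y k \<and> \<not> B k)(e := False)))"
      unfolding mean_bernoulli[OF assms(1,2)] by (simp del: fun_upd_apply) simp
  qed
  also have "\<dots> = \<beta> * mean (bits N p) (\<lambda>T. G (T(e := False)))"
    using mean_thinning[OF assms(1-4), where G = "\<lambda>T. G (T(e := False))"] by simp
  also have "mean (bits N p) (\<lambda>T. G (T(e := False))) = mean (bits N p) (\<lambda>T. G T * ((1 - of_bool (T e)) / (1 - p e)))"
  proof -
    have "mean (bits N p) (\<lambda>T. G T * ((1 - of_bool (T e)) / (1 - p e)))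
       = mean (bits N p) (\<lambda>T. mean (bernoulli_pmf (p e)) (\<lambda>x. G (T(e := x)) * ((1 - of_bool ((T(e := x)) e)) / (1 - p e))))"
      using e by (intro mean_resample) auto
    also have "\<dots> = mean (bits N p) (\<lambda>T. G (T(e := False)))"
      using e pe by (intro mean_cong) (simp add: mean_bernoulli)
    finally show ?thesis ..
  qed
  finally show ?thesis .
qed

text \<open>By \<open>mean_thinning_hidden\<close> each term acquires a density 1 - z, where z is
  centred with variance at most c / (1 - c), which is small because edges are rare. The main part is
  \<beta> times the full correlation. AM-GM with weight \<eta> splits the error between the squared
  norm of x, at most 1, and that of the vector of products \<theta> z.\<close>

lemma mean_hidden_correlation_ge:
  fixes x :: "(nat \<Rightarrow> bool) \<Rightarrow> nat \<Rightarrow> real" and \<theta> :: "nat \<Rightarrow> real"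
  assumes \<beta>: "0 \<le> \<beta>" "\<beta> \<le> 1" and p': "\<And>k. k < N \<Longrightarrow> 0 \<le> p' k \<and> p' k \<le> 1"
    and p: "\<And>k. k < N \<Longrightarrow> p k = (1 - \<beta>) * p' k" "\<And>k. k < N \<Longrightarrow> p k \<le> c" "c < 1" "0 \<le> c"
    and x: "\<And>T. (\<Sum>k<N. (x T k)\<^sup>2) \<le> 1" and \<theta>: "(\<Sum>k<N. (\<theta> k)\<^sup>2) \<le> 1" and eta: "\<eta> > 0"
  shows "\<beta> * (mean (bits N p) (\<lambda>T. \<Sum>k<N. x T k * \<theta> k) - \<eta> / 2 - c / (1 - c) / (2 * \<eta>))
    \<le> mean (bits N (\<lambda>_. \<beta>)) (\<lambda>B. mean (bits N p') (\<lambda>Y. \<Sum>k | k < N \<and> B k. x (\<lambda>k. Y k \<and> \<not> B k) k * \<theta> k))"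
proof -
  have fin: "finite (set_pmf (bits N r))" for r by simp
  have pk: "0 \<le> p k" "p k \<le> c" "p k < 1" if "k < N" for k
    using p(1,2)[OF that] p(3) p'[OF that] \<beta> by auto
  have rest: "(\<Sum>k | k < N \<and> B k. f k) = (\<Sum>k<N. f k * of_bool (B k))" for f :: "nat \<Rightarrow> real" and B
    by (simp add: of_bool_def if_distrib sum.If_cases Int_def cong: if_cong)
  have "mean (bits N (\<lambda>_. \<beta>)) (\<lambda>B. mean (bits N p') (\<lambda>Y. \<Sum>k | k < N \<and> B k. x (\<lambda>k. Y k \<and> \<not> B k) k * \<theta> k))
     = (\<Sum>k<N. mean (bits N (\<lambda>_. \<beta>)) (\<lambda>B. mean (bits N p') (\<lambda>Y. (x (\<lambda>k. Y k \<and> \<not> B k) k * \<theta> k) * of_bool (B k))))"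
    by (simp only: rest mean_sum[OF fin])
  also have "\<dots> = (\<Sum>k<N. \<beta> * mean (bits N p) (\<lambda>T. (x T k * \<theta> k) * ((1 - of_bool (T k)) / (1 - p k))))"
    using pk by (intro sum.cong refl mean_thinning_hidden[where G = "\<lambda>T. x T k * \<theta> k" for k] \<beta> p' p) auto
  also have "\<dots> = \<beta> * mean (bits N p) (\<lambda>T. \<Sum>k<N. (x T k * \<theta> k) * ((1 - of_bool (T k)) / (1 - p k)))"
    by (simp only: mean_sum[OF fin] sum_distrib_left)
  also have "\<dots> \<ge> \<beta> * (mean (bits N p) (\<lambda>T. \<Sum>k<N. x T k * \<theta> k) - \<eta> / 2 - c / (1 - c) / (2 * \<eta>))"
  proof (rule mult_left_mono[OF _ \<beta>(1)])
    let ?z = "\<lambda>T k. (of_bool (T k) - p k) / (1 - p k)"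
    have pt: "(\<Sum>k<N. x T k * \<theta> k) - \<eta> / 2 - 1 / (2 * \<eta>) * (\<Sum>k<N. (\<theta> k)\<^sup>2 * (?z T k)\<^sup>2)
       \<le> (\<Sum>k<N. (x T k * \<theta> k) * ((1 - of_bool (T k)) / (1 - p k)))" for T
    proof -
      have "(x T k * \<theta> k) * ((1 - of_bool (T k)) / (1 - p k)) \<ge> x T k * \<theta> k - (\<eta> / 2 * (x T k)\<^sup>2 + 1 / (2 * \<eta>) * ((\<theta> k)\<^sup>2 * (?z T k)\<^sup>2))"
        if "k < N" for k
      proof -
        define z where "z = ?z T k"
        have "(1 - of_bool (T k)) / (1 - p k) = 1 - z" using pk[OF that] by (simp add: z_def field_simps)
        then have "(x T k * \<theta> k) * ((1 - of_bool (T k)) / (1 - p k)) = x T k * \<theta> k - x T k * (\<theta> k * z)"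
          by (simp add: right_diff_distrib)
        moreover have "0 \<le> (\<eta> * x T k - \<theta> k * z)\<^sup>2 / (2 * \<eta>)" using eta by simp
        then have "x T k * (\<theta> k * z) \<le> \<eta> / 2 * (x T k)\<^sup>2 + 1 / (2 * \<eta>) * ((\<theta> k)\<^sup>2 * z\<^sup>2)"
          using eta by (simp add: power2_eq_square field_simps)
        ultimately show ?thesis unfolding z_def[symmetric] by linarith
      qed
      then have "(\<Sum>k<N. x T k * \<theta> k - (\<eta> / 2 * (x T k)\<^sup>2 + 1 / (2 * \<eta>) * ((\<theta> k)\<^sup>2 * (?z T k)\<^sup>2)))
         \<le> (\<Sum>k<N. (x T k * \<theta> k) * ((1 - of_bool (T k)) / (1 - p k)))"
        by (intro sum_mono) auto
      moreover have "(\<Sum>k<N. x T k * \<theta> k - (\<eta> / 2 * (x T k)\<^sup>2 + 1 / (2 * \<eta>) * ((\<theta> k)\<^sup>2 * (?z T k)\<^sup>2)))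
         = (\<Sum>k<N. x T k * \<theta> k) - (\<eta> / 2 * (\<Sum>k<N. (x T k)\<^sup>2) + 1 / (2 * \<eta>) * (\<Sum>k<N. (\<theta> k)\<^sup>2 * (?z T k)\<^sup>2))"
        by (simp only: sum_subtractf sum.distrib sum_distrib_left)
      moreover have "\<eta> / 2 * (\<Sum>k<N. (x T k)\<^sup>2) \<le> \<eta> / 2 * 1" using x eta by (intro mult_left_mono) auto
      ultimately show ?thesis by linarith
    qed
    have var: "mean (bits N p) (\<lambda>T. (?z T k)\<^sup>2) \<le> c / (1 - c)" if "k < N" for k
    proof -
      have "mean (bits N p) (\<lambda>T. (?z T k)\<^sup>2) = mean (bernoulli_pmf (p k)) (\<lambda>y. ((of_bool y - p k) / (1 - p k))\<^sup>2)"
        using that by (intro mean_Pi_component) auto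
      also have "\<dots> = p k / (1 - p k)"
      proof -
        have "1 - p k \<noteq> 0" using pk[OF that] by simp
        then have "p k * ((1 - p k) / (1 - p k))\<^sup>2 + (1 - p k) * ((0 - p k) / (1 - p k))\<^sup>2 = p k + (p k)\<^sup>2 / (1 - p k)"
          by (simp add: power2_eq_square)
        also have "\<dots> = p k / (1 - p k)"
          using pk[OF that] by (simp add: field_simps power2_eq_square)
        finally show ?thesis using pk[OF that] by (simp add: mean_bernoulli mult.commute)
      qed
      also have "\<dots> \<le> c / (1 - c)" using pk[OF that] p(3) by (intro frac_le) auto
      finally show ?thesis .
    qed
    have "mean (bits N p) (\<lambda>T. \<Sum>k<N. (\<theta> k)\<^sup>2 * (?z T k)\<^sup>2) \<le> (\<Sum>k<N. (\<theta> k)\<^sup>2 * (c / (1 - c)))"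
      unfolding mean_sum[OF fin] integral_mult_right_zero using var by (intro sum_mono mult_left_mono) auto
    also have "\<dots> \<le> c / (1 - c)"
      unfolding sum_distrib_right[symmetric] using \<theta> p(3,4) by (intro mult_left_le_one_le sum_nonneg) auto
    finally have "1 / (2 * \<eta>) * mean (bits N p) (\<lambda>T. \<Sum>k<N. (\<theta> k)\<^sup>2 * (?z T k)\<^sup>2) \<le> 1 / (2 * \<eta>) * (c / (1 - c))"
      using eta by (intro mult_left_mono) auto
    moreover have "mean (bits N p) (\<lambda>T. (\<Sum>k<N. x T k * \<theta> k) - \<eta> / 2 - 1 / (2 * \<eta>) * (\<Sum>k<N. (\<theta> k)\<^sup>2 * (?z T k)\<^sup>2))
       \<le> mean (bits N p) (\<lambda>T. \<Sum>k<N. (x T k * \<theta> k) * ((1 - of_bool (T k)) / (1 - p k)))"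
      by (intro mean_mono[OF fin] pt)
    moreover have "mean (bits N p) (\<lambda>T. (\<Sum>k<N. x T k * \<theta> k) - \<eta> / 2 - 1 / (2 * \<eta>) * (\<Sum>k<N. (\<theta> k)\<^sup>2 * (?z T k)\<^sup>2))
       = mean (bits N p) (\<lambda>T. \<Sum>k<N. x T k * \<theta> k) - \<eta> / 2 - 1 / (2 * \<eta>) * mean (bits N p) (\<lambda>T. \<Sum>k<N. (\<theta> k)\<^sup>2 * (?z T k)\<^sup>2)"
      by (simp only: mean_diff[OF fin] integral_mult_right_zero mean_const)
    moreover have "1 / (2 * \<eta>) * (c / (1 - c)) = c / (1 - c) / (2 * \<eta>)" by simp
    ultimately show "mean (bits N p) (\<lambda>T. \<Sum>k<N. x T k * \<theta> k) - \<eta> / 2 - c / (1 - c) / (2 * \<eta>)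
       \<le> mean (bits N p) (\<lambda>T. \<Sum>k<N. (x T k * \<theta> k) * ((1 - of_bool (T k)) / (1 - p k)))"
      by linarith
  qed
  finally show ?thesis .
qed

section \<open>Testing with a quantised estimate\<close>

definition level_count :: "nat \<Rightarrow> (nat \<Rightarrow> nat) \<Rightarrow> nat \<Rightarrow> nat" where
  "level_count N m j = card {k. k < N \<and> 2 ^ j \<le> m k}"

definition level :: "nat \<Rightarrow> nat \<Rightarrow> (nat \<Rightarrow> nat) \<Rightarrow> nat \<Rightarrow> bool" where
  "level N K m j \<longleftrightarrow> K \<le> level_count N m j \<and> level_count N m (Suc j) < K"

text \<open>A circuit can only track sums of polynomially many values, whereas the entries of an estimate are
  exponentially large. They are rounded to \<open>b\<close> bits at the dyadic level \<open>2\<^sup>j\<close> of the \<open>K\<close>-th largest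
  magnitude; the fewer than \<open>K\<close> larger entries are dropped, which costs little since no slot
  carries a large share of the target.\<close>

definition quant :: "nat \<Rightarrow> (nat \<Rightarrow> nat) \<Rightarrow> (nat \<Rightarrow> bool) \<Rightarrow> nat \<Rightarrow> nat \<Rightarrow> int" where
  "quant b m sg j k = (if m k < 2 ^ Suc j then (if sg k then - 1 else 1) * int (2 ^ b * m k div 2 ^ j) else 0)"

text \<open>The extra term under the root keeps every normalised entry below 2 / sqrt K, since
  quantised entries are at most 2^(b + 1) in size. This allows multipliers of order sqrt K in the
  Chernoff bound.\<close>

definition scale :: "nat \<Rightarrow> nat \<Rightarrow> nat \<Rightarrow> (nat \<Rightarrow> nat) \<Rightarrow> (nat \<Rightarrow> bool) \<Rightarrow> nat \<Rightarrow> real" where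
  "scale N K b m sg j = sqrt ((\<Sum>k<N. (real_of_int (quant b m sg j k))\<^sup>2) + real K * 4 ^ b)"

text \<open>The quantifier selects the level of the estimate, which is unique if it exists; without
  a level the test rejects.\<close>

definition accepts ::
  "nat \<Rightarrow> nat \<Rightarrow> nat \<Rightarrow> nat set \<Rightarrow> real \<Rightarrow> real \<Rightarrow> nat \<Rightarrow> (nat \<Rightarrow> nat) \<Rightarrow> (nat \<Rightarrow> bool) \<Rightarrow> (nat \<Rightarrow> bool) \<Rightarrow> bool" where
  "accepts N K b B p \<tau> w m sg y \<longleftrightarrow> (\<exists>j<w. level N K m j \<and>
     \<tau> * scale N K b m sg j \<le> (\<Sum>k\<in>B. real_of_int (quant b m sg j k) * (of_bool (y k) - p)))"

lemma level_count_antimono: "i \<le> j \<Longrightarrow> level_count N m j \<le> level_count N m i"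
  unfolding level_count_def
  by (intro card_mono) (auto intro: order_trans[OF power_increasing])

lemma level_unique:
  assumes "level N K m i" "level N K m j"
  shows "i = j"
proof (rule ccontr)
  have False if "level N K m i" "level N K m j" "i < j" for i j
    using level_count_antimono[of "Suc i" j N m] that by (auto simp: level_def)
  moreover assume "i \<noteq> j"
  ultimately show False using assms by (metis linorder_neqE_nat)
qed

lemma abs_quant_le: "\<bar>real_of_int (quant b m sg j k)\<bar> \<le> 2 ^ Suc b"
proof (cases "m k < 2 ^ Suc j")
  case True
  then have "2 ^ b * m k < 2 ^ Suc b * 2 ^ j" by simp
  then have "2 ^ b * m k div 2 ^ j < 2 ^ Suc b"
    by (metis less_mult_imp_div_less)
  then have "real (2 ^ b * m k div 2 ^ j) < real (2 ^ Suc b)" by (simp only: of_nat_less_iff)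
  then show ?thesis by (auto simp: quant_def abs_mult)
qed (simp add: quant_def)

lemma scale_ge: "sqrt (real K) * 2 ^ b \<le> scale N K b m sg j"
proof -
  have "sqrt (real K) * 2 ^ b = sqrt (real K * 4 ^ b)"
  proof -
    have "((2::real) ^ b)\<^sup>2 = 4 ^ b" by (simp add: power2_eq_square flip: power_mult_distrib)
    then have "sqrt (4 ^ b) = (2::real) ^ b" by (rule real_sqrt_unique) simp
    then show ?thesis by (simp add: real_sqrt_mult)
  qed
  also have "\<dots> \<le> scale N K b m sg j"
    unfolding scale_def by (intro real_sqrt_le_mono) (simp add: sum_nonneg)
  finally show ?thesis .
qed

lemma scale_pos: "K > 0 \<Longrightarrow> scale N K b m sg j > 0"
  unfolding scale_def by (intro iffD2[OF real_sqrt_gt_0_iff] add_nonneg_pos sum_nonneg) auto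

lemma sum_quant_sq_le:
  "(\<Sum>k<N. (real_of_int (quant b m sg j k))\<^sup>2) \<le> (scale N K b m sg j)\<^sup>2"
  unfolding scale_def by (subst real_sqrt_pow2) (auto intro!: add_nonneg_nonneg sum_nonneg)

text \<open>A fixed multiple \<open>u\<close> of the normalised quantised estimate serves as exponent in the Chernoff bound.\<close>

lemma mean_accepts_null_le:
  assumes p: "0 \<le> p" "p \<le> 1" and B: "B \<subseteq> {..<N}" and K: "K > 0"
    and inv: "\<And>c Y x. c \<in> B \<Longrightarrow> m (Y(c := x)) = m Y" "\<And>c Y x. c \<in> B \<Longrightarrow> sg (Y(c := x)) = sg Y"
    and u: "0 \<le> u" "2 * u \<le> sqrt (real K)"
  shows "mean (bits N (\<lambda>_. p)) (\<lambda>Y. of_bool (accepts N K b B p \<tau> w (m Y) (sg Y) Y)) \<le> exp (- (u * \<tau>) + u\<^sup>2 * p)"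
proof -
  have fin: "finite (set_pmf (bits N r))" for r by simp
  \<comment> \<open>The exponential bound needs coefficients for every Y. Where no level exists the
    choice is arbitrary, as the test rejects there.\<close>
  define J where "J Y = (SOME j. level N K (m Y) j)" for Y
  have J: "J Y = j" if "level N K (m Y) j" for Y j
    unfolding J_def using that by (rule some_equality) (metis level_unique that)
  define v where "v Y k = u / scale N K b (m Y) (sg Y) (J Y) * real_of_int (quant b (m Y) (sg Y) (J Y) k)" for Y k
  have vinv: "v (Y(c := x)) = v Y" if "c \<in> B" for c Y x
    by (rule ext) (simp add: v_def J_def inv[OF that])
  have vle: "\<bar>v Y k\<bar> \<le> 1" for Y k
  proof -
    have pos: "scale N K b (m Y) (sg Y) (J Y) > 0" by (rule scale_pos[OF K])
    have "u * \<bar>real_of_int (quant b (m Y) (sg Y) (J Y) k)\<bar> \<le> u * 2 ^ Suc b"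
      by (intro mult_left_mono abs_quant_le u)
    also have "\<dots> = (2 * u) * 2 ^ b" by simp
    also have "\<dots> \<le> sqrt (real K) * 2 ^ b" using u by (intro mult_right_mono) auto
    also have "\<dots> \<le> scale N K b (m Y) (sg Y) (J Y)" by (rule scale_ge)
    finally show ?thesis using pos u by (simp add: v_def abs_mult divide_le_eq)
  qed
  have "mean (bits N (\<lambda>_. p)) (\<lambda>Y. of_bool (accepts N K b B p \<tau> w (m Y) (sg Y) Y))
     \<le> mean (bits N (\<lambda>_. p)) (\<lambda>Y. exp (- (u * \<tau>) + u\<^sup>2 * p) * exp (\<Sum>k\<in>B. v Y k * (of_bool (Y k) - p) - (v Y k)\<^sup>2 * p))"
  proof (intro mean_mono fin)
    fix Y
    show "of_bool (accepts N K b B p \<tau> w (m Y) (sg Y) Y)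
      \<le> exp (- (u * \<tau>) + u\<^sup>2 * p) * exp (\<Sum>k\<in>B. v Y k * (of_bool (Y k) - p) - (v Y k)\<^sup>2 * p)"
    proof (cases "accepts N K b B p \<tau> w (m Y) (sg Y) Y")
      case True
      then obtain j where j: "level N K (m Y) j"
        "\<tau> * scale N K b (m Y) (sg Y) j \<le> (\<Sum>k\<in>B. real_of_int (quant b (m Y) (sg Y) j k) * (of_bool (Y k) - p))"
        by (auto simp: accepts_def)
      let ?R = "scale N K b (m Y) (sg Y) j"
      have R: "?R > 0" by (rule scale_pos[OF K])
      have v: "v Y k = u / ?R * real_of_int (quant b (m Y) (sg Y) j k)" for k
        by (simp add: v_def J[OF j(1)])
      have "u * \<tau> = u / ?R * (\<tau> * ?R)" using R by simp
      also have "\<dots> \<le> u / ?R * (\<Sum>k\<in>B. real_of_int (quant b (m Y) (sg Y) j k) * (of_bool (Y k) - p))"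
        using j(2) u R by (intro mult_left_mono) auto
      also have "\<dots> = (\<Sum>k\<in>B. v Y k * (of_bool (Y k) - p))" by (simp add: v sum_distrib_left mult.assoc)
      finally have lin: "u * \<tau> \<le> (\<Sum>k\<in>B. v Y k * (of_bool (Y k) - p))" .
      have "(\<Sum>k\<in>B. (v Y k)\<^sup>2) \<le> (\<Sum>k<N. (v Y k)\<^sup>2)"
        using B by (intro sum_mono2) auto
      also have "\<dots> = (u / ?R)\<^sup>2 * (\<Sum>k<N. (real_of_int (quant b (m Y) (sg Y) j k))\<^sup>2)"
        by (simp add: v power_mult_distrib sum_distrib_left power_divide)
      also have "\<dots> \<le> (u / ?R)\<^sup>2 * ?R\<^sup>2" by (intro mult_left_mono sum_quant_sq_le) auto
      also have "\<dots> = u\<^sup>2" using R by (simp add: power_divide)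
      finally have "(\<Sum>k\<in>B. (v Y k)\<^sup>2 * p) \<le> u\<^sup>2 * p"
        unfolding sum_distrib_right[symmetric] using p by (intro mult_right_mono)
      then have "0 \<le> (- (u * \<tau>) + u\<^sup>2 * p) + (\<Sum>k\<in>B. v Y k * (of_bool (Y k) - p) - (v Y k)\<^sup>2 * p)"
        using lin by (simp add: sum_subtractf)
      then show ?thesis using True by (simp flip: exp_add)
    qed simp
  qed
  also have "\<dots> = exp (- (u * \<tau>) + u\<^sup>2 * p) * mean (bits N (\<lambda>_. p)) (\<lambda>Y. exp (\<Sum>k\<in>B. v Y k * (of_bool (Y k) - p) - (v Y k)\<^sup>2 * p))"
    by simp
  also have "\<dots> \<le> exp (- (u * \<tau>) + u\<^sup>2 * p) * 1"
    using p by (intro mult_left_mono mean_exp_martingale_le[OF _ B vinv vle]) auto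
  finally show ?thesis by simp
qed

text \<open>The condition of \<open>accepts\<close> with the centred bits replaced by the target,
  that is, by their planted mean up to a factor \<gamma>.\<close>

definition signal :: "nat \<Rightarrow> nat \<Rightarrow> nat \<Rightarrow> nat set \<Rightarrow> (nat \<Rightarrow> real) \<Rightarrow> real \<Rightarrow> nat \<Rightarrow> (nat \<Rightarrow> nat) \<Rightarrow> (nat \<Rightarrow> bool) \<Rightarrow> bool" where
  "signal N K b B \<omega> \<mu> w m sg \<longleftrightarrow> (\<exists>j<w. level N K m j \<and>
     \<mu> * scale N K b m sg j \<le> (\<Sum>k\<in>B. real_of_int (quant b m sg j k) * \<omega> k))"

text \<open>On \<open>signal\<close> the planted mean of the statistic over the hidden slots is at
  least 2 \<tau> times the scale, so a rejection requires a fluctuation of \<tau> times the scale.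
  By Chebyshev's inequality this has probability at most c / \<tau>^2.\<close>

lemma mean_accepts_planted_ge:
  assumes r: "\<And>k. k < N \<Longrightarrow> 0 \<le> r k \<and> r k \<le> c" "c \<le> 1" "0 \<le> c"
    and B: "B \<subseteq> {..<N}" and K: "K > 0"
    and inv: "\<And>c Y x. c \<in> B \<Longrightarrow> m (Y(c := x)) = m Y" "\<And>c Y x. c \<in> B \<Longrightarrow> sg (Y(c := x)) = sg Y"
    and \<omega>: "\<And>k. k < N \<Longrightarrow> r k - p = \<gamma> * \<omega> k" "\<gamma> \<ge> 0" and \<tau>: "\<tau> > 0" "2 * \<tau> \<le> \<gamma> * \<mu>"
  shows "mean (bits N r) (\<lambda>Y. of_bool (signal N K b B \<omega> \<mu> w (m Y) (sg Y))) - c / \<tau>\<^sup>2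
    \<le> mean (bits N r) (\<lambda>Y. of_bool (accepts N K b B p \<tau> w (m Y) (sg Y) Y))"
proof -
  have fin: "finite (set_pmf (bits N r))" for r by simp
  define J where "J Y = (SOME j. level N K (m Y) j)" for Y
  have J: "J Y = j" if "level N K (m Y) j" for Y j
    unfolding J_def using that by (rule some_equality) (metis level_unique that)
  define v where "v Y k = real_of_int (quant b (m Y) (sg Y) (J Y) k) / scale N K b (m Y) (sg Y) (J Y)" for Y k
  have vinv: "v (Y(c := x)) = v Y" if "c \<in> B" for c Y x
    by (rule ext) (simp add: v_def J_def inv[OF that])
  have vle: "(\<Sum>k\<in>B. (v Y k)\<^sup>2) \<le> 1" for Y
  proof -
    let ?R = "scale N K b (m Y) (sg Y) (J Y)"
    have R: "?R > 0" by (rule scale_pos[OF K])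
    have "(\<Sum>k\<in>B. (v Y k)\<^sup>2) \<le> (\<Sum>k<N. (v Y k)\<^sup>2)" using B by (intro sum_mono2) auto
    also have "\<dots> = (\<Sum>k<N. (real_of_int (quant b (m Y) (sg Y) (J Y) k))\<^sup>2) / ?R\<^sup>2"
      by (simp add: v_def power_divide sum_divide_distrib)
    also have "\<dots> \<le> 1" using R sum_quant_sq_le by simp
    finally show ?thesis .
  qed
  let ?T = "\<lambda>Y. \<Sum>k\<in>B. v Y k * (of_bool (Y k) - r k)"
  have "mean (bits N r) (\<lambda>Y. of_bool (signal N K b B \<omega> \<mu> w (m Y) (sg Y)))
     \<le> mean (bits N r) (\<lambda>Y. of_bool (accepts N K b B p \<tau> w (m Y) (sg Y) Y) + (?T Y)\<^sup>2 / \<tau>\<^sup>2)"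
  proof (intro mean_mono fin)
    fix Y
    show "of_bool (signal N K b B \<omega> \<mu> w (m Y) (sg Y)) \<le> of_bool (accepts N K b B p \<tau> w (m Y) (sg Y) Y) + (?T Y)\<^sup>2 / \<tau>\<^sup>2"
    proof (cases "signal N K b B \<omega> \<mu> w (m Y) (sg Y) \<and> \<not> accepts N K b B p \<tau> w (m Y) (sg Y) Y")
      case True
      then obtain j where j: "j < w" "level N K (m Y) j"
        "\<mu> * scale N K b (m Y) (sg Y) j \<le> (\<Sum>k\<in>B. real_of_int (quant b (m Y) (sg Y) j k) * \<omega> k)"
        by (auto simp: signal_def)
      let ?R = "scale N K b (m Y) (sg Y) j" and ?q = "\<lambda>k. real_of_int (quant b (m Y) (sg Y) j k)"
      have R: "?R > 0" by (rule scale_pos[OF K])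
      have na: "(\<Sum>k\<in>B. ?q k * (of_bool (Y k) - p)) < \<tau> * ?R"
        using True j by (auto simp: accepts_def not_le)
      have "(\<Sum>k\<in>B. ?q k * (of_bool (Y k) - p)) = (\<Sum>k\<in>B. ?q k * (of_bool (Y k) - r k) + \<gamma> * (?q k * \<omega> k))"
      proof (intro sum.cong refl)
        fix k assume "k \<in> B"
        then have "r k - p = \<gamma> * \<omega> k" using \<omega>(1)[of k] B by auto
        then have "of_bool (Y k) - p = (of_bool (Y k) - r k) + \<gamma> * \<omega> k" by linarith
        then show "?q k * (of_bool (Y k) - p) = ?q k * (of_bool (Y k) - r k) + \<gamma> * (?q k * \<omega> k)"
          by (simp only: distrib_left mult.left_commute)
      qed
      also have "\<dots> = (\<Sum>k\<in>B. ?q k * (of_bool (Y k) - r k)) + \<gamma> * (\<Sum>k\<in>B. ?q k * \<omega> k)"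
        by (simp add: sum.distrib sum_distrib_left)
      finally have "(\<Sum>k\<in>B. ?q k * (of_bool (Y k) - r k)) + \<gamma> * (\<Sum>k\<in>B. ?q k * \<omega> k) < \<tau> * ?R"
        using na by simp
      moreover have "(\<gamma> * \<mu>) * ?R \<le> \<gamma> * (\<Sum>k\<in>B. ?q k * \<omega> k)"
        using mult_left_mono[OF j(3) \<omega>(2)] by (simp add: mult.assoc)
      moreover have "(2 * \<tau>) * ?R \<le> (\<gamma> * \<mu>) * ?R" using \<tau>(2) R by (intro mult_right_mono) auto
      ultimately have "(\<Sum>k\<in>B. ?q k * (of_bool (Y k) - r k)) < - (\<tau> * ?R)" by simp
      moreover have "(\<Sum>k\<in>B. ?q k * (of_bool (Y k) - r k)) = ?T Y * ?R"
        using R by (simp add: v_def J[OF j(2)] sum_distrib_right)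
      ultimately have "?T Y * ?R < (- \<tau>) * ?R" by simp
      then have "?T Y < - \<tau>" using R by (simp only: mult_less_cancel_right_pos)
      then have "\<tau> \<le> \<bar>?T Y\<bar>" by linarith
      then have "\<tau>\<^sup>2 \<le> (?T Y)\<^sup>2" using \<tau>(1) by (metis abs_le_square_iff abs_of_pos)
      then have "1 \<le> (?T Y)\<^sup>2 / \<tau>\<^sup>2" using \<tau> by simp
      then show ?thesis using True by simp
    qed (auto simp: \<tau>)
  qed
  also have "\<dots> = mean (bits N r) (\<lambda>Y. of_bool (accepts N K b B p \<tau> w (m Y) (sg Y) Y)) + mean (bits N r) (\<lambda>Y. (?T Y)\<^sup>2) / \<tau>\<^sup>2"
    by (simp add: mean_add[OF fin])
  also have "\<dots> \<le> mean (bits N r) (\<lambda>Y. of_bool (accepts N K b B p \<tau> w (m Y) (sg Y) Y)) + c / \<tau>\<^sup>2"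
    by (intro add_left_mono divide_right_mono mean_sq_martingale_le[OF r(1,2) B vinv vle r(3)]) auto
  finally show ?thesis by simp
qed

text \<open>\<open>level_count\<close> decreases from at least K to 0, and the level is the last
  index before it drops below K.\<close>

lemma exists_level:
  assumes "K > 0" "K \<le> level_count N m 0" "\<And>k. k < N \<Longrightarrow> m k < 2 ^ w"
  shows "\<exists>j<w. level N K m j"
proof -
  have "level_count N m w = 0"
    using assms(3) by (auto simp: level_count_def not_le)
  then have w: "level_count N m w < K" using assms by simp
  define i where "i = (LEAST i. level_count N m i < K)"
  have i: "level_count N m i < K" unfolding i_def by (rule LeastI[where P = "\<lambda>i. level_count N m i < K", OF w])
  have iw: "i \<le> w" unfolding i_def by (rule Least_le[where P = "\<lambda>i. level_count N m i < K", OF w])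
  have "i \<noteq> 0" using i assms(2) by (metis not_le)
  then obtain j where j: "i = Suc j" using not0_implies_Suc by blast
  have "\<not> level_count N m j < K"
    using not_less_Least[of j "\<lambda>i. level_count N m i < K"] j by (simp add: i_def)
  then show ?thesis using i iw j by (auto simp: level_def intro!: exI[of _ j])
qed

text \<open>Quantisation loses two quarters of the correlation: one for the fewer than K dropped
  entries, on which the target has norm at most C sqrt K, and one for rounding errors of at most 1
  per slot. The scale is at most twice the norm of the estimate in quantised units, so half of the
  correlation becomes \<kappa> / 4.\<close>

lemma signal_of_correlation:
  fixes m :: "nat \<Rightarrow> nat" and sg :: "nat \<Rightarrow> bool" and \<omega> :: "nat \<Rightarrow> real"
  defines "x \<equiv> \<lambda>k. (if sg k then - 1 else 1) * real (m k)"
  assumes B: "B \<subseteq> {..<N}" and K: "K > 0" and m: "\<And>k. k < N \<Longrightarrow> m k < 2 ^ w"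
    and \<omega>: "\<And>k. k < N \<Longrightarrow> \<bar>\<omega> k\<bar> \<le> C" and W: "W > 0" "W\<^sup>2 = (\<Sum>k<N. (\<omega> k)\<^sup>2)"
    and L: "L > 0" "L\<^sup>2 = (\<Sum>k<N. (x k)\<^sup>2)"
    and corr: "\<kappa> * L * W \<le> (\<Sum>k\<in>B. x k * \<omega> k)" and \<kappa>: "\<kappa> > 0"
    and small: "sqrt (real K) * C \<le> \<kappa> / 4 * W" "sqrt (real N) \<le> \<kappa> / 4 * sqrt (real K) * 2 ^ b"
  shows "signal N K b B \<omega> (\<kappa> / 4 * W) w m sg"
proof -
  have fin: "finite B" using B finite_subset by blast
  have few: "(\<Sum>k\<in>S. \<bar>x k\<bar> * \<bar>\<omega> k\<bar>) \<le> \<kappa> / 4 * W * L" if S: "S \<subseteq> {..<N}" "card S \<le> K" for S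
  proof -
    have fS: "finite S" using S finite_subset by blast
    have "(\<Sum>k\<in>S. (x k)\<^sup>2) \<le> L\<^sup>2" unfolding L(2) using S by (intro sum_mono2) auto
    moreover have "(\<Sum>k\<in>S. (\<omega> k)\<^sup>2) \<le> real K * C\<^sup>2"
    proof -
      have "(\<Sum>k\<in>S. (\<omega> k)\<^sup>2) \<le> (\<Sum>k\<in>S. C\<^sup>2)"
      proof (intro sum_mono)
        fix k assume "k \<in> S"
        then have "\<bar>\<omega> k\<bar> \<le> C" using S \<omega> by auto
        then show "(\<omega> k)\<^sup>2 \<le> C\<^sup>2" by (metis abs_ge_zero power2_abs power_mono)
      qed
      also have "\<dots> \<le> real K * C\<^sup>2" using S by (simp add: mult_right_mono)
      finally show ?thesis .
    qed
    ultimately have "L2_set x S * L2_set \<omega> S \<le> L * (sqrt (real K) * \<bar>C\<bar>)"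
      using L(1) unfolding L2_set_def
      by (intro mult_mono) (auto simp: real_le_lsqrt sum_nonneg real_sqrt_mult[symmetric] intro!: real_le_lsqrt simp: power_mult_distrib)
    moreover have "(\<Sum>k\<in>S. \<bar>x k\<bar> * \<bar>\<omega> k\<bar>) \<le> L2_set x S * L2_set \<omega> S" by (rule L2_set_mult_ineq)
    moreover have "L * (sqrt (real K) * \<bar>C\<bar>) \<le> \<kappa> / 4 * W * L"
    proof -
      have "N > 0" using L by (cases N) auto
      then have "C \<ge> 0" using \<omega>[of 0] by linarith
      then show ?thesis using small(1) L(1) by (simp add: mult.commute mult_left_mono)
    qed
    ultimately show ?thesis by linarith
  qed
  have abs_le: "(\<Sum>k\<in>S. x k * \<omega> k) \<le> (\<Sum>k\<in>S. \<bar>x k\<bar> * \<bar>\<omega> k\<bar>)" for S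
    by (intro sum_mono) (metis abs_ge_self abs_mult)
  have kLW: "\<kappa> * L * W > 0" using \<kappa> L W by simp
  \<comment> \<open>With fewer than K nonzero entries the whole correlation would obey the bound for
    few entries.\<close>
  have "K \<le> level_count N m 0"
  proof (rule ccontr)
    assume "\<not> K \<le> level_count N m 0"
    then have c: "card {k. k < N \<and> 1 \<le> m k} \<le> K" by (simp add: level_count_def)
    have "(\<Sum>k\<in>B. x k * \<omega> k) = (\<Sum>k\<in>B \<inter> {k. k < N \<and> 1 \<le> m k}. x k * \<omega> k)"
      using B fin by (intro sum.mono_neutral_right) (auto simp: x_def)
    also have "\<dots> \<le> \<kappa> / 4 * W * L"
      by (rule order_trans[OF abs_le few])
        (auto intro: order_trans[OF card_mono c])
    also have "\<kappa> / 4 * W * L = (\<kappa> * L * W) / 4" by (simp add: mult.assoc mult.commute)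
    finally show False using corr kLW by linarith
  qed
  then obtain j where j: "j < w" "level N K m j" using exists_level[of K N m w, OF K] m by blast
  define q where "q k = real_of_int (quant b m sg j k)" for k
  \<comment> \<open>The change of units: up to rounding, an entry that is not dropped is multiplied
    by s.\<close>
  define s where "s = (2::real) ^ b / 2 ^ j"
  have s: "s > 0" by (simp add: s_def)
  have q: "\<bar>q k\<bar> \<le> s * \<bar>x k\<bar>" "m k < 2 ^ Suc j \<Longrightarrow> \<bar>s * x k - q k\<bar> \<le> 1" for k
  proof -
    define t where "t = real (2 ^ b * m k div 2 ^ j)"
    have "t \<le> real (2 ^ b * m k) / real (2 ^ j)" unfolding t_def by (rule of_nat_div_le_of_nat)
    then have t: "0 \<le> t" "t \<le> s * real (m k)" by (simp_all add: t_def s_def)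
    have "real (2 ^ b * m k) / real (2 ^ j) < t + 1"
    proof -
      have "2 ^ b * m k < (2 ^ b * m k div 2 ^ j + 1) * 2 ^ j"
        by (metis Suc_eq_plus1 dividend_less_div_times mult.commute mult_Suc add.commute pos2 zero_less_power)
      then have "real (2 ^ b * m k) < real ((2 ^ b * m k div 2 ^ j + 1) * 2 ^ j)" by (simp only: of_nat_less_iff)
      then show ?thesis by (simp add: t_def divide_less_eq distrib_right add.commute)
    qed
    then have t2: "s * real (m k) - t \<le> 1" by (simp add: s_def)
    show "\<bar>q k\<bar> \<le> s * \<bar>x k\<bar>" using t s by (auto simp: q_def quant_def x_def abs_mult t_def)
    show "\<bar>s * x k - q k\<bar> \<le> 1" if "m k < 2 ^ Suc j"
      using that t t2 by (auto simp: q_def quant_def x_def t_def abs_le_iff)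
  qed
  define S where "S = {k. k < N \<and> 2 ^ Suc j \<le> m k}"
  have S: "card S \<le> K" "finite S" using j(2) by (simp_all add: S_def level_def level_count_def)
  \<comment> \<open>At least K entries reach 2^j, so the norm L dominates the accumulated rounding
    error.\<close>
  have "real K * (2 ^ j)\<^sup>2 \<le> L\<^sup>2"
  proof -
    have "real K * (2 ^ j)\<^sup>2 \<le> real (card {k. k < N \<and> 2 ^ j \<le> m k}) * (2 ^ j)\<^sup>2"
      using j(2) by (intro mult_right_mono) (auto simp: level_def level_count_def)
    also have "\<dots> = (\<Sum>k | k < N \<and> 2 ^ j \<le> m k. (2 ^ j)\<^sup>2)" by simp
    also have "\<dots> \<le> (\<Sum>k | k < N \<and> 2 ^ j \<le> m k. (x k)\<^sup>2)"
    proof (intro sum_mono)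
      fix k assume "k \<in> {k. k < N \<and> 2 ^ j \<le> m k}"
      then have "real (2 ^ j) \<le> real (m k)" by (simp only: of_nat_le_iff mem_Collect_eq)
      then show "(2 ^ j)\<^sup>2 \<le> (x k)\<^sup>2" by (auto simp: x_def intro: power_mono)
    qed
    also have "\<dots> \<le> L\<^sup>2" unfolding L(2) by (intro sum_mono2) auto
    finally show ?thesis .
  qed
  then have KL: "sqrt (real K) * 2 ^ j \<le> L"
    using L(1) by (metis abs_le_square_iff abs_of_nonneg less_imp_le mult_nonneg_nonneg power_mult_distrib real_sqrt_ge_zero real_sqrt_pow2 of_nat_0_le_iff zero_le_numeral zero_le_power)
  have scale_le: "scale N K b m sg j \<le> 2 * (s * L)"
  proof -
    have "(\<Sum>k<N. (q k)\<^sup>2) \<le> (\<Sum>k<N. s\<^sup>2 * (x k)\<^sup>2)"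
    proof (intro sum_mono)
      fix k
      have "\<bar>q k\<bar>\<^sup>2 \<le> (s * \<bar>x k\<bar>)\<^sup>2" using q(1)[of k] by (intro power_mono) auto
      then show "(q k)\<^sup>2 \<le> s\<^sup>2 * (x k)\<^sup>2" by (simp add: power_mult_distrib)
    qed
    also have "\<dots> = (s * L)\<^sup>2" by (simp add: power_mult_distrib L(2) sum_distrib_left)
    finally have "(\<Sum>k<N. (q k)\<^sup>2) \<le> (s * L)\<^sup>2" .
    moreover have "real K * 4 ^ b \<le> (s * L)\<^sup>2"
    proof -
      have "sqrt (real K) * 2 ^ b = s * (sqrt (real K) * 2 ^ j)" by (simp add: s_def)
      also have "\<dots> \<le> s * L" using KL s by (intro mult_left_mono) auto
      finally have "(sqrt (real K) * 2 ^ b)\<^sup>2 \<le> (s * L)\<^sup>2" by (intro power_mono) auto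
      moreover have "((2::real) ^ b)\<^sup>2 = 4 ^ b" by (simp add: power2_eq_square flip: power_mult_distrib)
      ultimately show ?thesis by (simp add: power_mult_distrib)
    qed
    moreover have "0 \<le> (s * L)\<^sup>2" by simp
    moreover have "(2 * (s * L))\<^sup>2 = 4 * (s * L)\<^sup>2" by (simp only: power_mult_distrib) simp
    ultimately have "(\<Sum>k<N. (q k)\<^sup>2) + real K * 4 ^ b \<le> (2 * (s * L))\<^sup>2"
      by linarith
    then show ?thesis unfolding scale_def q_def[symmetric] using s L by (intro real_le_lsqrt) auto
  qed
  have sw: "(\<Sum>k\<in>B. \<bar>\<omega> k\<bar>) \<le> sqrt (real N) * W"
  proof -
    have "(\<Sum>k\<in>B. \<bar>\<omega> k\<bar>) \<le> (\<Sum>k<N. \<bar>1\<bar> * \<bar>\<omega> k\<bar>)" using B by (simp add: sum_mono2)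
    also have "\<dots> \<le> L2_set (\<lambda>_. 1) {..<N} * L2_set \<omega> {..<N}" by (rule L2_set_mult_ineq)
    also have "\<dots> = sqrt (real N) * W" using W by (simp add: L2_set_def flip: W(2))
    finally show ?thesis .
  qed
  have "s * (\<Sum>k\<in>B. x k * \<omega> k) \<le> (\<Sum>k\<in>B. q k * \<omega> k + (s * (\<bar>x k\<bar> * \<bar>\<omega> k\<bar>) * of_bool (k \<in> S) + \<bar>\<omega> k\<bar>))"
    unfolding sum_distrib_left
  proof (rule sum_mono)
    fix k assume "k \<in> B"
    then have kN: "k < N" using B by auto
    show "s * (x k * \<omega> k) \<le> q k * \<omega> k + (s * (\<bar>x k\<bar> * \<bar>\<omega> k\<bar>) * of_bool (k \<in> S) + \<bar>\<omega> k\<bar>)"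
    proof (cases "k \<in> S")
      case True
      then have "q k = 0" by (simp add: q_def quant_def S_def)
      moreover have "s * (x k * \<omega> k) \<le> s * (\<bar>x k\<bar> * \<bar>\<omega> k\<bar>)"
        using s by (intro mult_left_mono) (auto simp flip: abs_mult)
      ultimately show ?thesis using True by simp
    next
      case False
      then have "m k < 2 ^ Suc j" using kN by (simp add: S_def)
      then have "\<bar>s * x k - q k\<bar> * \<bar>\<omega> k\<bar> \<le> 1 * \<bar>\<omega> k\<bar>" by (intro mult_right_mono q(2)) auto
      moreover have "(s * x k - q k) * \<omega> k \<le> \<bar>s * x k - q k\<bar> * \<bar>\<omega> k\<bar>" by (simp flip: abs_mult)
      ultimately show ?thesis using False by (simp add: algebra_simps)
    qed
  qed
  also have "\<dots> = (\<Sum>k\<in>B. q k * \<omega> k) + (s * (\<Sum>k\<in>B \<inter> S. \<bar>x k\<bar> * \<bar>\<omega> k\<bar>) + (\<Sum>k\<in>B. \<bar>\<omega> k\<bar>))"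
  proof -
    have "(\<Sum>k\<in>B. s * (\<bar>x k\<bar> * \<bar>\<omega> k\<bar>) * of_bool (k \<in> S)) = (\<Sum>k\<in>B \<inter> S. s * (\<bar>x k\<bar> * \<bar>\<omega> k\<bar>))"
      by (subst sum.inter_restrict[OF fin]) (auto intro!: sum.cong)
    then show ?thesis by (simp only: sum.distrib sum_distrib_left)
  qed
  also have "\<dots> \<le> (\<Sum>k\<in>B. q k * \<omega> k) + (s * (\<kappa> / 4 * W * L) + sqrt (real N) * W)"
    using s S B sw by (intro add_mono mult_left_mono few order_refl) (auto intro: order_trans[OF card_mono])
  also have "sqrt (real N) * W \<le> s * (\<kappa> / 4 * W * L)"
  proof -
    have "sqrt (real N) \<le> \<kappa> / 4 * (sqrt (real K) * 2 ^ b)" using small(2) by (simp add: mult.assoc)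
    also have "sqrt (real K) * 2 ^ b = s * (sqrt (real K) * 2 ^ j)" by (simp add: s_def)
    also have "\<kappa> / 4 * (s * (sqrt (real K) * 2 ^ j)) \<le> \<kappa> / 4 * (s * L)"
      using KL s \<kappa> by (intro mult_left_mono) auto
    finally have "sqrt (real N) * W \<le> \<kappa> / 4 * (s * L) * W" using W by (intro mult_right_mono) auto
    then show ?thesis by (simp add: mult_ac)
  qed
  finally have "s * (\<Sum>k\<in>B. x k * \<omega> k) \<le> (\<Sum>k\<in>B. q k * \<omega> k) + (s * (\<kappa> / 4 * W * L) + s * (\<kappa> / 4 * W * L))" by simp
  moreover have "s * (\<kappa> * L * W) \<le> s * (\<Sum>k\<in>B. x k * \<omega> k)" using corr s by (intro mult_left_mono) auto
  ultimately have "s * (\<kappa> * L * W) / 2 \<le> (\<Sum>k\<in>B. q k * \<omega> k)" by (simp add: mult_ac)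
  moreover have "\<kappa> / 4 * W * scale N K b m sg j \<le> \<kappa> / 4 * W * (2 * (s * L))"
    using \<kappa> W scale_le by (intro mult_left_mono) auto
  ultimately have "\<kappa> / 4 * W * scale N K b m sg j \<le> (\<Sum>k\<in>B. q k * \<omega> k)" by (simp add: mult_ac)
  then show ?thesis using j by (auto simp: signal_def q_def)
qed

section \<open>A circuit for the test\<close>

lemma less_power_iff_bits:
  fixes m :: nat
  shows "m < 2 ^ j \<longleftrightarrow> (\<forall>i. bit m i \<longrightarrow> i < j)"
proof -
  have "m < 2 ^ j \<longleftrightarrow> take_bit j m = m" by (simp add: take_bit_nat_eq_self_iff)
  also have "\<dots> \<longleftrightarrow> (\<forall>i. bit m i \<longrightarrow> i < j)" by (auto simp: bit_eq_iff bit_take_bit_iff)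
  finally show ?thesis .
qed

lemma bit_horner_upt: "bit (horner_sum of_bool 2 (map f [0..<w]) :: nat) i \<longleftrightarrow> i < w \<and> f i"
  by (auto simp: bit_horner_sum_bit_iff)

lemma power_le_horner_iff:
  "2 ^ j \<le> (horner_sum of_bool 2 (map f [0..<w]) :: nat) \<longleftrightarrow> (\<exists>i\<in>{j..<w}. f i)"
  using less_power_iff_bits[of "horner_sum of_bool 2 (map f [0..<w])" j]
  by (auto simp: bit_horner_upt not_le[symmetric] Bex_def)

text \<open>Quantisation is a mere choice of wires: below 2^(j + 1) the quotient consists of the
  bits of the magnitude at the b + 1 positions j - b, ..., j, with zeros where a position does not
  exist.\<close>

lemma horner_window:
  assumes "(horner_sum of_bool 2 (map f [0..<w]) :: nat) < 2 ^ Suc j"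
  shows "2 ^ b * (horner_sum of_bool 2 (map f [0..<w]) :: nat) div 2 ^ j
    = horner_sum of_bool 2 (map (\<lambda>i. b \<le> i + j \<and> i + j - b < w \<and> f (i + j - b)) [0..<Suc b])"
proof -
  let ?m = "horner_sum of_bool 2 (map f [0..<w]) :: nat"
  let ?a = "drop_bit j (push_bit b ?m)"
  have a: "?a = 2 ^ b * ?m div 2 ^ j" by (simp add: drop_bit_eq_div push_bit_eq_mult mult.commute)
  have "2 ^ b * ?m < 2 ^ Suc b * 2 ^ j" using assms by simp
  then have "2 ^ b * ?m div 2 ^ j < 2 ^ Suc b" by (metis less_mult_imp_div_less)
  then have "?a = take_bit (Suc b) ?a" by (subst take_bit_nat_eq_self) (simp_all only: a)
  also have "\<dots> = horner_sum of_bool 2 (map (bit ?a) [0..<Suc b])"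
    by (rule horner_sum_bit_eq_take_bit[symmetric])
  also have "map (bit ?a) [0..<Suc b] = map (\<lambda>i. b \<le> i + j \<and> i + j - b < w \<and> f (i + j - b)) [0..<Suc b]"
    by (intro map_cong refl) (auto simp: bit_drop_bit_eq bit_push_bit_iff bit_horner_upt add.commute)
  finally show ?thesis by (simp only: a)
qed

lemma horner_sum_less: "(horner_sum of_bool 2 bs :: nat) < 2 ^ length bs"
  by (induction bs) (auto simp: of_bool_def)

text \<open>What one slot adds to the five sums that decide acceptance: the two level counts, the sums of
  \<open>V\<^sub>k y\<^sub>k\<close> and of \<open>V\<^sub>k\<close> over the mask, and the squared norm of \<open>V\<close>.\<close>

definition contribution :: "nat set \<Rightarrow> nat \<Rightarrow> bool list \<Rightarrow> int \<times> int \<times> int \<times> int \<times> int" where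
  "contribution B k bs =
    (let v = if bs ! 1 then 0 else (if bs ! 2 then - 1 else 1) * int (horner_sum of_bool 2 (drop 4 bs))
     in (of_bool (bs ! 0), of_bool (bs ! 1), if k \<in> B \<and> bs ! 3 then v else 0, if k \<in> B then v else 0, v\<^sup>2))"

lemma contribution_append:
  "contribution B k ([b0, b1, b2, b3] @ bs) = (of_bool b0, of_bool b1,
     if k \<in> B \<and> b3 then (if b1 then 0 else (if b2 then - 1 else 1) * int (horner_sum of_bool 2 bs)) else 0,
     if k \<in> B then (if b1 then 0 else (if b2 then - 1 else 1) * int (horner_sum of_bool 2 bs)) else 0,
     (if b1 then 0 else (if b2 then - 1 else 1) * int (horner_sum of_bool 2 bs))\<^sup>2)"
  by (simp add: contribution_def Let_def)

text \<open>A range for the partial sums of contributions, which are the states of the branching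
  program. Its size is polynomial in N and 2^b.\<close>

definition box :: "int \<Rightarrow> (int \<times> int \<times> int \<times> int \<times> int) set" where
  "box l = {- l..l} \<times> {- l..l} \<times> {- l..l} \<times> {- l..l} \<times> {- l..l}"

text \<open>The largest of the five increments is the squared value, less than 4^(b + 1). The length
  b + 5 consists of four flags and b + 1 bits of magnitude.\<close>

lemma contribution_box:
  assumes "length bs = b + 5" "v \<in> box l"
  shows "v + contribution B k bs \<in> box (l + 4 ^ Suc b)"
proof -
  let ?h = "horner_sum of_bool 2 (drop 4 bs) :: nat"
  let ?H = "(4::int) ^ Suc b"
  have "?h < 2 ^ length (drop 4 bs)" by (rule horner_sum_less)
  then have "?h < 2 ^ Suc b" using assms(1) by simp
  then have h: "int ?h < 2 ^ Suc b" by (metis of_nat_less_iff of_nat_numeral of_nat_power)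
  have pw: "((2::int) ^ Suc b)\<^sup>2 = ?H" by (simp add: power2_eq_square power_mult_distrib[symmetric])
  have "(1::int) \<le> 2 ^ Suc b" by (rule one_le_power) simp
  then have "(2::int) ^ Suc b \<le> ?H" unfolding pw[symmetric] power2_eq_square by simp
  then have h1: "int ?h \<le> ?H" using h by linarith
  have h2: "(int ?h)\<^sup>2 \<le> ?H" unfolding pw[symmetric] using h by (intro power_mono) auto
  have one: "1 \<le> ?H" by (rule one_le_power) simp
  define e where "e = (if bs ! 1 then 0 else (if bs ! 2 then - 1 else 1) * int ?h)"
  have e: "- ?H \<le> e" "e \<le> ?H" "e\<^sup>2 \<le> ?H"
    using h1 h2 one by (auto simp: e_def)
  have "- ?H \<le> e\<^sup>2" using one zero_le_power2[of e] by linarith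
  note e = e this
  have c: "contribution B k bs = (of_bool (bs ! 0), of_bool (bs ! 1), if k \<in> B \<and> bs ! 3 then e else 0, if k \<in> B then e else 0, e\<^sup>2)"
    by (simp add: contribution_def Let_def e_def)
  obtain a1 a2 a3 a4 a5 where v: "v = (a1, a2, a3, a4, a5)" by (cases v) auto
  show ?thesis
    using assms(2) e one unfolding c v box_def by (auto simp: of_bool_def)
qed

lemma card_box: "l \<ge> 0 \<Longrightarrow> card (box l) = (2 * nat l + 1) ^ 5"
  by (simp add: box_def card_cartesian_product nat_add_distrib nat_mult_distrib eval_nat_numeral)

lemma finite_box: "finite (box l)"
  by (simp add: box_def)

text \<open>The three terms pay for comparing magnitudes with powers of 2, for one branching program
  per level, and for the final disjunction.\<close>

definition accept_cost :: "nat \<Rightarrow> nat \<Rightarrow> nat \<Rightarrow> nat" where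
  "accept_cost N b w = N * Suc w * (4 * w) + w * (4 * 2 ^ (b + 5) * (2 * (N * 4 ^ Suc b) + 1) ^ 5 * N) + 4 * w"

lemma sum_prod_components:
  fixes f :: "nat \<Rightarrow> 'a::comm_monoid_add \<times> 'b::comm_monoid_add"
  shows "sum f S = (\<Sum>k\<in>S. fst (f k), \<Sum>k\<in>S. snd (f k))"
  by (induction S rule: infinite_finite_induct) (auto simp: zero_prod_def prod_eq_iff)

text \<open>For each candidate level, a branching program runs through the slots, reading two
  comparison bits, the sign, the graph bit and the window of the magnitude, and adds up
  \<open>contribution\<close>.\<close>

lemma adds_accepts:
  fixes mbit :: "nat \<Rightarrow> nat \<Rightarrow> bool list \<Rightarrow> bool" and sg y :: "nat \<Rightarrow> bool list \<Rightarrow> bool" and w' :: nat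
  defines "m \<equiv> \<lambda>x k. horner_sum of_bool 2 (map (\<lambda>i. mbit k i x) [0..<w']) :: nat"
  assumes F: "\<And>k i. k < N \<Longrightarrow> i < w' \<Longrightarrow> mbit k i \<in> F" "\<And>k. k < N \<Longrightarrow> sg k \<in> F" "\<And>k. k < N \<Longrightarrow> y k \<in> F"
    and const: "(\<lambda>_. True) \<in> F" "(\<lambda>_. False) \<in> F" and w: "w' \<le> w" and B: "B \<subseteq> {..<N}"
  shows "adds n F {\<lambda>x. accepts N K b B p \<tau> w (m x) (\<lambda>k. sg k x) (\<lambda>k. y k x)} (accept_cost N b w)"
proof -
  define big where "big k j x \<longleftrightarrow> (\<exists>i\<in>{j..<w'}. mbit k i x)" for k j x
  have big: "big k j x \<longleftrightarrow> 2 ^ j \<le> m x k" for k j x by (simp add: big_def m_def power_le_horner_iff)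
  define H1 where "H1 = (\<lambda>(k, j). big k j) ` ({..<N} \<times> {..<Suc w})"
  have 1: "adds n F H1 (N * Suc w * (4 * w))"
  proof -
    have "adds n F ((\<lambda>(k, j). big k j) ` ({..<N} \<times> {..<Suc w})) (card ({..<N} \<times> {..<Suc w}) * (4 * w))"
    proof (rule adds_image)
      fix e assume "e \<in> {..<N} \<times> {..<Suc w}"
      then obtain k j where e: "e = (k, j)" "k < N" by auto
      have "adds n F {\<lambda>x. \<exists>i\<in>{j..<w'}. mbit k i x} (4 * card {j..<w'})"
        using F(1)[OF e(2)] const by (intro adds_exists) auto
      then have "adds n F {big k j} (4 * card {j..<w'})" by (simp add: big_def[abs_def])
      then show "adds n F {case e of (k, j) \<Rightarrow> big k j} (4 * w)"
        unfolding e prod.case using w by (elim adds_mono) auto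
    qed simp
    then show ?thesis by (simp add: H1_def card_cartesian_product)
  qed
  define fs where "fs j k = [big k j, big k (Suc j), sg k, y k]
      @ map (\<lambda>i. if b \<le> i + j \<and> i + j - b < w' then mbit k (i + j - b) else (\<lambda>_. False)) [0..<Suc b]" for j k
  \<comment> \<open>The comparison of reals is a fixed property of the final state, so thresholds
    and square roots are hardwired and cost no gates.\<close>
  define acc where "acc = (\<lambda>(c1, c2, t1, t0, q). int K \<le> c1 \<and> c2 < int K
      \<and> \<tau> * sqrt (real_of_int q + real K * 4 ^ b) \<le> real_of_int t1 - p * real_of_int t0)"
  define h where "h j x \<longleftrightarrow> acc (\<Sum>k<N. contribution B k (map (\<lambda>f. f x) (fs j k)))" for j x
  have len: "length (fs j k) = b + 5" for j k by (simp add: fs_def)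
  have 2: "adds n (F \<union> H1) (h ` {..<w}) (card {..<w} * (4 * 2 ^ (b + 5) * (2 * (N * 4 ^ Suc b) + 1) ^ 5 * N))"
  proof (rule adds_image)
    fix j assume j: "j \<in> {..<w}"
    show "adds n (F \<union> H1) {h j} (4 * 2 ^ (b + 5) * (2 * (N * 4 ^ Suc b) + 1) ^ 5 * N)"
      unfolding h_def[abs_def]
    proof (rule adds_branching_program[where V = "\<lambda>i. box (int i * 4 ^ Suc b)"])
      fix k assume k: "k < N"
      have "big k j \<in> H1" "big k (Suc j) \<in> H1" using j k by (force simp: H1_def)+
      then show "set (fs j k) \<subseteq> F \<union> H1" using F k const by (auto simp: fs_def)
      show "length (fs j k) \<le> b + 5" by (simp add: len)
      show "finite (box (int k * 4 ^ Suc b))" by (rule finite_box)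
      have "card (box (int k * 4 ^ Suc b)) = (2 * (k * 4 ^ Suc b) + 1) ^ 5"
        by (subst card_box) (auto simp: nat_mult_distrib nat_power_eq)
      also have "\<dots> \<le> (2 * (N * 4 ^ Suc b) + 1) ^ 5"
        using k by (intro power_mono add_right_mono mult_left_mono mult_right_mono) auto
      finally show "card (box (int k * 4 ^ Suc b)) \<le> (2 * (N * 4 ^ Suc b) + 1) ^ 5" .
      fix v and bs :: "bool list"
      assume "v \<in> box (int k * 4 ^ Suc b)" "length bs = length (fs j k)"
      then have "v + contribution B k bs \<in> box (int k * 4 ^ Suc b + 4 ^ Suc b)"
        by (intro contribution_box) (simp_all add: len)
      moreover have "int k * 4 ^ Suc b + 4 ^ Suc b = int (Suc k) * 4 ^ Suc b" by (simp add: algebra_simps)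
      ultimately show "v + contribution B k bs \<in> box (int (Suc k) * 4 ^ Suc b)" by (simp only:)
    next
      show "0 \<in> box (int 0 * 4 ^ Suc b)" by (simp add: box_def zero_prod_def)
    qed (use const in auto)
  qed simp
  have 3: "adds n (F \<union> (H1 \<union> h ` {..<w})) {\<lambda>x. \<exists>j\<in>{..<w}. h j x} (4 * card {..<w})"
    using const by (intro adds_exists) auto
  have "h j x \<longleftrightarrow> level N K (m x) j \<and>
     \<tau> * scale N K b (m x) (\<lambda>k. sg k x) j \<le> (\<Sum>k\<in>B. real_of_int (quant b (m x) (\<lambda>k. sg k x) j k) * (of_bool (y k x) - p))" for j x
  proof -
    let ?q = "quant b (m x) (\<lambda>k. sg k x) j"
    have contr: "contribution B k (map (\<lambda>f. f x) (fs j k))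
      = (of_bool (2 ^ j \<le> m x k), of_bool (2 ^ Suc j \<le> m x k), if k \<in> B \<and> y k x then ?q k else 0, if k \<in> B then ?q k else 0, (?q k)\<^sup>2)" for k
    proof -
      have win: "map (\<lambda>f. f x) (map (\<lambda>i. if b \<le> i + j \<and> i + j - b < w' then mbit k (i + j - b) else (\<lambda>_. False)) [0..<Suc b])
         = map (\<lambda>i. b \<le> i + j \<and> i + j - b < w' \<and> mbit k (i + j - b) x) [0..<Suc b]"
        by (auto simp del: upt_Suc)
      have v: "(if big k (Suc j) x then 0 else (if sg k x then - 1 else 1) * int (horner_sum of_bool 2
          (map (\<lambda>i. b \<le> i + j \<and> i + j - b < w' \<and> mbit k (i + j - b) x) [0..<Suc b]))) = ?q k"
      proof (cases "big k (Suc j) x")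
        case True
        then show ?thesis by (simp add: big quant_def)
      next
        case False
        then have "m x k < 2 ^ Suc j" by (simp add: big)
        then show ?thesis
          using horner_window[of "\<lambda>i. mbit k i x" w' j b] False by (simp add: quant_def m_def del: upt_Suc)
      qed
      have "map (\<lambda>f. f x) (fs j k) = [big k j x, big k (Suc j) x, sg k x, y k x]
         @ map (\<lambda>i. b \<le> i + j \<and> i + j - b < w' \<and> mbit k (i + j - b) x) [0..<Suc b]"
        unfolding fs_def map_append win by simp
      then show ?thesis
        by (simp only: contribution_append v) (simp only: big)
    qed
    have cnt: "(\<Sum>k<N. of_bool (2 ^ i \<le> m x k)) = int (level_count N (m x) i)" for i
      by (simp add: level_count_def of_bool_def sum.If_cases Int_def)
    have t1: "(\<Sum>k<N. if k \<in> B \<and> y k x then ?q k else 0) = (\<Sum>k\<in>B. ?q k * of_bool (y k x))"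
    proof -
      have "(\<Sum>k\<in>B. ?q k * of_bool (y k x)) = (\<Sum>k\<in>{..<N} \<inter> B. ?q k * of_bool (y k x))"
        using B by (simp add: Int_absorb1)
      then show ?thesis by (subst (asm) sum.inter_restrict) (auto intro!: sum.cong)
    qed
    have t0: "(\<Sum>k<N. if k \<in> B then ?q k else 0) = (\<Sum>k\<in>B. ?q k)"
      using B by (subst sum.inter_restrict[symmetric]) (auto simp: Int_absorb1)
    have "(\<Sum>k<N. contribution B k (map (\<lambda>f. f x) (fs j k)))
      = (int (level_count N (m x) j), int (level_count N (m x) (Suc j)), \<Sum>k\<in>B. ?q k * of_bool (y k x), \<Sum>k\<in>B. ?q k, \<Sum>k<N. (?q k)\<^sup>2)"
      unfolding contr by (simp add: sum_prod_components t1 t0 cnt[symmetric] del: power_Suc)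
    moreover have "real_of_int (\<Sum>k\<in>B. ?q k * of_bool (y k x)) - p * real_of_int (\<Sum>k\<in>B. ?q k)
      = (\<Sum>k\<in>B. real_of_int (?q k) * (of_bool (y k x) - p))"
      by (simp add: sum_subtractf sum_distrib_left right_diff_distrib mult.commute left_diff_distrib)
    ultimately show ?thesis
      by (simp add: h_def acc_def level_def scale_def)
  qed
  then have eq: "(\<lambda>x. \<exists>j\<in>{..<w}. h j x) = (\<lambda>x. accepts N K b B p \<tau> w (m x) (\<lambda>k. sg k x) (\<lambda>k. y k x))"
    by (auto simp: accepts_def fun_eq_iff)
  have "adds n F ((H1 \<union> h ` {..<w}) \<union> {\<lambda>x. \<exists>j\<in>{..<w}. h j x})
     (N * Suc w * (4 * w) + card {..<w} * (4 * 2 ^ (b + 5) * (2 * (N * 4 ^ Suc b) + 1) ^ 5 * N) + 4 * card {..<w})"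
    by (rule adds_trans[OF adds_trans[OF 1 2] 3])
  then show ?thesis unfolding eq accept_cost_def by (rule adds_mono) auto
qed

section \<open>The test on one block and its circuit\<close>

definition alg_out :: "circuit \<Rightarrow> bool list \<Rightarrow> bool list \<Rightarrow> bool list" where
  "alg_out A r T = map ((!) (eval_gates (T @ r) (gates A))) (outs A)"

lemma run_alg_out: "run A T = map_pmf (\<lambda>r. alg_out A r T) (pmf_of_set {r. length r = coins A})"
  by (simp add: run_def alg_out_def)

lemma length_alg_out: "valid_circuit k l A \<Longrightarrow> length (alg_out A r T) = l"
  by (simp add: alg_out_def valid_circuit_def)

definition mag :: "nat \<Rightarrow> bool list \<Rightarrow> nat \<Rightarrow> nat" where
  "mag w z k = horner_sum of_bool 2 (map (\<lambda>i. z ! (k * w + 1 + i)) [0..<w - 1])"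

lemma decode_estimate_mag:
  assumes "length z = N * w" "k < N" "w > 0"
  shows "decode_estimate w z k = (if z ! (k * w) then - 1 else 1) * real (mag w z k)"
proof -
  have le: "k * w + w \<le> N * w" using assms(2) by (metis Suc_leI add.commute mult_Suc mult_le_mono1)
  have "take w (drop (k * w) z) = map (\<lambda>i. z ! (k * w + i)) [0..<w]"
    using assms le by (intro nth_equalityI) auto
  also have "[0..<w] = 0 # map Suc [0..<w - 1]" using assms(3) by (simp add: map_Suc_upt upt_conv_Cons)
  finally have "take w (drop (k * w) z) = z ! (k * w) # map (\<lambda>i. z ! (k * w + 1 + i)) [0..<w - 1]"
    by (simp add: o_def)
  moreover have "real (horner_sum of_bool 2 bs :: nat) = horner_sum of_bool 2 bs" for bs
    by (induction bs) auto
  ultimately show ?thesis by (simp add: decode_estimate_def mag_def)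
qed

lemma mag_less: "mag w z k < 2 ^ w"
proof -
  have "mag w z k < 2 ^ (w - 1)"
    using horner_sum_less[of "map (\<lambda>i. z ! (k * w + 1 + i)) [0..<w - 1]"] by (simp add: mag_def)
  also have "\<dots> \<le> 2 ^ w" by (rule power_increasing) auto
  finally show ?thesis .
qed

text \<open>The coins \<open>r\<close> and the mask \<open>B\<close> are parameters of the test.
  Erasing the slots of \<open>B\<close> from the input makes the estimate a function of the visible
  slots alone.\<close>

definition block_test ::
  "circuit \<Rightarrow> bool list \<Rightarrow> nat set \<Rightarrow> nat \<Rightarrow> nat \<Rightarrow> nat \<Rightarrow> nat \<Rightarrow> real \<Rightarrow> real \<Rightarrow> (nat \<Rightarrow> bool) \<Rightarrow> bool" where
  "block_test A r B N w K b p \<tau> Y =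
    (let z = alg_out A r (map (\<lambda>k. Y k \<and> k \<notin> B) [0..<N])
     in accepts N K b B p \<tau> w (mag w z) (\<lambda>k. z ! (k * w)) Y)"

lemma adds_block_test:
  assumes A: "valid_circuit N (N * w) A" and r: "length r = coins A" and w: "w > 0" and B: "B \<subseteq> {..<N}"
    and Y: "\<And>k. k < N \<Longrightarrow> Y k \<in> F" and const: "(\<lambda>_. True) \<in> F" "(\<lambda>_. False) \<in> F"
  shows "adds n F {\<lambda>x. block_test A r B N w K b p \<tau> (\<lambda>k. Y k x)} (length (gates A) + accept_cost N b w)"
proof -
  \<comment> \<open>The inputs of \<open>A\<close>: constant False on masked slots, and constants in
    place of the coins.\<close>
  define us where "us = map (\<lambda>k. if k \<in> B then (\<lambda>_. False) else Y k) [0..<N] @ map (\<lambda>c _. c) r"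
  have us: "set us \<subseteq> F"
  proof -
    have "(\<lambda>_. c) \<in> F" for c using const by (cases c) auto
    then show ?thesis using Y const by (auto simp: us_def)
  qed
  have map_us: "map (\<lambda>u. u x) us = map (\<lambda>k. Y k x \<and> k \<notin> B) [0..<N] @ r" for x
  proof -
    have "map (\<lambda>u. u x) (map (\<lambda>k. if k \<in> B then (\<lambda>_. False) else Y k) [0..<N]) = map (\<lambda>k. Y k x \<and> k \<notin> B) [0..<N]"
      by simp
    moreover have "map (\<lambda>u. u x) (map (\<lambda>c _. c) r) = r" by (simp add: o_def)
    ultimately show ?thesis by (simp only: us_def map_append)
  qed
  have len_us: "length us = N + coins A" by (simp add: us_def r)
  define E where "E = (\<lambda>i x. eval_gates (map (\<lambda>u. u x) us) (gates A) ! i)"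
  let ?H = "E ` {..<length us + length (gates A)}"
  have 1: "adds n F ?H (length (gates A))"
    unfolding E_def using A us by (intro adds_eval_gates) (auto simp: len_us valid_circuit_def wires_ok_def)
  define Z where "Z i = E (outs A ! i)" for i
  have outs: "outs A ! i < length us + length (gates A)" if "i < N * w" for i
    using A that by (auto simp: valid_circuit_def len_us)
  have Z: "Z i \<in> F \<union> ?H" if "i < N * w" for i using outs[OF that] by (auto simp: Z_def)
  have Zx: "Z i x = alg_out A r (map (\<lambda>k. Y k x \<and> k \<notin> B) [0..<N]) ! i" if "i < N * w" for i x
    using A that by (simp add: Z_def E_def map_us alg_out_def valid_circuit_def)
  have idx: "k * w + i < N * w" if "k < N" "i < w" for k i
  proof -
    have "k * w + i < Suc k * w" using that by simp
    also have "\<dots> \<le> N * w" using that by (intro mult_le_mono1) simp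
    finally show ?thesis .
  qed
  let ?z = "\<lambda>x. alg_out A r (map (\<lambda>k. Y k x \<and> k \<notin> B) [0..<N])"
  have 2: "adds n (F \<union> ?H) {\<lambda>x. accepts N K b B p \<tau> w (\<lambda>k. horner_sum of_bool 2 (map (\<lambda>i. Z (k * w + 1 + i) x) [0..<w - 1]))
     (\<lambda>k. Z (k * w) x) (\<lambda>k. Y k x)} (accept_cost N b w)"
  proof (rule adds_accepts)
    fix k i assume ki: "k < N" "i < w - 1"
    then show "Z (k * w + 1 + i) \<in> F \<union> ?H" using idx[of k "1 + i"] by (intro Z) simp
  next
    fix k assume "k < N"
    then show "Z (k * w) \<in> F \<union> ?H" using idx[of k 0] w by (intro Z) simp
  qed (use Y const B in auto)
  have acc_cong: "accepts N K b B p \<tau> w m sg y = accepts N K b B p \<tau> w m' sg' y"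
    if "\<And>k. k < N \<Longrightarrow> m k = m' k" "\<And>k. k < N \<Longrightarrow> sg k = sg' k" for m m' sg sg' y
  proof -
    have lc: "level_count N m j = level_count N m' j" for j
      unfolding level_count_def by (rule arg_cong[where f = card]) (auto simp: that(1))
    have q: "quant b m sg j k = quant b m' sg' j k" if "k < N" for j k
      using that \<open>\<And>k. k < N \<Longrightarrow> m k = m' k\<close> \<open>\<And>k. k < N \<Longrightarrow> sg k = sg' k\<close> by (simp add: quant_def)
    have sc: "scale N K b m sg j = scale N K b m' sg' j" for j
      by (simp add: scale_def q)
    have "(\<Sum>k\<in>B. real_of_int (quant b m sg j k) * (of_bool (y k) - p)) = (\<Sum>k\<in>B. real_of_int (quant b m' sg' j k) * (of_bool (y k) - p))" for j
      using B by (intro sum.cong refl) (auto simp: q subset_iff)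
    then show ?thesis by (simp only: accepts_def level_def lc sc)
  qed
  have "accepts N K b B p \<tau> w (\<lambda>k. horner_sum of_bool 2 (map (\<lambda>i. Z (k * w + 1 + i) x) [0..<w - 1]))
     (\<lambda>k. Z (k * w) x) (\<lambda>k. Y k x) = block_test A r B N w K b p \<tau> (\<lambda>k. Y k x)" for x
    unfolding block_test_def Let_def
  proof (rule acc_cong)
    fix k assume k: "k < N"
    show "horner_sum of_bool 2 (map (\<lambda>i. Z (k * w + 1 + i) x) [0..<w - 1]) = mag w (?z x) k"
      unfolding mag_def
    proof (intro arg_cong[where f = "horner_sum of_bool 2"] map_cong refl Zx)
      fix i assume "i \<in> set [0..<w - 1]"
      then show "k * w + 1 + i < N * w" using idx[OF k, of "1 + i"] by simp
    qed
    show "Z (k * w) x = ?z x ! (k * w)" using idx[OF k w] by (intro Zx) simp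
  qed
  then have "adds n (F \<union> ?H) {\<lambda>x. block_test A r B N w K b p \<tau> (\<lambda>k. Y k x)} (accept_cost N b w)"
    using 2 by simp
  from adds_trans[OF 1 this] show ?thesis by (rule adds_mono) auto
qed

lemma detection_circuit:
  assumes A: "valid_circuit N (N * w) A" and r: "length r = coins A" and w: "w > 0" and B: "B \<subseteq> {..<N}"
    and MN: "M > 0" "N > 0"
  obtains C where "valid_circuit (M * N) 1 C"
    "runtime C \<le> 4 + M * (length (gates A) + accept_cost N b w) + 4 * M"
    "\<And>x. length x = M * N \<Longrightarrow> run C x = return_pmf [\<exists>\<kappa><M. block_test A r B N w K b p \<tau> (\<lambda>k. x ! (\<kappa> * N + k))]"
proof -
  let ?n = "M * N"
  let ?h = "\<lambda>\<kappa> x. block_test A r B N w K b p \<tau> (\<lambda>k. x ! (\<kappa> * N + k))"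
  let ?c = "length (gates A) + accept_cost N b w"
  have idx: "\<kappa> * N + k < M * N" if "\<kappa> < M" "k < N" for \<kappa> k
  proof -
    have "\<kappa> * N + k < Suc \<kappa> * N" using that by simp
    also have "\<dots> \<le> M * N" using that by (intro mult_le_mono1) simp
    finally show ?thesis .
  qed
  let ?F = "inputs ?n" and ?T = "{\<lambda>_. True, \<lambda>_. False}"
  have "(\<lambda>x. x ! 0) \<in> ?F" using idx[of 0 0] MN by (auto simp: inputs_def intro!: image_eqI[of _ _ 0])
  then have 1: "adds ?n ?F ?T 3" by (rule adds_consts)
  have "adds ?n (?F \<union> ?T) (?h ` {..<M}) (card {..<M} * ?c)"
  proof (rule adds_image)
    fix \<kappa> assume "\<kappa> \<in> {..<M}"
    then show "adds ?n (?F \<union> ?T) {?h \<kappa>} ?c"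
      using idx[of \<kappa>] by (intro adds_block_test[OF A r w B, where Y = "\<lambda>k x. x ! (\<kappa> * N + k)"]) (auto simp: inputs_def)
  qed simp
  from adds_trans[OF 1 this] have 2: "adds ?n ?F (?T \<union> ?h ` {..<M}) (3 + card {..<M} * ?c)" .
  have "adds ?n (?F \<union> (?T \<union> ?h ` {..<M})) {\<lambda>x. \<exists>\<kappa>\<in>{..<M}. ?h \<kappa> x} (4 * card {..<M})"
    by (rule adds_exists) auto
  from adds_trans[OF 2 this]
  have "adds ?n ?F (?T \<union> ?h ` {..<M} \<union> {\<lambda>x. \<exists>\<kappa>\<in>{..<M}. ?h \<kappa> x}) (3 + card {..<M} * ?c + 4 * card {..<M})" .
  from addsD[OF this computable_inputs]
  have comp: "computable ?n (?F \<union> (?T \<union> ?h ` {..<M} \<union> {\<lambda>x. \<exists>\<kappa>\<in>{..<M}. ?h \<kappa> x})) (3 + M * ?c + 4 * M)" by simp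
  from computable_circuit[OF comp, of "\<lambda>x. \<exists>\<kappa>\<in>{..<M}. ?h \<kappa> x"]
  obtain C where C: "valid_circuit ?n 1 C" "runtime C \<le> 3 + M * ?c + 4 * M + 1"
    "\<And>x. length x = ?n \<Longrightarrow> run C x = return_pmf [\<exists>\<kappa>\<in>{..<M}. ?h \<kappa> x]" by auto
  show ?thesis
    by (rule that[of C]) (use C in \<open>auto simp: Bex_def\<close>)
qed

text \<open>Under the null law this is a union bound over the blocks. Under the planted law,
  acceptance of the informative block alone already forces the answer True.\<close>

lemma detection_error_le:
  assumes P: "finite (set_pmf P)" "\<And>y. y \<in> set_pmf P \<Longrightarrow> length y = N"
    and Q: "finite (set_pmf Q)" "\<And>y. y \<in> set_pmf Q \<Longrightarrow> length y = N" and M: "M > 0"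
    and C: "\<And>x. length x = M * N \<Longrightarrow> run C x = return_pmf [\<exists>\<kappa><M. t (\<lambda>k. x ! (\<kappa> * N + k))]"
    and t: "\<And>Y Y'. (\<And>k. k < N \<Longrightarrow> Y k = Y' k) \<Longrightarrow> t Y = t Y'"
  shows "detection_error (hidden_planted M P Q) (hidden_null M Q) C
    \<le> real M * mean Q (\<lambda>y. of_bool (t ((!) y))) + (1 - mean P (\<lambda>y. of_bool (t ((!) y))))"
proof -
  let ?R = "Pi_pmf {..<M} [] (\<lambda>_. Q)"
  define f where "f x \<longleftrightarrow> (\<exists>\<kappa><M. t (\<lambda>k. x ! (\<kappa> * N + k)))" for x
  have R: "finite (set_pmf ?R)" using Q by simp
  have len: "length (Y j) = N" if "Y \<in> set_pmf ?R" "j < M" for Y j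
    using that Q(2) by (subst (asm) set_Pi_pmf) (auto simp: PiE_dflt_def)
  have f: "f (concat (map Y [0..<M])) \<longleftrightarrow> (\<exists>\<kappa><M. t ((!) (Y \<kappa>)))" if "\<And>j. j < M \<Longrightarrow> length (Y j) = N" for Y
  proof -
    have "t (\<lambda>k. concat (map Y [0..<M]) ! (\<kappa> * N + k)) = t ((!) (Y \<kappa>))" if "\<kappa> < M" for \<kappa>
      using concat_nth[of M Y N \<kappa>] \<open>\<And>j. j < M \<Longrightarrow> length (Y j) = N\<close> that by (intro t) auto
    then show ?thesis by (auto simp: f_def)
  qed
  have pmf_run: "pmf (run C (concat (map Y [0..<M]))) [v] = of_bool (f (concat (map Y [0..<M])) = v)"
    if "\<And>j. j < M \<Longrightarrow> length (Y j) = N" for Y v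
    using C[of "concat (map Y [0..<M])"] length_concat_blocks[of M Y N] that by (simp add: f_def[symmetric] indicator_def)
  have "pmf (bind_pmf (hidden_null M Q) (run C)) [True] = mean ?R (\<lambda>Y. pmf (run C (concat (map Y [0..<M]))) [True])"
    by (simp add: pmf_bind hidden_null_def product_law_def)
  also have "\<dots> \<le> mean ?R (\<lambda>Y. \<Sum>\<kappa><M. of_bool (t ((!) (Y \<kappa>))))"
  proof (intro mean_mono R)
    fix Y assume Y: "Y \<in> set_pmf ?R"
    show "pmf (run C (concat (map Y [0..<M]))) [True] \<le> (\<Sum>\<kappa><M. of_bool (t ((!) (Y \<kappa>))))"
    proof (cases "\<exists>\<kappa><M. t ((!) (Y \<kappa>))")
      case True
      then obtain \<kappa> where k: "\<kappa> < M" "t ((!) (Y \<kappa>))" by blast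
      have "(1::real) = of_bool (t ((!) (Y \<kappa>)))" using k by simp
      also have "\<dots> \<le> (\<Sum>\<kappa><M. of_bool (t ((!) (Y \<kappa>))))"
        using k by (intro member_le_sum[where f = "\<lambda>\<kappa>. of_bool (t ((!) (Y \<kappa>)))"]) auto
      finally show ?thesis by (rule order_trans[OF pmf_le_1])
    next
      case False
      then have "pmf (run C (concat (map Y [0..<M]))) [True] = 0"
        using pmf_run[of Y True] f[of Y] len[OF Y] by simp
      then show ?thesis by (simp add: sum_nonneg)
    qed
  qed
  also have "\<dots> = (\<Sum>\<kappa><M. mean ?R (\<lambda>Y. of_bool (t ((!) (Y \<kappa>)))))" by (rule mean_sum[OF R])
  also have "\<dots> = (\<Sum>\<kappa><M. mean Q (\<lambda>y. of_bool (t ((!) y))))"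
    by (intro sum.cong refl mean_Pi_component[where g = "\<lambda>y. of_bool (t ((!) y))"]) auto
  finally have null: "pmf (bind_pmf (hidden_null M Q) (run C)) [True] \<le> real M * mean Q (\<lambda>y. of_bool (t ((!) y)))"
    by simp
  have Mne: "{..<M} \<noteq> {}" using M by auto
  have "pmf (bind_pmf (hidden_planted M P Q) (run C)) [False]
     = mean (hidden_planted M P Q) (\<lambda>x. pmf (run C x) [False])" by (simp add: pmf_bind)
  also have "\<dots> = mean (pmf_of_set {..<M}) (\<lambda>\<kappa>. mean ?R (\<lambda>Y. mean P (\<lambda>y. pmf (run C (concat (map (Y(\<kappa> := y)) [0..<M]))) [False])))"
    unfolding hidden_planted_eq[OF M] using P R Mne by (simp add: mean_bind)
  also have "\<dots> \<le> mean (pmf_of_set {..<M}) (\<lambda>\<kappa>. mean ?R (\<lambda>Y. mean P (\<lambda>y. 1 - of_bool (t ((!) y)))))"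
  proof (intro mean_mono R P(1))
    show "finite (set_pmf (pmf_of_set {..<M}))" using Mne by simp
    fix \<kappa> Y y assume *: "\<kappa> \<in> set_pmf (pmf_of_set {..<M})" "Y \<in> set_pmf ?R" "y \<in> set_pmf P"
    then have k: "\<kappa> < M" using Mne by simp
    have l: "length ((Y(\<kappa> := y)) j) = N" if "j < M" for j using len[OF *(2) that] P(2)[OF *(3)] by simp
    have "f (concat (map (Y(\<kappa> := y)) [0..<M])) \<longleftrightarrow> (\<exists>i<M. t ((!) ((Y(\<kappa> := y)) i)))"
      by (rule f[OF l])
    then have "t ((!) y) \<Longrightarrow> f (concat (map (Y(\<kappa> := y)) [0..<M]))"
      using k by (metis fun_upd_same)
    then show "pmf (run C (concat (map (Y(\<kappa> := y)) [0..<M]))) [False] \<le> 1 - of_bool (t ((!) y))"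
      using pmf_run[OF l, where v = False] by (cases "t ((!) y)") (simp_all del: fun_upd_apply)
  qed
  also have "\<dots> = 1 - mean P (\<lambda>y. of_bool (t ((!) y)))"
    by (simp add: mean_diff[OF P(1)])
  finally show ?thesis using null by (simp add: detection_error_def)
qed

section \<open>Coins, masks and the power of the block test\<close>

abbreviation coin :: "circuit \<Rightarrow> bool list pmf" where
  "coin A \<equiv> pmf_of_set {r. length r = coins A}"

lemma coin_set: "finite {r :: bool list. length r = m}" "{r :: bool list. length r = m} \<noteq> {}"
  using finite_lists_length_eq[of "UNIV :: bool set" m] by (auto intro: exI[of _ "replicate m True"])

lemma set_coin: "set_pmf (coin A) = {r. length r = coins A}"
  by (rule set_pmf_of_set[OF coin_set(2,1)])

lemma finite_set_coin [simp]: "finite (set_pmf (coin A))"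
  unfolding set_coin by (rule coin_set)

lemma overlap_cong:
  assumes "\<And>k. k < N \<Longrightarrow> T k = T' k"
  shows "overlap N X T = overlap N X T'"
  using assms by (simp add: overlap_def L2_set_def)

text \<open>The mean over the coins becomes explicit, so that it can be exchanged with the other
  means and the coins can be fixed.\<close>

lemma expected_overlap_eq:
  assumes "n > 0" "q > 0" "d > 0" "lam > 0"
  shows "expected_overlap n d lam q w A = mean (labels n q) (\<lambda>s. mean (bits (sbm_dim n) (edge_prob n d lam q s))
    (\<lambda>Y. mean (coin A) (\<lambda>r. overlap (sbm_dim n) (decode_estimate w (alg_out A r (map Y [0..<sbm_dim n]))) (omega_slot n q s))))"
proof -
  let ?N = "sbm_dim n"
  have fin: "finite (set_pmf (labels n q))" by (rule finite_set_labels[OF assms(2)])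
  have Th: "overlap ?N X (Theta n d lam q (map s [0..<n])) = overlap ?N X (omega_slot n q s)" for X s
  proof -
    have "overlap ?N X (Theta n d lam q (map s [0..<n])) = overlap ?N X (\<lambda>k. (lam * d / n) * omega_slot n q s k)"
    proof (rule overlap_cong)
      fix k assume k: "k < ?N"
      obtain i j where e: "edge_slots n ! k = (i, j)" by force
      show "Theta n d lam q (map s [0..<n]) k = (lam * d / n) * omega_slot n q s k"
        using edge_slots_nth[OF k e] by (simp add: Theta_def omega_slot_def omega_def e algebra_simps diff_divide_distrib add_divide_distrib)
    qed
    then show ?thesis using assms overlap_cmult[of "lam * d / n"] by simp
  qed
  show ?thesis
    unfolding expected_overlap_def labelings_labels[OF assms(2)] bind_map_pmf sbm_given_sample run_alg_out
    by (simp add: mean_bind fin Th)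
qed

lemma accepts_cong:
  assumes "B \<subseteq> {..<N}" "\<And>k. k < N \<Longrightarrow> Y k = Y' k"
  shows "accepts N K b B p \<tau> w m sg Y = accepts N K b B p \<tau> w m sg Y'"
proof -
  have "(\<Sum>k\<in>B. real_of_int (quant b m sg j k) * (of_bool (Y k) - p)) = (\<Sum>k\<in>B. real_of_int (quant b m sg j k) * (of_bool (Y' k) - p))" for j
    using assms by (intro sum.cong refl) (auto simp: subset_iff)
  then show ?thesis by (simp only: accepts_def)
qed

lemma block_test_cong:
  assumes "B \<subseteq> {..<N}" "\<And>k. k < N \<Longrightarrow> Y k = Y' k"
  shows "block_test A r B N w K b p \<tau> Y = block_test A r B N w K b p \<tau> Y'"
proof -
  have eq: "map (\<lambda>k. Y k \<and> k \<notin> B) [0..<N] = map (\<lambda>k. Y' k \<and> k \<notin> B) [0..<N]"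
    using assms(2) by (intro map_cong) auto
  show ?thesis unfolding block_test_def Let_def eq by (rule accepts_cong[OF assms])
qed

lemma block_test_list:
  assumes "B \<subseteq> {..<N}"
  shows "block_test A r B N w K b p \<tau> ((!) (map Y [0..<N])) = block_test A r B N w K b p \<tau> Y"
  by (rule block_test_cong[OF assms]) simp

lemma train_fun_upd:
  assumes "c \<in> B"
  shows "map (\<lambda>k. (Y(c := x)) k \<and> k \<notin> B) [0..<N] = map (\<lambda>k. Y k \<and> k \<notin> B) [0..<N]"
  using assms by (intro map_cong) auto

lemma block_test_null_le:
  assumes "0 \<le> d" "d \<le> n" "n > 0" "B \<subseteq> {..<sbm_dim n}" "K > 0" "0 \<le> u" "2 * u \<le> sqrt (real K)"
  shows "mean (erdos_renyi n d) (\<lambda>y. of_bool (block_test A r B (sbm_dim n) w K b (d / n) \<tau> ((!) y)))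
    \<le> exp (- (u * \<tau>) + u\<^sup>2 * (d / n))"
proof -
  let ?N = "sbm_dim n"
  define z where "z Y = alg_out A r (map (\<lambda>k. Y k \<and> k \<notin> B) [0..<?N])" for Y
  have z: "z (Y(c := x)) = z Y" if "c \<in> B" for c Y x
    unfolding z_def train_fun_upd[OF that] ..
  have "mean (erdos_renyi n d) (\<lambda>y. of_bool (block_test A r B ?N w K b (d / n) \<tau> ((!) y)))
     = mean (bits ?N (\<lambda>_. d / n)) (\<lambda>Y. of_bool (accepts ?N K b B (d / n) \<tau> w (mag w (z Y)) (\<lambda>k. z Y ! (k * w)) Y))"
    unfolding erdos_renyi_sample integral_map_pmf block_test_list[OF assms(4)] by (simp add: block_test_def z_def Let_def)
  also have "\<dots> \<le> exp (- (u * \<tau>) + u\<^sup>2 * (d / n))"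
    using assms by (intro mean_accepts_null_le) (auto simp: z)
  finally show ?thesis .
qed

text \<open>Overlap c at the thinned degree gives a hidden correlation of mean at least \<beta> c /
  2. Being at most 1, it reaches \<kappa> = \<beta> c / 4 with probability at least \<beta> c / 2 -
  \<kappa>. For a typical labeling the quantised estimate then carries signal, and the test accepts
  up to the Chebyshev error pm / \<tau>^2.\<close>

lemma good_mask_exists:
  fixes n q w K b :: nat and d lam \<beta> c :: real and A :: circuit
  defines "N \<equiv> sbm_dim n" and "p \<equiv> d / n" and "\<kappa> \<equiv> \<beta> * c / 4"
  defines "pm \<equiv> (1 + real q * lam) * p" and "\<mu> \<equiv> \<kappa> / 4 * sqrt (real N * real q / 2)"
  defines "\<tau> \<equiv> lam * p * \<mu> / 2"
  assumes n: "n > 0" "N > 0" and q: "q \<ge> 2" and d: "0 < d" "d < n" and lam: "0 < lam" "lam \<le> 1"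
    and \<beta>: "0 < \<beta>" "\<beta> < 1" and c: "0 < c" "c \<le> 1" and pm: "pm \<le> c\<^sup>2 / 8"
    and A: "valid_circuit N (N * w) A" and w: "w > 0"
    and eo: "c \<le> expected_overlap n ((1 - \<beta>) * d) lam q w A"
    and K: "K > 0" and small: "sqrt (real K) * real q \<le> \<mu>" "sqrt (real N) \<le> \<kappa> / 4 * sqrt (real K) * 2 ^ b"
  shows "\<exists>r B. length r = coins A \<and> B \<subseteq> {..<N} \<and>
    \<beta> * c / 4 - 4 * real q / real N - pm / \<tau>\<^sup>2 \<le> mean (sbm n d lam q) (\<lambda>y. of_bool (block_test A r B N w K b p \<tau> ((!) y)))"
proof -
  let ?U = "labels n q" and ?M = "bits N (\<lambda>_. \<beta>)"
  let ?ep = "edge_prob n ((1 - \<beta>) * d) lam q" and ?ep' = "edge_prob n d lam q"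
  have q0: "q > 0" using q by simp
  note finU = finite_set_labels[OF q0, of n]
  have fin: "finite (set_pmf (bits N r))" for r by simp
  have p: "0 < p" "p < 1" using d n by (auto simp: p_def)
  have p0: "0 \<le> p" using p by simp
  have c2: "c\<^sup>2 / 8 \<le> 1 / 8" using c by (simp add: power_le_one)
  have pm1: "pm \<le> 1 / 2" "0 \<le> pm" using pm c2 p lam by (auto simp: pm_def)
  have ep': "0 \<le> ?ep' s k" "?ep' s k \<le> pm" "?ep' s k \<le> 1" for s k
    using edge_prob_range[of n d lam q s k] n d lam pm1 by (auto simp: pm_def p_def)
  have ep: "?ep s k = (1 - \<beta>) * ?ep' s k" for s k
    by (simp add: edge_prob_omega)
  define C0 where "C0 = (1 - \<beta>) * pm"
  have C0: "0 \<le> C0" "C0 \<le> c\<^sup>2 / 8"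
  proof -
    have "C0 \<le> 1 * pm" unfolding C0_def using \<beta> pm1 by (intro mult_right_mono) auto
    then show "C0 \<le> c\<^sup>2 / 8" using pm by simp
    show "0 \<le> C0" unfolding C0_def using \<beta> pm1 by simp
  qed
  have ep_le: "?ep s k \<le> C0" for s k
    unfolding ep C0_def using \<beta> ep' by (intro mult_left_mono) auto
  define est where "est r T = decode_estimate w (alg_out A r (map T [0..<N]))" for r T
  define x where "x r T k = est r T k / L2_set (est r T) {..<N}" for r T k
  define W where "W s = L2_set (omega_slot n q s) {..<N}" for s
  define \<theta> where "\<theta> s k = omega_slot n q s k / W s" for s k
  have unit: "(\<Sum>k<N. (f k / L2_set f {..<N})\<^sup>2) \<le> 1" for f
  proof -
    have "(\<Sum>k<N. (f k / L2_set f {..<N})\<^sup>2) = (\<Sum>k<N. (f k)\<^sup>2) / (L2_set f {..<N})\<^sup>2"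
      by (simp add: power_divide sum_divide_distrib)
    also have "\<dots> \<le> 1" by (simp add: L2_set_def sum_nonneg)
    finally show ?thesis .
  qed
  have xs: "(\<Sum>k<N. (x r T k)\<^sup>2) \<le> 1" for r T unfolding x_def by (rule unit)
  have \<theta>s: "(\<Sum>k<N. (\<theta> s k)\<^sup>2) \<le> 1" for s unfolding \<theta>_def W_def by (rule unit)
  have ov: "overlap N (est r T) (omega_slot n q s) = (\<Sum>k<N. x r T k * \<theta> s k)" for r T s
    by (simp add: overlap_def x_def \<theta>_def W_def sum_divide_distrib)
  define bset where "bset B = {k. k < N \<and> B k}" for B :: "nat \<Rightarrow> bool"
  define hid where "hid r s B Y = (\<Sum>k\<in>bset B. x r (\<lambda>k. Y k \<and> \<not> B k) k * \<theta> s k)" for r s B Y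
  define ty where "ty s \<longleftrightarrow> typical n q s" for s
  define acc where "acc r s B = mean (bits N (?ep' s)) (\<lambda>Y. of_bool (block_test A r (bset B) N w K b p \<tau> Y))" for r s B
  \<comment> \<open>The weight \<eta> = c / 2 loses c / 4, and C0 \<le> c^2 / 8 makes the other
    error at most c / 4 as well.\<close>
  have hid_mean: "\<beta> * (mean (bits N (?ep s)) (\<lambda>T. overlap N (est r T) (omega_slot n q s)) - c / 2)
      \<le> mean ?M (\<lambda>B. mean (bits N (?ep' s)) (hid r s B))" for r s
  proof -
    have "\<beta> * (mean (bits N (?ep s)) (\<lambda>T. \<Sum>k<N. x r T k * \<theta> s k) - (c / 2) / 2 - C0 / (1 - C0) / (2 * (c / 2)))
      \<le> mean ?M (\<lambda>B. mean (bits N (?ep' s)) (\<lambda>Y. \<Sum>k | k < N \<and> B k. x r (\<lambda>k. Y k \<and> \<not> B k) k * \<theta> s k))"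
      using \<beta> ep' ep ep_le C0 c2 c xs \<theta>s by (intro mean_hidden_correlation_ge) auto
    moreover have "C0 / (1 - C0) / (2 * (c / 2)) \<le> c / 4"
    proof -
      have "C0 / (1 - C0) \<le> (c\<^sup>2 / 8) / (1 / 2)" using C0 c2 by (intro frac_le) auto
      then have "C0 / (1 - C0) / c \<le> (c\<^sup>2 / 8) / (1 / 2) / c" using c by (intro divide_right_mono) auto
      then show ?thesis using c by (simp add: power2_eq_square)
    qed
    then have "\<beta> * (mean (bits N (?ep s)) (\<lambda>T. \<Sum>k<N. x r T k * \<theta> s k) - c / 2)
       \<le> \<beta> * (mean (bits N (?ep s)) (\<lambda>T. \<Sum>k<N. x r T k * \<theta> s k) - (c / 2) / 2 - C0 / (1 - C0) / (2 * (c / 2)))"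
      using \<beta> by (intro mult_left_mono) auto
    ultimately show ?thesis unfolding ov hid_def bset_def by (rule order_trans[rotated])
  qed
  have hid_le: "hid r s B Y \<le> \<kappa> + of_bool (\<kappa> \<le> hid r s B Y)" for r s B Y
  proof -
    have "hid r s B Y \<le> (\<Sum>k\<in>bset B. \<bar>x r (\<lambda>k. Y k \<and> \<not> B k) k\<bar> * \<bar>\<theta> s k\<bar>)"
      unfolding hid_def by (intro sum_mono) (metis abs_ge_self abs_mult)
    also have "\<dots> \<le> (\<Sum>k<N. \<bar>x r (\<lambda>k. Y k \<and> \<not> B k) k\<bar> * \<bar>\<theta> s k\<bar>)"
      by (intro sum_mono2) (auto simp: bset_def)
    also have "\<dots> \<le> L2_set (x r (\<lambda>k. Y k \<and> \<not> B k)) {..<N} * L2_set (\<theta> s) {..<N}"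
      by (rule L2_set_mult_ineq)
    also have "\<dots> \<le> 1 * 1"
      using xs \<theta>s by (intro mult_mono) (auto simp: L2_set_def sum_nonneg)
    finally have "hid r s B Y \<le> 1" by simp
    moreover have "0 \<le> \<kappa>" using \<beta> c by (simp add: \<kappa>_def)
    ultimately show ?thesis by auto
  qed
  have kpos: "\<kappa> > 0" using \<beta> c by (simp add: \<kappa>_def)
  have mu0: "\<mu> > 0" using kpos n q by (simp add: \<mu>_def)
  have tau0: "\<tau> > 0" using mu0 lam p by (simp add: \<tau>_def)
  \<comment> \<open>The norm W of a typical target is at least sqrt (N q / 2), so the threshold
    \<mu>, which is independent of the labeling, can replace \<kappa> W / 4.\<close>
  have sig: "signal N K b (bset B) (omega_slot n q s) \<mu> w (mag w z) (\<lambda>k. z ! (k * w))"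
    if h: "\<kappa> \<le> hid r s B Y" and t: "ty s" and z: "z = alg_out A r (map (\<lambda>k. Y k \<and> k \<notin> bset B) [0..<N])" for r s B Y z
  proof -
    have T: "map (\<lambda>k. Y k \<and> \<not> B k) [0..<N] = map (\<lambda>k. Y k \<and> k \<notin> bset B) [0..<N]"
      by (intro map_cong refl) (auto simp: bset_def)
    let ?x = "\<lambda>k. (if z ! (k * w) then - 1 else 1) * real (mag w z k)"
    have e: "est r (\<lambda>k. Y k \<and> \<not> B k) k = ?x k" if "k < N" for k
      unfolding est_def T z[symmetric] using that w by (intro decode_estimate_mag[of _ N]) (auto simp: z length_alg_out[OF A])
    let ?L = "L2_set (est r (\<lambda>k. Y k \<and> \<not> B k)) {..<N}"
    have L2: "?L\<^sup>2 = (\<Sum>k<N. (?x k)\<^sup>2)"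
      unfolding L2_set_def by (subst real_sqrt_pow2) (auto simp: e sum_nonneg)
    have W2: "(W s)\<^sup>2 = (\<Sum>k<N. (omega_slot n q s k)\<^sup>2)"
      unfolding W_def L2_set_def by (subst real_sqrt_pow2) (auto simp: sum_nonneg)
    have Wge: "sqrt (real N * real q / 2) \<le> W s"
      unfolding W_def L2_set_def using typical_bounds(1)[OF q t[unfolded ty_def]] by (simp add: N_def)
    have Wpos: "W s > 0"
    proof -
      have "0 < sqrt (real N * real q / 2)" using n q by simp
      then show ?thesis using Wge by linarith
    qed
    have hid_eq: "hid r s B Y = (\<Sum>k\<in>bset B. ?x k * omega_slot n q s k) / (?L * W s)"
      unfolding hid_def x_def \<theta>_def sum_divide_distrib by (intro sum.cong refl) (auto simp: e bset_def)
    have "?L \<noteq> 0" using h kpos hid_eq by auto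
    then have Lpos: "?L > 0" using L2_set_nonneg[of "est r (\<lambda>k. Y k \<and> \<not> B k)" "{..<N}"] by linarith
    have corr: "\<kappa> * ?L * W s \<le> (\<Sum>k\<in>bset B. ?x k * omega_slot n q s k)"
      using h Lpos Wpos unfolding hid_eq by (simp add: le_divide_eq mult.assoc)
    have om: "\<bar>omega_slot n q s k\<bar> \<le> real q" for k
      using q by (auto simp: omega_slot_def omega_def of_bool_def split: prod.splits)
    have mono: "\<mu> \<le> \<kappa> / 4 * W s" unfolding \<mu>_def using Wge kpos by (intro mult_left_mono) auto
    have "signal N K b (bset B) (omega_slot n q s) (\<kappa> / 4 * W s) w (mag w z) (\<lambda>k. z ! (k * w))"
      using K small mono kpos
      by (intro signal_of_correlation[where L = ?L and C = "real q"] Wpos W2 Lpos L2 corr om mag_less)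
         (auto simp: bset_def)
    then obtain j where j: "j < w" "level N K (mag w z) j"
      "\<kappa> / 4 * W s * scale N K b (mag w z) (\<lambda>k. z ! (k * w)) j \<le> (\<Sum>k\<in>bset B. real_of_int (quant b (mag w z) (\<lambda>k. z ! (k * w)) j k) * omega_slot n q s k)"
      by (auto simp: signal_def)
    have "\<mu> * scale N K b (mag w z) (\<lambda>k. z ! (k * w)) j \<le> \<kappa> / 4 * W s * scale N K b (mag w z) (\<lambda>k. z ! (k * w)) j"
      using mono scale_pos[OF K] by (intro mult_right_mono) (auto intro: less_imp_le)
    then show ?thesis using j by (auto simp: signal_def)
  qed
  have acc_ge: "mean (bits N (?ep' s)) (hid r s B) \<le> acc r s B + \<kappa> + pm / \<tau>\<^sup>2 + of_bool (\<not> ty s)" for r s B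
  proof -
    define z where "z Y = alg_out A r (map (\<lambda>k. Y k \<and> k \<notin> bset B) [0..<N])" for Y
    have zinv: "z (Y(c := x)) = z Y" if "c \<in> bset B" for c Y x
      unfolding z_def train_fun_upd[OF that] ..
    have acc_nonneg: "0 \<le> acc r s B" unfolding acc_def by (intro mean_nonneg) auto
    have pt: "0 \<le> pm / \<tau>\<^sup>2" using pm1 by simp
    have "mean (bits N (?ep' s)) (hid r s B) \<le> mean (bits N (?ep' s)) (\<lambda>Y. \<kappa> + of_bool (\<kappa> \<le> hid r s B Y))"
      by (intro mean_mono fin hid_le)
    also have "\<dots> = \<kappa> + mean (bits N (?ep' s)) (\<lambda>Y. of_bool (\<kappa> \<le> hid r s B Y))"
      by (simp add: mean_add[OF fin])
    also have "mean (bits N (?ep' s)) (\<lambda>Y. of_bool (\<kappa> \<le> hid r s B Y)) \<le> acc r s B + pm / \<tau>\<^sup>2 + of_bool (\<not> ty s)"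
    proof (cases "ty s")
      case False
      have "mean (bits N (?ep' s)) (\<lambda>Y. of_bool (\<kappa> \<le> hid r s B Y)) \<le> 1" by (intro mean_le_const fin) auto
      then show ?thesis using False acc_nonneg pt by simp
    next
      case True
      have "mean (bits N (?ep' s)) (\<lambda>Y. of_bool (\<kappa> \<le> hid r s B Y))
        \<le> mean (bits N (?ep' s)) (\<lambda>Y. of_bool (signal N K b (bset B) (omega_slot n q s) \<mu> w (mag w (z Y)) (\<lambda>k. z Y ! (k * w))))"
        by (intro mean_mono fin) (use sig[OF _ True z_def] in auto)
      moreover have "mean (bits N (?ep' s)) (\<lambda>Y. of_bool (signal N K b (bset B) (omega_slot n q s) \<mu> w (mag w (z Y)) (\<lambda>k. z Y ! (k * w)))) - pm / \<tau>\<^sup>2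
         \<le> mean (bits N (?ep' s)) (\<lambda>Y. of_bool (accepts N K b (bset B) p \<tau> w (mag w (z Y)) (\<lambda>k. z Y ! (k * w)) Y))"
      proof (rule mean_accepts_planted_ge[where \<gamma> = "lam * p" and \<omega> = "omega_slot n q s"])
        show "?ep' s k - p = lam * p * omega_slot n q s k" for k by (simp add: edge_prob_omega p_def algebra_simps)
        show "2 * \<tau> \<le> lam * p * \<mu>" by (simp add: \<tau>_def)
        show "bset B \<subseteq> {..<N}" by (auto simp: bset_def)
      qed (use ep' pm1 K zinv lam p0 tau0 in auto)
      ultimately show ?thesis by (simp add: acc_def block_test_def z_def True Let_def)
    qed
    finally show ?thesis by simp
  qed
  have eo': "c \<le> mean (coin A) (\<lambda>r. mean ?U (\<lambda>s. mean (bits N (?ep s)) (\<lambda>T. overlap N (est r T) (omega_slot n q s))))"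
  proof -
    have "expected_overlap n ((1 - \<beta>) * d) lam q w A
      = mean ?U (\<lambda>s. mean (bits N (?ep s)) (\<lambda>T. mean (coin A) (\<lambda>r. overlap N (est r T) (omega_slot n q s))))"
      unfolding est_def N_def using n d \<beta> lam q0 by (intro expected_overlap_eq) auto
    also have "\<dots> = mean ?U (\<lambda>s. mean (coin A) (\<lambda>r. mean (bits N (?ep s)) (\<lambda>T. overlap N (est r T) (omega_slot n q s))))"
      by (intro mean_cong mean_swap) auto
    also have "\<dots> = mean (coin A) (\<lambda>r. mean ?U (\<lambda>s. mean (bits N (?ep s)) (\<lambda>T. overlap N (est r T) (omega_slot n q s))))"
      by (rule mean_swap[OF finU]) simp
    finally show ?thesis using eo by simp
  qed
  \<comment> \<open>The coins are fixed while labeling and graph are still averaged, and the mask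
    follows in the same way; hence neither depends on the sample.\<close>
  from mean_attained[OF finite_set_coin eo'] obtain r where r: "r \<in> set_pmf (coin A)"
    "c \<le> mean ?U (\<lambda>s. mean (bits N (?ep s)) (\<lambda>T. overlap N (est r T) (omega_slot n q s)))" by blast
  have "\<beta> * c / 2 \<le> \<beta> * (mean ?U (\<lambda>s. mean (bits N (?ep s)) (\<lambda>T. overlap N (est r T) (omega_slot n q s))) - c / 2)"
  proof -
    have "\<beta> * (c - c / 2) \<le> \<beta> * (mean ?U (\<lambda>s. mean (bits N (?ep s)) (\<lambda>T. overlap N (est r T) (omega_slot n q s))) - c / 2)"
      using r(2) \<beta> by (intro mult_left_mono) auto
    then show ?thesis by (simp add: field_simps)
  qed
  also have "\<dots> = mean ?U (\<lambda>s. \<beta> * (mean (bits N (?ep s)) (\<lambda>T. overlap N (est r T) (omega_slot n q s)) - c / 2))"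
    by (simp add: mean_diff[OF finU])
  also have "\<dots> \<le> mean ?U (\<lambda>s. mean ?M (\<lambda>B. mean (bits N (?ep' s)) (hid r s B)))"
    by (intro mean_mono finU hid_mean)
  also have "\<dots> = mean ?M (\<lambda>B. mean ?U (\<lambda>s. mean (bits N (?ep' s)) (hid r s B)))"
    by (rule mean_swap[OF finU fin])
  finally have "\<beta> * c / 2 \<le> mean ?M (\<lambda>B. mean ?U (\<lambda>s. mean (bits N (?ep' s)) (hid r s B)))" .
  from mean_attained[OF fin this] obtain B where
    "\<beta> * c / 2 \<le> mean ?U (\<lambda>s. mean (bits N (?ep' s)) (hid r s B))" by blast
  also have "\<dots> \<le> mean ?U (\<lambda>s. acc r s B + \<kappa> + pm / \<tau>\<^sup>2 + of_bool (\<not> ty s))"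
    by (intro mean_mono finU acc_ge)
  also have "\<dots> = mean ?U (\<lambda>s. acc r s B) + \<kappa> + pm / \<tau>\<^sup>2 + mean ?U (\<lambda>s. of_bool (\<not> ty s))"
    by (simp add: mean_add[OF finU])
  finally have "\<beta> * c / 2 \<le> mean ?U (\<lambda>s. acc r s B) + \<kappa> + pm / \<tau>\<^sup>2 + mean ?U (\<lambda>s. of_bool (\<not> ty s))" .
  moreover have "mean ?U (\<lambda>s. of_bool (\<not> ty s)) \<le> 4 * real q / real N"
    using mean_not_typical[OF q0] n by (simp add: ty_def N_def)
  moreover have "mean (sbm n d lam q) (\<lambda>y. of_bool (block_test A r (bset B) N w K b p \<tau> ((!) y))) = mean ?U (\<lambda>s. acc r s B)"
  proof -
    have B: "bset B \<subseteq> {..<N}" by (auto simp: bset_def)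
    show ?thesis
      unfolding sbm_sample[OF q0] N_def[symmetric]
      by (simp add: mean_bind finU acc_def block_test_list[OF B])
  qed
  moreover have "\<beta> * c / 2 - \<kappa> = \<beta> * c / 4" by (simp add: \<kappa>_def)
  ultimately have "\<beta> * c / 4 - 4 * real q / real N - pm / \<tau>\<^sup>2 \<le> mean (sbm n d lam q) (\<lambda>y. of_bool (block_test A r (bset B) N w K b p \<tau> ((!) y)))"
    by linarith
  moreover have "length r = coins A" using r(1) by (simp add: set_coin)
  moreover have "bset B \<subseteq> {..<N}" by (auto simp: bset_def)
  ultimately show ?thesis by blast
qed

section \<open>Detection from recovery\<close>

lemma sbm_dim_bounds:
  assumes "n \<ge> 2"
  shows "(real n)\<^sup>2 / 4 \<le> real (sbm_dim n)" "real (sbm_dim n) \<le> (real n)\<^sup>2 / 2" "sbm_dim n > 0" "sbm_dim n \<le> n\<^sup>2"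
proof -
  have eq: "2 * real (sbm_dim n) = (real n)\<^sup>2 - real n"
    using sbm_dim_eq[of n] by (simp add: power2_eq_square algebra_simps)
  have "2 * real n \<le> (real n)\<^sup>2" using assms by (simp add: power2_eq_square mult_right_mono)
  then show lower: "(real n)\<^sup>2 / 4 \<le> real (sbm_dim n)" using eq by simp
  show upper: "real (sbm_dim n) \<le> (real n)\<^sup>2 / 2" using eq by simp
  have "0 < (real n)\<^sup>2 / 4" using assms by simp
  then show "sbm_dim n > 0" using lower by linarith
  have "real (sbm_dim n) \<le> real (n\<^sup>2)"
    using upper zero_le_power2[of "real n"] by (simp only: of_nat_power)
  then show "sbm_dim n \<le> n\<^sup>2" by (simp only: of_nat_le_iff)
qed

text \<open>The weight \<eta> = 1 / n works because \<open>low\<close> bounds the second moment of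
  the likelihood ratio by sqrt n; the two parts of the AM-GM bound become 1 / sqrt n and 8 /
  n.\<close>

lemma expected_overlap_le:
  assumes n: "n \<ge> 2" and q: "q \<ge> 2" and d: "0 < d" "d \<le> n / 2" and lam: "0 < lam" "lam \<le> 1"
    and range: "(1 + real q * lam) * (d / n) \<le> 1" and low: "n * real q * (d * lam\<^sup>2) \<le> ln n / 4"
  shows "expected_overlap n d lam q w A \<le> 16 * real q / (real n)\<^sup>2 + (1 / sqrt n + 8 / n) / 2"
proof -
  let ?N = "sbm_dim n"
  note Nb = sbm_dim_bounds[OF n]
  have q0: "q > 0" and n0: "n > 0" and dn: "d < n" using q n d by auto
  have finU: "finite (set_pmf (labels n q))" by (rule finite_set_labels[OF q0])
  have fin: "finite (set_pmf (bits N r))" for N r by simp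
  have E: "exp (3 / 2 * (lam\<^sup>2 * (d / n) / (1 - d / n)) * real ?N * real q) \<le> sqrt n"
  proof -
    have "d / n \<le> 1 / 2" using d n0 by (simp add: divide_le_eq)
    then have "lam\<^sup>2 * (d / n) / (1 - d / n) \<le> lam\<^sup>2 * (d / n) / (1 / 2)"
      using d by (intro divide_left_mono) auto
    then have "3 / 2 * (lam\<^sup>2 * (d / n) / (1 - d / n)) * real ?N * real q
        \<le> 3 / 2 * (lam\<^sup>2 * (d / n) / (1 / 2)) * ((real n)\<^sup>2 / 2) * real q"
      using Nb(2) d by (intro mult_mono mult_nonneg_nonneg) auto
    also have "\<dots> = 3 / 2 * (n * real q * (d * lam\<^sup>2))"
      using n0 by (simp add: power2_eq_square)
    also have "\<dots> \<le> 3 / 2 * (ln n / 4)" using low by (intro mult_left_mono) auto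
    also have "\<dots> \<le> ln n / 2" using n0 by simp
    finally have "exp (3 / 2 * (lam\<^sup>2 * (d / n) / (1 - d / n)) * real ?N * real q) \<le> exp (ln n / 2)" by simp
    also have "exp (ln n / 2) = sqrt n" using n0 by (simp add: ln_sqrt[symmetric])
    finally show ?thesis .
  qed
  have bound: "4 * real q / real ?N + (1 / n * exp (3 / 2 * (lam\<^sup>2 * (d / n) / (1 - d / n)) * real ?N * real q) + 2 / (real ?N * (1 / n))) / 2
     \<le> 16 * real q / (real n)\<^sup>2 + (1 / sqrt n + 8 / n) / 2"
  proof -
    have "4 * real q / real ?N \<le> 4 * real q / ((real n)\<^sup>2 / 4)"
      using Nb n0 by (intro divide_left_mono mult_pos_pos) auto
    then have h1: "4 * real q / real ?N \<le> 16 * real q / (real n)\<^sup>2" by simp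
    have "1 / n * exp (3 / 2 * (lam\<^sup>2 * (d / n) / (1 - d / n)) * real ?N * real q) \<le> 1 / n * sqrt n"
      using E by (intro mult_left_mono) auto
    also have "1 / n * sqrt n = 1 / sqrt n" using n0 by (simp add: field_simps)
    finally have h2: "1 / n * exp (3 / 2 * (lam\<^sup>2 * (d / n) / (1 - d / n)) * real ?N * real q) \<le> 1 / sqrt n" .
    have "2 / (real ?N * (1 / n)) \<le> 2 / ((real n)\<^sup>2 / 4 * (1 / n))"
      using Nb n0 by (intro divide_left_mono mult_right_mono mult_pos_pos) auto
    also have "2 / ((real n)\<^sup>2 / 4 * (1 / n)) = 8 / n" using n0 by (simp add: power2_eq_square)
    finally have h3: "2 / (real ?N * (1 / n)) \<le> 8 / n" .
    show ?thesis by (intro add_mono divide_right_mono h1 h2 h3) simp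
  qed
  have "expected_overlap n d lam q w A = mean (labels n q) (\<lambda>s. mean (bits ?N (edge_prob n d lam q s))
    (\<lambda>Y. mean (coin A) (\<lambda>r. overlap ?N (decode_estimate w (alg_out A r (map Y [0..<?N]))) (omega_slot n q s))))"
    by (rule expected_overlap_eq[OF n0 q0 d(1) lam(1)])
  also have "\<dots> = mean (labels n q) (\<lambda>s. mean (coin A) (\<lambda>r. mean (bits ?N (edge_prob n d lam q s))
    (\<lambda>Y. overlap ?N (decode_estimate w (alg_out A r (map Y [0..<?N]))) (omega_slot n q s))))"
    by (intro mean_cong mean_swap) auto
  also have "\<dots> = mean (coin A) (\<lambda>r. mean (labels n q) (\<lambda>s. mean (bits ?N (edge_prob n d lam q s))
    (\<lambda>Y. overlap ?N (decode_estimate w (alg_out A r (map Y [0..<?N]))) (omega_slot n q s))))"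
    by (rule mean_swap[OF finU]) simp
  also have "\<dots> \<le> 16 * real q / (real n)\<^sup>2 + (1 / sqrt n + 8 / n) / 2"
  proof (rule mean_le_const[OF finite_set_coin])
    fix r
    show "mean (labels n q) (\<lambda>s. mean (bits ?N (edge_prob n d lam q s))
      (\<lambda>Y. overlap ?N (decode_estimate w (alg_out A r (map Y [0..<?N]))) (omega_slot n q s)))
      \<le> 16 * real q / (real n)\<^sup>2 + (1 / sqrt n + 8 / n) / 2"
      using mean_overlap_le[of n q d lam "1 / n" "\<lambda>Y. decode_estimate w (alg_out A r (map Y [0..<?N]))"]
        n0 Nb q d dn lam range by (intro order_trans[OF _ bound]) simp
  qed
  finally show ?thesis .
qed

text \<open>Only polynomial growth matters, so all numerical constants are absorbed into powers of n
  \<ge> 2.\<close>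

lemma accept_cost_le:
  assumes n: "n \<ge> 2" and N: "N \<le> n\<^sup>2" and b: "2 ^ b \<le> 2 * n" and w: "w > 0"
  shows "accept_cost N b w \<le> w\<^sup>2 * n ^ 64"
proof -
  have pw: "2 ^ i \<le> n ^ i" for i using n by (rule power_mono) simp
  have t1: "N * Suc w * (4 * w) \<le> w\<^sup>2 * n ^ 5"
  proof -
    have "N * Suc w * (4 * w) \<le> n\<^sup>2 * (2 * w) * (4 * w)" using N w by (intro mult_mono) auto
    also have "\<dots> = 2 ^ 3 * (w\<^sup>2 * n\<^sup>2)" by (simp add: power2_eq_square)
    also have "\<dots> \<le> n ^ 3 * (w\<^sup>2 * n\<^sup>2)" by (intro mult_right_mono pw) simp
    also have "\<dots> = w\<^sup>2 * n ^ 5" by (simp add: power_add[of n 3 2, simplified])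
    finally show ?thesis .
  qed
  have t2: "w * (4 * 2 ^ (b + 5) * (2 * (N * 4 ^ Suc b) + 1) ^ 5 * N) \<le> w\<^sup>2 * n ^ 61"
  proof -
    have "4 * 2 ^ (b + 5) = 2 ^ 7 * (2::nat) ^ b" by (simp add: power_add)
    also have "\<dots> \<le> n ^ 7 * (n * n)" using pw[of 7] b n by (intro mult_mono) (auto intro: order_trans)
    also have "\<dots> = n ^ 9" by (simp add: eval_nat_numeral)
    finally have a: "4 * 2 ^ (b + 5) \<le> n ^ 9" .
    have "(4::nat) ^ Suc b = 2\<^sup>2 * (2 ^ b)\<^sup>2" by (simp add: power2_eq_square flip: power_mult_distrib)
    also have "\<dots> \<le> n\<^sup>2 * (2 * n)\<^sup>2" using b n pw[of 2] by (intro mult_mono power_mono) auto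
    also have "\<dots> \<le> n\<^sup>2 * (n * n)\<^sup>2" using n by (intro mult_left_mono power_mono) auto
    also have "\<dots> = n ^ 6" by (simp add: eval_nat_numeral)
    finally have e: "(4::nat) ^ Suc b \<le> n ^ 6" .
    have "2 * (N * 4 ^ Suc b) + 1 \<le> 2 * (n\<^sup>2 * n ^ 6) + 1" using N e by (intro add_right_mono mult_left_mono mult_mono) auto
    also have "\<dots> \<le> 2\<^sup>2 * n ^ 8" using n by (simp add: power_add[of n 2 6, simplified])
    also have "\<dots> \<le> n\<^sup>2 * n ^ 8" by (intro mult_right_mono pw) simp
    also have "\<dots> = n ^ 10" by (simp add: power_add[of n 2 8, simplified])
    finally have "(2 * (N * 4 ^ Suc b) + 1) ^ 5 \<le> (n ^ 10) ^ 5" by (rule power_mono) simp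
    then have "4 * 2 ^ (b + 5) * (2 * (N * 4 ^ Suc b) + 1) ^ 5 * N \<le> n ^ 9 * (n ^ 10) ^ 5 * n\<^sup>2"
      using a N by (intro mult_mono) auto
    also have "\<dots> = n ^ 61" by (simp flip: power_mult power_add)
    finally have "w * (4 * 2 ^ (b + 5) * (2 * (N * 4 ^ Suc b) + 1) ^ 5 * N) \<le> w * n ^ 61" by simp
    also have "\<dots> \<le> w\<^sup>2 * n ^ 61" using w by (simp add: power2_eq_square)
    finally show ?thesis .
  qed
  have t3: "4 * w \<le> w\<^sup>2 * n\<^sup>2"
  proof -
    have "4 * w \<le> n\<^sup>2 * w" using pw[of 2] by (intro mult_right_mono) auto
    also have "\<dots> \<le> n\<^sup>2 * w\<^sup>2" using w by (simp add: power2_eq_square)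
    finally show ?thesis by (simp add: mult.commute)
  qed
  have up: "n ^ i \<le> n ^ 61" if "i \<le> 61" for i using that n by (intro power_increasing) auto
  have "accept_cost N b w \<le> w\<^sup>2 * n ^ 5 + w\<^sup>2 * n ^ 61 + w\<^sup>2 * n\<^sup>2"
    unfolding accept_cost_def using t1 t2 t3 by (intro add_mono)
  also have "\<dots> \<le> w\<^sup>2 * n ^ 61 + w\<^sup>2 * n ^ 61 + w\<^sup>2 * n ^ 61"
    by (intro add_mono mult_left_mono up) auto
  also have "\<dots> = 3 * (w\<^sup>2 * n ^ 61)" by simp
  also have "\<dots> \<le> 2 ^ 3 * (w\<^sup>2 * n ^ 61)" by (intro mult_right_mono) auto
  also have "\<dots> \<le> n ^ 3 * (w\<^sup>2 * n ^ 61)" by (intro mult_right_mono pw) simp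
  also have "\<dots> = w\<^sup>2 * n ^ 64" by (simp add: power_add[of n 3 61, simplified])
  finally show ?thesis .
qed

lemma exists_power_between:
  assumes "n > 0"
  shows "\<exists>b. n \<le> 2 ^ b \<and> 2 ^ b \<le> 2 * (n::nat)"
proof -
  define b where "b = (LEAST b. n \<le> 2 ^ b)"
  have "n \<le> 2 ^ n" by (simp add: less_imp_le)
  then have b: "n \<le> 2 ^ b" unfolding b_def by (rule LeastI[where P = "\<lambda>b. n \<le> 2 ^ b"])
  show ?thesis
  proof (cases b)
    case 0
    then show ?thesis using b assms by (intro exI[of _ 0]) auto
  next
    case (Suc c)
    then have "\<not> n \<le> 2 ^ c" using not_less_Least[of c "\<lambda>b. n \<le> 2 ^ b"] by (simp add: b_def)
    then show ?thesis using b Suc by (intro exI[of _ b]) auto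
  qed
qed

text \<open>Up to constants, x and y are the two possible Chernoff exponents: y is the Gaussian
  exponent \<tau>^2 / p, and x arises where the size 1 / sqrt K of single entries limits the
  multiplier. The Chebyshev error of the planted side is controlled by their reciprocals.\<close>

lemma detection_from_recovery:
  fixes n q w M :: nat and d lam \<beta> c :: real and A :: circuit
  defines "N \<equiv> sbm_dim n" and "\<kappa> \<equiv> \<beta> * c / 4" and "x \<equiv> n * d * lam" and "y \<equiv> n * real q * (d * lam\<^sup>2)"
  assumes n: "n \<ge> 2" and q: "q \<ge> 2" and d: "0 < d" "d < n" and lam: "0 < lam" "lam \<le> 1"
    and \<beta>: "0 < \<beta>" "\<beta> < 1" and c: "0 < c" "c \<le> 1" and pm: "(1 + real q * lam) * (d / n) \<le> c\<^sup>2 / 8"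
    and A: "valid_circuit N (N * w) A" and w: "w > 0"
    and eo: "c \<le> expected_overlap n ((1 - \<beta>) * d) lam q w A"
    and M: "M > 0" and big: "64 * real q \<le> \<kappa>\<^sup>2 * real N" "32 * real q \<le> \<kappa>\<^sup>2 * real n"
  shows "\<exists>C. valid_circuit (M * N) 1 C \<and> runtime C \<le> M * (runtime A)\<^sup>2 * n ^ 70 \<and>
    detection_error (hidden_planted M (sbm n d lam q) (erdos_renyi n d)) (hidden_null M (erdos_renyi n d)) C
      \<le> M * exp (- (\<kappa>\<^sup>2 / 2048) * min x y) + 1 - (\<beta> * c / 4 - 4 * real q / N - 512 / \<kappa>\<^sup>2 * (1 / x + 1 / y))"
proof -
  note Nb = sbm_dim_bounds[OF n, folded N_def]
  have n0: "n > 0" and q0: "q > 0" and qr: "real q > 0" using n q by auto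
  have N0: "real N > 0" using Nb by simp
  have kp: "\<kappa> > 0" using \<beta> c by (simp add: \<kappa>_def)
  define p where "p = d / n"
  have p: "0 < p" "p < 1" using d n0 by (auto simp: p_def)
  \<comment> \<open>With 2^b of order n, rounding is negligible and the branching programs keep
    polynomially many states.\<close>
  obtain b where b: "n \<le> 2 ^ b" "2 ^ b \<le> 2 * n" using exists_power_between[OF n0] by blast
  \<comment> \<open>This is \<mu>^2 / q^2, the largest K for which the dropped entries are
    harmless.\<close>
  define Kr where "Kr = \<kappa>\<^sup>2 * real N / (32 * real q)"
  define K where "K = nat \<lfloor>Kr\<rfloor>"
  have Kr: "2 \<le> Kr" using big(1) qr by (simp add: Kr_def le_divide_eq)
  have K: "real K \<le> Kr" "Kr / 2 \<le> real K"
  proof -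
    have "real K = of_int \<lfloor>Kr\<rfloor>" using Kr by (simp add: K_def)
    then show "real K \<le> Kr" "Kr / 2 \<le> real K" using Kr by linarith+
  qed
  have K0: "K > 0" using K(2) Kr by (cases K) auto
  define \<mu> where "\<mu> = \<kappa> / 4 * sqrt (real N * real q / 2)"
  have mu: "\<mu> > 0" using kp N0 qr by (simp add: \<mu>_def)
  have mu2: "\<mu>\<^sup>2 = \<kappa>\<^sup>2 * real N * real q / 32"
    using N0 qr by (simp add: \<mu>_def power_mult_distrib power_divide)
  define \<tau> where "\<tau> = lam * p * \<mu> / 2"
  have tau: "\<tau> > 0" using lam p mu by (simp add: \<tau>_def)
  have small1: "sqrt (real K) * real q \<le> \<mu>"
  proof (rule power2_le_imp_le)
    have "(sqrt (real K) * real q)\<^sup>2 = real K * (real q)\<^sup>2" by (simp add: power_mult_distrib)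
    also have "\<dots> \<le> Kr * (real q)\<^sup>2" using K by (intro mult_right_mono) auto
    also have "\<dots> = \<mu>\<^sup>2" unfolding mu2 Kr_def using qr by (simp add: power2_eq_square)
    finally show "(sqrt (real K) * real q)\<^sup>2 \<le> \<mu>\<^sup>2" .
  qed (use mu in simp)
  have small2: "sqrt (real N) \<le> \<kappa> / 4 * sqrt (real K) * 2 ^ b"
  proof (rule power2_le_imp_le)
    have "1024 * real q \<le> (32 * real q)\<^sup>2" using q by (simp add: power2_eq_square)
    also have "\<dots> \<le> (\<kappa>\<^sup>2 * real n)\<^sup>2" using big(2) by (intro power_mono) auto
    finally have "real N * (1024 * real q) \<le> real N * (\<kappa>\<^sup>2 * real n)\<^sup>2" using N0 by (intro mult_left_mono) auto
    then have "real N \<le> \<kappa>\<^sup>2 / 16 * (Kr / 2) * (real n)\<^sup>2"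
      using qr by (simp add: Kr_def field_simps power2_eq_square)
    also have "\<dots> \<le> \<kappa>\<^sup>2 / 16 * real K * (2 ^ b)\<^sup>2"
    proof (intro mult_mono power_mono)
      have "real n \<le> real (2 ^ b)" using b(1) by (simp only: of_nat_le_iff)
      then show "real n \<le> 2 ^ b" by simp
    qed (use K in auto)
    finally show "(sqrt (real N))\<^sup>2 \<le> (\<kappa> / 4 * sqrt (real K) * 2 ^ b)\<^sup>2"
      by (simp add: power_mult_distrib power_divide)
  qed (use kp in simp)
  obtain r B where rB: "length r = coins A" "B \<subseteq> {..<N}"
    "\<beta> * c / 4 - 4 * real q / real N - (1 + real q * lam) * p / \<tau>\<^sup>2
       \<le> mean (sbm n d lam q) (\<lambda>y. of_bool (block_test A r B N w K b p \<tau> ((!) y)))"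
    using good_mask_exists[of n q d lam \<beta> c w A K b] n0 Nb q d lam \<beta> c pm A w eo K0 small1 small2
    unfolding N_def p_def \<tau>_def \<mu>_def \<kappa>_def by auto
  obtain C where C: "valid_circuit (M * N) 1 C"
    "runtime C \<le> 4 + M * (length (gates A) + accept_cost N b w) + 4 * M"
    "\<And>x. length x = M * N \<Longrightarrow> run C x = return_pmf [\<exists>\<kappa><M. block_test A r B N w K b p \<tau> (\<lambda>k. x ! (\<kappa> * N + k))]"
    using detection_circuit[OF A rB(1) w rB(2) M Nb(3)] by blast
  have "runtime C \<le> M * (runtime A)\<^sup>2 * n ^ 70"
  proof -
    let ?G = "runtime A"
    \<comment> \<open>Writing the output takes N w steps, so w is at most the running time. The
      factor w^2 in the cost of acceptance is the origin of the squared running time.\<close>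
    have "?G = length (gates A) + N * w" using A by (simp add: runtime_def valid_circuit_def)
    moreover have "w \<le> N * w" "0 < N * w" using Nb w by auto
    ultimately have G: "length (gates A) \<le> ?G" "w \<le> ?G" "1 \<le> ?G" by linarith+
    have "?G \<le> ?G\<^sup>2" using G(3) by (simp add: power2_eq_square)
    then have g1: "length (gates A) \<le> ?G\<^sup>2" using G(1) by simp
    have "accept_cost N b w \<le> w\<^sup>2 * n ^ 64" by (rule accept_cost_le[OF n Nb(4) b(2) w])
    also have "\<dots> \<le> ?G\<^sup>2 * n ^ 64" using G by (intro mult_right_mono power_mono) auto
    finally have g2: "accept_cost N b w \<le> ?G\<^sup>2 * n ^ 64" .
    have one: "1 \<le> ?G\<^sup>2" using G(3) by simp
    have n64: "1 \<le> n ^ 64" using n0 by simp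
    have "runtime C \<le> 4 * M + M * (?G\<^sup>2 + ?G\<^sup>2 * n ^ 64) + 4 * M"
      using C(2) M g1 g2 by (elim order_trans) (intro add_mono mult_left_mono, auto)
    also have "\<dots> = M * (8 + ?G\<^sup>2 + ?G\<^sup>2 * n ^ 64)" by (simp add: algebra_simps)
    also have "\<dots> \<le> M * (8 * (?G\<^sup>2 * n ^ 64) + ?G\<^sup>2 * n ^ 64 + ?G\<^sup>2 * n ^ 64)"
      using one n64 by (intro mult_left_mono add_mono) (auto simp: Suc_le_eq)
    also have "\<dots> = M * (10 * (?G\<^sup>2 * n ^ 64))" by simp
    also have "\<dots> \<le> M * (n ^ 6 * (?G\<^sup>2 * n ^ 64))"
    proof (intro mult_left_mono mult_right_mono)
      have "(2::nat) ^ 6 \<le> n ^ 6" using n by (rule power_mono) simp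
      then show "10 \<le> n ^ 6" by simp
    qed auto
    also have "\<dots> = M * ?G\<^sup>2 * n ^ 70" by (simp add: power_add[of n 6 64, simplified])
    finally show ?thesis .
  qed
  moreover have "detection_error (hidden_planted M (sbm n d lam q) (erdos_renyi n d)) (hidden_null M (erdos_renyi n d)) C
      \<le> M * exp (- (\<kappa>\<^sup>2 / 2048) * min x y) + 1 - (\<beta> * c / 4 - 4 * real q / N - 512 / \<kappa>\<^sup>2 * (1 / x + 1 / y))"
  proof -
    let ?t = "block_test A r B N w K b p \<tau>"
    have finU: "finite (set_pmf (labels n q))" by (rule finite_set_labels[OF q0])
    have "detection_error (hidden_planted M (sbm n d lam q) (erdos_renyi n d)) (hidden_null M (erdos_renyi n d)) C
      \<le> real M * mean (erdos_renyi n d) (\<lambda>y. of_bool (?t ((!) y))) + (1 - mean (sbm n d lam q) (\<lambda>y. of_bool (?t ((!) y))))"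
    proof (rule detection_error_le[OF _ _ _ _ M C(3)])
      show "finite (set_pmf (sbm n d lam q))" unfolding sbm_sample[OF q0] using finU by simp
      show "finite (set_pmf (erdos_renyi n d))" unfolding erdos_renyi_sample by simp
      show "length y = N" if "y \<in> set_pmf (sbm n d lam q)" for y
        using that unfolding sbm_sample[OF q0] N_def by auto
      show "length y = N" if "y \<in> set_pmf (erdos_renyi n d)" for y
        using that unfolding erdos_renyi_sample N_def by auto
      show "?t Y = ?t Y'" if "\<And>k. k < N \<Longrightarrow> Y k = Y' k" for Y Y'
        using rB(2) that by (rule block_test_cong)
    qed
    moreover have "mean (erdos_renyi n d) (\<lambda>y. of_bool (?t ((!) y))) \<le> exp (- (\<kappa>\<^sup>2 / 2048) * min x y)"
    proof -
      \<comment> \<open>The exponent - u \<tau> + u^2 p is minimal at \<tau> / (2 p). The cap sqrt K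
        / 2 is the range of the exponential bound, and in both cases the exponent is at most - u
        \<tau> / 2.\<close>
      define u where "u = min (sqrt (real K) / 2) (\<tau> / (2 * p))"
      have u: "0 \<le> u" "2 * u \<le> sqrt (real K)" "u \<le> \<tau> / (2 * p)" using tau p by (auto simp: u_def)
      have "mean (erdos_renyi n d) (\<lambda>y. of_bool (?t ((!) y))) \<le> exp (- (u * \<tau>) + u\<^sup>2 * p)"
        unfolding N_def p_def using d n0 rB(2) K0 u(1,2) by (intro block_test_null_le) (auto simp: N_def)
      also have "- (u * \<tau>) + u\<^sup>2 * p \<le> - (u * \<tau> / 2)"
      proof -
        have "u * (u * p) \<le> u * (\<tau> / 2)" using u p by (intro mult_left_mono) (auto simp: le_divide_eq mult_ac)
        then show ?thesis by (simp add: power2_eq_square mult.assoc)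
      qed
      also have "- (u * \<tau> / 2) \<le> - (\<kappa>\<^sup>2 / 2048) * min x y"
      proof -
        have "\<kappa>\<^sup>2 / 2048 * min x y \<le> u * \<tau> / 2"
        proof (cases "sqrt (real K) / 2 \<le> \<tau> / (2 * p)")
          case True
          have "\<kappa>\<^sup>2 * real N / 64 \<le> sqrt (real K) * \<mu>"
          proof (rule power2_le_imp_le)
            have "(\<kappa>\<^sup>2 * real N / 64)\<^sup>2 \<le> (Kr / 2) * \<mu>\<^sup>2"
            proof -
              have "(Kr / 2) * \<mu>\<^sup>2 = (\<kappa>\<^sup>2 * real N)\<^sup>2 / 2048" unfolding mu2 Kr_def using qr by (simp add: power2_eq_square)
              moreover have "(\<kappa>\<^sup>2 * real N / 64)\<^sup>2 = (\<kappa>\<^sup>2 * real N)\<^sup>2 / 4096" by (simp add: power_divide)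
              moreover have "0 \<le> (\<kappa>\<^sup>2 * real N)\<^sup>2" by simp
              ultimately show ?thesis by linarith
            qed
            also have "\<dots> \<le> real K * \<mu>\<^sup>2" using K by (intro mult_right_mono) auto
            finally show "(\<kappa>\<^sup>2 * real N / 64)\<^sup>2 \<le> (sqrt (real K) * \<mu>)\<^sup>2" by (simp add: power_mult_distrib)
          qed (use mu in simp)
          then have "lam * p / 8 * (\<kappa>\<^sup>2 * real N / 64) \<le> lam * p / 8 * (sqrt (real K) * \<mu>)"
            using lam p by (intro mult_left_mono) auto
          moreover have "lam * p / 8 * (\<kappa>\<^sup>2 * ((real n)\<^sup>2 / 4) / 64) \<le> lam * p / 8 * (\<kappa>\<^sup>2 * real N / 64)"
            using lam p Nb(1) by (intro mult_left_mono divide_right_mono) auto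
          moreover have "lam * p / 8 * (\<kappa>\<^sup>2 * ((real n)\<^sup>2 / 4) / 64) = \<kappa>\<^sup>2 / 2048 * x"
            using n0 by (simp add: x_def p_def power2_eq_square)
          moreover have "u * \<tau> / 2 = lam * p / 8 * (sqrt (real K) * \<mu>)" using True by (simp add: u_def \<tau>_def)
          moreover have "\<kappa>\<^sup>2 / 2048 * min x y \<le> \<kappa>\<^sup>2 / 2048 * x" by (intro mult_left_mono) auto
          ultimately show ?thesis by linarith
        next
          case False
          then have "u * \<tau> / 2 = \<tau>\<^sup>2 / (4 * p)" by (simp add: u_def power2_eq_square)
          also have "\<dots> = lam\<^sup>2 * p * \<mu>\<^sup>2 / 16" using p by (simp add: \<tau>_def power_mult_distrib power_divide) (simp add: power2_eq_square)
          also have "\<dots> = lam\<^sup>2 * p * \<kappa>\<^sup>2 * real q / 512 * real N" by (simp add: mu2)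
          also have "\<dots> \<ge> lam\<^sup>2 * p * \<kappa>\<^sup>2 * real q / 512 * ((real n)\<^sup>2 / 4)"
            using Nb(1) p by (intro mult_left_mono) auto
          also have "lam\<^sup>2 * p * \<kappa>\<^sup>2 * real q / 512 * ((real n)\<^sup>2 / 4) = \<kappa>\<^sup>2 / 2048 * y"
            using n0 by (simp add: y_def p_def power2_eq_square)
          finally have "\<kappa>\<^sup>2 / 2048 * y \<le> u * \<tau> / 2" .
          moreover have "\<kappa>\<^sup>2 / 2048 * min x y \<le> \<kappa>\<^sup>2 / 2048 * y" by (intro mult_left_mono) auto
          ultimately show ?thesis by linarith
        qed
        then show ?thesis by simp
      qed
      finally show ?thesis by simp
    qed
    then have "real M * mean (erdos_renyi n d) (\<lambda>y. of_bool (?t ((!) y))) \<le> real M * exp (- (\<kappa>\<^sup>2 / 2048) * min x y)"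
      by (intro mult_left_mono) auto
    moreover have "(1 + real q * lam) * p / \<tau>\<^sup>2 \<le> 512 / \<kappa>\<^sup>2 * (1 / x + 1 / y)"
    proof -
      have "\<tau>\<^sup>2 = lam\<^sup>2 * p\<^sup>2 * \<kappa>\<^sup>2 * real q / 128 * real N" by (simp add: \<tau>_def power_mult_distrib power_divide mu2)
      also have "\<dots> \<ge> lam\<^sup>2 * p\<^sup>2 * \<kappa>\<^sup>2 * real q / 128 * ((real n)\<^sup>2 / 4)"
        using Nb(1) by (intro mult_left_mono) auto
      finally have "(1 + real q * lam) * p / \<tau>\<^sup>2 \<le> (1 + real q * lam) * p / (lam\<^sup>2 * p\<^sup>2 * \<kappa>\<^sup>2 * real q / 128 * ((real n)\<^sup>2 / 4))"
        using lam p kp qr n0 tau by (intro divide_left_mono mult_pos_pos) auto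
      also have "\<dots> = 512 / \<kappa>\<^sup>2 * (1 / x + 1 / y)"
        using lam d kp qr n0 by (simp add: x_def y_def p_def power2_eq_square field_simps)
      finally show ?thesis .
    qed
    ultimately show ?thesis using rB(3) by linarith
  qed
  ultimately show ?thesis using C(1) by blast
qed

section \<open>Asymptotics\<close>

lemma smallo_bound:
  assumes "d \<in> o(\<lambda>n. real n)" "e > 0"
  shows "\<forall>\<^sub>F n in sequentially. d n \<le> e * real n"
  using landau_o.smallD[OF assms] by (rule eventually_mono) auto

text \<open>From (\<lambda> d)^2 = (d \<lambda>^2) d \<le> n, the term q \<lambda> d / n is at most
  q / sqrt n even where d is large.\<close>

lemma edge_prob_bound:
  assumes "n > 0" "0 < d" "d \<le> e * n" "d \<le> n" "0 \<le> lam" "d * lam\<^sup>2 \<le> 1"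
  shows "(1 + real q * lam) * (d / n) \<le> e + real q / sqrt n"
proof -
  have "(lam * d)\<^sup>2 = (d * lam\<^sup>2) * d" by (simp add: power2_eq_square)
  also have "\<dots> \<le> 1 * n" using assms by (intro mult_mono) auto
  finally have "lam * d \<le> sqrt n" by (intro real_le_rsqrt) simp
  then have "lam * d / n \<le> sqrt n / n" using assms by (intro divide_right_mono) auto
  also have "sqrt n / n = 1 / sqrt n" using assms by (simp add: field_simps)
  finally have "real q * (lam * d / n) \<le> real q * (1 / sqrt n)" by (intro mult_left_mono) auto
  moreover have "d / n \<le> e" using assms by (simp add: divide_le_eq)
  moreover have "(1 + real q * lam) * (d / n) = d / n + real q * (lam * d / n)"
    by (simp only: distrib_right mult_1 times_divide_eq_right mult.assoc add_divide_distrib)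
  moreover have "real q * (1 / sqrt n) = real q / sqrt n" by simp
  ultimately show ?thesis by linarith
qed

text \<open>The information-theoretic bound \<open>expected_overlap_le\<close> read backwards: a
  weaker signal would force the overlap below c.\<close>

lemma recovery_signal_lower:
  fixes d lam :: "nat \<Rightarrow> real" and q :: "nat \<Rightarrow> nat"
  assumes d: "\<forall>\<^sub>F n in sequentially. d n > 0 \<and> 0 < lam n \<and> lam n < 1" "d \<in> o(\<lambda>n. real n)"
    and q: "\<forall>\<^sub>F n in sequentially. 2 \<le> q n" "\<forall>\<^sub>F n in sequentially. real (q n) \<le> real n powr (1 / 8)"
    and s: "\<forall>\<^sub>F n in sequentially. d n * (lam n)\<^sup>2 \<le> 1"
    and eo: "c > 0" "\<forall>\<^sub>F n in sequentially. c \<le> expected_overlap n (d n) (lam n) (q n) (w n) (A n)"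
  shows "\<forall>\<^sub>F n in sequentially. ln (real n) / 4 \<le> n * real (q n) * (d n * (lam n)\<^sup>2)"
proof -
  have "\<forall>\<^sub>F n in sequentially. 16 * real n powr (1 / 8) / (real n)\<^sup>2 + (1 / sqrt n + 8 / n) / 2 < c"
    using eo(1) by real_asymp
  moreover have "\<forall>\<^sub>F n in sequentially. 1 / 2 + real n powr (1 / 8) / sqrt n \<le> 1" by real_asymp
  moreover have "\<forall>\<^sub>F n in sequentially. d n \<le> 1 / 2 * real n" by (rule smallo_bound[OF d(2)]) simp
  ultimately show ?thesis
    using d(1) q s eo(2) eventually_ge_at_top[of 2]
  proof eventually_elim
    case (elim n)
    show ?case
    proof (rule ccontr)
      assume "\<not> ?thesis"
      then have low: "n * real (q n) * (d n * (lam n)\<^sup>2) \<le> ln (real n) / 4" by simp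
      have "(1 + real (q n) * lam n) * (d n / n) \<le> 1 / 2 + real (q n) / sqrt n"
        using elim by (intro edge_prob_bound) auto
      also have "\<dots> \<le> 1 / 2 + real n powr (1 / 8) / sqrt n"
        using elim by (intro add_left_mono divide_right_mono) auto
      finally have range: "(1 + real (q n) * lam n) * (d n / n) \<le> 1" using elim by linarith
      have "c \<le> 16 * real (q n) / (real n)\<^sup>2 + (1 / sqrt n + 8 / n) / 2"
        using elim range low by (intro order_trans[OF _ expected_overlap_le]) auto
      also have "\<dots> \<le> 16 * real n powr (1 / 8) / (real n)\<^sup>2 + (1 / sqrt n + 8 / n) / 2"
        using elim by (intro add_right_mono divide_right_mono mult_left_mono) auto
      finally show False using elim by linarith
    qed
  qed
qed

lemma sbm_regimeE:
  fixes d lam :: "nat \<Rightarrow> real" and q :: "nat \<Rightarrow> nat"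
  assumes "sbm_regime d lam q"
  obtains \<delta> where "0 < \<delta>" "\<delta> \<le> 1" "\<forall>\<^sub>F n in sequentially. d n > 0 \<and> 0 < lam n \<and> lam n < 1"
    "d \<in> o(\<lambda>n. real n)" "\<forall>\<^sub>F n in sequentially. 2 \<le> q n"
    "\<forall>\<^sub>F n in sequentially. real (q n) \<le> real n powr (1 / 8)"
    "\<forall>\<^sub>F n in sequentially. d n * (lam n)\<^sup>2 < 1 - \<delta>"
proof -
  from assms obtain \<epsilon> \<delta> where *: "\<forall>\<^sub>F n in sequentially. d n > 0 \<and> 0 < lam n \<and> lam n < 1" "d \<in> o(\<lambda>n. real n)"
    "\<forall>\<^sub>F n in sequentially. 2 \<le> q n" "\<epsilon> > 0" "\<forall>\<^sub>F n in sequentially. real (q n) \<le> real n powr (1 / 8 - \<epsilon>)"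
    "\<delta> > 0" "\<forall>\<^sub>F n in sequentially. d n * (lam n)\<^sup>2 < 1 - \<delta>"
    by (auto simp: sbm_regime_def)
  show ?thesis
  proof (rule that[of "min \<delta> 1"])
    show "\<forall>\<^sub>F n in sequentially. real (q n) \<le> real n powr (1 / 8)"
      using *(5) eventually_ge_at_top[of 1]
    proof eventually_elim
      case (elim n)
      have "real n powr (1 / 8 - \<epsilon>) \<le> real n powr (1 / 8)" using elim *(4) by (intro powr_mono) auto
      then show ?case using elim by linarith
    qed
    show "\<forall>\<^sub>F n in sequentially. d n * (lam n)\<^sup>2 < 1 - min \<delta> 1"
      using *(7) by (rule eventually_mono) auto
  qed (use * in auto)
qed

text \<open>The graph is observed at a larger average degree \<open>d'\<close> of which the algorithm sees a thinned
  copy. A constant factor suffices unless the expected number of informative edges is small; then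
  \<open>d' = \<surd>n d\<close> still lies below the threshold.\<close>

lemma exists_denser_model:
  fixes d lam :: "nat \<Rightarrow> real" and q :: "nat \<Rightarrow> nat"
  assumes regime: "sbm_regime d lam q"
    and eo: "c > 0" "\<forall>\<^sub>F n in sequentially. c \<le> expected_overlap n (d n) (lam n) (q n) (w n) (A n)"
  obtains \<beta> d' :: "nat \<Rightarrow> real" and \<beta>0 :: real where "\<beta>0 > 0" "\<forall>\<^sub>F n in sequentially. \<beta>0 \<le> \<beta> n \<and> \<beta> n < 1 \<and> d n = (1 - \<beta> n) * d' n"
    "sbm_regime d' lam q" "\<forall>\<^sub>F n in sequentially. real n powr (1 / 4) \<le> n * d' n * lam n"
    "\<forall>\<^sub>F n in sequentially. ln (real n) / 4 \<le> n * real (q n) * (d' n * (lam n)\<^sup>2)"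
proof -
  obtain \<delta> where \<delta>: "0 < \<delta>" "\<delta> \<le> 1" and dl: "\<forall>\<^sub>F n in sequentially. d n > 0 \<and> 0 < lam n \<and> lam n < 1"
    and do: "d \<in> o(\<lambda>n. real n)" and q2: "\<forall>\<^sub>F n in sequentially. 2 \<le> q n"
    and q8: "\<forall>\<^sub>F n in sequentially. real (q n) \<le> real n powr (1 / 8)"
    and s: "\<forall>\<^sub>F n in sequentially. d n * (lam n)\<^sup>2 < 1 - \<delta>"
    using sbm_regimeE[OF regime] .
  have s1: "\<forall>\<^sub>F n in sequentially. d n * (lam n)\<^sup>2 \<le> 1"
    using s by (rule eventually_mono) (use \<delta> in auto)
  have low: "\<forall>\<^sub>F n in sequentially. ln (real n) / 4 \<le> n * real (q n) * (d n * (lam n)\<^sup>2)"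
    by (rule recovery_signal_lower[OF dl do q2 q8 s1 eo])
  \<comment> \<open>The rate \<delta> / 2 keeps d' \<lambda>^2 below 1 - \<delta> / 2, because 1 -
    \<delta> \<le> (1 - \<delta> / 2)^2. The other rate is the one for which d' = sqrt n *
    d.\<close>
  define \<beta> where "\<beta> n = (if real n powr (1 / 4) \<le> n * d n * lam n then \<delta> / 2 else 1 - 1 / sqrt n)" for n
  define d' where "d' n = d n / (1 - \<beta> n)" for n
  have as: "\<forall>\<^sub>F n in sequentially. 1 - 1 / sqrt (real n) \<ge> 1 / 2"
    "\<forall>\<^sub>F n in sequentially. ln (real n) \<ge> 1"
    "\<forall>\<^sub>F n in sequentially. 4 * real n powr (1 / 8) \<le> sqrt n"
    "\<forall>\<^sub>F n in sequentially. real n powr (- 1 / 4) < 1 / 2"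
    "\<forall>\<^sub>F n in sequentially. real n powr (1 / 4) \<le> sqrt n / (4 * real n powr (1 / 8))"
    by real_asymp+
  have b: "\<forall>\<^sub>F n in sequentially. \<delta> / 2 \<le> \<beta> n \<and> \<beta> n < 1 \<and> d n = (1 - \<beta> n) * d' n"
    using as(1) eventually_ge_at_top[of 1]
  proof eventually_elim
    case (elim n)
    have "\<delta> / 2 \<le> 1 / 2" using \<delta> by simp
    then have "\<delta> / 2 \<le> 1 - 1 / sqrt n" using elim by linarith
    moreover have "\<beta> n = \<delta> / 2 \<or> \<beta> n = 1 - 1 / sqrt n" by (simp add: \<beta>_def)
    moreover have "0 < 1 / sqrt n" using elim by simp
    ultimately have "\<delta> / 2 \<le> \<beta> n \<and> \<beta> n < 1" using \<delta> by (elim disjE; intro conjI; linarith)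
    then show ?case by (simp add: d'_def)
  qed
  text \<open>In the sparse case the lower bound on \<open>n q d \<lambda>\<^sup>2\<close> forces \<open>\<lambda>\<close> to be large and \<open>d\<close> to be small.\<close>
  have sparse: "\<forall>\<^sub>F n in sequentially. \<not> real n powr (1 / 4) \<le> n * d n * lam n \<longrightarrow>
      d' n = sqrt n * d n \<and> d' n \<le> sqrt n \<and> d' n * (lam n)\<^sup>2 \<le> real n powr (- 1 / 4) \<and> real n powr (1 / 4) \<le> n * d' n * lam n"
    using as dl q2 q8 low eventually_ge_at_top[of 1]
  proof eventually_elim
    case (elim n)
    show ?case
    proof
      assume c: "\<not> real n powr (1 / 4) \<le> n * d n * lam n"
      have n: "real n > 0" using elim by simp
      have dn: "d n > 0" "lam n > 0" "lam n < 1" using elim by auto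
      have d'eq: "d' n = sqrt n * d n" using c n by (simp add: d'_def \<beta>_def)
      have pw: "real n powr (1 / 4) * real n powr (1 / 4) = sqrt n" "real n = sqrt n * sqrt n"
        using n by (simp_all add: powr_add[symmetric] powr_half_sqrt)
      have quarter: "1 / 4 \<le> n * real (q n) * (d n * (lam n)\<^sup>2)" using elim by simp
      also have "\<dots> = (real (q n) * lam n) * (n * d n * lam n)" by (simp add: power2_eq_square)
      also have "\<dots> \<le> (real n powr (1 / 8) * lam n) * real n powr (1 / 4)"
        using elim c dn by (intro mult_mono) auto
      finally have lam: "1 / 4 \<le> lam n * (real n powr (1 / 8) * real n powr (1 / 4))" by (simp add: mult_ac)
      have "d n * n * lam n * 1 \<le> real n powr (1 / 4) * (4 * (lam n * (real n powr (1 / 8) * real n powr (1 / 4))))"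
        using c lam dn n by (intro mult_mono) (auto simp: mult_ac)
      then have "lam n * (d n * n) \<le> lam n * (4 * real n powr (1 / 8) * (real n powr (1 / 4) * real n powr (1 / 4)))"
        by (simp add: mult_ac)
      then have "d n * n \<le> 4 * real n powr (1 / 8) * sqrt n" using dn pw by (simp only: mult_le_cancel_left_pos)
      then have "sqrt n * (sqrt n * d n) \<le> sqrt n * (4 * real n powr (1 / 8))"
        using pw(2) by (metis mult.assoc mult.commute)
      then have "d' n \<le> 4 * real n powr (1 / 8)" using n by (simp add: d'eq)
      then have 1: "d' n \<le> sqrt n" using elim by linarith
      have "d' n * (lam n)\<^sup>2 \<le> d' n * lam n"
        using dn n by (intro mult_left_mono) (auto simp: d'eq power2_eq_square mult_left_le_one_le)
      also have "\<dots> = (n * d n * lam n) / sqrt n" using n by (simp add: d'eq field_simps)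
      also have "\<dots> \<le> real n powr (1 / 4) / sqrt n" using c by (intro divide_right_mono) auto
      also have "\<dots> = real n powr (- 1 / 4)" using n by (simp add: powr_diff[symmetric] flip: powr_half_sqrt)
      finally have 2: "d' n * (lam n)\<^sup>2 \<le> real n powr (- 1 / 4)" .
      have "real n powr (1 / 4) \<le> sqrt n / (4 * real n powr (1 / 8))" using elim by simp
      also have "\<dots> \<le> sqrt n / (4 * real (q n))" using elim by (intro divide_left_mono) auto
      also have "\<dots> = sqrt n * (1 / 4) / real (q n)" by simp
      also have "\<dots> \<le> sqrt n * (n * real (q n) * (d n * (lam n)\<^sup>2)) / real (q n)"
        using quarter by (intro divide_right_mono mult_left_mono) auto
      also have "\<dots> = (n * d' n * lam n) * lam n" using elim by (simp add: d'eq power2_eq_square)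
      also have "\<dots> \<le> (n * d' n * lam n) * 1" using dn n by (intro mult_left_mono) (auto simp: d'eq)
      finally have 3: "real n powr (1 / 4) \<le> n * d' n * lam n" by simp
      show "d' n = sqrt n * d n \<and> d' n \<le> sqrt n \<and> d' n * (lam n)\<^sup>2 \<le> real n powr (- 1 / 4) \<and> real n powr (1 / 4) \<le> n * d' n * lam n"
        using d'eq 1 2 3 by blast
    qed
  qed
  have d'_ge: "\<forall>\<^sub>F n in sequentially. d n \<le> d' n"
    using b dl
  proof eventually_elim
    case (elim n)
    have "(1 - \<beta> n) * d' n \<le> 1 * d' n" using elim \<delta> by (intro mult_right_mono) (auto simp: d'_def)
    then show ?case using elim by simp
  qed
  have d'_le: "\<forall>\<^sub>F n in sequentially. d' n \<le> 2 * d n + sqrt n"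
    using sparse dl
  proof eventually_elim
    case (elim n)
    show ?case
    proof (cases "real n powr (1 / 4) \<le> n * d n * lam n")
      case True
      then have "d' n = d n / (1 - \<delta> / 2)" by (simp add: d'_def \<beta>_def)
      also have "\<dots> \<le> d n / (1 / 2)" using \<delta> elim by (intro divide_left_mono) auto
      also have "\<dots> = 2 * d n" by simp
      finally show ?thesis by (rule order_trans) simp
    next
      case False
      then have "d' n \<le> sqrt n" using elim by blast
      then show ?thesis using elim by linarith
    qed
  qed
  have regime': "sbm_regime d' lam q"
    unfolding sbm_regime_def
  proof (intro conjI)
    show "\<forall>\<^sub>F n in sequentially. d' n > 0 \<and> 0 < lam n \<and> lam n < 1"
      using dl d'_ge by eventually_elim auto
    show "d' \<in> o(\<lambda>n. real n)"
    proof (rule landau_o.smallI)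
      fix e :: real assume e: "e > 0"
      have "\<forall>\<^sub>F n in sequentially. sqrt (real n) \<le> e / 2 * n" using e by real_asymp
      moreover have "\<forall>\<^sub>F n in sequentially. d n \<le> e / 4 * real n" by (rule smallo_bound[OF do]) (use e in simp)
      ultimately show "\<forall>\<^sub>F n in sequentially. norm (d' n) \<le> e * norm (real n)"
        using d'_le d'_ge dl by eventually_elim auto
    qed
    show "\<exists>\<delta>>0. \<forall>\<^sub>F n in sequentially. d' n * (lam n)\<^sup>2 < 1 - \<delta>"
    proof (intro exI[of _ "\<delta> / 2"] conjI)
      show "\<forall>\<^sub>F n in sequentially. d' n * (lam n)\<^sup>2 < 1 - \<delta> / 2"
        using sparse s as(4)
      proof eventually_elim
        case (elim n)
        show ?case
        proof (cases "real n powr (1 / 4) \<le> n * d n * lam n")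
          case True
          have "d' n * (lam n)\<^sup>2 = d n * (lam n)\<^sup>2 / (1 - \<delta> / 2)" using True by (simp add: d'_def \<beta>_def)
          also have "\<dots> < (1 - \<delta>) / (1 - \<delta> / 2)" using elim \<delta> by (intro divide_strict_right_mono) auto
          also have "\<dots> \<le> 1 - \<delta> / 2"
          proof (subst pos_divide_le_eq)
            show "1 - \<delta> \<le> (1 - \<delta> / 2) * (1 - \<delta> / 2)"
              using zero_le_square[of \<delta>] by (simp add: algebra_simps)
          qed (use \<delta> in simp)
          finally show ?thesis .
        next
          case False
          then have "d' n * (lam n)\<^sup>2 \<le> real n powr (- 1 / 4)" using elim by blast
          then show ?thesis using elim \<delta> by linarith
        qed
      qed
    qed (use \<delta> in simp)
  qed (use regime in \<open>auto simp: sbm_regime_def\<close>)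
  show ?thesis
  proof (rule that[of "\<delta> / 2" \<beta> d'])
    show "\<forall>\<^sub>F n in sequentially. real n powr (1 / 4) \<le> n * d' n * lam n"
      using sparse d'_ge dl
    proof eventually_elim
      case (elim n)
      show ?case
      proof (cases "real n powr (1 / 4) \<le> n * d n * lam n")
        case True
        have "n * d n * lam n \<le> n * d' n * lam n" using elim by (intro mult_right_mono mult_left_mono) auto
        then show ?thesis using True by linarith
      qed (use elim in blast)
    qed
    show "\<forall>\<^sub>F n in sequentially. ln (real n) / 4 \<le> n * real (q n) * (d' n * (lam n)\<^sup>2)"
      using low d'_ge
    proof eventually_elim
      case (elim n)
      have "n * real (q n) * (d n * (lam n)\<^sup>2) \<le> n * real (q n) * (d' n * (lam n)\<^sup>2)"
        using elim by (intro mult_left_mono mult_right_mono) auto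
      then show ?case using elim by linarith
    qed
  qed (use \<delta> b regime' in auto)
qed

text \<open>The square of the logarithm makes D ln (1 + n q^4) an arbitrarily small fraction of n /
  q^2 for large n; with a single logarithm a constant would have to be tuned to the gap
  \<delta>.\<close>

definition test_degree :: "nat \<Rightarrow> nat \<Rightarrow> nat" where
  "test_degree n q = nat \<lfloor>real n / (real q ^ 4 * (ln n)\<^sup>2)\<rfloor>"

text \<open>Here s stands for d \<lambda>^2. The factor 3 adds a tail of at most 1 to the factor 2
  of the typical part, and the factor 2 in the exponent absorbs (1 + a) / (1 - d / n).\<close>

definition adv_bound_sq :: "nat \<Rightarrow> nat \<Rightarrow> real \<Rightarrow> real" where
  "adv_bound_sq n q s = 3 * exp (2 * s * (real q)\<^sup>2 * ln (real n + 1))"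

lemma ereal_sq_le:
  assumes "0 \<le> x" "x \<le> ereal (sqrt b)" "0 \<le> b"
  shows "x\<^sup>2 \<le> ereal b"
proof -
  have "x\<^sup>2 \<le> ereal (sqrt b) * ereal (sqrt b)"
    unfolding power2_eq_square using assms by (intro ereal_mult_mono) auto
  then show ?thesis using assms by simp
qed

lemma sbm_adv_sq_le:
  fixes d lam :: "nat \<Rightarrow> real" and q :: "nat \<Rightarrow> nat"
  assumes "sbm_regime d lam q"
  shows "\<forall>\<^sub>F n in sequentially. (adv (sbm_dim n) (test_degree n (q n)) (sbm n (d n) (lam n) (q n)) (erdos_renyi n (d n)))\<^sup>2
    \<le> ereal (adv_bound_sq n (q n) (d n * (lam n)\<^sup>2))"
proof -
  obtain \<delta> where \<delta>: "0 < \<delta>" "\<delta> \<le> 1" and dl: "\<forall>\<^sub>F n in sequentially. d n > 0 \<and> 0 < lam n \<and> lam n < 1"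
    and do: "d \<in> o(\<lambda>n. real n)" and q2: "\<forall>\<^sub>F n in sequentially. 2 \<le> q n"
    and q8: "\<forall>\<^sub>F n in sequentially. real (q n) \<le> real n powr (1 / 8)"
    and s: "\<forall>\<^sub>F n in sequentially. d n * (lam n)\<^sup>2 < 1 - \<delta>"
    using sbm_regimeE[OF assms] .
  \<comment> \<open>Small enough for (1 - \<delta>) (1 + a) \<le> 1 - \<delta> / 8, which leaves
    room for the division by 1 - d / n.\<close>
  define a where "a = \<delta> / 8"
  define a1 where "a1 = a\<^sup>2 / (2 + a)"
  have a: "a > 0" "a1 > 0" using \<delta> by (auto simp: a_def a1_def)
  have "\<forall>\<^sub>F n in sequentially. sqrt (real n) * ln (real n + 1) \<le> n * (a1 / 2)" using a by real_asymp
  moreover have "\<forall>\<^sub>F n in sequentially. ln (1 + (real n)\<^sup>2) \<le> (ln (real n))\<^sup>2 * (a1 / 2)" using a by real_asymp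
  moreover have "\<forall>\<^sub>F n in sequentially. 1 / 2 + real n powr (1 / 8) / sqrt n \<le> 1" by real_asymp
  moreover have "\<forall>\<^sub>F n in sequentially. ln (real n) > 0" by real_asymp
  moreover have "\<forall>\<^sub>F n in sequentially. d n \<le> \<delta> / 8 * real n" by (rule smallo_bound[OF do]) (use \<delta> in simp)
  ultimately show ?thesis
    using dl q2 q8 s eventually_ge_at_top[of 2]
  proof eventually_elim
    case (elim n)
    let ?q = "real (q n)" and ?p = "d n / n" and ?s = "d n * (lam n)\<^sup>2"
    let ?r = "(lam n)\<^sup>2 * ?p / (1 - ?p)"
    have n: "real n > 0" and q0: "?q > 0" "1 \<le> ?q" using elim by auto
    have p1: "?p \<le> \<delta> / 8" "0 < ?p" using elim n by (simp_all add: divide_le_eq)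
    have p: "?p \<le> \<delta> / 8" "?p \<le> 1 / 8" "0 < ?p" using p1 \<delta> by linarith+
    have s0: "0 \<le> ?s" using elim by simp
    have rn: "?r * n * (1 + a) = ?s * ((1 + a) / (1 - ?p))" using n by simp
    have r1: "?r * n * (1 + a) \<le> 1"
    proof -
      have "?s * (1 + a) \<le> (1 - \<delta>) * (1 + a)" using elim a by (intro mult_right_mono) auto
      also have "\<dots> \<le> 1 - \<delta> / 8" using \<delta> by (simp add: a_def algebra_simps)
      also have "\<dots> \<le> 1 - ?p" using p by simp
      finally have "?s * (1 + a) \<le> 1 - ?p" .
      moreover have "1 - ?p > 0" using p by linarith
      ultimately have "?s * (1 + a) / (1 - ?p) \<le> 1" by (subst divide_le_eq_1_pos)
      then have "?s * ((1 + a) / (1 - ?p)) \<le> 1" by (simp only: times_divide_eq_right)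
      then show ?thesis unfolding rn .
    qed
    have r2: "?r * n * (1 + a) \<le> 2 * ?s"
    proof -
      have "(1 + a) / (1 - ?p) \<le> (1 + 1 / 8) / (1 - 1 / 8)" using p a \<delta> by (intro frac_le) (auto simp: a_def)
      then have "(1 + a) / (1 - ?p) \<le> 2" by (rule order_trans) simp
      then have "?s * ((1 + a) / (1 - ?p)) \<le> ?s * 2" using s0 by (intro mult_left_mono) auto
      then show ?thesis unfolding rn by simp
    qed
    have q4: "?q ^ 4 \<le> sqrt n"
    proof -
      have "?q ^ 4 \<le> (real n powr (1 / 8)) ^ 4" using elim by (intro power_mono) auto
      also have "\<dots> = sqrt n" using n by (simp add: powr_power powr_half_sqrt)
      finally show ?thesis .
    qed
    have "(1 + ?q * lam n) * ?p \<le> 1 / 2 + ?q / sqrt n"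
    proof (intro edge_prob_bound)
      have "d n \<le> 1 / 8 * n" using p(2) n by (simp add: divide_le_eq)
      then show "d n \<le> 1 / 2 * n" "d n \<le> n" using n by linarith+
    qed (use elim \<delta> in auto)
    also have "\<dots> \<le> 1 / 2 + real n powr (1 / 8) / sqrt n"
      using elim by (intro add_left_mono divide_right_mono) auto
    finally have range: "(1 + ?q * lam n) * ?p \<le> 1" using elim by linarith
    let ?D = "test_degree n (q n)"
    let ?tail = "(real n + 1) ^ ((q n)\<^sup>2) * (1 + real n * ?q ^ 4) ^ ?D * exp (- real n / ?q\<^sup>2 * (a\<^sup>2 / (2 + a)))"
    \<comment> \<open>One half of the exponent a1 n / q^2 pays for the number of types, by q^4 \<le>
      sqrt n, and the other half for the power of degree D.\<close>
    have tail: "?tail \<le> 1"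
    proof -
      have e1: "(real n + 1) ^ ((q n)\<^sup>2) = exp (?q\<^sup>2 * ln (real n + 1))"
        by (simp add: exp_of_nat_mult flip: of_nat_power)
      have pos: "0 < 1 + real n * ?q ^ 4" by (simp add: add_pos_nonneg)
      have e2: "(1 + real n * ?q ^ 4) ^ ?D = exp (real ?D * ln (1 + real n * ?q ^ 4))"
        using pos by (simp add: exp_of_nat_mult)
      have t1: "?q\<^sup>2 * ln (real n + 1) \<le> real n / ?q\<^sup>2 * (a1 / 2)"
      proof -
        have "?q\<^sup>2 * ?q\<^sup>2 * ln (real n + 1) \<le> sqrt n * ln (real n + 1)"
          using q4 by (intro mult_right_mono) (auto simp: power2_eq_square power4_eq_xxxx)
        also have "\<dots> \<le> n * (a1 / 2)" using elim by simp
        finally show ?thesis using q0 by (simp add: field_simps)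
      qed
      have t2: "real ?D * ln (1 + real n * ?q ^ 4) \<le> real n / ?q\<^sup>2 * (a1 / 2)"
      proof -
        have "real ?D \<le> real n / (?q ^ 4 * (ln n)\<^sup>2)" unfolding test_degree_def by (rule of_nat_floor) auto
        also have "\<dots> \<le> real n / (?q\<^sup>2 * (ln n)\<^sup>2)"
          using q0 elim n by (intro divide_left_mono mult_right_mono mult_pos_pos power_increasing) auto
        finally have D: "real ?D \<le> real n / (?q\<^sup>2 * (ln n)\<^sup>2)" .
        have "sqrt n \<le> n" using elim by (intro real_le_lsqrt) (simp_all add: self_le_power)
        with q4 have "?q ^ 4 \<le> n" by linarith
        then have "real n * ?q ^ 4 \<le> real n * n" by (rule mult_left_mono) simp
        then have "real n * ?q ^ 4 \<le> (real n)\<^sup>2" by (simp only: power2_eq_square)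
        then have "ln (1 + real n * ?q ^ 4) \<le> ln (1 + (real n)\<^sup>2)" using pos by simp
        also have "\<dots> \<le> (ln n)\<^sup>2 * (a1 / 2)" using elim by simp
        finally have "real ?D * ln (1 + real n * ?q ^ 4) \<le> real n / (?q\<^sup>2 * (ln n)\<^sup>2) * ((ln n)\<^sup>2 * (a1 / 2))"
          using D a pos n q0 by (intro mult_mono) auto
        also have "\<dots> = real n / ?q\<^sup>2 * (a1 / 2)" using elim by simp
        finally show ?thesis .
      qed
      have "?tail = exp (?q\<^sup>2 * ln (real n + 1) + real ?D * ln (1 + real n * ?q ^ 4) + - real n / ?q\<^sup>2 * a1)"
        unfolding e1 e2 a1_def by (simp only: exp_add)
      also have "\<dots> \<le> exp 0"
      proof -
        have "- real n / ?q\<^sup>2 * a1 = - (2 * (real n / ?q\<^sup>2 * (a1 / 2)))" by simp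
        then show ?thesis using t1 t2 by (subst exp_le_cancel_iff) linarith
      qed
      finally show ?thesis by simp
    qed
    let ?E = "2 * ?s * ?q\<^sup>2 * ln (real n + 1)"
    let ?X = "2 * exp (?r * n * (1 + a) * ?q\<^sup>2 * ln (real n + 1)) + ?tail"
    have "?X \<le> 2 * exp ?E + 1"
      using tail r2 by (intro add_mono mult_left_mono iffD2[OF exp_le_cancel_iff] mult_right_mono) auto
    also have "\<dots> \<le> 3 * exp ?E"
    proof -
      have "0 \<le> ?E" using s0 by simp
      then have "1 \<le> exp ?E" by simp
      then show ?thesis by simp
    qed
    finally have X: "?X \<le> adv_bound_sq n (q n) ?s" by (simp only: adv_bound_sq_def)
    have X0: "0 \<le> ?X" by (intro add_nonneg_nonneg mult_nonneg_nonneg) auto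
    have adv: "adv (sbm_dim n) ?D (sbm n (d n) (lam n) (q n)) (erdos_renyi n (d n)) \<le> ereal (sqrt ?X)"
      using elim n q0 a range r1 p by (intro sbm_adv_le) (auto simp: divide_less_eq)
    have "(adv (sbm_dim n) ?D (sbm n (d n) (lam n) (q n)) (erdos_renyi n (d n)))\<^sup>2 \<le> ereal ?X"
      using adv X0 adv_ge_1 by (intro ereal_sq_le) (auto intro: order_trans[of 0 1])
    also have "\<dots> \<le> ereal (adv_bound_sq n (q n) ?s)" using X by simp
    finally show ?case .
  qed
qed

text \<open>With no output bits every estimate vanishes; this excludes width 0 wherever the overlap
  is positive.\<close>

lemma expected_overlap_0: "expected_overlap n d lam q 0 A = 0"
proof -
  have "(\<lambda>(\<sigma>, z). overlap (sbm_dim n) (decode_estimate 0 z) (Theta n d lam q \<sigma>)) = (\<lambda>_. 0)"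
    by (auto simp: overlap_def decode_estimate_def)
  then show ?thesis by (simp add: expected_overlap_def)
qed

lemma exists_detection_tests:
  fixes d lam \<beta> :: "nat \<Rightarrow> real" and q w M :: "nat \<Rightarrow> nat" and A :: "nat \<Rightarrow> circuit"
  assumes regime: "sbm_regime d lam q"
    and A: "\<And>n. valid_circuit (sbm_dim n) (sbm_dim n * w n) (A n)"
    and \<beta>0: "\<beta>0 > 0" and \<beta>: "\<forall>\<^sub>F n in sequentially. \<beta>0 \<le> \<beta> n \<and> \<beta> n < 1"
    and c: "0 < c" "c \<le> 1"
    and eo: "\<forall>\<^sub>F n in sequentially. c \<le> expected_overlap n ((1 - \<beta> n) * d n) (lam n) (q n) (w n) (A n)"
    and x: "\<forall>\<^sub>F n in sequentially. real n powr (1 / 4) \<le> n * d n * lam n"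
    and y: "\<forall>\<^sub>F n in sequentially. ln (real n) / 4 \<le> n * real (q n) * (d n * (lam n)\<^sup>2)"
    and M: "\<forall>\<^sub>F n in sequentially. M n > 0"
  obtains C where "\<forall>n. valid_circuit (M n * sbm_dim n) 1 (C n)"
    "\<forall>\<^sub>F n in sequentially. runtime (C n) \<le> M n * (runtime (A n))\<^sup>2 * n ^ 70 \<and>
      detection_error (hidden_planted (M n) (sbm n (d n) (lam n) (q n)) (erdos_renyi n (d n))) (hidden_null (M n) (erdos_renyi n (d n))) (C n)
      \<le> M n * exp (- ((\<beta>0 * c / 4)\<^sup>2 / 2048) * min (n * d n * lam n) (n * real (q n) * (d n * (lam n)\<^sup>2))) + 1 - \<beta>0 * c / 8"
proof -
  let ?x = "\<lambda>n. n * d n * lam n" and ?y = "\<lambda>n. n * real (q n) * (d n * (lam n)\<^sup>2)"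
  define good where "good n C \<longleftrightarrow> valid_circuit (M n * sbm_dim n) 1 C \<and> runtime C \<le> M n * (runtime (A n))\<^sup>2 * n ^ 70 \<and>
      detection_error (hidden_planted (M n) (sbm n (d n) (lam n) (q n)) (erdos_renyi n (d n))) (hidden_null (M n) (erdos_renyi n (d n))) C
      \<le> M n * exp (- ((\<beta>0 * c / 4)\<^sup>2 / 2048) * min (?x n) (?y n)) + 1 - \<beta>0 * c / 8" for n C
  obtain \<delta> where \<delta>: "0 < \<delta>" "\<delta> \<le> 1" and dl: "\<forall>\<^sub>F n in sequentially. d n > 0 \<and> 0 < lam n \<and> lam n < 1"
    and do: "d \<in> o(\<lambda>n. real n)" and q2: "\<forall>\<^sub>F n in sequentially. 2 \<le> q n"
    and q8: "\<forall>\<^sub>F n in sequentially. real (q n) \<le> real n powr (1 / 8)"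
    and s: "\<forall>\<^sub>F n in sequentially. d n * (lam n)\<^sup>2 < 1 - \<delta>"
    using sbm_regimeE[OF regime] .
  define \<kappa>0 where "\<kappa>0 = \<beta>0 * c / 4"
  have \<kappa>0: "\<kappa>0 > 0" "\<kappa>0\<^sup>2 > 0" using \<beta>0 c by (auto simp: \<kappa>0_def)
  have bc: "\<beta>0 * c > 0" using \<beta>0 c by simp
  have d1: "\<forall>\<^sub>F n in sequentially. d n \<le> c\<^sup>2 / 16 * real n" by (rule smallo_bound[OF do]) (use c in simp)
  have as: "\<forall>\<^sub>F n in sequentially. 64 * real n powr (1 / 8) \<le> \<kappa>0\<^sup>2 * ((real n)\<^sup>2 / 4)"
    "\<forall>\<^sub>F n in sequentially. 32 * real n powr (1 / 8) \<le> \<kappa>0\<^sup>2 * n"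
    "\<forall>\<^sub>F n in sequentially. real n powr (1 / 8) / sqrt n \<le> c\<^sup>2 / 16"
    "\<forall>\<^sub>F n in sequentially. 4 * real n powr (1 / 8) / ((real n)\<^sup>2 / 4) + 512 / \<kappa>0\<^sup>2 * (1 / real n powr (1 / 4) + 1 / (ln n / 4)) \<le> \<beta>0 * c / 8"
    "\<forall>\<^sub>F n in sequentially. ln (real n) > 0"
    using \<kappa>0 bc c by real_asymp+
  have ex: "\<forall>\<^sub>F n in sequentially. \<exists>C. good n C"
    using as d1 dl q2 q8 s \<beta> eo x y M eventually_ge_at_top[of 2]
  proof eventually_elim
    case (elim n)
    let ?\<kappa> = "\<beta> n * c / 4" and ?N = "sbm_dim n"
    note N = sbm_dim_bounds[OF \<open>2 \<le> n\<close>]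
    have n: "real n > 0" using elim by simp
    have c16: "c\<^sup>2 / 16 < 1" using power_le_one[of c 2] c by simp
    have \<kappa>: "\<kappa>0 \<le> ?\<kappa>" using elim c by (simp add: \<kappa>0_def mult_right_mono)
    then have \<kappa>2: "\<kappa>0\<^sup>2 \<le> ?\<kappa>\<^sup>2" using \<kappa>0 by (intro power_mono) auto
    have xy: "0 < real n powr (1 / 4)" "0 < ln n / 4" using n elim by simp_all
    have dn: "d n < n"
    proof -
      have "c\<^sup>2 / 16 * real n < 1 * real n" using c16 n by (intro mult_strict_right_mono) auto
      then show ?thesis using elim by linarith
    qed
    have pm: "(1 + real (q n) * lam n) * (d n / n) \<le> c\<^sup>2 / 8"
    proof -
      have "(1 + real (q n) * lam n) * (d n / n) \<le> c\<^sup>2 / 16 + real (q n) / sqrt n"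
        using elim dn \<delta> by (intro edge_prob_bound) auto
      also have "real (q n) / sqrt n \<le> real n powr (1 / 8) / sqrt n" using elim by (intro divide_right_mono) auto
      finally show ?thesis using elim by linarith
    qed
    have big1: "64 * real (q n) \<le> ?\<kappa>\<^sup>2 * real ?N"
    proof -
      have "64 * real (q n) \<le> \<kappa>0\<^sup>2 * ((real n)\<^sup>2 / 4)" using elim by linarith
      also have "\<dots> \<le> ?\<kappa>\<^sup>2 * real ?N" using \<kappa>2 N by (intro mult_mono) auto
      finally show ?thesis .
    qed
    have big2: "32 * real (q n) \<le> ?\<kappa>\<^sup>2 * real n"
    proof -
      have "32 * real (q n) \<le> \<kappa>0\<^sup>2 * n" using elim by linarith
      also have "\<dots> \<le> ?\<kappa>\<^sup>2 * real n" using \<kappa>2 by (intro mult_right_mono) auto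
      finally show ?thesis .
    qed
    have w: "w n > 0"
    proof (rule ccontr)
      assume "\<not> w n > 0"
      then have "c \<le> 0" using elim by (simp add: expected_overlap_0)
      then show False using c by simp
    qed
    have \<beta>n: "0 < \<beta> n" "\<beta> n < 1" using elim \<beta>0 by auto
    have e: "2 \<le> n" "2 \<le> q n" "0 < d n" "0 < lam n" "lam n \<le> 1"
      "c \<le> expected_overlap n ((1 - \<beta> n) * d n) (lam n) (q n) (w n) (A n)" "0 < M n"
      using elim by auto
    obtain C where C: "valid_circuit (M n * ?N) 1 C" "runtime C \<le> M n * (runtime (A n))\<^sup>2 * n ^ 70"
      and err: "detection_error (hidden_planted (M n) (sbm n (d n) (lam n) (q n)) (erdos_renyi n (d n))) (hidden_null (M n) (erdos_renyi n (d n))) C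
      \<le> M n * exp (- (?\<kappa>\<^sup>2 / 2048) * min (?x n) (?y n)) + 1 - (\<beta> n * c / 4 - 4 * real (q n) / ?N - 512 / ?\<kappa>\<^sup>2 * (1 / ?x n + 1 / ?y n))"
      using detection_from_recovery[OF e(1-3) dn e(4,5) \<beta>n c pm A w e(6,7) big1 big2] by blast
    have 1: "M n * exp (- (?\<kappa>\<^sup>2 / 2048) * min (?x n) (?y n)) \<le> M n * exp (- (\<kappa>0\<^sup>2 / 2048) * min (?x n) (?y n))"
    proof (intro mult_left_mono iffD2[OF exp_le_cancel_iff] mult_right_mono)
      show "0 \<le> min (?x n) (?y n)" using elim xy by simp
    qed (use \<kappa>2 in auto)
    have 2: "\<beta>0 * c / 4 \<le> \<beta> n * c / 4" using \<kappa> by (simp add: \<kappa>0_def)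
    have 3: "4 * real (q n) / ?N \<le> 4 * real n powr (1 / 8) / ((real n)\<^sup>2 / 4)"
      using elim N n by (intro frac_le) auto
    have 4: "512 / ?\<kappa>\<^sup>2 * (1 / ?x n + 1 / ?y n) \<le> 512 / \<kappa>0\<^sup>2 * (1 / real n powr (1 / 4) + 1 / (ln n / 4))"
    proof (intro mult_mono add_mono divide_left_mono)
      show "0 < ?x n * real n powr (1 / 4)" "0 < ?y n * (ln n / 4)" "0 \<le> 1 / ?x n + 1 / ?y n"
        using elim xy by (auto intro!: mult_pos_pos)
      show "0 < ?\<kappa>\<^sup>2 * \<kappa>0\<^sup>2" using \<kappa>0 \<kappa>2 by (intro mult_pos_pos) auto
    qed (use elim \<kappa>2 \<kappa>0 in auto)
    have "good n C"
      unfolding good_def \<kappa>0_def[symmetric]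
    proof (intro conjI C)
      show "detection_error (hidden_planted (M n) (sbm n (d n) (lam n) (q n)) (erdos_renyi n (d n))) (hidden_null (M n) (erdos_renyi n (d n))) C
        \<le> M n * exp (- (\<kappa>0\<^sup>2 / 2048) * min (?x n) (?y n)) + 1 - \<beta>0 * c / 8"
        using err 1 2 3 4 elim(4) by linarith
    qed
    then show ?case by blast
  qed
  \<comment> \<open>For the finitely many other n some valid circuit has to be named; this one
    outputs its only coin.\<close>
  define C where "C n = (if \<exists>C. good n C then SOME C. good n C else Circuit 1 [] [M n * sbm_dim n])" for n
  have "good n (C n)" if "\<exists>C. good n C" for n
    using someI_ex[OF that] that by (simp add: C_def)
  moreover have "valid_circuit (M n * sbm_dim n) 1 (C n)" if "\<nexists>C. good n C" for n
    using that by (simp add: C_def valid_circuit_def)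
  ultimately have "valid_circuit (M n * sbm_dim n) 1 (C n)" for n
    by (cases "\<exists>C. good n C") (auto simp: good_def)
  moreover have "\<forall>\<^sub>F n in sequentially. good n (C n)"
    using ex by eventually_elim (rule \<open>\<And>n. \<exists>C. good n C \<Longrightarrow> good n (C n)\<close>)
  ultimately show ?thesis by (intro that) (simp_all add: good_def)
qed

section \<open>Running time, errors and advantage of the test in the limit\<close>

lemma le_ereal_sqrt:
  assumes "0 \<le> x" "x\<^sup>2 \<le> ereal b"
  shows "x \<le> ereal (sqrt b)"
proof (cases x)
  case (real r)
  then show ?thesis using assms by (simp add: real_le_rsqrt)
qed (use assms in auto)

lemma exp_log_bound:
  fixes x b L e E :: real
  assumes "0 \<le> x" "x \<le> exp b" "0 < L" "6 * L \<le> exp L" "0 \<le> e" "E \<le> e"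
  shows "6 * L * exp E * x\<^sup>2 * exp (70 * L) \<le> exp (71 * L + e + 2 * b)"
proof -
  have "x\<^sup>2 \<le> (exp b)\<^sup>2" using assms by (intro power_mono) auto
  also have "\<dots> = exp (2 * b)" by (simp add: exp_double)
  finally have x: "x\<^sup>2 \<le> exp (2 * b)" .
  have "6 * L * exp E * x\<^sup>2 * exp (70 * L) \<le> exp L * exp e * exp (2 * b) * exp (70 * L)"
    using assms x by (intro mult_mono) auto
  also have "\<dots> = exp (71 * L + e + 2 * b)" by (simp flip: exp_add)
  finally show ?thesis .
qed

text \<open>The left side collects 70 ln n from the overhead of the test, ln n from 6 ln n \<le> n,
  the exponent of \<Delta> at d \<lambda>^2 \<le> 1, and twice the exponent of the assumed running
  time. With Y = n / (q^4 (ln n)^2) the last part is at most 2 Y / ln n. The others are of lower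
  order than sqrt n / (ln n)^2 \<le> Y, because q^2 \<le> n^(1/4).\<close>

lemma runtime_exponent_bound:
  fixes q :: "nat \<Rightarrow> nat"
  assumes C: "C > 0" and q1: "\<forall>\<^sub>F n in sequentially. 2 \<le> q n" and q8: "\<forall>\<^sub>F n in sequentially. real (q n) \<le> real n powr (1 / 8)"
  shows "\<forall>\<^sub>F n in sequentially. 71 * ln (real n) + 2 * (real (q n))\<^sup>2 * ln (real n + 1) + 2 * (real n / (real (q n) ^ 6 * ln (real n) ^ 3))
    \<le> real (test_degree n (q n)) / C"
proof -
  have "\<forall>\<^sub>F n in sequentially. 2 / ln (real n) \<le> 1 / (2 * C)"
    "\<forall>\<^sub>F n in sequentially. 71 * ln (real n) + 2 * real n powr (1 / 4) * ln (real n + 1) + 1 / C \<le> sqrt n / (ln n)\<^sup>2 * (1 / (2 * C))"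
    "\<forall>\<^sub>F n in sequentially. ln (real n) > 0"
    using C by real_asymp+
  then show ?thesis
    using q1 q8 eventually_ge_at_top[of 1]
  proof eventually_elim
    case (elim n)
    let ?q = "real (q n)" and ?L = "ln (real n)"
    define Y where "Y = real n / (?q ^ 4 * ?L\<^sup>2)"
    have n: "real n > 0" and q: "?q \<ge> 1" and L: "?L > 0" using elim by auto
    have Y0: "Y \<ge> 0" by (simp add: Y_def)
    have D: "Y - 1 \<le> real (test_degree n (q n))" unfolding test_degree_def Y_def by linarith
    have q2: "?q\<^sup>2 \<le> real n powr (1 / 4)"
    proof -
      have "?q\<^sup>2 \<le> (real n powr (1 / 8))\<^sup>2" using elim by (intro power_mono) auto
      then show ?thesis using n by (simp add: powr_power)
    qed
    have q4: "?q ^ 4 \<le> sqrt n"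
    proof -
      have "?q ^ 4 \<le> (real n powr (1 / 8)) ^ 4" using elim by (intro power_mono) auto
      also have "\<dots> = sqrt n" using n by (simp add: powr_power powr_half_sqrt)
      finally show ?thesis .
    qed
    have "sqrt n / ?L\<^sup>2 = real n / (sqrt n * ?L\<^sup>2)"
      using n L by (simp add: field_simps)
    also have "\<dots> \<le> Y" unfolding Y_def
      using q4 n L q by (intro divide_left_mono mult_right_mono mult_pos_pos) auto
    finally have Y: "sqrt n / ?L\<^sup>2 \<le> Y" .
    have "real n / (?q ^ 6 * ?L ^ 3) \<le> real n / (?q ^ 4 * ?L ^ 3)"
      using q n L by (intro divide_left_mono mult_right_mono mult_pos_pos power_increasing) auto
    also have "\<dots> = Y / ?L" by (simp add: Y_def power2_eq_square power3_eq_cube)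
    finally have "2 * (real n / (?q ^ 6 * ?L ^ 3)) \<le> 2 * (Y / ?L)" by (rule mult_left_mono) simp
    also have "\<dots> = Y * (2 / ?L)" by simp
    also have "\<dots> \<le> Y * (1 / (2 * C))" using elim Y0 by (intro mult_left_mono) auto
    finally have 1: "2 * (real n / (?q ^ 6 * ?L ^ 3)) \<le> Y * (1 / (2 * C))" .
    have "2 * ?q\<^sup>2 * ln (real n + 1) \<le> 2 * real n powr (1 / 4) * ln (real n + 1)"
      using q2 by (intro mult_right_mono) auto
    then have 2: "71 * ?L + 2 * ?q\<^sup>2 * ln (real n + 1) + 1 / C \<le> sqrt n / ?L\<^sup>2 * (1 / (2 * C))"
      using elim by linarith
    have 3: "sqrt n / ?L\<^sup>2 * (1 / (2 * C)) \<le> Y * (1 / (2 * C))" using Y C by (intro mult_right_mono) auto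
    have "71 * ?L + 2 * ?q\<^sup>2 * ln (real n + 1) + 2 * (real n / (?q ^ 6 * ?L ^ 3)) \<le> 2 * (Y * (1 / (2 * C))) - 1 / C"
      using 1 2 3 by linarith
    also have "\<dots> = (Y - 1) / C" using C by (simp add: field_simps)
    also have "\<dots> \<le> real (test_degree n (q n)) / C" using D C by (intro divide_right_mono) auto
    finally show ?case .
  qed
qed

text \<open>The factor in front of the last exponential bounds M. Both entries of the minimum are at
  least n d \<lambda>^2, and q^2 ln n = o(n), so the exponent of M is at most half of the Chernoff
  exponent. The other half is at least a ln n / 8 and outweighs 6 ln n.\<close>

lemma false_positive_bound:
  fixes d lam :: "nat \<Rightarrow> real" and q :: "nat \<Rightarrow> nat"
  assumes a: "a > 0" and e: "e > 0"
    and dl: "\<forall>\<^sub>F n in sequentially. d n > 0 \<and> 0 < lam n \<and> lam n < 1"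
    and q2: "\<forall>\<^sub>F n in sequentially. 2 \<le> q n" and q8: "\<forall>\<^sub>F n in sequentially. real (q n) \<le> real n powr (1 / 8)"
    and x: "\<forall>\<^sub>F n in sequentially. real n powr (1 / 4) \<le> n * d n * lam n"
    and y: "\<forall>\<^sub>F n in sequentially. ln (real n) / 4 \<le> n * real (q n) * (d n * (lam n)\<^sup>2)"
  shows "\<forall>\<^sub>F n in sequentially. 6 * ln (real n) * exp (2 * (d n * (lam n)\<^sup>2) * (real (q n))\<^sup>2 * ln (real n + 1))
      * exp (- a * min (n * d n * lam n) (n * real (q n) * (d n * (lam n)\<^sup>2))) \<le> e"
proof -
  have "\<forall>\<^sub>F n in sequentially. 2 * real n powr (1 / 4) * ln (real n + 1) \<le> a / 2 * n"
    "\<forall>\<^sub>F n in sequentially. 6 * ln (real n) * exp (- (a / 8) * ln (real n)) \<le> e"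
    "\<forall>\<^sub>F n in sequentially. ln (real n) / 4 \<le> real n powr (1 / 4)"
    using a e by real_asymp+
  then show ?thesis
    using dl q2 q8 x y eventually_ge_at_top[of 1]
  proof eventually_elim
    case (elim n)
    let ?q = "real (q n)" and ?s = "d n * (lam n)\<^sup>2" and ?m = "min (n * d n * lam n) (n * real (q n) * (d n * (lam n)\<^sup>2))"
    have n: "real n > 0" and q: "?q \<ge> 1" and d: "d n > 0" "lam n > 0" "lam n \<le> 1" using elim by auto
    have s0: "?s \<ge> 0" using d by simp
    have lamsq: "(lam n)\<^sup>2 \<le> lam n" using d by (simp add: power2_eq_square mult_left_le_one_le)
    have "?q\<^sup>2 \<le> (real n powr (1 / 8))\<^sup>2" using elim by (intro power_mono) auto
    then have qq: "?q\<^sup>2 \<le> real n powr (1 / 4)" using n by (simp add: powr_power)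
    have "2 * ?q\<^sup>2 * ln (real n + 1) \<le> 2 * real n powr (1 / 4) * ln (real n + 1)"
      using qq by (intro mult_right_mono) auto
    then have Q: "2 * ?q\<^sup>2 * ln (real n + 1) \<le> a / 2 * n" using elim by linarith
    have "?s * (2 * ?q\<^sup>2 * ln (real n + 1)) \<le> ?s * (a / 2 * n)" using Q s0 by (rule mult_left_mono)
    then have E: "2 * ?s * ?q\<^sup>2 * ln (real n + 1) \<le> a / 2 * (n * ?s)" by (simp add: mult_ac)
    have m1: "n * ?s \<le> n * d n * lam n"
      using lamsq d n by simp
    have "n * ?s * 1 \<le> n * ?s * ?q" using q s0 n by (intro mult_left_mono) auto
    then have m2: "n * ?s \<le> n * ?q * ?s" by (simp add: mult_ac)
    have "a / 2 * (n * ?s) \<le> a / 2 * ?m" using m1 m2 a by (intro mult_left_mono) auto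
    with E have E': "2 * ?s * ?q\<^sup>2 * ln (real n + 1) \<le> a / 2 * ?m" by linarith
    have "ln (real n) / 4 \<le> ?m" using elim by simp
    then have "a / 2 * (ln (real n) / 4) \<le> a / 2 * ?m" using a by (intro mult_left_mono) auto
    then have "2 * ?s * ?q\<^sup>2 * ln (real n + 1) + - a * ?m \<le> - (a / 8) * ln (real n)" using E' by (simp add: algebra_simps)
    then have "exp (2 * ?s * ?q\<^sup>2 * ln (real n + 1)) * exp (- a * ?m) \<le> exp (- (a / 8) * ln (real n))"
      by (simp only: exp_add[symmetric] exp_le_cancel_iff)
    then have "6 * ln (real n) * (exp (2 * ?s * ?q\<^sup>2 * ln (real n + 1)) * exp (- a * ?m)) \<le> 6 * ln (real n) * exp (- (a / 8) * ln (real n))"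
      using elim by (intro mult_left_mono) auto
    also have "\<dots> \<le> e" using elim by simp
    finally show ?case by (simp only: mult.assoc)
  qed
qed

text \<open>M exceeds \<Delta> by a factor ln n, so the advantage is at most 1 + sqrt (\<Delta> / M)
  \<le> 1 + 1 / sqrt (ln n).\<close>

lemma hidden_sbm_adv_tendsto:
  fixes d lam :: "nat \<Rightarrow> real" and q M :: "nat \<Rightarrow> nat"
  assumes q: "\<forall>\<^sub>F n in sequentially. 2 \<le> q n"
    and adv: "\<forall>\<^sub>F n in sequentially. (adv (sbm_dim n) (D n) (sbm n (d n) (lam n) (q n)) (erdos_renyi n (d n)))\<^sup>2 \<le> ereal (\<Delta> n)"
    and M: "\<forall>\<^sub>F n in sequentially. \<Delta> n * ln (real n) \<le> M n" and \<Delta>: "\<forall>\<^sub>F n in sequentially. 1 < \<Delta> n"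
  shows "(\<lambda>n. adv (M n * sbm_dim n) (D n) (hidden_planted (M n) (sbm n (d n) (lam n) (q n)) (erdos_renyi n (d n)))
      (hidden_null (M n) (erdos_renyi n (d n)))) \<longlonglongrightarrow> 1"
proof (rule tendsto_sandwich[where f = "\<lambda>_. 1" and h = "\<lambda>n. ereal (1 + 1 / sqrt (ln (real n)))"])
  have L: "\<forall>\<^sub>F n in sequentially. ln (real n) > 0" by real_asymp
  show "\<forall>\<^sub>F n in sequentially. adv (M n * sbm_dim n) (D n) (hidden_planted (M n) (sbm n (d n) (lam n) (q n)) (erdos_renyi n (d n)))
      (hidden_null (M n) (erdos_renyi n (d n))) \<le> ereal (1 + 1 / sqrt (ln (real n)))"
    using q adv M \<Delta> L
  proof eventually_elim
    case (elim n)
    have q0: "q n > 0" using elim by simp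
    have Mpos: "real (M n) > 0" using elim by (intro less_le_trans[OF _ elim(3)]) simp
    have "adv (M n * sbm_dim n) (D n) (hidden_planted (M n) (sbm n (d n) (lam n) (q n)) (erdos_renyi n (d n)))
      (hidden_null (M n) (erdos_renyi n (d n))) \<le> ereal (1 + sqrt (\<Delta> n) / sqrt (M n))"
    proof (rule hidden_adv_le)
      show "finite (set_pmf (sbm n (d n) (lam n) (q n)))"
        unfolding sbm_sample[OF q0] using finite_set_labels[OF q0, of n] by simp
      show "finite (set_pmf (erdos_renyi n (d n)))" unfolding erdos_renyi_sample by simp
      show "length y = sbm_dim n" if "y \<in> set_pmf (sbm n (d n) (lam n) (q n))" for y
        using that unfolding sbm_sample[OF q0] by auto
      show "length y = sbm_dim n" if "y \<in> set_pmf (erdos_renyi n (d n))" for y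
        using that unfolding erdos_renyi_sample by auto
      show "adv (sbm_dim n) (D n) (sbm n (d n) (lam n) (q n)) (erdos_renyi n (d n)) \<le> ereal (sqrt (\<Delta> n))"
        using elim by (intro le_ereal_sqrt) (auto intro: order_trans[OF _ adv_ge_1])
    qed (use Mpos elim in auto)
    also have "sqrt (\<Delta> n) / sqrt (M n) \<le> 1 / sqrt (ln (real n))"
    proof -
      have "sqrt (\<Delta> n) * sqrt (ln (real n)) \<le> sqrt (M n)"
        using elim by (simp flip: real_sqrt_mult)
      then show ?thesis using Mpos elim by (simp add: field_simps)
    qed
    finally show ?case by simp
  qed
  have "(\<lambda>n. 1 + 1 / sqrt (ln (real n))) \<longlonglongrightarrow> 1" by real_asymp
  then show "(\<lambda>n. ereal (1 + 1 / sqrt (ln (real n)))) \<longlonglongrightarrow> 1" by (simp add: one_ereal_def)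
qed (auto intro: always_eventually adv_ge_1)

text \<open>The heuristic is applied to the denser model d', in which the test receives its samples;
  the assumed algorithm for d only runs on their thinned copies.\<close>

lemma no_fast_recovery:
  fixes d lam :: "nat \<Rightarrow> real" and q :: "nat \<Rightarrow> nat"
  assumes regime: "sbm_regime d lam q" and heuristic: sbm_low_degree_heuristic and recovery: "weak_recovery d lam q A"
  shows "\<not> runs_within A (\<lambda>n. exp (real n / (real (q n) ^ 6 * ln (real n) ^ 3)))"
proof
  assume fast: "runs_within A (\<lambda>n. exp (real n / (real (q n) ^ 6 * ln (real n) ^ 3)))"
  obtain w c0 where A: "\<And>n. valid_circuit (sbm_dim n) (sbm_dim n * w n) (A n)" and c0: "c0 > 0"
    and eo0: "\<forall>\<^sub>F n in sequentially. c0 \<le> expected_overlap n (d n) (lam n) (q n) (w n) (A n)"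
    using recovery by (auto simp: weak_recovery_def)
  define c where "c = min c0 1"
  have c: "0 < c" "c \<le> 1" using c0 by (auto simp: c_def)
  have eo: "\<forall>\<^sub>F n in sequentially. c \<le> expected_overlap n (d n) (lam n) (q n) (w n) (A n)"
    using eo0 by eventually_elim (simp add: c_def)
  obtain \<beta> d' :: "nat \<Rightarrow> real" and \<beta>0 :: real where \<beta>0: "\<beta>0 > 0" and \<beta>d: "\<forall>\<^sub>F n in sequentially. \<beta>0 \<le> \<beta> n \<and> \<beta> n < 1 \<and> d n = (1 - \<beta> n) * d' n"
    and regime': "sbm_regime d' lam q" and x: "\<forall>\<^sub>F n in sequentially. real n powr (1 / 4) \<le> n * d' n * lam n"
    and y: "\<forall>\<^sub>F n in sequentially. ln (real n) / 4 \<le> n * real (q n) * (d' n * (lam n)\<^sup>2)"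
    by (rule exists_denser_model[OF regime c(1) eo])
  have \<beta>: "\<forall>\<^sub>F n in sequentially. \<beta>0 \<le> \<beta> n \<and> \<beta> n < 1"
    using \<beta>d by eventually_elim simp
  have eo': "\<forall>\<^sub>F n in sequentially. c \<le> expected_overlap n ((1 - \<beta> n) * d' n) (lam n) (q n) (w n) (A n)"
    using \<beta>d eo by eventually_elim metis
  obtain \<delta> where \<delta>: "0 < \<delta>" "\<delta> \<le> 1" and dl: "\<forall>\<^sub>F n in sequentially. d' n > 0 \<and> 0 < lam n \<and> lam n < 1"
    and q2: "\<forall>\<^sub>F n in sequentially. 2 \<le> q n"
    and q8: "\<forall>\<^sub>F n in sequentially. real (q n) \<le> real n powr (1 / 8)"
    and s: "\<forall>\<^sub>F n in sequentially. d' n * (lam n)\<^sup>2 < 1 - \<delta>"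
    by (rule sbm_regimeE[OF regime'])
  define D where "D n = test_degree n (q n)" for n
  define \<Delta> where "\<Delta> n = adv_bound_sq n (q n) (d' n * (lam n)\<^sup>2)" for n
  \<comment> \<open>The factor ln n gives \<Delta> = o(M) and stays far below the admissible factor,
    the dimension of the base pair.\<close>
  define M where "M n = nat \<lceil>\<Delta> n * ln (real n)\<rceil>" for n
  let ?N = "\<lambda>n. M n * sbm_dim n"
  let ?P = "\<lambda>n. hidden_planted (M n) (sbm n (d' n) (lam n) (q n)) (erdos_renyi n (d' n))"
  let ?Q = "\<lambda>n. hidden_null (M n) (erdos_renyi n (d' n))"
  have adv: "\<forall>\<^sub>F n in sequentially. (adv (sbm_dim n) (D n) (sbm n (d' n) (lam n) (q n)) (erdos_renyi n (d' n)))\<^sup>2 \<le> ereal (\<Delta> n)"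
    unfolding D_def \<Delta>_def by (rule sbm_adv_sq_le[OF regime'])
  have \<Delta>: "\<forall>\<^sub>F n in sequentially. 1 < \<Delta> n"
    using dl
  proof eventually_elim
    case (elim n)
    then have "1 \<le> exp (2 * (d' n * (lam n)\<^sup>2) * (real (q n))\<^sup>2 * ln (real n + 1))" by simp
    then show ?case unfolding \<Delta>_def adv_bound_sq_def by linarith
  qed
  have L1: "\<forall>\<^sub>F n in sequentially. 1 \<le> ln (real n)" by real_asymp
  have M_ge: "\<forall>\<^sub>F n in sequentially. \<Delta> n * ln (real n) \<le> M n" by (simp add: M_def real_nat_ceiling_ge)
  have M_le: "\<forall>\<^sub>F n in sequentially. M n \<le> 2 * \<Delta> n * ln (real n)"
    using \<Delta> L1
  proof eventually_elim
    case (elim n)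
    have "1 * 1 \<le> \<Delta> n * ln (real n)" using elim by (intro mult_mono) auto
    then show ?case unfolding M_def by linarith
  qed
  have M0: "\<forall>\<^sub>F n in sequentially. M n > 0"
    using M_ge \<Delta> L1
  proof eventually_elim
    case (elim n)
    have "0 < \<Delta> n * ln (real n)" using elim by simp
    then show ?case using elim by linarith
  qed
  have "low_degree_heuristic D (sbm_hidden_problems d' lam q \<Delta>)"
    using heuristic regime' eventually_conj[OF \<Delta> adv] unfolding sbm_low_degree_heuristic_def by blast
  then obtain C where C: "C > 0" and weak: "\<And>p. p \<in> sbm_hidden_problems d' lam q \<Delta> \<Longrightarrow> weak_clause D C p"
    by (auto simp: low_degree_heuristic_def)
  have "hidden_problem M (sbm_problem d' lam q) \<in> sbm_hidden_problems d' lam q \<Delta>"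
    unfolding sbm_hidden_problems_def
  proof (intro CollectI exI[of _ M] conjI)
    show "\<Delta> \<in> o(\<lambda>n. real (M n))"
    proof (rule landau_o.smallI)
      fix e :: real assume e: "e > 0"
      have "\<forall>\<^sub>F n in sequentially. 1 \<le> e * ln (real n)" using e by real_asymp
      then show "\<forall>\<^sub>F n in sequentially. norm (\<Delta> n) \<le> e * norm (real (M n))"
        using M_ge \<Delta>
      proof eventually_elim
        case (elim n)
        have "\<Delta> n * 1 \<le> \<Delta> n * (e * ln (real n))" using elim by (intro mult_left_mono) auto
        also have "\<dots> = e * (\<Delta> n * ln (real n))" by simp
        also have "\<dots> \<le> e * M n" using elim e by (intro mult_left_mono) auto
        finally show ?case using elim by simp
      qed
    qed
    have "\<forall>\<^sub>F n in sequentially. 2 * ln (real n) \<le> (real n)\<^sup>2 / 4" by real_asymp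
    then show "\<forall>\<^sub>F n in sequentially. real (M n) \<le> real (sbm_dim n) * \<Delta> n"
      using M_le \<Delta> eventually_ge_at_top[of 2]
    proof eventually_elim
      case (elim n)
      have "2 * ln (real n) \<le> sbm_dim n" using elim sbm_dim_bounds(1)[of n] by linarith
      then have "2 * ln (real n) * \<Delta> n \<le> sbm_dim n * \<Delta> n" using elim by (intro mult_right_mono) auto
      moreover have "M n \<le> 2 * ln (real n) * \<Delta> n" using elim(2) by (simp add: mult_ac)
      ultimately show ?case by linarith
    qed
  qed simp
  then have "weak_clause D C (hidden_problem M (sbm_problem d' lam q))" by (rule weak)
  moreover have "(\<lambda>n. adv (?N n) (D n) (?P n) (?Q n)) \<longlonglongrightarrow> 1"
    by (rule hidden_sbm_adv_tendsto[OF q2 adv M_ge \<Delta>])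
  ultimately have no_test: "\<not> (\<exists>T. (\<forall>n. valid_circuit (?N n) 1 (T n)) \<and> runs_within T (heuristic_time ?N D C) \<and> weak_detection ?P ?Q T)"
    by (simp add: weak_clause_def hidden_problem_def sbm_problem_def)
  obtain T where T: "\<forall>n. valid_circuit (?N n) 1 (T n)" and good: "\<forall>\<^sub>F n in sequentially. runtime (T n) \<le> M n * (runtime (A n))\<^sup>2 * n ^ 70 \<and>
      detection_error (?P n) (?Q n) (T n)
      \<le> M n * exp (- ((\<beta>0 * c / 4)\<^sup>2 / 2048) * min (n * d' n * lam n) (n * real (q n) * (d' n * (lam n)\<^sup>2))) + 1 - \<beta>0 * c / 8"
    by (rule exists_detection_tests[OF regime' A \<beta>0 \<beta> c eo' x y M0])
  have M_le': "\<forall>\<^sub>F n in sequentially. M n \<le> 6 * ln (real n) * exp (2 * (d' n * (lam n)\<^sup>2) * (real (q n))\<^sup>2 * ln (real n + 1))"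
    using M_le by eventually_elim (simp add: \<Delta>_def adv_bound_sq_def mult_ac)
  have "runs_within T (heuristic_time ?N D C)"
    unfolding runs_within_def
  proof -
    have "\<forall>\<^sub>F n in sequentially. 6 * ln (real n) \<le> n" by real_asymp
    then show "\<forall>\<^sub>F n in sequentially. real (runtime (T n)) \<le> heuristic_time ?N D C n"
      using fast[unfolded runs_within_def] runtime_exponent_bound[OF C q2 q8] good M_le' M0 L1 dl s eventually_ge_at_top[of 3]
    proof eventually_elim
      case (elim n)
      let ?b = "real n / (real (q n) ^ 6 * ln (real n) ^ 3)" and ?s = "d' n * (lam n)\<^sup>2"
      have n: "real n > 0" using elim by simp
      have "real (runtime (T n)) \<le> real (M n * (runtime (A n))\<^sup>2 * n ^ 70)" using elim by (simp only: of_nat_le_iff)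
      also have "\<dots> = real (M n) * (real (runtime (A n)))\<^sup>2 * real n ^ 70" by simp
      also have "real n ^ 70 = exp (70 * ln (real n))" using n exp_of_nat_mult[of 70 "ln (real n)"] by simp
      also have "real (M n) * (real (runtime (A n)))\<^sup>2 * exp (70 * ln (real n))
        \<le> 6 * ln (real n) * exp (2 * ?s * (real (q n))\<^sup>2 * ln (real n + 1)) * (real (runtime (A n)))\<^sup>2 * exp (70 * ln (real n))"
        using elim by (intro mult_right_mono) auto
      also have "\<dots> \<le> exp (71 * ln (real n) + 2 * (real (q n))\<^sup>2 * ln (real n + 1) + 2 * ?b)"
      proof (rule exp_log_bound)
        have "?s * (2 * (real (q n))\<^sup>2 * ln (real n + 1)) \<le> 1 * (2 * (real (q n))\<^sup>2 * ln (real n + 1))"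
          using elim \<delta> by (intro mult_right_mono) auto
        then show "2 * ?s * (real (q n))\<^sup>2 * ln (real n + 1) \<le> 2 * (real (q n))\<^sup>2 * ln (real n + 1)"
          by (simp add: mult_ac)
      qed (use elim n in auto)
      also have "\<dots> \<le> exp (real (D n) / C)" using elim by (simp add: D_def)
      \<comment> \<open>N^(D / (C ln N)) is exp (D / C) for every dimension N > 1, so the
        enlargement of the dimension by M does not affect the time limit.\<close>
      also have "\<dots> = heuristic_time ?N D C n"
      proof -
        have "9 \<le> (real n)\<^sup>2" using power_mono[of 3 "real n" 2] elim by simp
        then have "real (sbm_dim n) > 1" using sbm_dim_bounds(1)[of n] elim by linarith
        then have N: "sbm_dim n > 1" and M: "M n \<ge> 1" using elim by simp_all
        then have "?N n > 1" by (metis less_1_mult less_le mult_1)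
        then have "real (?N n) > 1" by (simp only: of_nat_1 flip: of_nat_less_iff)
        then show ?thesis using N M by (simp add: heuristic_time_def powr_def)
      qed
      finally show ?case .
    qed
  qed
  moreover have "weak_detection ?P ?Q T"
    unfolding weak_detection_def
  proof (intro exI[of _ "\<beta>0 * c / 16"] conjI)
    have a: "(\<beta>0 * c / 4)\<^sup>2 / 2048 > 0" and e: "\<beta>0 * c / 16 > 0" using \<beta>0 c by simp_all
    show "\<forall>\<^sub>F n in sequentially. detection_error (?P n) (?Q n) (T n) \<le> 1 - \<beta>0 * c / 16"
      using false_positive_bound[OF a e dl q2 q8 x y] good M_le'
    proof eventually_elim
      case (elim n)
      let ?E = "exp (- ((\<beta>0 * c / 4)\<^sup>2 / 2048) * min (n * d' n * lam n) (n * real (q n) * (d' n * (lam n)\<^sup>2)))"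
      have "M n * ?E \<le> 6 * ln (real n) * exp (2 * (d' n * (lam n)\<^sup>2) * (real (q n))\<^sup>2 * ln (real n + 1)) * ?E"
        using elim(3) by (rule mult_right_mono) simp
      then show ?case using elim(1,2) by linarith
    qed
  qed (use \<beta>0 c in simp)
  ultimately show False using no_test T by blast
qed

theorem theorem2p10:
  fixes d lam :: "nat \<Rightarrow> real" and q :: "nat \<Rightarrow> nat"
  assumes "sbm_regime d lam q"
    and "sbm_low_degree_heuristic"
  shows "(\<forall>A. weak_recovery d lam q A \<longrightarrow>
            \<not> runs_within A (\<lambda>n. exp (real n / (real (q n) ^ 6 * ln (real n) ^ 3)))) \<and>
         ((\<exists>\<eta>. \<eta> \<longlonglongrightarrow> 0 \<and> (\<forall>\<^sub>F n in sequentially. real (q n) = real n powr \<eta> n)) \<longrightarrow>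
           (\<exists>\<epsilon>. \<epsilon> \<longlonglongrightarrow> 0 \<and>
             (\<forall>A. weak_recovery d lam q A \<longrightarrow>
                \<not> runs_within A (\<lambda>n. exp (real n powr (1 - \<epsilon> n))))))"
proof (intro conjI impI allI)
  note slow = no_fast_recovery[OF assms]
  show "\<not> runs_within A (\<lambda>n. exp (real n / (real (q n) ^ 6 * ln (real n) ^ 3)))" if "weak_recovery d lam q A" for A
    by (rule slow[OF that])
  assume "\<exists>\<eta>. \<eta> \<longlonglongrightarrow> 0 \<and> (\<forall>\<^sub>F n in sequentially. real (q n) = real n powr \<eta> n)"
  then obtain \<eta> where \<eta>: "\<eta> \<longlonglongrightarrow> 0" "\<forall>\<^sub>F n in sequentially. real (q n) = real n powr \<eta> n" by blast
  \<comment> \<open>\<open>q\<^sup>6 = n\<^bsup>6 \<eta>\<^esup>\<close>, and \<open>(ln n)\<^sup>3\<close> is \<open>n\<close> to the power \<open>3 ln (ln n) / ln n\<close>\<close>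
  define \<epsilon> where "\<epsilon> n = 6 * \<eta> n + 3 * (ln (ln (real n)) / ln (real n))" for n
  have "(\<lambda>n. ln (ln (real n)) / ln (real n)) \<longlonglongrightarrow> 0" by real_asymp
  then have "\<epsilon> \<longlonglongrightarrow> 6 * 0 + 3 * 0" unfolding \<epsilon>_def by (intro tendsto_intros \<eta>)
  then have \<epsilon>: "\<epsilon> \<longlonglongrightarrow> 0" by simp
  have L: "\<forall>\<^sub>F n in sequentially. ln (real n) > 0" by real_asymp
  have eq: "\<forall>\<^sub>F n in sequentially. real n powr (1 - \<epsilon> n) = real n / (real (q n) ^ 6 * ln (real n) ^ 3)"
    using \<eta>(2) L eventually_ge_at_top[of 1]
  proof eventually_elim
    case (elim n)
    have n: "real n > 0" using elim by simp
    have q6: "real (q n) ^ 6 = exp (6 * \<eta> n * ln (real n))"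
      using n exp_of_nat_mult[of 6 "\<eta> n * ln (real n)"] elim by (simp add: powr_def mult_ac)
    have L3: "ln (real n) ^ 3 = exp (3 * ln (ln (real n)))"
      using exp_of_nat_mult[of 3 "ln (ln (real n))"] elim by simp
    have "(1 - \<epsilon> n) * ln (real n) = ln (real n) - (6 * \<eta> n * ln (real n) + 3 * ln (ln (real n)))"
      using elim by (simp add: \<epsilon>_def field_simps)
    then have "real n powr (1 - \<epsilon> n) = exp (ln (real n) - (6 * \<eta> n * ln (real n) + 3 * ln (ln (real n))))"
      using n by (simp add: powr_def)
    also have "\<dots> = exp (ln (real n)) / (exp (6 * \<eta> n * ln (real n)) * exp (3 * ln (ln (real n))))"
      by (simp only: exp_diff exp_add)
    finally show ?case using n q6 L3 by simp
  qed
  have "\<not> runs_within A (\<lambda>n. exp (real n powr (1 - \<epsilon> n)))" if "weak_recovery d lam q A" for A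
  proof
    assume "runs_within A (\<lambda>n. exp (real n powr (1 - \<epsilon> n)))"
    then have "runs_within A (\<lambda>n. exp (real n / (real (q n) ^ 6 * ln (real n) ^ 3)))"
      unfolding runs_within_def using eq by eventually_elim simp
    then show False using slow[OF that] by blast
  qed
  then show "\<exists>\<epsilon>. \<epsilon> \<longlonglongrightarrow> 0 \<and> (\<forall>A. weak_recovery d lam q A \<longrightarrow> \<not> runs_within A (\<lambda>n. exp (real n powr (1 - \<epsilon> n))))"
    using \<epsilon> by blast
qed

end
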